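(* Let $\mathcal{C}$ be a coalgebra with a group-like element $e$, let $\mathcal{B}\subseteq\mathcal{A}$ and $\mathcal{B}'\subseteq\mathcal{A}'$ be principal $\mathcal{C}$-extensions (with respect to $e$), and let $V$ be a finite-dimensional left $\mathcal{C}$-comodule. Then every $\mathcal{C}$-equivariant (right $\mathcal{C}$-colinear) algebra map $f\colon\mathcal{A}\to\mathcal{A}'$ restricts and corestricts to an algebra homomorphism $\mathcal{B}\to\mathcal{B}'$, and induces an isomorphism of finitely generated projective left $\mathcal{B}'$-modules $$\mathcal{B}'\otimes_{\mathcal{B}}(\mathcal{A}\,\Box^{\mathcal{C}}V)\cong\mathcal{A}'\,\Box^{\mathcal{C}}V$$ that is natural in $V$. In particular, the induced map $f_*\colon K_0(\mathcal{B})\to K_0(\mathcal{B}')$ satisfies $$f_*([\mathcal{A}\,\Box^{\mathcal{C}}V])=[\mathcal{A}'\,\Box^{\mathcal{C}}V].$$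
   Context: Algebras, coalgebras and vector spaces are over $\mathbb{C}$; algebras and algebra homomorphisms are unital; unadorned $\otimes$ is over $\mathbb{C}$. For a right $\mathcal{C}$-comodule $(M,\delta_M)$ and a left $\mathcal{C}$-comodule $(N,{}_N\delta)$, the cotensor product is $M\,\Box^{\mathcal{C}}N:=\ker(\delta_M\otimes\mathrm{id}-\mathrm{id}\otimes{}_N\delta)\subseteq M\otimes N$. $e$-coaugmented $\mathcal{C}$-Galois extension: let $e\in\mathcal{C}$ be group-like, and let $\mathcal{A}$ be an algebra and a right $\mathcal{C}$-comodule via $\delta_{\mathcal{A}}\colon\mathcal{A}\to\mathcal{A}\otimes\mathcal{C}$ (not assumed to be an algebra map) with $\delta_{\mathcal{A}}(1)=1\otimes e$. Put $\mathcal{B}:=\{b\in\mathcal{A}\mid\forall a\in\mathcal{A}:\ \delta_{\mathcal{A}}(ba)=b\,\delta_{\mathcal{A}}(a)\}$ (coaction-invariant subalgebra). The inclusion $\mathcal{B}\subseteq\mathcal{A}$ is an $e$-coaugmented $\mathcal{C}$-Galois extension if the canonical map $can\colon\mathcal{A}\otimes_{\mathcal{B}}\mathcal{A}\to\mathcal{A}\otimes\mathcal{C}$, $a\otimes a'\mapsto a\,\delta_{\mathcal{A}}(a')$, is bijective. Principal $\mathcal{C}$-extension: an $e$-coaugmented $\mathcal{C}$-Galois extension $\mathcal{B}\subseteq\mathcal{A}$ such that (i) the canonical entwining $\psi\colon\mathcal{C}\otimes\mathcal{A}\to\mathcal{A}\otimes\mathcal{C}$, $c\otimes a\mapsto can(can^{-1}(1\otimes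 c)a)$, is bijective, and (ii) there exists a left $\mathcal{B}$-linear right $\mathcal{C}$-colinear splitting of the multiplication map $\mathcal{B}\otimes\mathcal{A}\to\mathcal{A}$ (equivariant projectivity). The left $\mathcal{B}$-module structure on $\mathcal{A}\,\Box^{\mathcal{C}}V$ is by left multiplication on $\mathcal{A}$ (and similarly for $\mathcal{A}'$); $\mathcal{B}'$ is a right $\mathcal{B}$-module via $b'\cdot b:=b'f(b)$. The induced map on $K_0$ (classes of finitely generated projective left modules) is $[P]\mapsto[\mathcal{B}'\otimes_{\mathcal{B}}P]$. *)

theory Defs
  imports Complex_Main "HOL-Algebra.Free_Abelian_Groups" "HOL-Algebra.Module"
begin

text \<open>
  All structures are carrier-based records in the style of HOL-Algebra, so that subspaces such as
  the coaction-invariant subalgebra and cotensor products are again structures of the same kind.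
  Only the additive fields and \<open>smult\<close> of a \<open>module\<close> record are relevant when it is used as a
  vector space or module; its \<open>mult\<close> and \<open>one\<close> matter only for algebras.
\<close>

section \<open>Modules over arbitrary rings\<close>

definition complex_ring :: "complex ring" where
  "complex_ring = \<lparr>carrier = UNIV, mult = (*), one = 1, zero = 0, add = (+)\<rparr>"

text \<open>The library locale \<open>module\<close> requires a commutative base ring.\<close>

locale left_module = R?: ring R + M?: abelian_group M for R (structure) and M (structure) +
  assumes smult_closed:
      "\<lbrakk>a \<in> carrier R; x \<in> carrier M\<rbrakk> \<Longrightarrow> a \<odot>\<^bsub>M\<^esub> x \<in> carrier M"
    and smult_l_distr:
      "\<lbrakk>a \<in> carrier R; b \<in> carrier R; x \<in> carrier M\<rbrakk>
        \<Longrightarrow> (a \<oplus>\<^bsub>R\<^esub> b) \<odot>\<^bsub>M\<^esub> x = a \<odot>\<^bsub>M\<^esub> x \<oplus>\<^bsub>M\<^esub> b \<odot>\<^bsub>M\<^esub> x"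
    and smult_r_distr:
      "\<lbrakk>a \<in> carrier R; x \<in> carrier M; y \<in> carrier M\<rbrakk>
        \<Longrightarrow> a \<odot>\<^bsub>M\<^esub> (x \<oplus>\<^bsub>M\<^esub> y) = a \<odot>\<^bsub>M\<^esub> x \<oplus>\<^bsub>M\<^esub> a \<odot>\<^bsub>M\<^esub> y"
    and smult_assoc:
      "\<lbrakk>a \<in> carrier R; b \<in> carrier R; x \<in> carrier M\<rbrakk>
        \<Longrightarrow> (a \<otimes>\<^bsub>R\<^esub> b) \<odot>\<^bsub>M\<^esub> x = a \<odot>\<^bsub>M\<^esub> (b \<odot>\<^bsub>M\<^esub> x)"
    and smult_one:
      "x \<in> carrier M \<Longrightarrow> \<one>\<^bsub>R\<^esub> \<odot>\<^bsub>M\<^esub> x = x"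

text \<open>
  The scalars \<open>R\<close> may be a subring of a larger ring acting on \<open>M\<close> and \<open>N\<close>: only its carrier
  is used.
\<close>

definition linear_maps ::
    "('r, 's) ring_scheme \<Rightarrow> ('r, 'm, 'x) module_scheme \<Rightarrow> ('r, 'n, 'y) module_scheme \<Rightarrow> ('m \<Rightarrow> 'n) set"
where
  "linear_maps R M N =
    {h \<in> carrier M \<rightarrow> carrier N.
      (\<forall>x \<in> carrier M. \<forall>y \<in> carrier M. h (x \<oplus>\<^bsub>M\<^esub> y) = h x \<oplus>\<^bsub>N\<^esub> h y) \<and>
      (\<forall>r \<in> carrier R. \<forall>x \<in> carrier M. h (r \<odot>\<^bsub>M\<^esub> x) = r \<odot>\<^bsub>N\<^esub> h x)}"

definition linear_isos ::
    "('r, 's) ring_scheme \<Rightarrow> ('r, 'm, 'x) module_scheme \<Rightarrow> ('r, 'n, 'y) module_scheme \<Rightarrow> ('m \<Rightarrow> 'n) set"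
where
  "linear_isos R M N = {h \<in> linear_maps R M N. bij_betw h (carrier M) (carrier N)}"

definition module_isomorphic ::
    "('r, 's) ring_scheme \<Rightarrow> ('r, 'm, 'x) module_scheme \<Rightarrow> ('r, 'n, 'y) module_scheme \<Rightarrow> bool"
where
  "module_isomorphic R M N \<longleftrightarrow> linear_isos R M N \<noteq> {}"

definition finitely_generated :: "('r, 's) ring_scheme \<Rightarrow> ('r, 'm, 'x) module_scheme \<Rightarrow> bool" where
  "finitely_generated R M \<longleftrightarrow>
    (\<exists>S. finite S \<and> S \<subseteq> carrier M \<and>
      (\<forall>x \<in> carrier M. \<exists>k \<in> S \<rightarrow> carrier R. x = (\<Oplus>\<^bsub>M\<^esub>s\<in>S. k s \<odot>\<^bsub>M\<^esub> s)))"

definition finite_dimensional :: "(complex, 'v, 'x) module_scheme \<Rightarrow> bool" where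
  "finite_dimensional V \<longleftrightarrow> finitely_generated complex_ring V"

definition direct_sum ::
    "('r, 'm, 'x) module_scheme \<Rightarrow> ('r, 'n, 'y) module_scheme \<Rightarrow> ('r, 'm \<times> 'n) module"
where
  "direct_sum M N =
    \<lparr>carrier = carrier M \<times> carrier N, mult = undefined, one = undefined,
     zero = (\<zero>\<^bsub>M\<^esub>, \<zero>\<^bsub>N\<^esub>),
     add = (\<lambda>(m, n) (m', n'). (m \<oplus>\<^bsub>M\<^esub> m', n \<oplus>\<^bsub>N\<^esub> n')),
     smult = (\<lambda>r (m, n). (r \<odot>\<^bsub>M\<^esub> m, r \<odot>\<^bsub>N\<^esub> n))\<rparr>"

definition free_module :: "('r, 's) ring_scheme \<Rightarrow> nat \<Rightarrow> ('r, nat \<Rightarrow> 'r) module" where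
  "free_module R n =
    \<lparr>carrier = {..<n} \<rightarrow>\<^sub>E carrier R, mult = undefined, one = undefined,
     zero = (\<lambda>i\<in>{..<n}. \<zero>\<^bsub>R\<^esub>),
     add = (\<lambda>x y. \<lambda>i\<in>{..<n}. x i \<oplus>\<^bsub>R\<^esub> y i),
     smult = (\<lambda>r x. \<lambda>i\<in>{..<n}. r \<otimes>\<^bsub>R\<^esub> x i)\<rparr>"

text \<open>
  Finitely generated projective modules are the direct summands of the modules \<open>R^n\<close>. Taking the
  complement \<open>Q\<close> in the carrier type of \<open>R^n\<close> is no restriction, since \<open>Q\<close> embeds into \<open>R^n\<close>.
\<close>

definition fg_projective :: "('r, 's) ring_scheme \<Rightarrow> ('r, 'm, 'x) module_scheme \<Rightarrow> bool" where
  "fg_projective R P \<longleftrightarrow> left_module R P \<and>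
    (\<exists>n. \<exists>Q :: ('r, nat \<Rightarrow> 'r) module. left_module R Q \<and>
      module_isomorphic R (direct_sum P Q) (free_module R n))"

definition regular_module :: "('a, 's) ring_scheme \<Rightarrow> ('a, 'a) module" where
  "regular_module A =
    \<lparr>carrier = carrier A, mult = mult A, one = one A, zero = zero A, add = add A, smult = mult A\<rparr>"

text \<open>
  A right \<open>R\<close>-module is encoded as a record whose \<open>smult r m\<close> stands for \<open>m \<cdot> r\<close>. The following is
  the right \<open>R\<close>-module structure \<open>m \<cdot> r = m f(r)\<close> on a ring \<open>M\<close> given by \<open>f : R \<rightarrow> M\<close>.
\<close>

definition right_via :: "('m, 's) ring_scheme \<Rightarrow> ('r \<Rightarrow> 'm) \<Rightarrow> ('r, 'm) module" where
  "right_via M f =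
    \<lparr>carrier = carrier M, mult = mult M, one = one M, zero = zero M, add = add M,
     smult = (\<lambda>r m. m \<otimes>\<^bsub>M\<^esub> f r)\<rparr>"

section \<open>Tensor products\<close>

text \<open>
  \<open>M \<otimes>\<^sub>R N\<close>, for a right \<open>R\<close>-module \<open>M\<close> (encoded as above) and a left \<open>R\<close>-module \<open>N\<close>, is the free
  abelian group on \<open>carrier M \<times> carrier N\<close> modulo the usual relations. For commutative \<open>R\<close> the
  encodings of left and right modules agree.
\<close>

type_synonym ('m, 'n) tensor = "('m \<times> 'n \<Rightarrow>\<^sub>0 int) set"

definition tensor_relations ::
    "('r, 's) ring_scheme \<Rightarrow> ('r, 'm, 'x) module_scheme \<Rightarrow> ('r, 'n, 'y) module_scheme \<Rightarrow> ('m, 'n) tensor"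
where
  "tensor_relations R M N =
    {frag_of (m \<oplus>\<^bsub>M\<^esub> m', n) - frag_of (m, n) - frag_of (m', n) | m m' n.
      m \<in> carrier M \<and> m' \<in> carrier M \<and> n \<in> carrier N} \<union>
    {frag_of (m, n \<oplus>\<^bsub>N\<^esub> n') - frag_of (m, n) - frag_of (m, n') | m n n'.
      m \<in> carrier M \<and> n \<in> carrier N \<and> n' \<in> carrier N} \<union>
    {frag_of (r \<odot>\<^bsub>M\<^esub> m, n) - frag_of (m, r \<odot>\<^bsub>N\<^esub> n) | r m n.
      r \<in> carrier R \<and> m \<in> carrier M \<and> n \<in> carrier N}"

definition tensor_kernel ::
    "('r, 's) ring_scheme \<Rightarrow> ('r, 'm, 'x) module_scheme \<Rightarrow> ('r, 'n, 'y) module_scheme \<Rightarrow> ('m, 'n) tensor"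
where
  "tensor_kernel R M N =
    generate (free_Abelian_group (carrier M \<times> carrier N)) (tensor_relations R M N)"

definition tensor_group ::
    "('r, 's) ring_scheme \<Rightarrow> ('r, 'm, 'x) module_scheme \<Rightarrow> ('r, 'n, 'y) module_scheme \<Rightarrow> ('m, 'n) tensor ring"
where
  "tensor_group R M N =
    (let T = free_Abelian_group (carrier M \<times> carrier N) Mod tensor_kernel R M N in
     \<lparr>carrier = carrier T, mult = undefined, one = undefined, zero = one T, add = mult T\<rparr>)"

definition tens ::
    "('r, 's) ring_scheme \<Rightarrow> ('r, 'm, 'x) module_scheme \<Rightarrow> ('r, 'n, 'y) module_scheme
      \<Rightarrow> 'm \<Rightarrow> 'n \<Rightarrow> ('m, 'n) tensor"
where
  "tens R M N m n =
    tensor_kernel R M N #>\<^bsub>free_Abelian_group (carrier M \<times> carrier N)\<^esub> frag_of (m, n)"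

text \<open>
  The additive map out of a tensor product into \<open>G\<close> that sends \<open>m \<otimes> n\<close> to \<open>\<beta> m n\<close>, evaluated on an
  arbitrary representative. It is only used for balanced biadditive \<open>\<beta>\<close>, where the value does not
  depend on the representative.
\<close>

definition tensor_lift :: "('g, 'z) ring_scheme \<Rightarrow> ('m \<Rightarrow> 'n \<Rightarrow> 'g) \<Rightarrow> ('m, 'n) tensor \<Rightarrow> 'g" where
  "tensor_lift G \<beta> X =
    (let x = (SOME x. x \<in> X) in
     (\<Oplus>\<^bsub>G\<^esub>p\<in>Poly_Mapping.keys x. [Poly_Mapping.lookup x p] \<cdot>\<^bsub>G\<^esub> \<beta> (fst p) (snd p)))"

text \<open>
  For a ring \<open>M\<close> with a right action of \<open>R\<close> (commuting with left multiplication), the left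
  \<open>M\<close>-module \<open>M \<otimes>\<^sub>R N\<close> with action \<open>a (m \<otimes> n) = am \<otimes> n\<close>.
\<close>

definition left_tensor ::
    "('r, 's) ring_scheme \<Rightarrow> ('r, 'm, 'x) module_scheme \<Rightarrow> ('r, 'n, 'y) module_scheme
      \<Rightarrow> ('m, ('m, 'n) tensor) module"
where
  "left_tensor R M N =
    ring.extend (tensor_group R M N)
      (module.fields (\<lambda>a. tensor_lift (tensor_group R M N) (\<lambda>m n. tens R M N (a \<otimes>\<^bsub>M\<^esub> m) n)))"

definition vtens ::
    "(complex, 'm, 'x) module_scheme \<Rightarrow> (complex, 'n, 'y) module_scheme \<Rightarrow> 'm \<Rightarrow> 'n \<Rightarrow> ('m, 'n) tensor"
where
  "vtens M N = tens complex_ring M N"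

definition vtensor ::
    "(complex, 'm, 'x) module_scheme \<Rightarrow> (complex, 'n, 'y) module_scheme
      \<Rightarrow> (complex, ('m, 'n) tensor) module" (infixr \<open>\<otimes>\<^sub>\<complex>\<close> 75)
where
  "M \<otimes>\<^sub>\<complex> N =
    ring.extend (tensor_group complex_ring M N)
      (module.fields
        (\<lambda>z. tensor_lift (tensor_group complex_ring M N) (\<lambda>m n. vtens M N (z \<odot>\<^bsub>M\<^esub> m) n)))"

text \<open>In \<open>vtensor_map M N f g\<close>, the spaces \<open>M\<close> and \<open>N\<close> are the targets of \<open>f\<close> and \<open>g\<close>.\<close>

definition vtensor_map ::
    "(complex, 'm, 'x) module_scheme \<Rightarrow> (complex, 'n, 'y) module_scheme
      \<Rightarrow> ('k \<Rightarrow> 'm) \<Rightarrow> ('l \<Rightarrow> 'n) \<Rightarrow> ('k, 'l) tensor \<Rightarrow> ('m, 'n) tensor"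
where
  "vtensor_map M N f g = tensor_lift (M \<otimes>\<^sub>\<complex> N) (\<lambda>k l. vtens M N (f k) (g l))"

text \<open>The associativity isomorphism \<open>(M \<otimes> N) \<otimes> P \<rightarrow> M \<otimes> (N \<otimes> P)\<close>.\<close>

definition vassoc ::
    "(complex, 'm, 'x) module_scheme \<Rightarrow> (complex, 'n, 'y) module_scheme \<Rightarrow> (complex, 'p, 'z) module_scheme
      \<Rightarrow> (('m, 'n) tensor, 'p) tensor \<Rightarrow> ('m, ('n, 'p) tensor) tensor"
where
  "vassoc M N P =
    tensor_lift (M \<otimes>\<^sub>\<complex> (N \<otimes>\<^sub>\<complex> P))
      (\<lambda>t p. tensor_lift (M \<otimes>\<^sub>\<complex> (N \<otimes>\<^sub>\<complex> P)) (\<lambda>m n. vtens M (N \<otimes>\<^sub>\<complex> P) m (vtens N P n p)) t)"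

section \<open>Algebras, coalgebras and comodules over the complex numbers\<close>

text \<open>The library locale \<open>algebra\<close> is restricted to commutative algebras.\<close>

definition complex_algebra :: "(complex, 'a, 'x) module_scheme \<Rightarrow> bool" where
  "complex_algebra A \<longleftrightarrow> module complex_ring A \<and> ring A \<and>
    (\<forall>z. \<forall>x \<in> carrier A. \<forall>y \<in> carrier A.
      (z \<odot>\<^bsub>A\<^esub> x) \<otimes>\<^bsub>A\<^esub> y = z \<odot>\<^bsub>A\<^esub> (x \<otimes>\<^bsub>A\<^esub> y) \<and>
      x \<otimes>\<^bsub>A\<^esub> (z \<odot>\<^bsub>A\<^esub> y) = z \<odot>\<^bsub>A\<^esub> (x \<otimes>\<^bsub>A\<^esub> y))"

definition algebra_homs ::
    "(complex, 'a, 'x) module_scheme \<Rightarrow> (complex, 'b, 'y) module_scheme \<Rightarrow> ('a \<Rightarrow> 'b) set"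
where
  "algebra_homs A A' = ring_hom A A' \<inter> linear_maps complex_ring A A'"

record 'c coalgebra = "(complex, 'c) module" +
  comult :: "'c \<Rightarrow> ('c, 'c) tensor"
  counit :: "'c \<Rightarrow> complex"

definition coalgebra :: "'c coalgebra \<Rightarrow> bool" where
  "coalgebra C \<longleftrightarrow> module complex_ring C \<and>
    comult C \<in> linear_maps complex_ring C (C \<otimes>\<^sub>\<complex> C) \<and>
    counit C \<in> linear_maps complex_ring C (regular_module complex_ring) \<and>
    (\<forall>c \<in> carrier C.
      vassoc C C C (vtensor_map (C \<otimes>\<^sub>\<complex> C) C (comult C) id (comult C c)) =
        vtensor_map C (C \<otimes>\<^sub>\<complex> C) id (comult C) (comult C c) \<and>
      tensor_lift C (\<lambda>x y. counit C x \<odot>\<^bsub>C\<^esub> y) (comult C c) = c \<and>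
      tensor_lift C (\<lambda>x y. counit C y \<odot>\<^bsub>C\<^esub> x) (comult C c) = c)"

definition group_like :: "'c coalgebra \<Rightarrow> 'c \<Rightarrow> bool" where
  "group_like C e \<longleftrightarrow> e \<in> carrier C \<and> comult C e = vtens C C e e \<and> counit C e = 1"

record ('c, 'm) right_comodule = "(complex, 'm) module" +
  rcoact :: "'m \<Rightarrow> ('m, 'c) tensor"

definition right_comodule :: "'c coalgebra \<Rightarrow> ('c, 'm) right_comodule \<Rightarrow> bool" where
  "right_comodule C M \<longleftrightarrow> module complex_ring M \<and>
    rcoact M \<in> linear_maps complex_ring M (M \<otimes>\<^sub>\<complex> C) \<and>
    (\<forall>m \<in> carrier M.
      vassoc M C C (vtensor_map (M \<otimes>\<^sub>\<complex> C) C (rcoact M) id (rcoact M m)) =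
        vtensor_map M (C \<otimes>\<^sub>\<complex> C) id (comult C) (rcoact M m) \<and>
      tensor_lift M (\<lambda>x c. counit C c \<odot>\<^bsub>M\<^esub> x) (rcoact M m) = m)"

record ('c, 'v) left_comodule = "(complex, 'v) module" +
  lcoact :: "'v \<Rightarrow> ('c, 'v) tensor"

definition left_comodule :: "'c coalgebra \<Rightarrow> ('c, 'v) left_comodule \<Rightarrow> bool" where
  "left_comodule C V \<longleftrightarrow> module complex_ring V \<and>
    lcoact V \<in> linear_maps complex_ring V (C \<otimes>\<^sub>\<complex> V) \<and>
    (\<forall>v \<in> carrier V.
      vassoc C C V (vtensor_map (C \<otimes>\<^sub>\<complex> C) V (comult C) id (lcoact V v)) =
        vtensor_map C (C \<otimes>\<^sub>\<complex> V) id (lcoact V) (lcoact V v) \<and>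
      tensor_lift V (\<lambda>c x. counit C c \<odot>\<^bsub>V\<^esub> x) (lcoact V v) = v)"

definition left_colinear_maps ::
    "'c coalgebra \<Rightarrow> ('c, 'v) left_comodule \<Rightarrow> ('c, 'w) left_comodule \<Rightarrow> ('v \<Rightarrow> 'w) set"
where
  "left_colinear_maps C V W =
    {g \<in> linear_maps complex_ring V W.
      \<forall>v \<in> carrier V. lcoact W (g v) = vtensor_map C W id g (lcoact V v)}"

section \<open>Principal coalgebra extensions\<close>

definition coaction_invariants :: "'c coalgebra \<Rightarrow> ('c, 'a) right_comodule \<Rightarrow> ('c, 'a) right_comodule"
where
  "coaction_invariants C A =
    A\<lparr>carrier := {b \<in> carrier A. \<forall>a \<in> carrier A.
      rcoact A (b \<otimes>\<^bsub>A\<^esub> a) = b \<odot>\<^bsub>left_tensor complex_ring A C\<^esub> rcoact A a}\<rparr>"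

definition tensor_over_invariants ::
    "'c coalgebra \<Rightarrow> ('c, 'a) right_comodule \<Rightarrow> ('a, 'a) tensor ring"
where
  "tensor_over_invariants C A =
    tensor_group (coaction_invariants C A) (right_via A id) (regular_module A)"

definition can :: "'c coalgebra \<Rightarrow> ('c, 'a) right_comodule \<Rightarrow> ('a, 'a) tensor \<Rightarrow> ('a, 'c) tensor" where
  "can C A = tensor_lift (A \<otimes>\<^sub>\<complex> C) (\<lambda>a a'. a \<odot>\<^bsub>left_tensor complex_ring A C\<^esub> rcoact A a')"

definition coaugmented_galois_extension :: "'c coalgebra \<Rightarrow> 'c \<Rightarrow> ('c, 'a) right_comodule \<Rightarrow> bool" where
  "coaugmented_galois_extension C e A \<longleftrightarrow>
    group_like C e \<and> complex_algebra A \<and> right_comodule C A \<and>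
    rcoact A \<one>\<^bsub>A\<^esub> = vtens A C \<one>\<^bsub>A\<^esub> e \<and>
    bij_betw (can C A) (carrier (tensor_over_invariants C A)) (carrier (A \<otimes>\<^sub>\<complex> C))"

definition right_mult ::
    "'c coalgebra \<Rightarrow> ('c, 'a) right_comodule \<Rightarrow> ('a, 'a) tensor \<Rightarrow> 'a \<Rightarrow> ('a, 'a) tensor"
where
  "right_mult C A t a =
    tensor_lift (tensor_over_invariants C A)
      (\<lambda>x y. tens (coaction_invariants C A) (right_via A id) (regular_module A) x (y \<otimes>\<^bsub>A\<^esub> a)) t"

definition canonical_entwining ::
    "'c coalgebra \<Rightarrow> ('c, 'a) right_comodule \<Rightarrow> ('c, 'a) tensor \<Rightarrow> ('a, 'c) tensor"
where
  "canonical_entwining C A =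
    tensor_lift (A \<otimes>\<^sub>\<complex> C)
      (\<lambda>c a. can C A
        (right_mult C A
          (inv_into (carrier (tensor_over_invariants C A)) (can C A) (vtens A C \<one>\<^bsub>A\<^esub> c)) a))"

text \<open>
  The coaction on \<open>B \<otimes> A\<close> is \<open>id \<otimes> \<delta>\<close>; colinearity of \<open>s\<close> is stated in \<open>B \<otimes> (A \<otimes> C)\<close>.
\<close>

definition equivariantly_projective :: "'c coalgebra \<Rightarrow> ('c, 'a) right_comodule \<Rightarrow> bool" where
  "equivariantly_projective C A \<longleftrightarrow>
    (let B = coaction_invariants C A in
     \<exists>s. s \<in> linear_maps B (regular_module A) (left_tensor complex_ring B A) \<and>
       s \<in> linear_maps complex_ring A (B \<otimes>\<^sub>\<complex> A) \<and>
       (\<forall>a \<in> carrier A.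
         vassoc B A C (vtensor_map (B \<otimes>\<^sub>\<complex> A) C s id (rcoact A a)) =
           vtensor_map B (A \<otimes>\<^sub>\<complex> C) id (rcoact A) (s a) \<and>
         tensor_lift A (\<lambda>b x. b \<otimes>\<^bsub>A\<^esub> x) (s a) = a))"

definition principal_extension :: "'c coalgebra \<Rightarrow> 'c \<Rightarrow> ('c, 'a) right_comodule \<Rightarrow> bool" where
  "principal_extension C e A \<longleftrightarrow>
    coaugmented_galois_extension C e A \<and>
    bij_betw (canonical_entwining C A) (carrier (C \<otimes>\<^sub>\<complex> A)) (carrier (A \<otimes>\<^sub>\<complex> C)) \<and>
    equivariantly_projective C A"

definition equivariant_algebra_homs ::
    "'c coalgebra \<Rightarrow> ('c, 'a) right_comodule \<Rightarrow> ('c, 'b) right_comodule \<Rightarrow> ('a \<Rightarrow> 'b) set"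
where
  "equivariant_algebra_homs C A A' =
    {f \<in> algebra_homs A A'.
      \<forall>a \<in> carrier A. rcoact A' (f a) = vtensor_map A' C f id (rcoact A a)}"

text \<open>
  The cotensor product as a module under left multiplication on \<open>A\<close>; it is used with scalars in
  the coaction-invariant subalgebra only.
\<close>

definition cotensor ::
    "'c coalgebra \<Rightarrow> ('c, 'a) right_comodule \<Rightarrow> ('c, 'v) left_comodule \<Rightarrow> ('a, ('a, 'v) tensor) module"
where
  "cotensor C A V =
    (left_tensor complex_ring A V)\<lparr>carrier :=
      {x \<in> carrier (A \<otimes>\<^sub>\<complex> V).
        vassoc A C V (vtensor_map (A \<otimes>\<^sub>\<complex> C) V (rcoact A) id x) \<ominus>\<^bsub>A \<otimes>\<^sub>\<complex> (C \<otimes>\<^sub>\<complex> V)\<^esub>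
          vtensor_map A (C \<otimes>\<^sub>\<complex> V) id (lcoact V) x
        = \<zero>\<^bsub>A \<otimes>\<^sub>\<complex> (C \<otimes>\<^sub>\<complex> V)\<^esub>}\<rparr>"

section \<open>Base change and the Grothendieck group\<close>

text \<open>For a ring homomorphism \<open>f : R \<rightarrow> R'\<close>, the left \<open>R'\<close>-module \<open>R' \<otimes>\<^sub>R P\<close>.\<close>

definition base_change ::
    "('r, 's) ring_scheme \<Rightarrow> ('q, 't) ring_scheme \<Rightarrow> ('r \<Rightarrow> 'q) \<Rightarrow> ('r, 'm, 'x) module_scheme
      \<Rightarrow> ('q, ('q, 'm) tensor) module"
where
  "base_change R R' f P = left_tensor R (right_via R' f) P"

definition base_change_tens ::
    "('r, 's) ring_scheme \<Rightarrow> ('q, 't) ring_scheme \<Rightarrow> ('r \<Rightarrow> 'q) \<Rightarrow> ('r, 'm, 'x) module_scheme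
      \<Rightarrow> 'q \<Rightarrow> 'm \<Rightarrow> ('q, 'm) tensor"
where
  "base_change_tens R R' f P = tens R (right_via R' f) P"

text \<open>The map \<open>id \<otimes> h\<close> from \<open>R' \<otimes>\<^sub>R P\<close> to \<open>R' \<otimes>\<^sub>R Q\<close>, where \<open>Q\<close> is the target of \<open>h\<close>.\<close>

definition base_change_map ::
    "('r, 's) ring_scheme \<Rightarrow> ('q, 't) ring_scheme \<Rightarrow> ('r \<Rightarrow> 'q) \<Rightarrow> ('r, 'n, 'x) module_scheme
      \<Rightarrow> ('m \<Rightarrow> 'n) \<Rightarrow> ('q, 'm) tensor \<Rightarrow> ('q, 'n) tensor"
where
  "base_change_map R R' f Q h =
    tensor_lift (base_change R R' f Q) (\<lambda>r p. base_change_tens R R' f Q r (h p))"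

text \<open>
  \<open>K\<^sub>0(R)\<close> is the Grothendieck group of isomorphism classes of finitely generated projective left
  \<open>R\<close>-modules under direct sum. Its elements are equivalence classes of pairs \<open>(P, Q)\<close>, standing
  for \<open>[P] - [Q]\<close>, where the representatives are drawn from the type \<open>nat \<Rightarrow> 'r\<close>, in which every
  finitely generated projective module has an isomorphic copy (inside some \<open>R^n\<close>). In
  \<open>K0_diff R P Q\<close>, on the other hand, \<open>P\<close> and \<open>Q\<close> may live in any type. As in \<open>HOL-Algebra\<close>, the
  abelian group \<open>K\<^sub>0(R)\<close> is a \<open>monoid\<close> record, hence written multiplicatively.
\<close>

definition K0_diff ::
    "('r, 's) ring_scheme \<Rightarrow> ('r, 'm, 'x) module_scheme \<Rightarrow> ('r, 'n, 'y) module_scheme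
      \<Rightarrow> (('r, nat \<Rightarrow> 'r) module \<times> ('r, nat \<Rightarrow> 'r) module) set"
where
  "K0_diff R P Q =
    {(P', Q'). fg_projective R P' \<and> fg_projective R Q' \<and>
      (\<exists>S :: ('r, nat \<Rightarrow> 'r) module. fg_projective R S \<and>
        module_isomorphic R (direct_sum (direct_sum P Q') S) (direct_sum (direct_sum P' Q) S))}"

definition K0 ::
    "('r, 's) ring_scheme \<Rightarrow> (('r, nat \<Rightarrow> 'r) module \<times> ('r, nat \<Rightarrow> 'r) module) set monoid"
where
  "K0 R =
    \<lparr>carrier = {K0_diff R P Q | (P :: ('r, nat \<Rightarrow> 'r) module) (Q :: ('r, nat \<Rightarrow> 'r) module).
        fg_projective R P \<and> fg_projective R Q},
     mult = (\<lambda>X Y. \<Union>(P, Q)\<in>X. \<Union>(P', Q')\<in>Y. K0_diff R (direct_sum P P') (direct_sum Q Q')),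
     one = K0_diff R (free_module R 0) (free_module R 0)\<rparr>"

definition K0_class ::
    "('r, 's) ring_scheme \<Rightarrow> ('r, 'm, 'x) module_scheme
      \<Rightarrow> (('r, nat \<Rightarrow> 'r) module \<times> ('r, nat \<Rightarrow> 'r) module) set"
where
  "K0_class R P = K0_diff R P (free_module R 0)"

text \<open>
  The map \<open>[P] - [Q] \<mapsto> [R' \<otimes>\<^sub>R P] - [R' \<otimes>\<^sub>R Q]\<close>; all sets in the union are equal.
\<close>

definition K0_map ::
    "('r, 's) ring_scheme \<Rightarrow> ('q, 't) ring_scheme \<Rightarrow> ('r \<Rightarrow> 'q)
      \<Rightarrow> (('r, nat \<Rightarrow> 'r) module \<times> ('r, nat \<Rightarrow> 'r) module) set
      \<Rightarrow> (('q, nat \<Rightarrow> 'q) module \<times> ('q, nat \<Rightarrow> 'q) module) set"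
where
  "K0_map R R' f X = (\<Union>(P, Q)\<in>X. K0_diff R' (base_change R R' f P) (base_change R R' f Q))"

end

theory Submission
  imports Defs "HOL-Algebra.Subrings"
begin

text \<open>
  Write \<open>\<delta>(a) = a_0 \<otimes> a_1\<close> for the coaction and \<open>t\<^sup>1 \<otimes> t\<^sup>2\<close> for the preimage of \<open>1 \<otimes> c\<close> under the canonical map
  \<open>A \<otimes>\<^sub>B A \<rightarrow> A \<otimes> C\<close>. Bijectivity of the canonical map says that the left \<open>B\<close>-linear endomorphisms of \<open>A\<close> are
  exactly the convolution operators \<open>a \<mapsto> a_0 L(a_1)\<close>, for a unique linear map \<open>L : C \<rightarrow> A\<close>: the endomorphism
  \<open>h\<close> corresponds to \<open>L(c) = t\<^sup>1 h(t\<^sup>2)\<close> (\<open>hat_tau\<close>, \<open>hat_inject\<close>). This turns identities between maps out of \<open>C\<close> into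
  identities between endomorphisms of \<open>A\<close>. A first consequence is that \<open>b\<close> is invariant as soon as
  \<open>\<delta>(b) = b \<otimes> e\<close> (\<open>invariantI\<close>), so that an equivariant algebra map \<open>f\<close> sends \<open>B\<close> to \<open>B'\<close>.

  Applied to an equivariant splitting \<open>s : A \<rightarrow> B \<otimes> A\<close> of the multiplication, the correspondence yields the strong
  connection \<open>\<ell>(c) = t\<^sup>1 s(t\<^sup>2)\<close> in \<open>A \<otimes> A\<close>, with \<open>s(a) = a_0 \<ell>(a_1)\<close>. Its product \<open>\<ell>\<^sup>1(c) \<ell>\<^sup>2(c)\<close> is \<open>\<epsilon>(c)\<close>
  (\<open>mult_ell\<close>), and it is colinear on both sides (\<open>ell_right_colinear\<close>, \<open>ell_left_colinear\<close>), the left coaction being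
  given by the entwining. As \<open>f\<close> carries the translation map of \<open>A\<close> to the one of \<open>A'\<close> (\<open>f_tau\<close>), the left colinearity
  persists in \<open>A'\<close>, and \<open>a' \<mapsto> a'_0 f(\<ell>\<^sup>1(a'_1)) \<otimes> \<ell>\<^sup>2(a'_1)\<close> takes values in \<open>B' \<otimes> A\<close>
  (\<open>hat_f_ell_invariant\<close>).

  Let \<open>V\<close> be finite-dimensional with coaction \<open>\<rho>(v) = v_{-1} \<otimes> v_0\<close>. For each vector \<open>r\<close> of a basis of \<open>V\<close> consider the
  kernel tensor \<open>\<ell>(r_{-1}) \<otimes> r_0\<close> in \<open>A \<otimes> (A \<otimes> V)\<close>, and decompose these finitely many tensors simultaneously as
  \<open>\<Sum>k. G k r \<otimes> F k\<close> with as few summands as possible. Both families of legs are then linearly independent, so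
  the right colinearity of \<open>\<ell>\<close> puts every \<open>F k\<close> into \<open>A \<box> V\<close>, and the invariance statement above shows that
  \<open>\<phi>' k : \<Sum>r. x'_r \<otimes> r \<mapsto> \<Sum>r. x'_r f(G k r)\<close> maps \<open>A' \<box> V\<close> to \<open>B'\<close>. Since \<open>\<ell>\<^sup>1 \<ell>\<^sup>2 = \<epsilon>\<close>, every \<open>x'\<close> in \<open>A' \<box> V\<close> equals
  \<open>\<Sum>k. \<phi>' k (x') (f \<otimes> id)(F k)\<close> (\<open>phi_expansion\<close>). In other words, the elements \<open>(f \<otimes> id)(F k)\<close> and the functionals \<open>\<phi>' k\<close>
  form a finite dual basis of \<open>A' \<box> V\<close>. The case \<open>f = id\<close> provides a dual basis \<open>F k\<close>, \<open>\<phi> k\<close> of \<open>A \<box> V\<close>, and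
  \<open>\<phi>' k ((f \<otimes> id) x) = f(\<phi> k x)\<close>.

  A module with a finite dual basis is finitely generated projective. The comparison map
  \<open>b \<otimes> x \<mapsto> b (f \<otimes> id)(x)\<close> from \<open>B' \<otimes>\<^sub>B (A \<box> V)\<close> to \<open>A' \<box> V\<close> has the inverse \<open>x' \<mapsto> \<Sum>k. \<phi>' k (x') \<otimes> F k\<close>, because
  the two dual bases correspond under \<open>f\<close> (\<open>comparison_iso\<close>); its formula makes it natural in \<open>V\<close>. The statement on
  \<open>K\<^sub>0\<close> follows, because base change along \<open>f\<close> preserves isomorphisms, direct sums and finitely generated projective
  modules and hence induces a well-defined homomorphism of Grothendieck groups (\<open>K0_map_diff\<close>).
\<close>

section \<open>Additive maps and finite sums\<close>

definition additive_maps :: "('g, 'x) ring_scheme \<Rightarrow> ('h, 'y) ring_scheme \<Rightarrow> ('g \<Rightarrow> 'h) set" where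
  "additive_maps G H =
    {h \<in> carrier G \<rightarrow> carrier H.
      \<forall>x \<in> carrier G. \<forall>y \<in> carrier G. h (x \<oplus>\<^bsub>G\<^esub> y) = h x \<oplus>\<^bsub>H\<^esub> h y}"

lemma additive_mapsI:
  assumes "\<And>x. x \<in> carrier G \<Longrightarrow> h x \<in> carrier H"
    and "\<And>x y. \<lbrakk>x \<in> carrier G; y \<in> carrier G\<rbrakk> \<Longrightarrow> h (x \<oplus>\<^bsub>G\<^esub> y) = h x \<oplus>\<^bsub>H\<^esub> h y"
  shows "h \<in> additive_maps G H"
  using assms by (auto simp: additive_maps_def)

lemma additive_closed: "\<lbrakk>h \<in> additive_maps G H; x \<in> carrier G\<rbrakk> \<Longrightarrow> h x \<in> carrier H"
  by (auto simp: additive_maps_def)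

lemma additive_add:
  "\<lbrakk>h \<in> additive_maps G H; x \<in> carrier G; y \<in> carrier G\<rbrakk> \<Longrightarrow> h (x \<oplus>\<^bsub>G\<^esub> y) = h x \<oplus>\<^bsub>H\<^esub> h y"
  by (auto simp: additive_maps_def)

lemma additive_comp:
  "\<lbrakk>h \<in> additive_maps G H; k \<in> additive_maps H K\<rbrakk> \<Longrightarrow> (\<lambda>x. k (h x)) \<in> additive_maps G K"
  by (auto simp: additive_maps_def Pi_iff)

lemma additive_group_hom:
  assumes "h \<in> additive_maps G H" "abelian_group G" "abelian_group H"
  shows "group_hom (add_monoid G) (add_monoid H) h"
  using assms
  by (auto simp: additive_maps_def group_hom_def group_hom_axioms_def hom_def
      intro: abelian_group.a_group)

lemma additive_zero:
  assumes "h \<in> additive_maps G H" "abelian_group G" "abelian_group H"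
  shows "h \<zero>\<^bsub>G\<^esub> = \<zero>\<^bsub>H\<^esub>"
  using group_hom.hom_one[OF additive_group_hom[OF assms]] by simp

lemma additive_minus:
  assumes "h \<in> additive_maps G H" "abelian_group G" "abelian_group H" "x \<in> carrier G"
  shows "h (\<ominus>\<^bsub>G\<^esub> x) = \<ominus>\<^bsub>H\<^esub> h x"
  using group_hom.hom_inv[OF additive_group_hom[OF assms(1-3)]] assms(4)
  by (simp add: a_inv_def)

lemma additive_diff:
  assumes "h \<in> additive_maps G H" "abelian_group G" "abelian_group H" "x \<in> carrier G" "y \<in> carrier G"
  shows "h (x \<ominus>\<^bsub>G\<^esub> y) = h x \<ominus>\<^bsub>H\<^esub> h y"
  using assms
  by (simp add: a_minus_def additive_add additive_minus abelian_group.a_inv_closed)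

lemma additive_finsum:
  assumes h: "h \<in> additive_maps G H" and G: "abelian_group G" and H: "abelian_group H"
    and a: "a \<in> I \<rightarrow> carrier G"
  shows "h (\<Oplus>\<^bsub>G\<^esub>i\<in>I. a i) = (\<Oplus>\<^bsub>H\<^esub>i\<in>I. h (a i))"
proof -
  interpret G: abelian_group G by fact
  interpret H: abelian_group H by fact
  show ?thesis
    using a
  proof (induction I rule: infinite_finite_induct)
    case (infinite I)
    then show ?case
      using additive_zero[OF h G H] by simp
  next
    case empty
    then show ?case
      using additive_zero[OF h G H] by simp
  next
    case (insert i I)
    then have "a i \<in> carrier G" "a \<in> I \<rightarrow> carrier G" by auto
    moreover have "(\<lambda>i. h (a i)) \<in> I \<rightarrow> carrier H" "h (a i) \<in> carrier H"
      using insert.prems additive_closed[OF h] by auto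
    ultimately show ?case
      using insert additive_add[OF h] by simp
  qed
qed

lemma (in abelian_group) finsum_swap:
  assumes "finite I" "finite J" "\<And>i j. \<lbrakk>i \<in> I; j \<in> J\<rbrakk> \<Longrightarrow> a i j \<in> carrier G"
  shows "(\<Oplus>i\<in>I. \<Oplus>j\<in>J. a i j) = (\<Oplus>j\<in>J. \<Oplus>i\<in>I. a i j)"
  using assms(1,3)
proof (induction I rule: finite_induct)
  case empty
  then show ?case by simp
next
  case (insert i I)
  have "(\<Oplus>i\<in>insert i I. \<Oplus>j\<in>J. a i j) = (\<Oplus>j\<in>J. a i j) \<oplus> (\<Oplus>i\<in>I. \<Oplus>j\<in>J. a i j)"
    using insert by (subst finsum_insert) (auto intro!: finsum_closed)
  also have "\<dots> = (\<Oplus>j\<in>J. a i j) \<oplus> (\<Oplus>j\<in>J. \<Oplus>i\<in>I. a i j)"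
    using insert by simp
  also have "\<dots> = (\<Oplus>j\<in>J. a i j \<oplus> (\<Oplus>i\<in>I. a i j))"
    using insert by (intro finsum_addf[symmetric]) (auto intro!: finsum_closed)
  also have "\<dots> = (\<Oplus>j\<in>J. \<Oplus>i\<in>insert i I. a i j)"
    using insert by (intro finsum_cong') (auto simp: finsum_insert intro!: finsum_closed)
  finally show ?case .
qed

lemma (in abelian_group) finsum_delta:
  assumes "finite I" "i \<in> I" "x \<in> carrier G"
  shows "(\<Oplus>j\<in>I. if j = i then x else \<zero>) = x"
  using finsum_singleton[of i I "\<lambda>_. x"] assms by (simp add: eq_commute)

lemma (in abelian_group) finsum_append:
  fixes m n :: nat
  assumes "\<And>k. k < m \<Longrightarrow> a k \<in> carrier G" "\<And>k. k < n \<Longrightarrow> b k \<in> carrier G"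
  shows "(\<Oplus>k\<in>{..<m + n}. if k < m then a k else b (k - m)) =
    (\<Oplus>k\<in>{..<m}. a k) \<oplus> (\<Oplus>k\<in>{..<n}. b k)"
  using assms(2)
proof (induction n)
  case 0
  then show ?case
    using assms(1) by (auto intro!: finsum_cong' finsum_closed)
next
  case (Suc n)
  have c: "(\<lambda>k. if k < m then a k else b (k - m)) \<in> {..<m + n} \<rightarrow> carrier G" "b n \<in> carrier G"
    "b \<in> {..<n} \<rightarrow> carrier G" "a \<in> {..<m} \<rightarrow> carrier G"
    using assms(1) Suc.prems by auto
  have "(\<Oplus>k\<in>{..<m + Suc n}. if k < m then a k else b (k - m)) =
      b n \<oplus> (\<Oplus>k\<in>{..<m + n}. if k < m then a k else b (k - m))"
    using c by (simp add: lessThan_Suc)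
  also have "\<dots> = b n \<oplus> ((\<Oplus>k\<in>{..<m}. a k) \<oplus> (\<Oplus>k\<in>{..<n}. b k))"
    using Suc by simp
  also have "\<dots> = (\<Oplus>k\<in>{..<m}. a k) \<oplus> (\<Oplus>k\<in>{..<Suc n}. b k)"
    using c by (simp add: lessThan_Suc a_ac)
  finally show ?case .
qed

lemma linear_maps_additive: "h \<in> linear_maps R M N \<Longrightarrow> h \<in> additive_maps M N"
  by (auto simp: linear_maps_def additive_maps_def)

lemma linear_mapsI:
  assumes "h \<in> additive_maps M N"
    and "\<And>r x. \<lbrakk>r \<in> carrier R; x \<in> carrier M\<rbrakk> \<Longrightarrow> h (r \<odot>\<^bsub>M\<^esub> x) = r \<odot>\<^bsub>N\<^esub> h x"
  shows "h \<in> linear_maps R M N"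
  using assms by (auto simp: additive_maps_def linear_maps_def)

lemma linear_closed: "\<lbrakk>h \<in> linear_maps R M N; x \<in> carrier M\<rbrakk> \<Longrightarrow> h x \<in> carrier N"
  and linear_add: "\<lbrakk>h \<in> linear_maps R M N; x \<in> carrier M; y \<in> carrier M\<rbrakk>
    \<Longrightarrow> h (x \<oplus>\<^bsub>M\<^esub> y) = h x \<oplus>\<^bsub>N\<^esub> h y"
  and linear_smult: "\<lbrakk>h \<in> linear_maps R M N; r \<in> carrier R; x \<in> carrier M\<rbrakk>
    \<Longrightarrow> h (r \<odot>\<^bsub>M\<^esub> x) = r \<odot>\<^bsub>N\<^esub> h x"
  by (auto simp: linear_maps_def)

lemma linear_comp:
  "\<lbrakk>h \<in> linear_maps R M N; k \<in> linear_maps R N P\<rbrakk> \<Longrightarrow> (\<lambda>x. k (h x)) \<in> linear_maps R M P"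
  by (auto simp: linear_maps_def Pi_iff)

lemma linear_id: "id \<in> linear_maps R M M" "(\<lambda>x. x) \<in> linear_maps R M M"
  by (auto simp: linear_maps_def)

section \<open>The universal property of the tensor product\<close>

definition balanced_maps ::
    "('r, 's) ring_scheme \<Rightarrow> ('r, 'm, 'x) module_scheme \<Rightarrow> ('r, 'n, 'y) module_scheme
      \<Rightarrow> ('g, 'z) ring_scheme \<Rightarrow> ('m \<Rightarrow> 'n \<Rightarrow> 'g) set"
where
  "balanced_maps R M N G =
    {\<beta>. (\<forall>m \<in> carrier M. (\<lambda>n. \<beta> m n) \<in> additive_maps N G) \<and>
        (\<forall>n \<in> carrier N. (\<lambda>m. \<beta> m n) \<in> additive_maps M G) \<and>
        (\<forall>r \<in> carrier R. \<forall>m \<in> carrier M. \<forall>n \<in> carrier N.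
          \<beta> (r \<odot>\<^bsub>M\<^esub> m) n = \<beta> m (r \<odot>\<^bsub>N\<^esub> n))}"

lemma balanced_mapsI:
  assumes "\<And>m n. \<lbrakk>m \<in> carrier M; n \<in> carrier N\<rbrakk> \<Longrightarrow> \<beta> m n \<in> carrier G"
    and "\<And>m n n'. \<lbrakk>m \<in> carrier M; n \<in> carrier N; n' \<in> carrier N\<rbrakk>
      \<Longrightarrow> \<beta> m (n \<oplus>\<^bsub>N\<^esub> n') = \<beta> m n \<oplus>\<^bsub>G\<^esub> \<beta> m n'"
    and "\<And>m m' n. \<lbrakk>m \<in> carrier M; m' \<in> carrier M; n \<in> carrier N\<rbrakk>
      \<Longrightarrow> \<beta> (m \<oplus>\<^bsub>M\<^esub> m') n = \<beta> m n \<oplus>\<^bsub>G\<^esub> \<beta> m' n"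
    and "\<And>r m n. \<lbrakk>r \<in> carrier R; m \<in> carrier M; n \<in> carrier N\<rbrakk>
      \<Longrightarrow> \<beta> (r \<odot>\<^bsub>M\<^esub> m) n = \<beta> m (r \<odot>\<^bsub>N\<^esub> n)"
  shows "\<beta> \<in> balanced_maps R M N G"
  using assms by (auto simp: balanced_maps_def additive_maps_def)

lemma balanced_closed:
    "\<lbrakk>\<beta> \<in> balanced_maps R M N G; m \<in> carrier M; n \<in> carrier N\<rbrakk> \<Longrightarrow> \<beta> m n \<in> carrier G"
  and balanced_right: "\<lbrakk>\<beta> \<in> balanced_maps R M N G; m \<in> carrier M\<rbrakk> \<Longrightarrow> (\<lambda>n. \<beta> m n) \<in> additive_maps N G"
  and balanced_left: "\<lbrakk>\<beta> \<in> balanced_maps R M N G; n \<in> carrier N\<rbrakk> \<Longrightarrow> (\<lambda>m. \<beta> m n) \<in> additive_maps M G"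
  and balanced_add_right:
    "\<lbrakk>\<beta> \<in> balanced_maps R M N G; m \<in> carrier M; n \<in> carrier N; n' \<in> carrier N\<rbrakk>
      \<Longrightarrow> \<beta> m (n \<oplus>\<^bsub>N\<^esub> n') = \<beta> m n \<oplus>\<^bsub>G\<^esub> \<beta> m n'"
  and balanced_add_left:
    "\<lbrakk>\<beta> \<in> balanced_maps R M N G; m \<in> carrier M; m' \<in> carrier M; n \<in> carrier N\<rbrakk>
      \<Longrightarrow> \<beta> (m \<oplus>\<^bsub>M\<^esub> m') n = \<beta> m n \<oplus>\<^bsub>G\<^esub> \<beta> m' n"
  and balanced_smult:
    "\<lbrakk>\<beta> \<in> balanced_maps R M N G; r \<in> carrier R; m \<in> carrier M; n \<in> carrier N\<rbrakk>
      \<Longrightarrow> \<beta> (r \<odot>\<^bsub>M\<^esub> m) n = \<beta> m (r \<odot>\<^bsub>N\<^esub> n)"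
  by (auto simp: balanced_maps_def additive_maps_def)

lemma add_monoid_tensor_group:
  "add_monoid (tensor_group R M N) =
    free_Abelian_group (carrier M \<times> carrier N) Mod tensor_kernel R M N"
  by (simp add: tensor_group_def Let_def)

text \<open>
  The tensor product of two modules carries several module structures on one abelian group; facts about the
  additive structure are transferred between them through this relation.
\<close>

definition same_additive :: "('g, 'x) ring_scheme \<Rightarrow> ('g, 'y) ring_scheme \<Rightarrow> bool" where
  "same_additive G H \<longleftrightarrow> carrier G = carrier H \<and> add G = add H \<and> zero G = zero H"

lemma finsum_same: "same_additive G H \<Longrightarrow> finsum G = finsum H"
  unfolding same_additive_def finsum_def finprod_def by (intro ext) simp

lemma add_pow_int_same: "same_additive G H \<Longrightarrow> [(k::int)] \<cdot>\<^bsub>G\<^esub> x = [k] \<cdot>\<^bsub>H\<^esub> x"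
  by (auto simp: same_additive_def add_pow_def int_pow_def nat_pow_def m_inv_def Let_def)

lemma same_additive_sym: "same_additive G H \<Longrightarrow> same_additive H G"
  by (simp add: same_additive_def)

lemma abelian_group_same:
  assumes "same_additive G H" "abelian_group G"
  shows "abelian_group H"
proof -
  interpret G: abelian_group G by fact
  have "carrier H = carrier G" "add H = add G" "zero H = zero G"
    using assms(1) by (auto simp: same_additive_def)
  then show ?thesis
    by (intro abelian_groupI)
      (auto simp: G.a_ac intro!: bexI[of _ "\<ominus>\<^bsub>G\<^esub> _"] G.l_neg)
qed

lemma additive_maps_same:
  "\<lbrakk>same_additive G G'; same_additive H H'\<rbrakk> \<Longrightarrow> additive_maps G H = additive_maps G' H'"
  by (auto simp: same_additive_def additive_maps_def)

lemma balanced_maps_same: "same_additive G H \<Longrightarrow> balanced_maps R M N G = balanced_maps R M N H"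
  by (auto simp: balanced_maps_def same_additive_def additive_maps_def)

lemma tensor_lift_same:
  assumes "same_additive G H"
  shows "tensor_lift G = tensor_lift H"
  unfolding tensor_lift_def fun_eq_iff Let_def
  by (simp add: finsum_same[OF assms] add_pow_int_same[OF assms])

locale tensor_factors =
  M: abelian_group M + N: abelian_group N
  for R :: "('r, 's) ring_scheme" and M :: "('r, 'm, 'x) module_scheme"
    and N :: "('r, 'n, 'y) module_scheme" +
  assumes left_closed: "\<lbrakk>r \<in> carrier R; m \<in> carrier M\<rbrakk> \<Longrightarrow> r \<odot>\<^bsub>M\<^esub> m \<in> carrier M"
    and right_closed: "\<lbrakk>r \<in> carrier R; n \<in> carrier N\<rbrakk> \<Longrightarrow> r \<odot>\<^bsub>N\<^esub> n \<in> carrier N"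
begin

abbreviation "F \<equiv> free_Abelian_group (carrier M \<times> carrier N)"
abbreviation "K \<equiv> tensor_kernel R M N"
abbreviation "T \<equiv> tensor_group R M N"

lemma comm_group_F: "comm_group F"
  by (rule abelian_free_Abelian_group)

lemma relations_subset: "tensor_relations R M N \<subseteq> carrier F"
proof
  have three: "frag_of p - frag_of q - frag_of s \<in> carrier F"
    if "p \<in> carrier M \<times> carrier N" "q \<in> carrier M \<times> carrier N" "s \<in> carrier M \<times> carrier N"
    for p q s :: "'m \<times> 'n"
    using that keys_diff[of "frag_of p - frag_of q" "frag_of s"] keys_diff[of "frag_of p" "frag_of q"]
    by auto
  have two: "frag_of p - frag_of q \<in> carrier F"
    if "p \<in> carrier M \<times> carrier N" "q \<in> carrier M \<times> carrier N" for p q :: "'m \<times> 'n"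
    using that keys_diff[of "frag_of p" "frag_of q"] by auto
  fix x assume "x \<in> tensor_relations R M N"
  then show "x \<in> carrier F"
    unfolding tensor_relations_def
    by (elim UnE CollectE exE conjE; hypsubst; intro three two) (auto intro: left_closed right_closed)
qed

lemma subgroup_K: "subgroup K F"
  unfolding tensor_kernel_def
  by (intro group.generate_is_subgroup relations_subset) simp

lemma normal_K: "K \<lhd> F"
  by (rule comm_group.subgroup_imp_normal[OF comm_group_F subgroup_K])

lemma abelian_group_T: "abelian_group T"
proof (rule comm_group_abelian_groupI)
  show "comm_group (add_monoid T)"
    unfolding add_monoid_tensor_group
    by (rule comm_group.abelian_FactGroup[OF comm_group_F subgroup_K])
qed

sublocale T: abelian_group T
  by (rule abelian_group_T)

lemma carrier_T: "carrier T = rcosets\<^bsub>F\<^esub> K"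
  by (simp add: tensor_group_def Let_def FactGroup_def)

lemma add_coset:
  assumes "x \<in> carrier F" "y \<in> carrier F"
  shows "(K #>\<^bsub>F\<^esub> x) \<oplus>\<^bsub>T\<^esub> (K #>\<^bsub>F\<^esub> y) = K #>\<^bsub>F\<^esub> (x + y)"
  using normal.rcos_sum[OF normal_K assms] by (simp add: tensor_group_def Let_def FactGroup_def)

lemma coset_closed: "x \<in> carrier F \<Longrightarrow> K #>\<^bsub>F\<^esub> x \<in> carrier T"
  by (auto simp: carrier_T RCOSETS_def)

lemma coset_zero: "K #>\<^bsub>F\<^esub> 0 = \<zero>\<^bsub>T\<^esub>"
proof -
  have "K #>\<^bsub>F\<^esub> 0 = K"
    using group.coset_mult_one[of F K] subgroup.subset[OF subgroup_K] by simp
  then show ?thesis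
    by (simp add: tensor_group_def Let_def FactGroup_def)
qed

lemma coset_eq:
  assumes "x \<in> carrier F" "y \<in> carrier F" "x - y \<in> K"
  shows "K #>\<^bsub>F\<^esub> x = K #>\<^bsub>F\<^esub> y"
proof -
  have *: "x \<otimes>\<^bsub>F\<^esub> inv\<^bsub>F\<^esub> y \<in> K"
    using assms by simp
  have "K #>\<^bsub>F\<^esub> (x \<otimes>\<^bsub>F\<^esub> inv\<^bsub>F\<^esub> y) = K"
    by (rule group.coset_join2[OF group_free_Abelian_group subsetD[OF subgroup.subset[OF subgroup_K] *] subgroup_K *])
  then show ?thesis
    by (rule group.coset_mult_inv1[OF group_free_Abelian_group])
      (use assms subgroup.subset[OF subgroup_K] in auto)
qed

lemma relation_in_K: "x \<in> tensor_relations R M N \<Longrightarrow> x \<in> K"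
  by (auto simp: tensor_kernel_def intro: generate.incl)

lemma tens_closed [intro, simp]:
  "\<lbrakk>m \<in> carrier M; n \<in> carrier N\<rbrakk> \<Longrightarrow> tens R M N m n \<in> carrier T"
  unfolding tens_def by (rule coset_closed) simp

lemma tens_balanced: "tens R M N \<in> balanced_maps R M N T"
proof (rule balanced_mapsI)
  fix m n n' assume c: "m \<in> carrier M" "n \<in> carrier N" "n' \<in> carrier N"
  have "frag_of (m, n \<oplus>\<^bsub>N\<^esub> n') - (frag_of (m, n) + frag_of (m, n')) \<in> K"
    using c by (intro relation_in_K) (auto simp: tensor_relations_def diff_diff_add)
  moreover have "frag_of (m, n) + frag_of (m, n') \<in> carrier F" "frag_of (m, n \<oplus>\<^bsub>N\<^esub> n') \<in> carrier F"
    using c keys_add[of "frag_of (m, n)" "frag_of (m, n')"] by auto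
  ultimately show "tens R M N m (n \<oplus>\<^bsub>N\<^esub> n') = tens R M N m n \<oplus>\<^bsub>T\<^esub> tens R M N m n'"
    using c by (simp add: tens_def add_coset coset_eq)
next
  fix m m' n assume c: "m \<in> carrier M" "m' \<in> carrier M" "n \<in> carrier N"
  have "frag_of (m \<oplus>\<^bsub>M\<^esub> m', n) - (frag_of (m, n) + frag_of (m', n)) \<in> K"
    using c by (intro relation_in_K) (auto simp: tensor_relations_def diff_diff_add)
  moreover have "frag_of (m, n) + frag_of (m', n) \<in> carrier F" "frag_of (m \<oplus>\<^bsub>M\<^esub> m', n) \<in> carrier F"
    using c keys_add[of "frag_of (m, n)" "frag_of (m', n)"] by auto
  ultimately show "tens R M N (m \<oplus>\<^bsub>M\<^esub> m') n = tens R M N m n \<oplus>\<^bsub>T\<^esub> tens R M N m' n"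
    using c by (simp add: tens_def add_coset coset_eq)
next
  fix r m n assume c: "r \<in> carrier R" "m \<in> carrier M" "n \<in> carrier N"
  then have "frag_of (r \<odot>\<^bsub>M\<^esub> m, n) - frag_of (m, r \<odot>\<^bsub>N\<^esub> n) \<in> K"
    by (intro relation_in_K) (auto simp: tensor_relations_def)
  then show "tens R M N (r \<odot>\<^bsub>M\<^esub> m) n = tens R M N m (r \<odot>\<^bsub>N\<^esub> n)"
    using c left_closed right_closed by (simp add: tens_def coset_eq)
qed auto

lemmas tens_add_left = balanced_add_left[OF tens_balanced]
  and tens_add_right = balanced_add_right[OF tens_balanced]
  and tens_smult = balanced_smult[OF tens_balanced]

lemma tens_minus: "\<lbrakk>m \<in> carrier M; n \<in> carrier N\<rbrakk> \<Longrightarrow> \<ominus>\<^bsub>T\<^esub> tens R M N m n = tens R M N (\<ominus>\<^bsub>M\<^esub> m) n"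
  using additive_minus[OF balanced_left[OF tens_balanced] M.abelian_group_axioms T.abelian_group_axioms]
  by simp

lemma tensor_induct [consumes 1, case_names zero tens add]:
  assumes X: "X \<in> carrier T"
    and zero: "P \<zero>\<^bsub>T\<^esub>"
    and tens: "\<And>m n. \<lbrakk>m \<in> carrier M; n \<in> carrier N\<rbrakk> \<Longrightarrow> P (tens R M N m n)"
    and add: "\<And>X Y. \<lbrakk>X \<in> carrier T; Y \<in> carrier T; P X; P Y\<rbrakk> \<Longrightarrow> P (X \<oplus>\<^bsub>T\<^esub> Y)"
  shows "P X"
proof -
  obtain x where x: "x \<in> carrier F" "X = K #>\<^bsub>F\<^esub> x"
    using X by (auto simp: carrier_T RCOSETS_def)
  have "P (K #>\<^bsub>F\<^esub> x) \<and> P (\<ominus>\<^bsub>T\<^esub> (K #>\<^bsub>F\<^esub> x))"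
    using x(1)[unfolded carrier_free_Abelian_group_iff]
  proof (induction x rule: free_Abelian_group_induct[consumes 1])
    case 1
    then show ?case
    proof -
      have "\<ominus>\<^bsub>T\<^esub> \<zero>\<^bsub>T\<^esub> = \<zero>\<^bsub>T\<^esub>"
        by (rule T.minus_equality) simp_all
      then show ?thesis
        using zero by (simp only: coset_zero)
    qed
  next
    case (2 x y)
    have xy: "x \<in> carrier F" "y \<in> carrier F" "x - y \<in> carrier F"
      using 2 subset_trans[OF keys_diff[of x y] Un_least] by simp_all
    have "(K #>\<^bsub>F\<^esub> (x - y)) \<oplus>\<^bsub>T\<^esub> (K #>\<^bsub>F\<^esub> y) = K #>\<^bsub>F\<^esub> x"
      using add_coset[OF xy(3,2)] by simp
    moreover have c: "K #>\<^bsub>F\<^esub> (x - y) \<in> carrier T" "K #>\<^bsub>F\<^esub> x \<in> carrier T" "K #>\<^bsub>F\<^esub> y \<in> carrier T"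
      by (fact coset_closed[OF xy(3)], fact coset_closed[OF xy(1)], fact coset_closed[OF xy(2)])
    ultimately have e: "K #>\<^bsub>F\<^esub> (x - y) = (K #>\<^bsub>F\<^esub> x) \<oplus>\<^bsub>T\<^esub> (\<ominus>\<^bsub>T\<^esub> (K #>\<^bsub>F\<^esub> y))"
      by (metis T.a_assoc T.a_inv_closed T.r_neg T.r_zero)
    then have e': "\<ominus>\<^bsub>T\<^esub> (K #>\<^bsub>F\<^esub> (x - y)) = (\<ominus>\<^bsub>T\<^esub> (K #>\<^bsub>F\<^esub> x)) \<oplus>\<^bsub>T\<^esub> (K #>\<^bsub>F\<^esub> y)"
      using c by (simp add: T.minus_add)
    show ?case
      unfolding e'
      unfolding e
      using 2 c by (auto intro!: add)
  next
    case (3 a)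
    then have "P (tens R M N (fst a) (snd a))" "P (tens R M N (\<ominus>\<^bsub>M\<^esub> fst a) (snd a))"
      by (auto intro!: tens)
    moreover have "\<ominus>\<^bsub>T\<^esub> tens R M N (fst a) (snd a) = tens R M N (\<ominus>\<^bsub>M\<^esub> fst a) (snd a)"
      using 3 by (intro tens_minus) auto
    ultimately show ?case
      by (simp add: tens_def)
  qed
  with x show ?thesis by simp
qed

lemma tensor_ext:
  assumes "g \<in> additive_maps T H" "h \<in> additive_maps T H" "abelian_group H"
    and "\<And>m n. \<lbrakk>m \<in> carrier M; n \<in> carrier N\<rbrakk> \<Longrightarrow> g (tens R M N m n) = h (tens R M N m n)"
    and "X \<in> carrier T"
  shows "g X = h X"
  using assms(5)
proof (induction X rule: tensor_induct)
  case zero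
  then show ?case
    using assms(1-3) by (simp add: additive_zero T.abelian_group_axioms)
next
  case (add X Y)
  then show ?case
    using assms(1,2) by (simp add: additive_add)
qed (use assms in auto)

text \<open>
  \<open>tensor_lift\<close> evaluates \<open>\<beta>\<close> on the support of some representative, which is the homomorphism given by the
  universal property of the free abelian group; it kills the relations because \<open>\<beta>\<close> is balanced.
\<close>

lemma tensor_lift_coset:
  assumes G: "abelian_group G" and \<beta>: "\<beta> \<in> balanced_maps R M N G"
  obtains h where "h \<in> hom F (add_monoid G)"
    and "\<And>m n. \<lbrakk>m \<in> carrier M; n \<in> carrier N\<rbrakk> \<Longrightarrow> h (frag_of (m, n)) = \<beta> m n"
    and "\<And>x. x \<in> carrier F \<Longrightarrow> tensor_lift G \<beta> (K #>\<^bsub>F\<^esub> x) = h x"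
proof -
  interpret G: abelian_group G by fact
  obtain h where h: "h \<in> hom F (add_monoid G)"
      "\<And>p. p \<in> carrier M \<times> carrier N \<Longrightarrow> h (frag_of p) = \<beta> (fst p) (snd p)"
  proof (rule comm_group.free_Abelian_group_universal[OF G.a_comm_group,
          where S = "carrier M \<times> carrier N" and f = "\<lambda>p. \<beta> (fst p) (snd p)"])
    show "(\<lambda>p. \<beta> (fst p) (snd p)) ` (carrier M \<times> carrier N) \<subseteq> carrier (add_monoid G)"
      using balanced_closed[OF \<beta>] by auto
  qed auto
  interpret h: group_hom F "add_monoid G" h
    using h(1) by (auto simp: group_hom_def group_hom_axioms_def G.a_group)
  have closed: "frag_cmul z (frag_of p) \<in> carrier F" if "p \<in> carrier M \<times> carrier N" for z p
    using that keys_cmul[of z "frag_of p"] by auto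
  have sums: "h (\<Sum>p\<in>P. frag_cmul (c p) (frag_of p)) = (\<Oplus>\<^bsub>G\<^esub>p\<in>P. [c p] \<cdot>\<^bsub>G\<^esub> \<beta> (fst p) (snd p))"
    if "finite P" "P \<subseteq> carrier M \<times> carrier N" for P c
    using that
  proof (induction P rule: finite_induct)
    case empty
    then show ?case
      using h.hom_one by simp
  next
    case (insert p P)
    have "(\<Sum>p\<in>P. frag_cmul (c p) (frag_of p)) \<in> carrier F"
      using insert closed by (intro sum_closed_free_Abelian_group) auto
    then have "h (frag_cmul (c p) (frag_of p) \<otimes>\<^bsub>F\<^esub> (\<Sum>p\<in>P. frag_cmul (c p) (frag_of p))) =
        h (frag_cmul (c p) (frag_of p)) \<oplus>\<^bsub>G\<^esub> h (\<Sum>p\<in>P. frag_cmul (c p) (frag_of p))"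
      using insert closed by (subst h.hom_mult) auto
    moreover have "h (frag_cmul (c p) (frag_of p)) = [c p] \<cdot>\<^bsub>G\<^esub> \<beta> (fst p) (snd p)"
      using insert h(2) h.hom_int_pow[of "frag_of p" "c p"] by (simp add: add_pow_def)
    ultimately show ?case
      using insert balanced_closed[OF \<beta>]
      by (subst G.finsum_insert) (auto intro!: G.add.int_pow_closed)
  qed
  have E: "h x = (\<Oplus>\<^bsub>G\<^esub>p\<in>Poly_Mapping.keys x. [Poly_Mapping.lookup x p] \<cdot>\<^bsub>G\<^esub> \<beta> (fst p) (snd p))"
    if "x \<in> carrier F" for x
    using sums[of "Poly_Mapping.keys x" "Poly_Mapping.lookup x"] that
      frag_expansion[of x] by (simp add: frag_extend_def)
  have rel: "h k = \<zero>\<^bsub>G\<^esub>" if "k \<in> tensor_relations R M N" for k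
  proof -
    have d: "h (x - y) = h x \<ominus>\<^bsub>G\<^esub> h y" if "x \<in> carrier F" "y \<in> carrier F" for x y
    proof -
      have "h (x \<otimes>\<^bsub>F\<^esub> inv\<^bsub>F\<^esub> y) = h x \<oplus>\<^bsub>G\<^esub> h (inv\<^bsub>F\<^esub> y)"
        using that h.hom_mult[of x "inv\<^bsub>F\<^esub> y"] h.G.inv_closed[of y]
        by (simp del: carrier_free_Abelian_group_iff inv_free_Abelian_group mult_free_Abelian_group)
      also have "h (inv\<^bsub>F\<^esub> y) = \<ominus>\<^bsub>G\<^esub> h y"
        using that h.hom_inv[of y] by (simp add: a_inv_def del: inv_free_Abelian_group)
      finally show ?thesis
        using that by (simp add: a_minus_def)
    qed
    have fc: "frag_of p - frag_of q \<in> carrier F" if "p \<in> carrier M \<times> carrier N" "q \<in> carrier M \<times> carrier N" for p q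
      using that keys_diff[of "frag_of p" "frag_of q"] by auto
    have z: "(x \<oplus>\<^bsub>G\<^esub> y) \<ominus>\<^bsub>G\<^esub> x \<ominus>\<^bsub>G\<^esub> y = \<zero>\<^bsub>G\<^esub>" if "x \<in> carrier G" "y \<in> carrier G" for x y
    proof -
      have "(x \<oplus>\<^bsub>G\<^esub> y) \<ominus>\<^bsub>G\<^esub> x \<ominus>\<^bsub>G\<^esub> y = (x \<oplus>\<^bsub>G\<^esub> y) \<oplus>\<^bsub>G\<^esub> (\<ominus>\<^bsub>G\<^esub> (x \<oplus>\<^bsub>G\<^esub> y))"
        using that by (simp add: a_minus_def G.minus_add G.a_assoc)
      then show ?thesis
        using that by (simp add: G.r_neg)
    qed
    show ?thesis
      using that unfolding tensor_relations_def
      using h(2) balanced_closed[OF \<beta>] left_closed right_closed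
      by (auto simp: d[OF fc] d[OF fc, unfolded carrier_free_Abelian_group_iff] d
          balanced_add_left[OF \<beta>] balanced_add_right[OF \<beta>] balanced_smult[OF \<beta>] z[unfolded a_minus_def]
          G.r_neg a_minus_def[of G] simp del: carrier_free_Abelian_group_iff)
  qed
  have ker: "h k = \<zero>\<^bsub>G\<^esub>" if "k \<in> K" for k
    using that unfolding tensor_kernel_def
  proof (induction rule: generate.induct)
    case one
    then show ?case using h.hom_one by simp
  next
    case (incl k)
    then show ?case by (rule rel)
  next
    case (inv k)
    then show ?case
      using h.hom_inv[of k] rel[OF inv] relations_subset
      by (auto simp: a_inv_def[symmetric] simp del: carrier_free_Abelian_group_iff inv_free_Abelian_group)
  next
    case (eng k l)
    then show ?case
      using h.hom_mult[of k l] subsetD[OF subgroup.subset[OF subgroup_K, unfolded tensor_kernel_def]]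
      by (simp del: carrier_free_Abelian_group_iff mult_free_Abelian_group)
  qed
  have lift: "tensor_lift G \<beta> (K #>\<^bsub>F\<^esub> x) = h x" if x: "x \<in> carrier F" for x
  proof -
    define y where "y = (SOME y. y \<in> K #>\<^bsub>F\<^esub> x)"
    have "x \<in> K #>\<^bsub>F\<^esub> x"
      using group.rcos_self[of F x K] x subgroup_K by simp
    then have "y \<in> K #>\<^bsub>F\<^esub> x"
      unfolding y_def by (rule someI)
    then obtain k where k: "k \<in> K" "y = k \<otimes>\<^bsub>F\<^esub> x"
      by (auto simp: r_coset_def)
    then have kF: "k \<in> carrier F"
      using subgroup.subset[OF subgroup_K] by blast
    then have "y \<in> carrier F"
      using k x keys_add[of k x] by auto
    moreover have "h y = h x"
      using k kF x h.hom_mult[of k x] ker[OF k(1)] h.hom_closed[OF x]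
      by (simp del: carrier_free_Abelian_group_iff mult_free_Abelian_group)
    ultimately show ?thesis
      unfolding tensor_lift_def Let_def y_def[symmetric] using E[of y] by simp
  qed
  show thesis
    by (rule that[OF h(1) _ lift]) (simp_all add: h(2))
qed

lemma tensor_lift_additive:
  assumes G: "abelian_group G" and \<beta>: "\<beta> \<in> balanced_maps R M N G"
  shows "tensor_lift G \<beta> \<in> additive_maps T G"
proof -
  obtain h where h: "h \<in> hom F (add_monoid G)"
      "\<And>x. x \<in> carrier F \<Longrightarrow> tensor_lift G \<beta> (K #>\<^bsub>F\<^esub> x) = h x"
    by (rule tensor_lift_coset[OF assms]) (rule that, assumption, assumption)
  show ?thesis
  proof (rule additive_mapsI)
    fix X Y assume "X \<in> carrier T" "Y \<in> carrier T"
    then obtain x y where xy: "x \<in> carrier F" "y \<in> carrier F" "X = K #>\<^bsub>F\<^esub> x" "Y = K #>\<^bsub>F\<^esub> y"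
      unfolding carrier_T RCOSETS_def by blast
    have "x + y \<in> carrier F"
      using xy keys_add[of x y] by auto
    then show "tensor_lift G \<beta> (X \<oplus>\<^bsub>T\<^esub> Y) = tensor_lift G \<beta> X \<oplus>\<^bsub>G\<^esub> tensor_lift G \<beta> Y"
      using xy h(1) hom_mult[OF h(1), of x y]
      by (simp add: add_coset h(2) del: carrier_free_Abelian_group_iff)
  next
    fix X assume "X \<in> carrier T"
    then obtain x where "x \<in> carrier F" "X = K #>\<^bsub>F\<^esub> x"
      unfolding carrier_T RCOSETS_def by blast
    then show "tensor_lift G \<beta> X \<in> carrier G"
      using h hom_in_carrier[OF h(1), of x] by simp
  qed
qed

lemma tensor_lift_tens:
  assumes G: "abelian_group G" and \<beta>: "\<beta> \<in> balanced_maps R M N G"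
    and "m \<in> carrier M" "n \<in> carrier N"
  shows "tensor_lift G \<beta> (tens R M N m n) = \<beta> m n"
proof (rule tensor_lift_coset[OF G \<beta>])
  fix h
  assume h: "\<And>m n. \<lbrakk>m \<in> carrier M; n \<in> carrier N\<rbrakk> \<Longrightarrow> h (frag_of (m, n)) = \<beta> m n"
    and c: "\<And>x. x \<in> carrier F \<Longrightarrow> tensor_lift G \<beta> (K #>\<^bsub>F\<^esub> x) = h x"
  show ?thesis
    unfolding tens_def using assms(3,4) by (subst c) (auto simp: h)
qed

lemma tensor_lift_cong:
  assumes "abelian_group G" "\<beta> \<in> balanced_maps R M N G"
    and eq: "\<And>m n. \<lbrakk>m \<in> carrier M; n \<in> carrier N\<rbrakk> \<Longrightarrow> \<beta>' m n = \<beta> m n"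
    and "X \<in> carrier T"
  shows "tensor_lift G \<beta>' X = tensor_lift G \<beta> X"
proof -
  have \<beta>': "\<beta>' \<in> balanced_maps R M N G"
    using assms(2) eq left_closed right_closed
    by (auto simp: balanced_maps_def additive_maps_def Pi_iff)
  show ?thesis
    by (rule tensor_ext[OF tensor_lift_additive[OF assms(1) \<beta>'] tensor_lift_additive[OF assms(1,2)]])
      (use assms \<beta>' in \<open>auto simp: tensor_lift_tens\<close>)
qed

lemma tensor_decompose:
  assumes "X \<in> carrier T"
  obtains n g f where "\<And>k. k < n \<Longrightarrow> g k \<in> carrier M" "\<And>k. k < n \<Longrightarrow> f k \<in> carrier N"
    "X = (\<Oplus>\<^bsub>T\<^esub>k\<in>{..<n::nat}. tens R M N (g k) (f k))"
proof -
  have "\<exists>n g f. (\<forall>k<n. g k \<in> carrier M \<and> f k \<in> carrier N) \<and>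
      X = (\<Oplus>\<^bsub>T\<^esub>k\<in>{..<n::nat}. tens R M N (g k) (f k))"
    using assms
  proof (induction X rule: tensor_induct)
    case zero
    show ?case
      by (intro exI[of _ 0]) auto
  next
    case (tens m n)
    then show ?case
      by (intro exI[of _ 1] exI[of _ "\<lambda>_. m"] exI[of _ "\<lambda>_. n"]) (auto simp: lessThan_Suc)
  next
    case (add X Y)
    then obtain n g f n' g' f' where
      X: "\<And>k. k < n \<Longrightarrow> g k \<in> carrier M \<and> f k \<in> carrier N"
        "X = (\<Oplus>\<^bsub>T\<^esub>k\<in>{..<n::nat}. tens R M N (g k) (f k))" and
      Y: "\<And>k. k < n' \<Longrightarrow> g' k \<in> carrier M \<and> f' k \<in> carrier N"
        "Y = (\<Oplus>\<^bsub>T\<^esub>k\<in>{..<n'::nat}. tens R M N (g' k) (f' k))"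
      by blast
    let ?g = "\<lambda>k. if k < n then g k else g' (k - n)" and ?f = "\<lambda>k. if k < n then f k else f' (k - n)"
    have "X \<oplus>\<^bsub>T\<^esub> Y =
        (\<Oplus>\<^bsub>T\<^esub>k\<in>{..<n + n'}. if k < n then tens R M N (g k) (f k) else tens R M N (g' (k - n)) (f' (k - n)))"
      using X Y by (subst T.finsum_append) auto
    also have "\<dots> = (\<Oplus>\<^bsub>T\<^esub>k\<in>{..<n + n'}. tens R M N (?g k) (?f k))"
      by (rule T.finsum_cong') (use X(1) Y(1) in auto)
    finally show ?case
      using X(1) Y(1) by (intro exI[of _ "n + n'"] exI[of _ ?g] exI[of _ ?f]) auto
  qed
  then show thesis
    using that by blast
qed

end

section \<open>Tensor products as functors and as modules\<close>

lemma same_additive_left_tensor: "same_additive (left_tensor R M N) (tensor_group R M N)"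
  by (simp add: same_additive_def left_tensor_def ring.defs module.defs)

lemma same_additive_vtensor: "same_additive (M \<otimes>\<^sub>\<complex> N) (tensor_group complex_ring M N)"
  by (simp add: same_additive_def vtensor_def ring.defs module.defs)

lemma same_additive_left_vtensor: "same_additive (left_tensor complex_ring M N) (M \<otimes>\<^sub>\<complex> N)"
  by (simp add: same_additive_def vtensor_def left_tensor_def ring.defs module.defs)

lemma smult_left_tensor:
  "a \<odot>\<^bsub>left_tensor R M N\<^esub> X =
    tensor_lift (tensor_group R M N) (\<lambda>m n. tens R M N (a \<otimes>\<^bsub>M\<^esub> m) n) X"
  by (simp add: left_tensor_def ring.defs module.defs)

lemma smult_vtensor:
  "z \<odot>\<^bsub>M \<otimes>\<^sub>\<complex> N\<^esub> X =
    tensor_lift (tensor_group complex_ring M N) (\<lambda>m n. tens complex_ring M N (z \<odot>\<^bsub>M\<^esub> m) n) X"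
  by (simp add: vtensor_def vtens_def ring.defs module.defs)

lemma tens_map_balanced:
  assumes "tensor_factors R M N" "tensor_factors R M' N'"
    and u: "u \<in> linear_maps R M M'" and w: "w \<in> linear_maps R N N'"
  shows "(\<lambda>m n. tens R M' N' (u m) (w n)) \<in> balanced_maps R M N (tensor_group R M' N')"
proof -
  interpret T: tensor_factors R M N by fact
  interpret T': tensor_factors R M' N' by fact
  show ?thesis
    by (rule balanced_mapsI)
      (use linear_closed[OF u] linear_closed[OF w] in
        \<open>auto simp: linear_add[OF u] linear_add[OF w] linear_smult[OF u] linear_smult[OF w]
          T'.tens_add_left T'.tens_add_right T'.tens_smult\<close>)
qed

text \<open>
  Functoriality in the first factor. The instances are the scalars acting on a tensor product of vector
  spaces, an algebra \<open>A\<close> acting on \<open>A \<otimes> N\<close> by left multiplication, and \<open>R'\<close> acting on \<open>R' \<otimes>\<^sub>R P\<close>.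
\<close>

lemma tensor_left_module:
  fixes S :: "('s, 'k) ring_scheme" and X :: "('s, ('m, 'n) tensor, 'l) module_scheme"
  assumes T: "tensor_factors R M N" and S: "ring S"
    and u: "\<And>a. a \<in> carrier S \<Longrightarrow> u a \<in> linear_maps R M M"
    and u_add: "\<And>a b m. \<lbrakk>a \<in> carrier S; b \<in> carrier S; m \<in> carrier M\<rbrakk>
      \<Longrightarrow> u (a \<oplus>\<^bsub>S\<^esub> b) m = u a m \<oplus>\<^bsub>M\<^esub> u b m"
    and u_mult: "\<And>a b m. \<lbrakk>a \<in> carrier S; b \<in> carrier S; m \<in> carrier M\<rbrakk>
      \<Longrightarrow> u (a \<otimes>\<^bsub>S\<^esub> b) m = u a (u b m)"
    and u_one: "\<And>m. m \<in> carrier M \<Longrightarrow> u \<one>\<^bsub>S\<^esub> m = m"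
    and X: "same_additive X (tensor_group R M N)"
    and smult: "\<And>a Y. a \<odot>\<^bsub>X\<^esub> Y = tensor_lift (tensor_group R M N) (\<lambda>m n. tens R M N (u a m) n) Y"
  shows "left_module S X"
    and "\<lbrakk>a \<in> carrier S; m \<in> carrier M; n \<in> carrier N\<rbrakk>
      \<Longrightarrow> a \<odot>\<^bsub>X\<^esub> tens R M N m n = tens R M N (u a m) n"
proof -
  interpret T: tensor_factors R M N by fact
  interpret S: ring S by fact
  have bal: "(\<lambda>m n. tens R M N (u a m) n) \<in> balanced_maps R M N T.T" if "a \<in> carrier S" for a
    using tens_map_balanced[OF T T u[OF that] linear_id(2)] by simp
  have tens: "a \<odot>\<^bsub>X\<^esub> tens R M N m n = tens R M N (u a m) n"
    if "a \<in> carrier S" "m \<in> carrier M" "n \<in> carrier N" for a m n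
    unfolding smult using T.tensor_lift_tens[OF T.abelian_group_T bal[OF that(1)] that(2,3)] .
  then show "\<lbrakk>a \<in> carrier S; m \<in> carrier M; n \<in> carrier N\<rbrakk>
      \<Longrightarrow> a \<odot>\<^bsub>X\<^esub> tens R M N m n = tens R M N (u a m) n" .
  have add: "(\<lambda>Y. a \<odot>\<^bsub>X\<^esub> Y) \<in> additive_maps T.T T.T" if "a \<in> carrier S" for a
    unfolding smult using T.tensor_lift_additive[OF T.abelian_group_T bal[OF that]] .
  have uc: "u a m \<in> carrier M" if "a \<in> carrier S" "m \<in> carrier M" for a m
    using linear_closed[OF u] that by simp
  have X': "carrier X = carrier T.T" "add X = add T.T" "zero X = zero T.T"
    using X by (auto simp: same_additive_def)
  interpret X: abelian_group X
    by (rule abelian_group_same[OF same_additive_sym[OF X] T.abelian_group_T])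
  have sum: "(\<lambda>Y. a \<odot>\<^bsub>X\<^esub> Y \<oplus>\<^bsub>T.T\<^esub> b \<odot>\<^bsub>X\<^esub> Y) \<in> additive_maps T.T T.T"
    if "a \<in> carrier S" "b \<in> carrier S" for a b
    by (rule additive_mapsI)
      (use additive_closed[OF add[OF that(1)]] additive_closed[OF add[OF that(2)]] in
        \<open>simp_all add: additive_add[OF add[OF that(1)]] additive_add[OF add[OF that(2)]] T.T.a_ac\<close>)
  show "left_module S X"
  proof
    fix a x assume "a \<in> carrier S" "x \<in> carrier X"
    then show "a \<odot>\<^bsub>X\<^esub> x \<in> carrier X"
      using additive_closed[OF add] X' by simp
  next
    fix a b x assume c: "a \<in> carrier S" "b \<in> carrier S" "x \<in> carrier X"
    show "(a \<oplus>\<^bsub>S\<^esub> b) \<odot>\<^bsub>X\<^esub> x = a \<odot>\<^bsub>X\<^esub> x \<oplus>\<^bsub>X\<^esub> b \<odot>\<^bsub>X\<^esub> x"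
      unfolding X'
      by (rule T.tensor_ext[OF add sum T.abelian_group_T])
        (use c X' uc in \<open>auto simp: tens u_add T.tens_add_left\<close>)
    show "(a \<otimes>\<^bsub>S\<^esub> b) \<odot>\<^bsub>X\<^esub> x = a \<odot>\<^bsub>X\<^esub> (b \<odot>\<^bsub>X\<^esub> x)"
      by (rule T.tensor_ext[OF add additive_comp[OF add add] T.abelian_group_T])
        (use c X' uc in \<open>auto simp: tens u_mult\<close>)
  next
    fix a x y assume "a \<in> carrier S" "x \<in> carrier X" "y \<in> carrier X"
    then show "a \<odot>\<^bsub>X\<^esub> (x \<oplus>\<^bsub>X\<^esub> y) = a \<odot>\<^bsub>X\<^esub> x \<oplus>\<^bsub>X\<^esub> a \<odot>\<^bsub>X\<^esub> y"
      using additive_add[OF add] X' by simp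
  next
    fix x assume x: "x \<in> carrier X"
    have "(\<lambda>Y. Y) \<in> additive_maps T.T T.T"
      by (rule additive_mapsI) auto
    from T.tensor_ext[OF add[OF S.one_closed] this T.abelian_group_T]
    show "\<one>\<^bsub>S\<^esub> \<odot>\<^bsub>X\<^esub> x = x"
      using x X' by (auto simp: tens u_one)
  qed
qed

lemma left_module_smult_additive:
  assumes "left_module R M"
  shows "r \<in> carrier R \<Longrightarrow> (\<lambda>x. r \<odot>\<^bsub>M\<^esub> x) \<in> additive_maps M M"
    and "x \<in> carrier M \<Longrightarrow> (\<lambda>r. r \<odot>\<^bsub>M\<^esub> x) \<in> additive_maps R M"
  using assms
  by (auto intro!: additive_mapsI
      simp: left_module.smult_closed left_module.smult_l_distr left_module.smult_r_distr)

lemma left_module_abelian_group: "left_module R M \<Longrightarrow> abelian_group M"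
  and left_module_ring: "left_module R M \<Longrightarrow> ring R"
  by (auto simp: left_module_def)

lemma ring_abelian_group: "ring R \<Longrightarrow> abelian_group R"
  by (simp add: ring_def)

lemma left_module_smult_zero:
  assumes "left_module R M"
  shows "x \<in> carrier M \<Longrightarrow> \<zero>\<^bsub>R\<^esub> \<odot>\<^bsub>M\<^esub> x = \<zero>\<^bsub>M\<^esub>"
    and "r \<in> carrier R \<Longrightarrow> r \<odot>\<^bsub>M\<^esub> \<zero>\<^bsub>M\<^esub> = \<zero>\<^bsub>M\<^esub>"
  using additive_zero[OF left_module_smult_additive(2)[OF assms]]
    additive_zero[OF left_module_smult_additive(1)[OF assms]]
    left_module_abelian_group[OF assms] ring_abelian_group[OF left_module_ring[OF assms]]
  by auto

section \<open>Complex vector spaces\<close>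

lemma complex_ring_simps [simp]:
  "carrier complex_ring = UNIV" "\<one>\<^bsub>complex_ring\<^esub> = 1" "\<zero>\<^bsub>complex_ring\<^esub> = 0"
  "x \<otimes>\<^bsub>complex_ring\<^esub> y = x * y" "x \<oplus>\<^bsub>complex_ring\<^esub> y = x + y"
  by (simp_all add: complex_ring_def)

lemma cring_complex_ring: "cring complex_ring"
proof (intro cringI abelian_groupI comm_monoidI)
  fix x :: complex
  show "\<exists>y \<in> carrier complex_ring. y \<oplus>\<^bsub>complex_ring\<^esub> x = \<zero>\<^bsub>complex_ring\<^esub>"
    by (rule bexI[of _ "- x"]) simp_all
qed (simp_all add: algebra_simps)

abbreviation vspace :: "(complex, 'm, 'x) module_scheme \<Rightarrow> bool" where
  "vspace M \<equiv> module complex_ring M"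

abbreviation lin ::
    "(complex, 'm, 'x) module_scheme \<Rightarrow> (complex, 'n, 'y) module_scheme \<Rightarrow> ('m \<Rightarrow> 'n) set" where
  "lin M N \<equiv> linear_maps complex_ring M N"

abbreviation dual :: "(complex, 'm, 'x) module_scheme \<Rightarrow> ('m \<Rightarrow> complex) set" where
  "dual M \<equiv> lin M (regular_module complex_ring)"

lemma vspace_iff: "vspace M \<longleftrightarrow> left_module complex_ring M"
proof
  assume "vspace M"
  then interpret module complex_ring M .
  show "left_module complex_ring M"
    by unfold_locales (simp_all add: smult_l_distr smult_r_distr smult_assoc1 del: complex_ring_simps)
next
  assume "left_module complex_ring M"
  then interpret left_module complex_ring M .
  show "vspace M"
    by (rule moduleI[OF cring_complex_ring left_module_abelian_group[OF left_module_axioms]])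
      (simp_all add: smult_closed smult_l_distr smult_r_distr smult_assoc smult_one
        del: complex_ring_simps)
qed

lemma vspace_abelian_group: "vspace M \<Longrightarrow> abelian_group M"
  by (simp add: module_def)

lemma vspace_tensor_factors: "\<lbrakk>vspace M; vspace N\<rbrakk> \<Longrightarrow> tensor_factors complex_ring M N"
  by (auto simp: tensor_factors_def tensor_factors_axioms_def vspace_abelian_group module.smult_closed)

lemma vspace_regular: "vspace (regular_module complex_ring)"
proof (rule moduleI[OF cring_complex_ring])
  show "abelian_group (regular_module complex_ring)"
    by (rule abelian_group_same[of complex_ring])
      (use cring_complex_ring in \<open>auto simp: same_additive_def regular_module_def cring_def ring_def\<close>)
qed (simp_all add: regular_module_def algebra_simps)

lemma regular_complex_simps [simp]:
  "carrier (regular_module complex_ring) = UNIV" "\<zero>\<^bsub>regular_module complex_ring\<^esub> = 0"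
  "x \<oplus>\<^bsub>regular_module complex_ring\<^esub> y = x + y" "x \<odot>\<^bsub>regular_module complex_ring\<^esub> y = x * y"
  by (simp_all add: regular_module_def)

lemma finsum_regular_complex: "finsum (regular_module complex_ring) a I = (\<Sum>i\<in>I. a i)"
proof -
  interpret module complex_ring "regular_module complex_ring" by (rule vspace_regular)
  show ?thesis
    by (induction I rule: infinite_finite_induct) auto
qed

lemma linI:
  assumes "\<And>x. x \<in> carrier M \<Longrightarrow> h x \<in> carrier N"
    and "\<And>x y. \<lbrakk>x \<in> carrier M; y \<in> carrier M\<rbrakk> \<Longrightarrow> h (x \<oplus>\<^bsub>M\<^esub> y) = h x \<oplus>\<^bsub>N\<^esub> h y"
    and "\<And>z x. x \<in> carrier M \<Longrightarrow> h (z \<odot>\<^bsub>M\<^esub> x) = z \<odot>\<^bsub>N\<^esub> h x"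
  shows "h \<in> lin M N"
  using assms by (auto simp: linear_maps_def)

lemma lin_smult: "\<lbrakk>h \<in> lin M N; x \<in> carrier M\<rbrakk> \<Longrightarrow> h (z \<odot>\<^bsub>M\<^esub> x) = z \<odot>\<^bsub>N\<^esub> h x"
  by (simp add: linear_smult)

lemma lin_finsum:
  assumes "h \<in> lin M N" "vspace M" "vspace N" "a \<in> I \<rightarrow> carrier M"
  shows "h (\<Oplus>\<^bsub>M\<^esub>i\<in>I. a i) = (\<Oplus>\<^bsub>N\<^esub>i\<in>I. h (a i))"
  by (rule additive_finsum[OF linear_maps_additive[OF assms(1)] vspace_abelian_group[OF assms(2)]
      vspace_abelian_group[OF assms(3)] assms(4)])

lemma lin_zero: "\<lbrakk>h \<in> lin M N; vspace M; vspace N\<rbrakk> \<Longrightarrow> h \<zero>\<^bsub>M\<^esub> = \<zero>\<^bsub>N\<^esub>"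
  by (rule additive_zero[OF linear_maps_additive vspace_abelian_group vspace_abelian_group])

lemma lin_diff:
  "\<lbrakk>h \<in> lin M N; vspace M; vspace N; x \<in> carrier M; y \<in> carrier M\<rbrakk>
    \<Longrightarrow> h (x \<ominus>\<^bsub>M\<^esub> y) = h x \<ominus>\<^bsub>N\<^esub> h y"
  by (rule additive_diff[OF linear_maps_additive vspace_abelian_group vspace_abelian_group])

lemma lin_smult_left:
  assumes "vspace G" "g \<in> carrier G" "\<theta> \<in> dual M"
  shows "(\<lambda>x. \<theta> x \<odot>\<^bsub>G\<^esub> g) \<in> lin M G"
  using assms
  by (intro linI) (auto simp: linear_add[OF assms(3)] lin_smult[OF assms(3)]
      module.smult_closed module.smult_l_distr[where R = complex_ring, simplified]
      module.smult_assoc1[where R = complex_ring, simplified])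

lemma lin_smult_right:
  assumes "vspace G" "h \<in> lin M G"
  shows "(\<lambda>x. z \<odot>\<^bsub>G\<^esub> h x) \<in> lin M G"
  using assms linear_closed[OF assms(2)]
  by (intro linI) (auto simp: linear_add[OF assms(2)] lin_smult[OF assms(2)] mult.commute
      module.smult_closed module.smult_r_distr[where R = complex_ring, simplified]
      module.smult_assoc1[where R = complex_ring, simplified, symmetric])

lemma lin_sum:
  assumes "vspace G" "h \<in> lin M G" "k \<in> lin M G"
  shows "(\<lambda>x. h x \<oplus>\<^bsub>G\<^esub> k x) \<in> lin M G"
proof -
  interpret G: module complex_ring G by fact
  show ?thesis
    using linear_closed[OF assms(2)] linear_closed[OF assms(3)]
    by (intro linI) (auto simp: linear_add[OF assms(2)] linear_add[OF assms(3)] lin_smult[OF assms(2)]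
        lin_smult[OF assms(3)] G.smult_r_distr G.a_ac)
qed

lemma lin_zero_map:
  assumes "vspace G"
  shows "(\<lambda>x. \<zero>\<^bsub>G\<^esub>) \<in> lin M G"
proof -
  interpret G: module complex_ring G by fact
  show ?thesis
    by (intro linI) (auto simp: G.smult_r_null)
qed

lemma lin_finsum_map:
  assumes "vspace M" "vspace G" "\<And>i. i \<in> I \<Longrightarrow> h i \<in> lin M G"
  shows "(\<lambda>x. \<Oplus>\<^bsub>G\<^esub>i\<in>I. h i x) \<in> lin M G"
  using assms(3)
proof (induction I rule: infinite_finite_induct)
  case (insert i I)
  interpret G: module complex_ring G by fact
  have "(\<lambda>x. h i x \<oplus>\<^bsub>G\<^esub> (\<Oplus>\<^bsub>G\<^esub>i\<in>I. h i x)) \<in> lin M G"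
    by (intro lin_sum) (use insert assms in auto)
  moreover have "(\<Oplus>\<^bsub>G\<^esub>j\<in>insert i I. h j x) = h i x \<oplus>\<^bsub>G\<^esub> (\<Oplus>\<^bsub>G\<^esub>j\<in>I. h j x)"
    if "x \<in> carrier M" for x
    using insert that by (intro G.finsum_insert) (auto dest: linear_closed)
  ultimately show ?case
    using module.smult_closed[OF assms(1)] abelian_group.axioms(1)[OF vspace_abelian_group[OF assms(1)]]
    by (auto simp: linear_maps_def Pi_iff abelian_monoid.a_closed)
next
  case (infinite I)
  interpret G: module complex_ring G by fact
  show ?case
    using infinite lin_zero_map[OF assms(2)] by simp
next
  case empty
  interpret G: module complex_ring G by fact
  show ?case
    using lin_zero_map[OF assms(2)] by simp
qed

subsection \<open>Bilinear maps\<close>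

definition bilinear_maps ::
    "(complex, 'm, 'x) module_scheme \<Rightarrow> (complex, 'n, 'y) module_scheme \<Rightarrow> (complex, 'g, 'z) module_scheme
      \<Rightarrow> ('m \<Rightarrow> 'n \<Rightarrow> 'g) set"
where
  "bilinear_maps M N G =
    {\<beta>. (\<forall>m \<in> carrier M. (\<lambda>n. \<beta> m n) \<in> lin N G) \<and> (\<forall>n \<in> carrier N. (\<lambda>m. \<beta> m n) \<in> lin M G)}"

lemma bilinearI:
  assumes "\<And>m. m \<in> carrier M \<Longrightarrow> (\<lambda>n. \<beta> m n) \<in> lin N G"
    and "\<And>n. n \<in> carrier N \<Longrightarrow> (\<lambda>m. \<beta> m n) \<in> lin M G"
  shows "\<beta> \<in> bilinear_maps M N G"
  using assms by (auto simp: bilinear_maps_def)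

lemma bilinear_right: "\<lbrakk>\<beta> \<in> bilinear_maps M N G; m \<in> carrier M\<rbrakk> \<Longrightarrow> (\<lambda>n. \<beta> m n) \<in> lin N G"
  and bilinear_left: "\<lbrakk>\<beta> \<in> bilinear_maps M N G; n \<in> carrier N\<rbrakk> \<Longrightarrow> (\<lambda>m. \<beta> m n) \<in> lin M G"
  by (auto simp: bilinear_maps_def)

lemma bilinear_closed:
  "\<lbrakk>\<beta> \<in> bilinear_maps M N G; m \<in> carrier M; n \<in> carrier N\<rbrakk> \<Longrightarrow> \<beta> m n \<in> carrier G"
  using linear_closed[OF bilinear_right] by metis

lemma bilinear_balanced: "\<beta> \<in> bilinear_maps M N G \<Longrightarrow> \<beta> \<in> balanced_maps complex_ring M N G"
  by (auto simp: bilinear_maps_def balanced_maps_def linear_maps_additive lin_smult)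
    (simp add: linear_maps_def)

lemma bilinear_comp_right:
  "\<lbrakk>\<beta> \<in> bilinear_maps M N G; m \<in> carrier M; h \<in> lin X N\<rbrakk> \<Longrightarrow> (\<lambda>x. \<beta> m (h x)) \<in> lin X G"
  by (rule linear_comp[OF _ bilinear_right])

lemma bilinear_comp_left:
  "\<lbrakk>\<beta> \<in> bilinear_maps M N G; n \<in> carrier N; h \<in> lin X M\<rbrakk> \<Longrightarrow> (\<lambda>x. \<beta> (h x) n) \<in> lin X G"
  by (rule linear_comp[OF _ bilinear_left])

lemma bilinear_comp:
  assumes "\<beta> \<in> bilinear_maps M N G" "h \<in> lin X M" "k \<in> lin Y N"
  shows "(\<lambda>x y. \<beta> (h x) (k y)) \<in> bilinear_maps X Y G"
proof (rule bilinearI)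
  fix x assume "x \<in> carrier X"
  then show "(\<lambda>y. \<beta> (h x) (k y)) \<in> lin Y G"
    by (intro bilinear_comp_right[OF assms(1) _ assms(3)] linear_closed[OF assms(2)])
next
  fix y assume "y \<in> carrier Y"
  then show "(\<lambda>x. \<beta> (h x) (k y)) \<in> lin X G"
    by (intro bilinear_comp_left[OF assms(1) _ assms(2)] linear_closed[OF assms(3)])
qed

lemma bilinear_post:
  assumes "\<beta> \<in> bilinear_maps M N G" "h \<in> lin G H"
  shows "(\<lambda>x y. h (\<beta> x y)) \<in> bilinear_maps M N H"
  using linear_comp[OF bilinear_right[OF assms(1)] assms(2)] linear_comp[OF bilinear_left[OF assms(1)] assms(2)]
  by (simp add: bilinear_maps_def)

lemma bilinear_smult:
  assumes "vspace M"
  shows "(\<lambda>z m. z \<odot>\<^bsub>M\<^esub> m) \<in> bilinear_maps (regular_module complex_ring) M M"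
  using assms by (intro bilinearI lin_smult_left lin_smult_right linear_id)

lemma bilinear_flip: "\<beta> \<in> bilinear_maps M N G \<Longrightarrow> (\<lambda>n m. \<beta> m n) \<in> bilinear_maps N M G"
  by (auto simp: bilinear_maps_def)

text \<open>The contraction \<open>id \<otimes> \<theta>\<close> of the second tensor factor with a linear functional.\<close>

definition slice :: "(complex, 'm, 'x) module_scheme \<Rightarrow> ('n \<Rightarrow> complex) \<Rightarrow> ('m, 'n) tensor \<Rightarrow> 'm" where
  "slice M \<theta> = tensor_lift M (\<lambda>m n. \<theta> n \<odot>\<^bsub>M\<^esub> m)"

context
  fixes M :: "(complex, 'm, 'x) module_scheme" and N :: "(complex, 'n, 'y) module_scheme"
  assumes M: "vspace M" and N: "vspace N"
begin

interpretation tensor_factors complex_ring M N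
  by (rule vspace_tensor_factors[OF M N])

lemma vtensor_carrier: "carrier (M \<otimes>\<^sub>\<complex> N) = carrier T" "add (M \<otimes>\<^sub>\<complex> N) = add T" "zero (M \<otimes>\<^sub>\<complex> N) = zero T"
  using same_additive_vtensor[of M N] by (auto simp: same_additive_def)

lemma vtensor_module: "left_module complex_ring (M \<otimes>\<^sub>\<complex> N)"
  and smult_vtens: "\<lbrakk>m \<in> carrier M; n \<in> carrier N\<rbrakk>
    \<Longrightarrow> z \<odot>\<^bsub>M \<otimes>\<^sub>\<complex> N\<^esub> vtens M N m n = vtens M N (z \<odot>\<^bsub>M\<^esub> m) n"
proof -
  interpret M: module complex_ring M by (rule M)
  have r: "ring complex_ring"
    using cring_complex_ring by (simp add: cring_def)
  show "left_module complex_ring (M \<otimes>\<^sub>\<complex> N)"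
    by (rule tensor_left_module(1)[OF tensor_factors_axioms r _ _ _ _ same_additive_vtensor smult_vtensor])
      (auto intro!: lin_smult_right[OF M linear_id(2)] simp: M.smult_l_distr[simplified] M.smult_assoc1[simplified]
        M.smult_one[simplified])
  show "\<lbrakk>m \<in> carrier M; n \<in> carrier N\<rbrakk>
    \<Longrightarrow> z \<odot>\<^bsub>M \<otimes>\<^sub>\<complex> N\<^esub> vtens M N m n = vtens M N (z \<odot>\<^bsub>M\<^esub> m) n"
    unfolding vtens_def
    by (rule tensor_left_module(2)[OF tensor_factors_axioms r _ _ _ _ same_additive_vtensor smult_vtensor])
      (auto intro!: lin_smult_right[OF M linear_id(2)] simp: M.smult_l_distr[simplified] M.smult_assoc1[simplified]
        M.smult_one[simplified])
qed

lemma vspace_vtensor: "vspace (M \<otimes>\<^sub>\<complex> N)"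
  using vtensor_module by (simp add: vspace_iff)

lemma vtens_bilinear: "vtens M N \<in> bilinear_maps M N (M \<otimes>\<^sub>\<complex> N)"
proof -
  interpret M: module complex_ring M by (rule M)
  interpret N: module complex_ring N by (rule N)
  show ?thesis
    by (intro bilinearI linI)
      (auto simp: vtensor_carrier vtens_def tens_add_left tens_add_right
        smult_vtens[unfolded vtens_def] tens_smult)
qed

lemma vtens_closed: "\<lbrakk>m \<in> carrier M; n \<in> carrier N\<rbrakk> \<Longrightarrow> vtens M N m n \<in> carrier (M \<otimes>\<^sub>\<complex> N)"
  using bilinear_closed[OF vtens_bilinear] .

lemma vtens_smult_right:
  "\<lbrakk>m \<in> carrier M; n \<in> carrier N\<rbrakk> \<Longrightarrow> vtens M N m (z \<odot>\<^bsub>N\<^esub> n) = vtens M N (z \<odot>\<^bsub>M\<^esub> m) n"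
  by (simp add: vtens_def tens_smult)

lemma vtensor_ext:
  assumes "g \<in> lin (M \<otimes>\<^sub>\<complex> N) H" "h \<in> lin (M \<otimes>\<^sub>\<complex> N) H" "vspace H"
    and "\<And>m n. \<lbrakk>m \<in> carrier M; n \<in> carrier N\<rbrakk> \<Longrightarrow> g (vtens M N m n) = h (vtens M N m n)"
    and "X \<in> carrier (M \<otimes>\<^sub>\<complex> N)"
  shows "g X = h X"
proof (rule tensor_ext)
  have "additive_maps (M \<otimes>\<^sub>\<complex> N) H = additive_maps T H"
    by (rule additive_maps_same[OF same_additive_vtensor]) (simp add: same_additive_def)
  then show "g \<in> additive_maps T H" "h \<in> additive_maps T H"
    using assms linear_maps_additive by blast+
qed (use assms vspace_abelian_group in \<open>auto simp: vtensor_carrier vtens_def\<close>)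

lemma vtensor_lift_vtens:
  assumes "\<beta> \<in> bilinear_maps M N G" "vspace G" "m \<in> carrier M" "n \<in> carrier N"
  shows "tensor_lift G \<beta> (vtens M N m n) = \<beta> m n"
  unfolding vtens_def
  by (rule tensor_lift_tens) (use assms bilinear_balanced vspace_abelian_group in auto)

lemma vtensor_lift_linear:
  assumes \<beta>: "\<beta> \<in> bilinear_maps M N G" and G: "vspace G"
  shows "tensor_lift G \<beta> \<in> lin (M \<otimes>\<^sub>\<complex> N) G"
proof (rule linear_mapsI)
  interpret M: module complex_ring M by (rule M)
  interpret G: module complex_ring G by (rule G)
  interpret MN: module complex_ring "M \<otimes>\<^sub>\<complex> N" by (rule vspace_vtensor)
  have eq: "additive_maps (M \<otimes>\<^sub>\<complex> N) H = additive_maps T H" for H :: "(complex, 'h, 'k) module_scheme"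
    by (rule additive_maps_same[OF same_additive_vtensor]) (simp add: same_additive_def)
  show add: "tensor_lift G \<beta> \<in> additive_maps (M \<otimes>\<^sub>\<complex> N) G"
    unfolding eq by (rule tensor_lift_additive) (use assms bilinear_balanced vspace_abelian_group in auto)
  fix z X assume X: "X \<in> carrier (M \<otimes>\<^sub>\<complex> N)"
  show "tensor_lift G \<beta> (z \<odot>\<^bsub>M \<otimes>\<^sub>\<complex> N\<^esub> X) = z \<odot>\<^bsub>G\<^esub> tensor_lift G \<beta> X"
  proof (rule tensor_ext[of "\<lambda>X. tensor_lift G \<beta> (z \<odot>\<^bsub>M \<otimes>\<^sub>\<complex> N\<^esub> X)" G "\<lambda>X. z \<odot>\<^bsub>G\<^esub> tensor_lift G \<beta> X"])
    have a: "(\<lambda>x. z \<odot>\<^bsub>M \<otimes>\<^sub>\<complex> N\<^esub> x) \<in> additive_maps (M \<otimes>\<^sub>\<complex> N) (M \<otimes>\<^sub>\<complex> N)"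
        "(\<lambda>x. z \<odot>\<^bsub>G\<^esub> x) \<in> additive_maps G G"
      by (auto intro!: linear_maps_additive[of _ complex_ring] lin_smult_right linear_id vspace_vtensor G)
    show "(\<lambda>X. tensor_lift G \<beta> (z \<odot>\<^bsub>M \<otimes>\<^sub>\<complex> N\<^esub> X)) \<in> additive_maps T G"
      "(\<lambda>X. z \<odot>\<^bsub>G\<^esub> tensor_lift G \<beta> X) \<in> additive_maps T G"
      unfolding eq[symmetric] by (rule additive_comp[OF a(1) add], rule additive_comp[OF add a(2)])
  next
    fix m n assume mn: "m \<in> carrier M" "n \<in> carrier N"
    have "tensor_lift G \<beta> (z \<odot>\<^bsub>M \<otimes>\<^sub>\<complex> N\<^esub> vtens M N m n) = z \<odot>\<^bsub>G\<^esub> tensor_lift G \<beta> (vtens M N m n)"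
      using mn assms by (simp add: smult_vtens vtensor_lift_vtens lin_smult[OF bilinear_left[OF \<beta>]])
    then show "tensor_lift G \<beta> (z \<odot>\<^bsub>M \<otimes>\<^sub>\<complex> N\<^esub> tens complex_ring M N m n) =
        z \<odot>\<^bsub>G\<^esub> tensor_lift G \<beta> (tens complex_ring M N m n)"
      by (simp add: vtens_def)
  qed (use X in \<open>auto simp: vtensor_carrier G.abelian_group_axioms\<close>)
qed

lemma vtensor_lift_cong:
  assumes "\<beta> \<in> bilinear_maps M N G" "vspace G"
    and "\<And>m n. \<lbrakk>m \<in> carrier M; n \<in> carrier N\<rbrakk> \<Longrightarrow> \<beta>' m n = \<beta> m n"
    and "X \<in> carrier (M \<otimes>\<^sub>\<complex> N)"
  shows "tensor_lift G \<beta>' X = tensor_lift G \<beta> X"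
  by (rule tensor_lift_cong[OF _ bilinear_balanced[OF assms(1)] assms(3)])
    (use assms in \<open>auto simp: vtensor_carrier vspace_abelian_group\<close>)

lemma vtensor_decompose:
  assumes "X \<in> carrier (M \<otimes>\<^sub>\<complex> N)"
  obtains n g f where "\<And>k. k < n \<Longrightarrow> g k \<in> carrier M" "\<And>k. k < n \<Longrightarrow> f k \<in> carrier N"
    "X = (\<Oplus>\<^bsub>M \<otimes>\<^sub>\<complex> N\<^esub>k\<in>{..<n::nat}. vtens M N (g k) (f k))"
  using tensor_decompose[of X] assms
  unfolding vtens_def finsum_same[OF same_additive_vtensor] vtensor_carrier by blast

lemma slice_bilinear: "\<theta> \<in> dual N \<Longrightarrow> (\<lambda>m n. \<theta> n \<odot>\<^bsub>M\<^esub> m) \<in> bilinear_maps M N M"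
  by (intro bilinearI lin_smult_left lin_smult_right linear_id M)

end

lemma bilinear_lift:
  assumes "\<And>m. m \<in> carrier M \<Longrightarrow> \<beta> m \<in> bilinear_maps N P G" 
    and "\<And>n p. \<lbrakk>n \<in> carrier N; p \<in> carrier P\<rbrakk> \<Longrightarrow> (\<lambda>m. \<beta> m n p) \<in> lin M G"
    and M: "vspace M" and N: "vspace N" and P: "vspace P" and G: "vspace G"
  shows "(\<lambda>m. tensor_lift G (\<beta> m)) \<in> bilinear_maps M (N \<otimes>\<^sub>\<complex> P) G"
proof (rule bilinearI)
  fix m assume "m \<in> carrier M"
  then show "tensor_lift G (\<beta> m) \<in> lin (N \<otimes>\<^sub>\<complex> P) G"
    by (intro vtensor_lift_linear N P G assms(1))
next
  interpret M: module complex_ring M by (rule M)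
  interpret G: module complex_ring G by (rule G)
  note L = vtensor_lift_linear[OF N P assms(1) G]
  fix X assume X: "X \<in> carrier (N \<otimes>\<^sub>\<complex> P)"
  show "(\<lambda>m. tensor_lift G (\<beta> m) X) \<in> lin M G"
  proof (rule linI)
    fix m assume "m \<in> carrier M"
    then show "tensor_lift G (\<beta> m) X \<in> carrier G"
      using linear_closed[OF L X] by simp
  next
    fix m m' assume m: "m \<in> carrier M" "m' \<in> carrier M"
    then have mm: "m \<oplus>\<^bsub>M\<^esub> m' \<in> carrier M" by simp
    show "tensor_lift G (\<beta> (m \<oplus>\<^bsub>M\<^esub> m')) X = tensor_lift G (\<beta> m) X \<oplus>\<^bsub>G\<^esub> tensor_lift G (\<beta> m') X"
      by (rule vtensor_ext[OF N P L[OF mm] lin_sum[OF G L[OF m(1)] L[OF m(2)]] G _ X])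
        (simp add: vtensor_lift_vtens[OF N P assms(1) G] m linear_add[OF assms(2)])
  next
    fix z m assume m: "m \<in> carrier M"
    then have mm: "z \<odot>\<^bsub>M\<^esub> m \<in> carrier M" by simp
    show "tensor_lift G (\<beta> (z \<odot>\<^bsub>M\<^esub> m)) X = z \<odot>\<^bsub>G\<^esub> tensor_lift G (\<beta> m) X"
      by (rule vtensor_ext[OF N P L[OF mm] lin_smult_right[OF G L[OF m]] G _ X])
        (simp add: vtensor_lift_vtens[OF N P assms(1) G] m lin_smult[OF assms(2)])
  qed
qed

lemma slice_linear:
  assumes "vspace M" "vspace N" "\<theta> \<in> dual N"
  shows "slice M \<theta> \<in> lin (M \<otimes>\<^sub>\<complex> N) M"
  unfolding slice_def by (rule vtensor_lift_linear[OF assms(1,2) slice_bilinear[OF assms(1-3)] assms(1)])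

lemma slice_vtens:
  assumes "vspace M" "vspace N" "\<theta> \<in> dual N" "m \<in> carrier M" "n \<in> carrier N"
  shows "slice M \<theta> (vtens M N m n) = \<theta> n \<odot>\<^bsub>M\<^esub> m"
  unfolding slice_def by (rule vtensor_lift_vtens[OF assms(1,2) slice_bilinear[OF assms(1-3)] assms(1,4,5)])

lemma vtensor_map_bilinear:
  assumes "vspace M'" "vspace N'" "u \<in> lin M M'" "w \<in> lin N N'"
  shows "(\<lambda>m n. vtens M' N' (u m) (w n)) \<in> bilinear_maps M N (M' \<otimes>\<^sub>\<complex> N')"
  by (rule bilinear_comp[OF vtens_bilinear[OF assms(1,2)] assms(3,4)])

lemma vtensor_map_linear:
  assumes "vspace M" "vspace N" "vspace M'" "vspace N'" "u \<in> lin M M'" "w \<in> lin N N'"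
  shows "vtensor_map M' N' u w \<in> lin (M \<otimes>\<^sub>\<complex> N) (M' \<otimes>\<^sub>\<complex> N')"
  unfolding vtensor_map_def
  by (rule vtensor_lift_linear[OF assms(1,2) vtensor_map_bilinear[OF assms(3-6)]
      vspace_vtensor[OF assms(3,4)]])

lemma vtensor_map_vtens:
  assumes "vspace M" "vspace N" "vspace M'" "vspace N'" "u \<in> lin M M'" "w \<in> lin N N'"
    and "m \<in> carrier M" "n \<in> carrier N"
  shows "vtensor_map M' N' u w (vtens M N m n) = vtens M' N' (u m) (w n)"
  unfolding vtensor_map_def
  by (rule vtensor_lift_vtens[OF assms(1,2) vtensor_map_bilinear[OF assms(3-6)]
      vspace_vtensor[OF assms(3,4)] assms(7,8)])

lemma vassoc_inner_bilinear:
  assumes "vspace M" "vspace N" "vspace P" "p \<in> carrier P"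
  shows "(\<lambda>m n. vtens M (N \<otimes>\<^sub>\<complex> P) m (vtens N P n p)) \<in> bilinear_maps M N (M \<otimes>\<^sub>\<complex> (N \<otimes>\<^sub>\<complex> P))"
  by (rule bilinear_comp[OF vtens_bilinear[OF assms(1) vspace_vtensor[OF assms(2,3)]]
        linear_id(2) bilinear_left[OF vtens_bilinear[OF assms(2,3)] assms(4)]])

lemma vassoc_bilinear:
  assumes M: "vspace M" and N: "vspace N" and P: "vspace P"
  shows "(\<lambda>t p. tensor_lift (M \<otimes>\<^sub>\<complex> (N \<otimes>\<^sub>\<complex> P)) (\<lambda>m n. vtens M (N \<otimes>\<^sub>\<complex> P) m (vtens N P n p)) t)
    \<in> bilinear_maps (M \<otimes>\<^sub>\<complex> N) P (M \<otimes>\<^sub>\<complex> (N \<otimes>\<^sub>\<complex> P))"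
proof (rule bilinear_flip[OF bilinear_lift])
  fix m n assume "m \<in> carrier M" "n \<in> carrier N"
  then show "(\<lambda>p. vtens M (N \<otimes>\<^sub>\<complex> P) m (vtens N P n p)) \<in> lin P (M \<otimes>\<^sub>\<complex> (N \<otimes>\<^sub>\<complex> P))"
    using bilinear_comp_right[OF vtens_bilinear[OF M vspace_vtensor[OF N P]] _
        bilinear_right[OF vtens_bilinear[OF N P]]] by blast
qed (use assms in \<open>auto intro: vassoc_inner_bilinear vspace_vtensor\<close>)

lemma vassoc_linear:
  assumes "vspace M" "vspace N" "vspace P"
  shows "vassoc M N P \<in> lin ((M \<otimes>\<^sub>\<complex> N) \<otimes>\<^sub>\<complex> P) (M \<otimes>\<^sub>\<complex> (N \<otimes>\<^sub>\<complex> P))"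
  unfolding vassoc_def
  by (intro vtensor_lift_linear vassoc_bilinear vspace_vtensor assms)

lemma vassoc_vtens:
  assumes "vspace M" "vspace N" "vspace P" "m \<in> carrier M" "n \<in> carrier N" "p \<in> carrier P"
  shows "vassoc M N P (vtens (M \<otimes>\<^sub>\<complex> N) P (vtens M N m n) p) = vtens M (N \<otimes>\<^sub>\<complex> P) m (vtens N P n p)"
proof -
  have "vassoc M N P (vtens (M \<otimes>\<^sub>\<complex> N) P (vtens M N m n) p) =
      tensor_lift (M \<otimes>\<^sub>\<complex> (N \<otimes>\<^sub>\<complex> P)) (\<lambda>m n. vtens M (N \<otimes>\<^sub>\<complex> P) m (vtens N P n p)) (vtens M N m n)"
    unfolding vassoc_def
    by (rule vtensor_lift_vtens[OF _ _ vassoc_bilinear])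
      (use assms in \<open>auto intro: vspace_vtensor vtens_closed\<close>)
  also have "\<dots> = vtens M (N \<otimes>\<^sub>\<complex> P) m (vtens N P n p)"
    by (rule vtensor_lift_vtens[OF _ _ vassoc_inner_bilinear])
      (use assms in \<open>auto intro: vspace_vtensor\<close>)
  finally show ?thesis .
qed

subsection \<open>Linear functionals separate points\<close>

definition linear_subspace :: "(complex, 'm, 'x) module_scheme \<Rightarrow> 'm set \<Rightarrow> bool" where
  "linear_subspace M S \<longleftrightarrow> S \<subseteq> carrier M \<and> \<zero>\<^bsub>M\<^esub> \<in> S \<and>
    (\<forall>x \<in> S. \<forall>y \<in> S. x \<oplus>\<^bsub>M\<^esub> y \<in> S) \<and> (\<forall>z. \<forall>x \<in> S. z \<odot>\<^bsub>M\<^esub> x \<in> S)"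

text \<open>
  Among the subspaces containing \<open>S\<close> but not \<open>x\<close>, choose a maximal one \<open>H\<close> by Zorn's lemma. It has codimension
  one: for \<open>y\<close> outside \<open>H\<close>, maximality puts \<open>x\<close> into \<open>H + \<complex>y\<close>, hence \<open>y\<close> into \<open>H + \<complex>x\<close>. The functional is
  the coefficient of \<open>x\<close> in this decomposition.
\<close>

lemma separating_functional:
  assumes M: "vspace M" and S: "linear_subspace M S" and x: "x \<in> carrier M" "x \<notin> S"
  obtains \<theta> where "\<theta> \<in> dual M" "\<theta> x = 1" "\<And>s. s \<in> S \<Longrightarrow> \<theta> s = 0"
proof -
  interpret M: module complex_ring M by fact
  have sl: "(a + b) \<odot>\<^bsub>M\<^esub> v = a \<odot>\<^bsub>M\<^esub> v \<oplus>\<^bsub>M\<^esub> b \<odot>\<^bsub>M\<^esub> v"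
    and sa: "(a * b) \<odot>\<^bsub>M\<^esub> v = a \<odot>\<^bsub>M\<^esub> (b \<odot>\<^bsub>M\<^esub> v)"
    and s1: "1 \<odot>\<^bsub>M\<^esub> v = v" and s0: "0 \<odot>\<^bsub>M\<^esub> v = \<zero>\<^bsub>M\<^esub>" if "v \<in> carrier M" for a b v
    using that M.smult_l_distr[of a b v] M.smult_assoc1[of a b v] M.smult_one[of v] M.smult_l_null[of v]
    by simp_all
  note smult = sl sa s1 s0 M.smult_r_distr
  let ?A = "{H. linear_subspace M H \<and> S \<subseteq> H \<and> x \<notin> H}"
  have "\<exists>H\<in>?A. \<forall>X\<in>?A. H \<subseteq> X \<longrightarrow> X = H"
  proof (rule subset_Zorn_nonempty)
    show "?A \<noteq> {}" using S x by auto
    fix C assume C: "C \<noteq> {}" "subset.chain ?A C"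
    have sub: "linear_subspace M X" "S \<subseteq> X" "x \<notin> X" if "X \<in> C" for X
      using C that unfolding subset.chain_def by auto
    have "u \<oplus>\<^bsub>M\<^esub> v \<in> \<Union>C" if "u \<in> \<Union>C" "v \<in> \<Union>C" for u v
    proof -
      from that obtain X Y where XY: "u \<in> X" "X \<in> C" "v \<in> Y" "Y \<in> C" by auto
      then have "X \<subseteq> Y \<or> Y \<subseteq> X" using C(2) by (auto simp: subset.chain_def)
      then obtain Z where "Z \<in> C" "u \<in> Z" "v \<in> Z" using XY by auto
      then show ?thesis using sub(1)[of Z] by (auto simp: linear_subspace_def)
    qed
    moreover have "\<Union>C \<subseteq> carrier M" "x \<notin> \<Union>C" "\<forall>z. \<forall>x \<in> \<Union>C. z \<odot>\<^bsub>M\<^esub> x \<in> \<Union>C"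
      using sub unfolding linear_subspace_def by blast+
    moreover have "\<zero>\<^bsub>M\<^esub> \<in> \<Union>C" "S \<subseteq> \<Union>C"
      using sub C(1) unfolding linear_subspace_def by blast+
    ultimately show "\<Union>C \<in> ?A"
      unfolding linear_subspace_def mem_Collect_eq by (intro conjI ballI) simp_all
  qed
  then obtain H where H: "linear_subspace M H" "S \<subseteq> H" "x \<notin> H"
    and max: "\<And>X. \<lbrakk>linear_subspace M X; S \<subseteq> X; x \<notin> X; H \<subseteq> X\<rbrakk> \<Longrightarrow> X = H"
    by auto
  have Hc: "h \<in> carrier M" if "h \<in> H" for h
    using H(1) that by (auto simp: linear_subspace_def)
  have Hadd: "\<lbrakk>h \<in> H; k \<in> H\<rbrakk> \<Longrightarrow> h \<oplus>\<^bsub>M\<^esub> k \<in> H" and Hsm: "h \<in> H \<Longrightarrow> z \<odot>\<^bsub>M\<^esub> h \<in> H"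
    and H0: "\<zero>\<^bsub>M\<^esub> \<in> H" for h k z
    using H(1) by (auto simp: linear_subspace_def)
  have neg: "(-1) \<odot>\<^bsub>M\<^esub> v = \<ominus>\<^bsub>M\<^esub> v" if "v \<in> carrier M" for v
    using sl[of v "-1" 1] that by (intro M.minus_equality[symmetric]) (simp_all add: smult)
  have span: "\<exists>z. \<exists>h\<in>H. y = h \<oplus>\<^bsub>M\<^esub> z \<odot>\<^bsub>M\<^esub> x" if y: "y \<in> carrier M" for y
  proof (cases "y \<in> H")
    case True
    then show ?thesis
      using y x s0[of x] by (intro exI[of _ 0] bexI[of _ y]) auto
  next
    case False
    let ?X = "{h \<oplus>\<^bsub>M\<^esub> z \<odot>\<^bsub>M\<^esub> y | h z. h \<in> H}"
    have "linear_subspace M ?X"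
      unfolding linear_subspace_def
    proof (intro conjI ballI allI)
      show "?X \<subseteq> carrier M" using y Hc by auto
      show "\<zero>\<^bsub>M\<^esub> \<in> ?X"
        using H0 y s0[of y] by (auto intro!: exI[of _ "\<zero>\<^bsub>M\<^esub>"] exI[of _ 0])
    next
      fix u v assume "u \<in> ?X" "v \<in> ?X"
      then obtain h z k w where "u = h \<oplus>\<^bsub>M\<^esub> z \<odot>\<^bsub>M\<^esub> y" "v = k \<oplus>\<^bsub>M\<^esub> w \<odot>\<^bsub>M\<^esub> y" "h \<in> H" "k \<in> H" by auto
      then show "u \<oplus>\<^bsub>M\<^esub> v \<in> ?X"
        using Hadd[of h k] Hc[of h] Hc[of k] y
        by (auto intro!: exI[of _ "h \<oplus>\<^bsub>M\<^esub> k"] exI[of _ "z + w"] simp: smult M.a_ac)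
    next
      fix c u assume "u \<in> ?X"
      then obtain h z where "u = h \<oplus>\<^bsub>M\<^esub> z \<odot>\<^bsub>M\<^esub> y" "h \<in> H" by auto
      then show "c \<odot>\<^bsub>M\<^esub> u \<in> ?X"
        using Hsm[of h c] Hc[of h] y
        by (auto intro!: exI[of _ "c \<odot>\<^bsub>M\<^esub> h"] exI[of _ "c * z"] simp: smult)
    qed
    moreover have sub: "H \<subseteq> ?X"
    proof
      fix h assume "h \<in> H"
      then show "h \<in> ?X"
        using Hc y s0[of y] by (auto intro!: exI[of _ h] exI[of _ 0])
    qed
    moreover have "y \<in> ?X"
      using H0 y by (auto intro!: exI[of _ "\<zero>\<^bsub>M\<^esub>"] exI[of _ 1] simp: smult)
    ultimately have "x \<in> ?X"
      using max[of ?X] H False by blast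
    then obtain h z where hz: "h \<in> H" "x = h \<oplus>\<^bsub>M\<^esub> z \<odot>\<^bsub>M\<^esub> y" by auto
    have "z \<noteq> 0"
      using hz H(3) Hc y s0[of y] by auto
    moreover have "(inverse z) \<odot>\<^bsub>M\<^esub> x = (inverse z) \<odot>\<^bsub>M\<^esub> h \<oplus>\<^bsub>M\<^esub> (inverse z * z) \<odot>\<^bsub>M\<^esub> y"
      using hz Hc y by (simp add: smult)
    ultimately have "(inverse z) \<odot>\<^bsub>M\<^esub> x = (inverse z) \<odot>\<^bsub>M\<^esub> h \<oplus>\<^bsub>M\<^esub> y"
      using y by (simp add: smult)
    then have "y = (- inverse z) \<odot>\<^bsub>M\<^esub> h \<oplus>\<^bsub>M\<^esub> (inverse z) \<odot>\<^bsub>M\<^esub> x"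
      using hz(1) Hc y neg[of "inverse z \<odot>\<^bsub>M\<^esub> h"] sa[of h "-1" "inverse z"]
      by (simp add: M.r_neg1 smult)
    then show ?thesis
      using Hsm[OF hz(1)] by blast
  qed
  have uniq: "z = w" if "h \<oplus>\<^bsub>M\<^esub> z \<odot>\<^bsub>M\<^esub> x = k \<oplus>\<^bsub>M\<^esub> w \<odot>\<^bsub>M\<^esub> x" "h \<in> H" "k \<in> H" for h k z w
  proof (rule ccontr)
    assume "z \<noteq> w"
    have c: "h \<in> carrier M" "k \<in> carrier M" using that Hc by auto
    have "(z - w) \<odot>\<^bsub>M\<^esub> x = k \<oplus>\<^bsub>M\<^esub> (-1) \<odot>\<^bsub>M\<^esub> h"
    proof -
      have "(z - w) \<odot>\<^bsub>M\<^esub> x = ((h \<oplus>\<^bsub>M\<^esub> z \<odot>\<^bsub>M\<^esub> x) \<oplus>\<^bsub>M\<^esub> (- w) \<odot>\<^bsub>M\<^esub> x) \<oplus>\<^bsub>M\<^esub> (-1) \<odot>\<^bsub>M\<^esub> h"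
        using c x sl[of x z "-w"] by (simp add: neg M.a_ac M.r_neg1 M.r_neg2)
      also have "\<dots> = k \<oplus>\<^bsub>M\<^esub> (w + (- w)) \<odot>\<^bsub>M\<^esub> x \<oplus>\<^bsub>M\<^esub> (-1) \<odot>\<^bsub>M\<^esub> h"
        unfolding that(1) using c x sl[of x w "-w"] by (simp add: M.a_assoc)
      finally show ?thesis
        using c x s0[of x] by simp
    qed
    then have "(z - w) \<odot>\<^bsub>M\<^esub> x \<in> H"
      using Hadd Hsm that by simp
    then have "inverse (z - w) \<odot>\<^bsub>M\<^esub> ((z - w) \<odot>\<^bsub>M\<^esub> x) \<in> H"
      by (rule Hsm)
    then show False
      using \<open>z \<noteq> w\<close> H(3) x sa[of x "inverse (z - w)" "z - w"] by (simp add: smult)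
  qed
  define \<theta> where "\<theta> y = (THE z. \<exists>h\<in>H. y = h \<oplus>\<^bsub>M\<^esub> z \<odot>\<^bsub>M\<^esub> x)" for y
  have \<theta>: "\<theta> (h \<oplus>\<^bsub>M\<^esub> z \<odot>\<^bsub>M\<^esub> x) = z" if "h \<in> H" for h z
    unfolding \<theta>_def
    by (rule the_equality) (use that uniq in blast)+
  show thesis
  proof (rule that)
    show "\<theta> \<in> dual M"
    proof (rule linI)
      fix u v assume "u \<in> carrier M" "v \<in> carrier M"
      then obtain h z k w where *: "u = h \<oplus>\<^bsub>M\<^esub> z \<odot>\<^bsub>M\<^esub> x" "v = k \<oplus>\<^bsub>M\<^esub> w \<odot>\<^bsub>M\<^esub> x" "h \<in> H" "k \<in> H"
        using span by metis
      have "u \<oplus>\<^bsub>M\<^esub> v = (h \<oplus>\<^bsub>M\<^esub> k) \<oplus>\<^bsub>M\<^esub> (z + w) \<odot>\<^bsub>M\<^esub> x"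
        using * Hc x by (simp add: smult M.a_ac)
      then show "\<theta> (u \<oplus>\<^bsub>M\<^esub> v) = \<theta> u \<oplus>\<^bsub>regular_module complex_ring\<^esub> \<theta> v"
        using * \<theta> Hadd by simp
    next
      fix c u assume "u \<in> carrier M"
      then obtain h z where *: "u = h \<oplus>\<^bsub>M\<^esub> z \<odot>\<^bsub>M\<^esub> x" "h \<in> H"
        using span by metis
      have "c \<odot>\<^bsub>M\<^esub> u = (c \<odot>\<^bsub>M\<^esub> h) \<oplus>\<^bsub>M\<^esub> (c * z) \<odot>\<^bsub>M\<^esub> x"
        using * Hc x by (simp add: smult)
      then show "\<theta> (c \<odot>\<^bsub>M\<^esub> u) = c \<odot>\<^bsub>regular_module complex_ring\<^esub> \<theta> u"
        using * \<theta> Hsm by simp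
    qed simp
    show "\<theta> x = 1"
      using \<theta>[OF H0, of 1] x by (simp add: smult)
    show "\<theta> s = 0" if "s \<in> S" for s
      using \<theta>[of s 0] that H(2) Hc[of s] x s0[of x] by auto
  qed
qed

lemma (in abelian_group) diff_zero_imp_eq:
  assumes "x \<in> carrier G" "y \<in> carrier G" "x \<ominus> y = \<zero>"
  shows "x = y"
proof -
  have "x = (x \<ominus> y) \<oplus> y"
    using assms(1,2) by (simp add: a_minus_def a_assoc l_neg)
  then show ?thesis
    using assms by simp
qed

lemma dual_separates:
  assumes M: "vspace M" and "x \<in> carrier M" "y \<in> carrier M" "\<And>\<theta>. \<theta> \<in> dual M \<Longrightarrow> \<theta> x = \<theta> y"
  shows "x = y"
proof -
  interpret M: module complex_ring M by fact
  have S: "linear_subspace M {\<zero>\<^bsub>M\<^esub>}"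
    by (auto simp: linear_subspace_def M.smult_r_null)
  have "x \<ominus>\<^bsub>M\<^esub> y = \<zero>\<^bsub>M\<^esub>"
  proof (rule ccontr)
    assume "x \<ominus>\<^bsub>M\<^esub> y \<noteq> \<zero>\<^bsub>M\<^esub>"
    then obtain \<theta> where \<theta>: "\<theta> \<in> dual M" "\<theta> (x \<ominus>\<^bsub>M\<^esub> y) = 1"
      using separating_functional[OF M S, of "x \<ominus>\<^bsub>M\<^esub> y"] assms(2,3) by auto
    have "\<theta> (x \<ominus>\<^bsub>M\<^esub> y) = 0"
    proof -
      have "\<theta> (x \<ominus>\<^bsub>M\<^esub> y) = \<theta> x \<ominus>\<^bsub>regular_module complex_ring\<^esub> \<theta> y"
        by (rule lin_diff[OF \<theta>(1) M vspace_regular assms(2,3)])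
      also have "\<dots> = \<theta> y \<ominus>\<^bsub>regular_module complex_ring\<^esub> \<theta> y"
        using assms(4)[OF \<theta>(1)] by simp
      also have "\<dots> = 0"
        using abelian_group.r_neg[OF vspace_abelian_group[OF vspace_regular], of "\<theta> y"]
        by (simp only: a_minus_def regular_complex_simps UNIV_I simp_thms)
      finally show ?thesis .
    qed
    with \<theta> show False by simp
  qed
  then show ?thesis
    by (rule M.diff_zero_imp_eq[OF assms(2,3)])
qed

subsection \<open>Independent families and tensors of minimal length\<close>

definition independent_family ::
    "(complex, 'm, 'x) module_scheme \<Rightarrow> 'j set \<Rightarrow> ('j \<Rightarrow> 'm) \<Rightarrow> bool" where
  "independent_family M J F \<longleftrightarrow>
    (\<forall>z. (\<Oplus>\<^bsub>M\<^esub>k\<in>J. z k \<odot>\<^bsub>M\<^esub> F k) = \<zero>\<^bsub>M\<^esub> \<longrightarrow> (\<forall>k\<in>J. z k = 0))"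

lemma solve_dependency:
  assumes M: "vspace M" and J: "finite J" "k0 \<in> J" and F: "\<And>k. k \<in> J \<Longrightarrow> F k \<in> carrier M"
    and dep: "(\<Oplus>\<^bsub>M\<^esub>k\<in>J. z k \<odot>\<^bsub>M\<^esub> F k) = \<zero>\<^bsub>M\<^esub>" and nz: "z k0 \<noteq> 0"
  shows "F k0 = (\<Oplus>\<^bsub>M\<^esub>k\<in>J - {k0}. (- z k / z k0) \<odot>\<^bsub>M\<^esub> F k)"
proof -
  interpret M: module complex_ring M by fact
  have sa: "(a * b) \<odot>\<^bsub>M\<^esub> v = a \<odot>\<^bsub>M\<^esub> (b \<odot>\<^bsub>M\<^esub> v)"
    and s1: "1 \<odot>\<^bsub>M\<^esub> v = v" and sl: "(a + b) \<odot>\<^bsub>M\<^esub> v = a \<odot>\<^bsub>M\<^esub> v \<oplus>\<^bsub>M\<^esub> b \<odot>\<^bsub>M\<^esub> v"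
    and s0: "0 \<odot>\<^bsub>M\<^esub> v = \<zero>\<^bsub>M\<^esub>" if "v \<in> carrier M" for a b v
    using that M.smult_l_distr[of a b v] M.smult_assoc1[of a b v] M.smult_one[of v] M.smult_l_null[of v]
    by simp_all
  let ?c = "- inverse (z k0)"
  let ?S = "\<Oplus>\<^bsub>M\<^esub>k\<in>J - {k0}. z k \<odot>\<^bsub>M\<^esub> F k"
  have S: "?S \<in> carrier M" and Fk0: "F k0 \<in> carrier M"
    using F J by (auto intro!: M.finsum_closed)
  have "(\<Oplus>\<^bsub>M\<^esub>k\<in>insert k0 (J - {k0}). z k \<odot>\<^bsub>M\<^esub> F k) = z k0 \<odot>\<^bsub>M\<^esub> F k0 \<oplus>\<^bsub>M\<^esub> ?S"
    by (rule M.finsum_insert) (use J F in auto)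
  then have "z k0 \<odot>\<^bsub>M\<^esub> F k0 \<oplus>\<^bsub>M\<^esub> ?S = \<zero>\<^bsub>M\<^esub>"
    using J(2) dep by (simp add: insert_absorb)
  then have "?c \<odot>\<^bsub>M\<^esub> (z k0 \<odot>\<^bsub>M\<^esub> F k0 \<oplus>\<^bsub>M\<^esub> ?S) = \<zero>\<^bsub>M\<^esub>"
    by (simp add: M.smult_r_null)
  moreover have "?c \<odot>\<^bsub>M\<^esub> (z k0 \<odot>\<^bsub>M\<^esub> F k0) = (-1) \<odot>\<^bsub>M\<^esub> F k0"
    using nz by (subst sa[OF Fk0, symmetric]) simp
  ultimately have "(-1) \<odot>\<^bsub>M\<^esub> F k0 \<oplus>\<^bsub>M\<^esub> ?c \<odot>\<^bsub>M\<^esub> ?S = \<zero>\<^bsub>M\<^esub>"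
    using S Fk0 by (simp add: M.smult_r_distr)
  then have "F k0 \<oplus>\<^bsub>M\<^esub> ((-1) \<odot>\<^bsub>M\<^esub> F k0 \<oplus>\<^bsub>M\<^esub> ?c \<odot>\<^bsub>M\<^esub> ?S) = F k0"
    using nz Fk0 by simp
  moreover have "F k0 \<oplus>\<^bsub>M\<^esub> (-1) \<odot>\<^bsub>M\<^esub> F k0 = \<zero>\<^bsub>M\<^esub>"
    using sl[OF Fk0, of 1 "-1"] s1[OF Fk0] s0[OF Fk0] by simp
  ultimately have "F k0 = ?c \<odot>\<^bsub>M\<^esub> ?S"
    using S Fk0 by (simp add: M.a_assoc[symmetric])
  also have "\<dots> = (\<Oplus>\<^bsub>M\<^esub>k\<in>J - {k0}. ?c \<odot>\<^bsub>M\<^esub> (z k \<odot>\<^bsub>M\<^esub> F k))"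
    by (rule lin_finsum[OF lin_smult_right[OF M linear_id(2)] M M]) (use F in auto)
  also have "\<dots> = (\<Oplus>\<^bsub>M\<^esub>k\<in>J - {k0}. (- z k / z k0) \<odot>\<^bsub>M\<^esub> F k)"
    by (rule M.finsum_cong') (use F in \<open>auto simp: sa[symmetric] field_simps\<close>)
  finally show ?thesis .
qed

text \<open>
  Each \<open>\<theta> k\<close> separates \<open>F k\<close> from the span of the other vectors of the family.
\<close>

lemma dual_family:
  assumes M: "vspace M" and J: "finite J" and F: "\<And>k. k \<in> J \<Longrightarrow> F k \<in> carrier M"
    and ind: "independent_family M J F"
  obtains \<theta> where "\<And>k. k \<in> J \<Longrightarrow> \<theta> k \<in> dual M"
    "\<And>k l. \<lbrakk>k \<in> J; l \<in> J\<rbrakk> \<Longrightarrow> \<theta> k (F l) = (if k = l then 1 else 0)"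
proof -
  interpret M: module complex_ring M by fact
  have sa: "(a * b) \<odot>\<^bsub>M\<^esub> v = a \<odot>\<^bsub>M\<^esub> (b \<odot>\<^bsub>M\<^esub> v)"
    and s1: "1 \<odot>\<^bsub>M\<^esub> v = v" and sl: "(a + b) \<odot>\<^bsub>M\<^esub> v = a \<odot>\<^bsub>M\<^esub> v \<oplus>\<^bsub>M\<^esub> b \<odot>\<^bsub>M\<^esub> v"
    and s0: "0 \<odot>\<^bsub>M\<^esub> v = \<zero>\<^bsub>M\<^esub>" if "v \<in> carrier M" for a b v
    using that M.smult_l_distr[of a b v] M.smult_assoc1[of a b v] M.smult_one[of v] M.smult_l_null[of v]
    by simp_all
  have "\<exists>\<theta>. \<theta> \<in> dual M \<and> (\<forall>l\<in>J. \<theta> (F l) = (if k = l then 1 else 0))" if k: "k \<in> J" for k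
  proof -
    let ?s = "\<lambda>z. \<Oplus>\<^bsub>M\<^esub>l\<in>J - {k}. z l \<odot>\<^bsub>M\<^esub> F l"
    let ?S = "range ?s"
    have c: "?s z \<in> carrier M" for z
      using F by (auto intro!: M.finsum_closed)
    have S: "linear_subspace M ?S"
      unfolding linear_subspace_def
    proof (intro conjI ballI allI)
      show "?S \<subseteq> carrier M" using c by auto
      have "?s (\<lambda>_. 0) = (\<Oplus>\<^bsub>M\<^esub>l\<in>J - {k}. \<zero>\<^bsub>M\<^esub>)"
        by (rule M.finsum_cong') (use F in \<open>auto simp: s0\<close>)
      then show "\<zero>\<^bsub>M\<^esub> \<in> ?S" by (auto intro!: image_eqI[of _ _ "\<lambda>_. 0"])
    next
      fix u v assume "u \<in> ?S" "v \<in> ?S"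
      then obtain z w where "u = ?s z" "v = ?s w" by auto
      moreover have "?s (\<lambda>l. z l + w l) = (\<Oplus>\<^bsub>M\<^esub>l\<in>J - {k}. z l \<odot>\<^bsub>M\<^esub> F l \<oplus>\<^bsub>M\<^esub> w l \<odot>\<^bsub>M\<^esub> F l)"
        by (rule M.finsum_cong') (use F in \<open>auto simp: sl\<close>)
      moreover have "\<dots> = ?s z \<oplus>\<^bsub>M\<^esub> ?s w"
        by (rule M.finsum_addf) (use F in auto)
      ultimately show "u \<oplus>\<^bsub>M\<^esub> v \<in> ?S" by (auto intro!: image_eqI[of _ _ "\<lambda>l. z l + w l"])
    next
      fix a u assume "u \<in> ?S"
      then obtain z where "u = ?s z" by auto
      moreover have "a \<odot>\<^bsub>M\<^esub> ?s z = (\<Oplus>\<^bsub>M\<^esub>l\<in>J - {k}. a \<odot>\<^bsub>M\<^esub> (z l \<odot>\<^bsub>M\<^esub> F l))"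
        by (rule lin_finsum[OF lin_smult_right[OF M linear_id(2)] M M]) (use F in auto)
      moreover have "\<dots> = ?s (\<lambda>l. a * z l)"
        by (rule M.finsum_cong') (use F in \<open>auto simp: sa\<close>)
      ultimately show "a \<odot>\<^bsub>M\<^esub> u \<in> ?S" by (auto intro!: image_eqI[of _ _ "\<lambda>l. a * z l"])
    qed
    have "F k \<notin> ?S"
    proof
      assume "F k \<in> ?S"
      then obtain z where z: "F k = ?s z" by auto
      let ?w = "\<lambda>l. if l = k then - 1 else z l"
      have "(\<Oplus>\<^bsub>M\<^esub>l\<in>insert k (J - {k}). ?w l \<odot>\<^bsub>M\<^esub> F l) = (- 1) \<odot>\<^bsub>M\<^esub> F k \<oplus>\<^bsub>M\<^esub> (\<Oplus>\<^bsub>M\<^esub>l\<in>J - {k}. ?w l \<odot>\<^bsub>M\<^esub> F l)"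
        using J F k by (subst M.finsum_insert) auto
      also have "(\<Oplus>\<^bsub>M\<^esub>l\<in>J - {k}. ?w l \<odot>\<^bsub>M\<^esub> F l) = F k"
        unfolding z by (rule M.finsum_cong') (use F in auto)
      also have "(- 1) \<odot>\<^bsub>M\<^esub> F k \<oplus>\<^bsub>M\<^esub> F k = \<zero>\<^bsub>M\<^esub>"
        using sl[OF F[OF k], of "-1" 1] s1[OF F[OF k]] s0[OF F[OF k]] by simp
      finally have "(\<Oplus>\<^bsub>M\<^esub>l\<in>J. ?w l \<odot>\<^bsub>M\<^esub> F l) = \<zero>\<^bsub>M\<^esub>"
        using k by (simp add: insert_absorb)
      then have "?w k = 0"
        by (rule ind[unfolded independent_family_def, rule_format, where z = ?w, OF _ k])
      then show False by simp
    qed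
    then obtain \<theta> where \<theta>: "\<theta> \<in> dual M" "\<theta> (F k) = 1" "\<And>s. s \<in> ?S \<Longrightarrow> \<theta> s = 0"
      by (rule separating_functional[OF M S F[OF k]]) (rule that)
    have "F l \<in> ?S" if l: "l \<in> J" "l \<noteq> k" for l
    proof -
      have "?s (\<lambda>i. if i = l then 1 else 0) = (\<Oplus>\<^bsub>M\<^esub>i\<in>J - {k}. if i = l then F l else \<zero>\<^bsub>M\<^esub>)"
        by (rule M.finsum_cong') (use F l in \<open>auto simp: s0 s1\<close>)
      also have "\<dots> = F l"
        by (rule M.finsum_delta) (use J l F in auto)
      finally show ?thesis
        by (intro image_eqI[of _ _ "\<lambda>i. if i = l then 1 else 0"]) auto
    qed
    with \<theta> show ?thesis by (intro exI[of _ \<theta>]) auto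
  qed
  then have "\<exists>\<theta>. \<forall>k\<in>J. \<theta> k \<in> dual M \<and> (\<forall>l\<in>J. \<theta> k (F l) = (if k = l then 1 else 0))"
    by (intro bchoice) blast
  then show thesis using that by blast
qed

text \<open>
  A spanning set of least cardinality is independent, since a dependent vector could be omitted. The
  coefficients of a vector are read off by the dual family.
\<close>

lemma finite_dimensional_basis:
  assumes V: "vspace V" and fd: "finite_dimensional V"
  obtains S \<xi> where "finite S" "S \<subseteq> carrier V" "\<And>s. s \<in> S \<Longrightarrow> \<xi> s \<in> dual V"
    "\<And>s t. \<lbrakk>s \<in> S; t \<in> S\<rbrakk> \<Longrightarrow> \<xi> s t = (if s = t then 1 else 0)"
    "\<And>v. v \<in> carrier V \<Longrightarrow> v = (\<Oplus>\<^bsub>V\<^esub>s\<in>S. \<xi> s v \<odot>\<^bsub>V\<^esub> s)"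
proof -
  interpret V: module complex_ring V by fact
  have sa: "(a * b) \<odot>\<^bsub>V\<^esub> v = a \<odot>\<^bsub>V\<^esub> (b \<odot>\<^bsub>V\<^esub> v)"
    and sl: "(a + b) \<odot>\<^bsub>V\<^esub> v = a \<odot>\<^bsub>V\<^esub> v \<oplus>\<^bsub>V\<^esub> b \<odot>\<^bsub>V\<^esub> v" if "v \<in> carrier V" for a b v
    using that V.smult_l_distr[of a b v] V.smult_assoc1[of a b v]
    by simp_all
  define spans where "spans S \<longleftrightarrow> finite S \<and> S \<subseteq> carrier V \<and>
      (\<forall>v \<in> carrier V. \<exists>k. v = (\<Oplus>\<^bsub>V\<^esub>s\<in>S. k s \<odot>\<^bsub>V\<^esub> s))" for S
  obtain S0 where S0: "finite S0 \<and> S0 \<subseteq> carrier V \<and>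
      (\<forall>x \<in> carrier V. \<exists>k \<in> S0 \<rightarrow> carrier complex_ring. x = (\<Oplus>\<^bsub>V\<^esub>s\<in>S0. k s \<odot>\<^bsub>V\<^esub> s))"
    using fd unfolding finite_dimensional_def finitely_generated_def by (elim exE) (rule that)
  have "spans S0"
    unfolding spans_def
  proof (intro conjI ballI)
    fix v assume "v \<in> carrier V"
    with S0 show "\<exists>k. v = (\<Oplus>\<^bsub>V\<^esub>s\<in>S0. k s \<odot>\<^bsub>V\<^esub> s)"
      by (elim conjE) (drule (1) bspec, elim bexE, rule exI)
  qed (use S0 in simp_all)
  then have "\<exists>S. spans S \<and> (\<forall>T. spans T \<longrightarrow> card S \<le> card T)"
    by (rule ex_has_least_nat)
  then obtain S where S: "spans S" and min: "\<forall>T. spans T \<longrightarrow> card S \<le> card T"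
    by (elim exE conjE) (rule that)
  then have fin: "finite S" and sub: "S \<subseteq> carrier V"
    and span: "\<And>v. v \<in> carrier V \<Longrightarrow> \<exists>k. v = (\<Oplus>\<^bsub>V\<^esub>s\<in>S. k s \<odot>\<^bsub>V\<^esub> s)"
    by (auto simp: spans_def)
  have ind: "independent_family V S (\<lambda>s. s)"
    unfolding independent_family_def
  proof (intro allI impI ballI, rule ccontr)
    fix z s0 assume dep: "(\<Oplus>\<^bsub>V\<^esub>s\<in>S. z s \<odot>\<^bsub>V\<^esub> s) = \<zero>\<^bsub>V\<^esub>" and s0: "s0 \<in> S" "z s0 \<noteq> 0"
    let ?w = "\<lambda>s. - z s / z s0"
    have s0_eq: "s0 = (\<Oplus>\<^bsub>V\<^esub>s\<in>S - {s0}. ?w s \<odot>\<^bsub>V\<^esub> s)"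
      using solve_dependency[OF V fin s0(1) _ dep s0(2)] sub by auto
    have "spans (S - {s0})"
      unfolding spans_def
    proof (intro conjI ballI)
      fix v assume v: "v \<in> carrier V"
      obtain k where k: "v = (\<Oplus>\<^bsub>V\<^esub>s\<in>S. k s \<odot>\<^bsub>V\<^esub> s)" using span[OF v] by (elim exE) (rule that)
      have "v = (\<Oplus>\<^bsub>V\<^esub>s\<in>insert s0 (S - {s0}). k s \<odot>\<^bsub>V\<^esub> s)"
        using k s0 by (simp add: insert_absorb)
      also have "\<dots> = k s0 \<odot>\<^bsub>V\<^esub> s0 \<oplus>\<^bsub>V\<^esub> (\<Oplus>\<^bsub>V\<^esub>s\<in>S - {s0}. k s \<odot>\<^bsub>V\<^esub> s)"
        by (rule V.finsum_insert) (use fin sub s0 in auto)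
      also have "k s0 \<odot>\<^bsub>V\<^esub> s0 = (\<Oplus>\<^bsub>V\<^esub>s\<in>S - {s0}. k s0 \<odot>\<^bsub>V\<^esub> (?w s \<odot>\<^bsub>V\<^esub> s))"
        by (subst s0_eq, rule lin_finsum[OF lin_smult_right[OF V linear_id(2)] V V]) (use sub in auto)
      also have "\<dots> \<oplus>\<^bsub>V\<^esub> (\<Oplus>\<^bsub>V\<^esub>s\<in>S - {s0}. k s \<odot>\<^bsub>V\<^esub> s) =
          (\<Oplus>\<^bsub>V\<^esub>s\<in>S - {s0}. k s0 \<odot>\<^bsub>V\<^esub> (?w s \<odot>\<^bsub>V\<^esub> s) \<oplus>\<^bsub>V\<^esub> k s \<odot>\<^bsub>V\<^esub> s)"
        by (rule V.finsum_addf[symmetric]) (use sub in auto)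
      also have "\<dots> = (\<Oplus>\<^bsub>V\<^esub>s\<in>S - {s0}. (k s0 * ?w s + k s) \<odot>\<^bsub>V\<^esub> s)"
      proof (rule V.finsum_cong')
        fix s assume "s \<in> S - {s0}"
        then have "s \<in> carrier V" using sub by auto
        then show "k s0 \<odot>\<^bsub>V\<^esub> (?w s \<odot>\<^bsub>V\<^esub> s) \<oplus>\<^bsub>V\<^esub> k s \<odot>\<^bsub>V\<^esub> s = (k s0 * ?w s + k s) \<odot>\<^bsub>V\<^esub> s"
          by (simp only: sl sa)
      qed (use sub in auto)
      finally show "\<exists>k. v = (\<Oplus>\<^bsub>V\<^esub>s\<in>S - {s0}. k s \<odot>\<^bsub>V\<^esub> s)"
        by (rule exI[of _ "\<lambda>s. k s0 * ?w s + k s"])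
    qed (use fin sub in auto)
    then show False
      using min[rule_format, of "S - {s0}"] card_Diff1_less[OF fin s0(1)] by simp
  qed
  have id: "(\<lambda>s. s) k \<in> carrier V" if "k \<in> S" for k
    using that sub by auto
  obtain \<xi> where \<xi>: "\<And>s. s \<in> S \<Longrightarrow> \<xi> s \<in> dual V"
    "\<And>s t. \<lbrakk>s \<in> S; t \<in> S\<rbrakk> \<Longrightarrow> \<xi> s t = (if s = t then 1 else 0)"
    by (rule dual_family[OF V fin id ind], assumption, rule that)
  have exp: "v = (\<Oplus>\<^bsub>V\<^esub>s\<in>S. \<xi> s v \<odot>\<^bsub>V\<^esub> s)" if v: "v \<in> carrier V" for v
  proof -
    obtain k where k: "v = (\<Oplus>\<^bsub>V\<^esub>s\<in>S. k s \<odot>\<^bsub>V\<^esub> s)" using span[OF v] by (elim exE) (rule that)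
    have "\<xi> s v = k s" if s: "s \<in> S" for s
    proof -
      have "\<xi> s v = (\<Sum>t\<in>S. \<xi> s (k t \<odot>\<^bsub>V\<^esub> t))"
        unfolding k finsum_regular_complex[symmetric]
        by (rule lin_finsum[OF \<xi>(1)[OF s] V vspace_regular]) (use sub in auto)
      also have "\<dots> = (\<Sum>t\<in>S. if s = t then k t else 0)"
        by (rule sum.cong) (use sub s in \<open>auto simp: lin_smult[OF \<xi>(1)[OF s]] \<xi>(2) subset_iff\<close>)
      also have "\<dots> = k s"
        using fin s by simp
      finally show ?thesis .
    qed
    then show ?thesis
      by (subst k, intro V.finsum_cong') (use sub in auto)
  qed
  show thesis
    by (rule that[OF fin sub \<xi> exp])
qed

text \<open>
  In a simultaneous decomposition of finitely many tensors with the least number of summands both families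
  of legs are independent: from a dependency among either of them, one summand could be absorbed into the
  others. For the first legs \<open>G k\<close> this means independence as functions on \<open>I\<close>.
\<close>

lemma minimal_decomposition:
  assumes M: "vspace M" and N: "vspace N" and I: "finite I"
    and t: "\<And>i. i \<in> I \<Longrightarrow> t i \<in> carrier (M \<otimes>\<^sub>\<complex> N)"
  obtains J :: "('i \<times> nat) set" and G :: "'i \<times> nat \<Rightarrow> 'i \<Rightarrow> 'm" and F :: "'i \<times> nat \<Rightarrow> 'n"
  where "finite J" "\<And>k. k \<in> J \<Longrightarrow> F k \<in> carrier N" "\<And>k i. \<lbrakk>k \<in> J; i \<in> I\<rbrakk> \<Longrightarrow> G k i \<in> carrier M"
    "\<And>i. i \<in> I \<Longrightarrow> t i = (\<Oplus>\<^bsub>M \<otimes>\<^sub>\<complex> N\<^esub>k\<in>J. vtens M N (G k i) (F k))"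
    "independent_family N J F"
    "\<forall>z. (\<forall>i\<in>I. (\<Oplus>\<^bsub>M\<^esub>k\<in>J. z k \<odot>\<^bsub>M\<^esub> G k i) = \<zero>\<^bsub>M\<^esub>) \<longrightarrow> (\<forall>k\<in>J. z k = 0)"
proof -
  let ?T = "M \<otimes>\<^sub>\<complex> N"
  interpret M: module complex_ring M by fact
  interpret N: module complex_ring N by fact
  interpret T: module complex_ring ?T by (rule vspace_vtensor[OF M N])
  note bil = vtens_bilinear[OF M N]
  note [simp] = vtens_closed[OF M N]
  define rep where "rep J G F \<longleftrightarrow> finite J \<and> (\<forall>k\<in>J. F k \<in> carrier N) \<and>
      (\<forall>k\<in>J. \<forall>i\<in>I. G k i \<in> carrier M) \<and>
      (\<forall>i\<in>I. t i = (\<Oplus>\<^bsub>?T\<^esub>k\<in>J. vtens M N (G k i) (F k)))"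
    for J :: "('i \<times> nat) set" and G :: "'i \<times> nat \<Rightarrow> 'i \<Rightarrow> 'm" and F :: "'i \<times> nat \<Rightarrow> 'n"
  have "\<forall>i\<in>I. \<exists>n g f. (\<forall>k < n. g k \<in> carrier M \<and> f k \<in> carrier N) \<and>
      t i = (\<Oplus>\<^bsub>?T\<^esub>k\<in>{..<n::nat}. vtens M N (g k) (f k))"
  proof
    fix i assume i: "i \<in> I"
    show "\<exists>n g f. (\<forall>k < n. g k \<in> carrier M \<and> f k \<in> carrier N) \<and>
        t i = (\<Oplus>\<^bsub>?T\<^esub>k\<in>{..<n::nat}. vtens M N (g k) (f k))"
      by (rule vtensor_decompose[OF M N t[OF i]], intro exI conjI allI impI) (assumption | simp)+
  qed
  then obtain n g f where d: "\<forall>i\<in>I. (\<forall>k < n i. g i k \<in> carrier M \<and> f i k \<in> carrier N) \<and>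
      t i = (\<Oplus>\<^bsub>?T\<^esub>k\<in>{..<n i::nat}. vtens M N (g i k) (f i k))"
    by (elim exE[OF bchoice]) (rule that)
  then have d3: "t i = (\<Oplus>\<^bsub>?T\<^esub>k\<in>{..<n i}. vtens M N (g i k) (f i k))" if "i \<in> I" for i
    using that by blast
  \<comment> \<open>separate decompositions of the tensors are combined by padding the first legs with zeros\<close>
  have ex: "rep (Sigma I (\<lambda>i. {..<n i}))
      (\<lambda>p i. if fst p = i then g i (snd p) else \<zero>\<^bsub>M\<^esub>) (\<lambda>p. f (fst p) (snd p))"
    unfolding rep_def
  proof (intro conjI ballI)
    fix i assume i: "i \<in> I"
    let ?h = "\<lambda>p. vtens M N (if fst p = i then g i (snd p) else \<zero>\<^bsub>M\<^esub>) (f (fst p) (snd p))"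
    have z: "vtens M N \<zero>\<^bsub>M\<^esub> n = \<zero>\<^bsub>?T\<^esub>" if "n \<in> carrier N" for n
      using lin_zero[OF bilinear_left[OF bil that] M T.module_axioms] .
    have "(\<Oplus>\<^bsub>?T\<^esub>p\<in>Sigma I (\<lambda>i. {..<n i}). ?h p) = (\<Oplus>\<^bsub>?T\<^esub>p\<in>Pair i ` {..<n i}. ?h p)"
      using I d i z by (intro T.add.finprod_mono_neutral_cong_right) auto
    also have "\<dots> = (\<Oplus>\<^bsub>?T\<^esub>k\<in>{..<n i}. ?h (i, k))"
      using d i by (intro T.finsum_reindex) (auto simp: inj_on_def)
    also have "\<dots> = t i"
      unfolding d3[OF i] by (rule T.finsum_cong') (use d i in auto)
    finally show "t i = (\<Oplus>\<^bsub>?T\<^esub>p\<in>Sigma I (\<lambda>i. {..<n i}). ?h p)" ..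
  qed (use I d in auto)
  then have "\<exists>J. (\<exists>G F. rep J G F) \<and> (\<forall>J'. (\<exists>G F. rep J' G F) \<longrightarrow> card J \<le> card J')"
    by (intro ex_has_least_nat exI) (rule ex)
  then obtain J G F where rep: "rep J G F"
    and least: "\<forall>J'. (\<exists>G F. rep J' G F) \<longrightarrow> card J \<le> card J'"
    by (elim exE conjE) (rule that)
  have min: "card J \<le> card J'" if "rep J' G' F'" for J' G' F'
    using least that by auto
  have J: "finite J" and F: "\<And>k. k \<in> J \<Longrightarrow> F k \<in> carrier N"
    and G: "\<And>k i. \<lbrakk>k \<in> J; i \<in> I\<rbrakk> \<Longrightarrow> G k i \<in> carrier M"
    and sum: "\<And>i. i \<in> I \<Longrightarrow> t i = (\<Oplus>\<^bsub>?T\<^esub>k\<in>J. vtens M N (G k i) (F k))"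
    using rep by (auto simp: rep_def)
  have split: "t i = vtens M N (G k0 i) (F k0) \<oplus>\<^bsub>?T\<^esub> (\<Oplus>\<^bsub>?T\<^esub>k\<in>J - {k0}. vtens M N (G k i) (F k))"
    if "k0 \<in> J" "i \<in> I" for k0 i
  proof -
    have "t i = (\<Oplus>\<^bsub>?T\<^esub>k\<in>insert k0 (J - {k0}). vtens M N (G k i) (F k))"
      using sum that by (simp add: insert_absorb)
    also have "\<dots> = vtens M N (G k0 i) (F k0) \<oplus>\<^bsub>?T\<^esub> (\<Oplus>\<^bsub>?T\<^esub>k\<in>J - {k0}. vtens M N (G k i) (F k))"
      by (rule T.finsum_insert) (use J F G that in auto)
    finally show ?thesis .
  qed
  have smaller: False if "rep (J - {k0}) G' F'" "k0 \<in> J" for k0 G' F'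
    using min[OF that(1)] card_Diff1_less[OF J that(2)] by simp
  have "independent_family N J F"
    unfolding independent_family_def
  proof (intro allI impI ballI, rule ccontr)
    fix z k0 assume dep: "(\<Oplus>\<^bsub>N\<^esub>k\<in>J. z k \<odot>\<^bsub>N\<^esub> F k) = \<zero>\<^bsub>N\<^esub>" and k0: "k0 \<in> J" "z k0 \<noteq> 0"
    let ?w = "\<lambda>k. - z k / z k0"
    have F0: "F k0 = (\<Oplus>\<^bsub>N\<^esub>k\<in>J - {k0}. ?w k \<odot>\<^bsub>N\<^esub> F k)"
      by (rule solve_dependency[OF N J k0(1) F dep k0(2)])
    have "rep (J - {k0}) (\<lambda>k i. ?w k \<odot>\<^bsub>M\<^esub> G k0 i \<oplus>\<^bsub>M\<^esub> G k i) F"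
      unfolding rep_def
    proof (intro conjI ballI)
      fix i assume i: "i \<in> I"
      note Gi = G[OF _ i]
      have "vtens M N (G k0 i) (F k0) = (\<Oplus>\<^bsub>?T\<^esub>k\<in>J - {k0}. vtens M N (G k0 i) (?w k \<odot>\<^bsub>N\<^esub> F k))"
        by (subst F0, rule lin_finsum[OF bilinear_right[OF bil Gi[OF k0(1)]] N T.module_axioms])
          (use F in auto)
      then have "t i = (\<Oplus>\<^bsub>?T\<^esub>k\<in>J - {k0}. vtens M N (G k0 i) (?w k \<odot>\<^bsub>N\<^esub> F k) \<oplus>\<^bsub>?T\<^esub> vtens M N (G k i) (F k))"
        unfolding split[OF k0(1) i]
        using F Gi k0(1) by (subst T.finsum_addf) auto
      also have "\<dots> = (\<Oplus>\<^bsub>?T\<^esub>k\<in>J - {k0}. vtens M N (?w k \<odot>\<^bsub>M\<^esub> G k0 i \<oplus>\<^bsub>M\<^esub> G k i) (F k))"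
        by (rule T.finsum_cong')
          (use F Gi k0(1) in \<open>auto simp: vtens_smult_right[OF M N] linear_add[OF bilinear_left[OF bil]]\<close>)
      finally show "t i = (\<Oplus>\<^bsub>?T\<^esub>k\<in>J - {k0}. vtens M N (?w k \<odot>\<^bsub>M\<^esub> G k0 i \<oplus>\<^bsub>M\<^esub> G k i) (F k))" .
    qed (use J F G k0 in auto)
    then show False using smaller k0 by blast
  qed
  moreover have "z k0 = 0" if dep: "\<And>i. i \<in> I \<Longrightarrow> (\<Oplus>\<^bsub>M\<^esub>k\<in>J. z k \<odot>\<^bsub>M\<^esub> G k i) = \<zero>\<^bsub>M\<^esub>" and k0: "k0 \<in> J" for z k0
  proof (rule ccontr)
    assume nz: "z k0 \<noteq> 0"
    let ?w = "\<lambda>k. - z k / z k0"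
    have "rep (J - {k0}) G (\<lambda>k. ?w k \<odot>\<^bsub>N\<^esub> F k0 \<oplus>\<^bsub>N\<^esub> F k)"
      unfolding rep_def
    proof (intro conjI ballI)
      fix i assume i: "i \<in> I"
      note Gi = G[OF _ i]
      have G0: "G k0 i = (\<Oplus>\<^bsub>M\<^esub>k\<in>J - {k0}. ?w k \<odot>\<^bsub>M\<^esub> G k i)"
        by (rule solve_dependency[OF M J k0 Gi dep[OF i] nz])
      have "vtens M N (G k0 i) (F k0) = (\<Oplus>\<^bsub>?T\<^esub>k\<in>J - {k0}. vtens M N (?w k \<odot>\<^bsub>M\<^esub> G k i) (F k0))"
        by (subst G0, rule lin_finsum[OF bilinear_left[OF bil F[OF k0]] M T.module_axioms])
          (use Gi in auto)
      then have "t i = (\<Oplus>\<^bsub>?T\<^esub>k\<in>J - {k0}. vtens M N (?w k \<odot>\<^bsub>M\<^esub> G k i) (F k0) \<oplus>\<^bsub>?T\<^esub> vtens M N (G k i) (F k))"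
        unfolding split[OF k0 i]
        using F Gi k0 by (subst T.finsum_addf) auto
      also have "\<dots> = (\<Oplus>\<^bsub>?T\<^esub>k\<in>J - {k0}. vtens M N (G k i) (?w k \<odot>\<^bsub>N\<^esub> F k0 \<oplus>\<^bsub>N\<^esub> F k))"
        by (rule T.finsum_cong')
          (use F Gi k0 in \<open>auto simp: vtens_smult_right[OF M N] linear_add[OF bilinear_right[OF bil]]\<close>)
      finally show "t i = (\<Oplus>\<^bsub>?T\<^esub>k\<in>J - {k0}. vtens M N (G k i) (?w k \<odot>\<^bsub>N\<^esub> F k0 \<oplus>\<^bsub>N\<^esub> F k))" .
    qed (use J F G k0 in auto)
    then show False using smaller k0 by blast
  qed
  ultimately show thesis
    using that[OF J F G sum] by blast
qed

text \<open>Slices determine a tensor, since the second legs can be chosen independent.\<close>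

lemma slices_separate:
  assumes M: "vspace M" and N: "vspace N" and X: "X \<in> carrier (M \<otimes>\<^sub>\<complex> N)" "Y \<in> carrier (M \<otimes>\<^sub>\<complex> N)"
    and eq: "\<And>\<theta>. \<theta> \<in> dual N \<Longrightarrow> slice M \<theta> X = slice M \<theta> Y"
  shows "X = Y"
proof -
  let ?T = "M \<otimes>\<^sub>\<complex> N"
  interpret M: module complex_ring M by fact
  interpret N: module complex_ring N by fact
  interpret T: module complex_ring ?T by (rule vspace_vtensor[OF M N])
  have D: "X \<ominus>\<^bsub>?T\<^esub> Y \<in> carrier ?T" using X by simp
  obtain J G F where J: "finite (J :: (unit \<times> nat) set)" and F: "\<And>k. k \<in> J \<Longrightarrow> F k \<in> carrier N"
    and G: "\<And>k i. \<lbrakk>k \<in> J; i \<in> {()}\<rbrakk> \<Longrightarrow> G k i \<in> carrier M"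
    and sum: "\<And>i. i \<in> {()} \<Longrightarrow> X \<ominus>\<^bsub>?T\<^esub> Y = (\<Oplus>\<^bsub>?T\<^esub>k\<in>J. vtens M N (G k i) (F k))"
    and ind: "independent_family N J F"
    by (rule minimal_decomposition[OF M N, of "{()}" "\<lambda>_. X \<ominus>\<^bsub>?T\<^esub> Y"]) (use D in auto)
  obtain \<theta> where \<theta>: "\<And>k. k \<in> J \<Longrightarrow> \<theta> k \<in> dual N"
    "\<And>k l. \<lbrakk>k \<in> J; l \<in> J\<rbrakk> \<Longrightarrow> \<theta> k (F l) = (if k = l then 1 else 0)"
    by (rule dual_family[OF N J F ind], assumption, rule that)
  have "G k () = \<zero>\<^bsub>M\<^esub>" if k: "k \<in> J" for k
  proof -
    note lin = slice_linear[OF M N \<theta>(1)[OF k]]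
    have c: "(\<lambda>l. vtens M N (G l ()) (F l)) \<in> J \<rightarrow> carrier ?T"
      using G F by (auto intro: vtens_closed[OF M N])
    have "slice M (\<theta> k) (X \<ominus>\<^bsub>?T\<^esub> Y) = (\<Oplus>\<^bsub>M\<^esub>l\<in>J. slice M (\<theta> k) (vtens M N (G l ()) (F l)))"
      using sum lin_finsum[OF lin T.module_axioms M c] by simp
    also have "\<dots> = (\<Oplus>\<^bsub>M\<^esub>l\<in>J. if l = k then G k () else \<zero>\<^bsub>M\<^esub>)"
      by (rule M.finsum_cong')
        (use F G k M.smult_one M.smult_l_null in \<open>auto simp: slice_vtens[OF M N \<theta>(1)[OF k]] \<theta>(2)\<close>)
    also have "\<dots> = G k ()"
      by (rule M.finsum_delta) (use J G k in auto)
    finally have "G k () = slice M (\<theta> k) X \<ominus>\<^bsub>M\<^esub> slice M (\<theta> k) Y"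
      using lin_diff[OF lin T.module_axioms M X] by simp
    also have "\<dots> = \<zero>\<^bsub>M\<^esub>"
      using eq[OF \<theta>(1)[OF k]] linear_closed[OF lin X(2)] by (simp add: a_minus_def M.r_neg)
    finally show ?thesis .
  qed
  then have "X \<ominus>\<^bsub>?T\<^esub> Y = (\<Oplus>\<^bsub>?T\<^esub>k\<in>J. vtens M N \<zero>\<^bsub>M\<^esub> (F k))"
    unfolding sum[OF singletonI] by (intro T.finsum_cong') (auto intro: vtens_closed[OF M N] F)
  also have "\<dots> = (\<Oplus>\<^bsub>?T\<^esub>k\<in>J. \<zero>\<^bsub>?T\<^esub>)"
    by (rule T.finsum_cong')
      (auto simp: lin_zero[OF bilinear_left[OF vtens_bilinear[OF M N] F] M T.module_axioms])
  finally have "X \<ominus>\<^bsub>?T\<^esub> Y = \<zero>\<^bsub>?T\<^esub>" by simp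
  then show ?thesis
    by (rule T.diff_zero_imp_eq[OF X])
qed

section \<open>Algebras with a coaction\<close>

lemma algebra_vspace: "complex_algebra A \<Longrightarrow> vspace A"
  and algebra_ring: "complex_algebra A \<Longrightarrow> ring A"
  by (auto simp: complex_algebra_def)

lemma algebra_mult_bilinear: "complex_algebra A \<Longrightarrow> (\<lambda>x y. x \<otimes>\<^bsub>A\<^esub> y) \<in> bilinear_maps A A A"
  unfolding complex_algebra_def
  by (intro bilinearI linI)
    (auto simp: ring.ring_simprules(13) ring.ring_simprules(23) ring.ring_simprules(5))

lemma algebra_mult_left_linear:
  "\<lbrakk>complex_algebra A; a \<in> carrier A\<rbrakk> \<Longrightarrow> (\<lambda>x. a \<otimes>\<^bsub>A\<^esub> x) \<in> lin A A"
  by (rule bilinear_right[OF algebra_mult_bilinear])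

lemma algebra_mult_right_linear:
  "\<lbrakk>complex_algebra A; a \<in> carrier A\<rbrakk> \<Longrightarrow> (\<lambda>x. x \<otimes>\<^bsub>A\<^esub> a) \<in> lin A A"
  by (rule bilinear_left[OF algebra_mult_bilinear])

context
  fixes A :: "(complex, 'a, 'x) module_scheme" and N :: "(complex, 'n, 'y) module_scheme"
  assumes A: "complex_algebra A" and N: "vspace N"
begin

interpretation A: ring A by (rule algebra_ring[OF A])

lemma left_tensor_module: "left_module A (left_tensor complex_ring A N)"
  by (rule tensor_left_module(1)[OF vspace_tensor_factors[OF algebra_vspace[OF A] N] A.ring_axioms _ _ _ _
        same_additive_left_tensor smult_left_tensor])
    (auto intro: algebra_mult_left_linear[OF A] simp: A.l_distr A.m_assoc)

lemma left_tensor_smult_eq: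
  "a \<odot>\<^bsub>left_tensor complex_ring A N\<^esub> X =
    tensor_lift (A \<otimes>\<^sub>\<complex> N) (\<lambda>m n. vtens A N (a \<otimes>\<^bsub>A\<^esub> m) n) X"
  unfolding smult_left_tensor vtens_def tensor_lift_same[OF same_additive_vtensor] ..

lemma left_tensor_inner_bilinear:
  assumes "a \<in> carrier A"
  shows "(\<lambda>m n. vtens A N (a \<otimes>\<^bsub>A\<^esub> m) n) \<in> bilinear_maps A N (A \<otimes>\<^sub>\<complex> N)"
  by (rule bilinear_comp[OF vtens_bilinear[OF algebra_vspace[OF A] N]
        algebra_mult_left_linear[OF A assms] linear_id(2)])

lemma left_tensor_bilinear:
  "(\<lambda>a X. a \<odot>\<^bsub>left_tensor complex_ring A N\<^esub> X) \<in> bilinear_maps A (A \<otimes>\<^sub>\<complex> N) (A \<otimes>\<^sub>\<complex> N)"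
  unfolding left_tensor_smult_eq
proof (rule bilinear_lift)
  fix m n assume "m \<in> carrier A" "n \<in> carrier N"
  then show "(\<lambda>a. vtens A N (a \<otimes>\<^bsub>A\<^esub> m) n) \<in> lin A (A \<otimes>\<^sub>\<complex> N)"
    by (intro bilinear_comp_left[OF vtens_bilinear[OF algebra_vspace[OF A] N]] algebra_mult_right_linear[OF A])
qed (intro left_tensor_inner_bilinear algebra_vspace[OF A] N vspace_vtensor | assumption)+

lemma left_tensor_smult_vtens:
  "\<lbrakk>a \<in> carrier A; m \<in> carrier A; n \<in> carrier N\<rbrakk>
    \<Longrightarrow> a \<odot>\<^bsub>left_tensor complex_ring A N\<^esub> vtens A N m n = vtens A N (a \<otimes>\<^bsub>A\<^esub> m) n"
  unfolding left_tensor_smult_eq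
  by (rule vtensor_lift_vtens[OF algebra_vspace[OF A] N left_tensor_inner_bilinear
        vspace_vtensor[OF algebra_vspace[OF A] N]])

lemma left_tensor_smult_one:
  assumes "X \<in> carrier (A \<otimes>\<^sub>\<complex> N)"
  shows "\<one>\<^bsub>A\<^esub> \<odot>\<^bsub>left_tensor complex_ring A N\<^esub> X = X"
  using left_module.smult_one[OF left_tensor_module] assms same_additive_left_vtensor[of A N]
  by (simp add: same_additive_def)

lemma left_tensor_smult_mult:
  assumes "a \<in> carrier A" "b \<in> carrier A" "X \<in> carrier (A \<otimes>\<^sub>\<complex> N)"
  shows "(a \<otimes>\<^bsub>A\<^esub> b) \<odot>\<^bsub>left_tensor complex_ring A N\<^esub> X =
    a \<odot>\<^bsub>left_tensor complex_ring A N\<^esub> (b \<odot>\<^bsub>left_tensor complex_ring A N\<^esub> X)"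
  using left_module.smult_assoc[OF left_tensor_module] assms same_additive_left_vtensor[of A N]
  by (simp add: same_additive_def)

lemma slice_left_tensor:
  assumes "\<theta> \<in> dual N" "a \<in> carrier A" "X \<in> carrier (A \<otimes>\<^sub>\<complex> N)"
  shows "slice A \<theta> (a \<odot>\<^bsub>left_tensor complex_ring A N\<^esub> X) = a \<otimes>\<^bsub>A\<^esub> slice A \<theta> X"
proof (rule vtensor_ext[OF algebra_vspace[OF A] N _ _ algebra_vspace[OF A] _ assms(3)])
  note S = slice_linear[OF algebra_vspace[OF A] N assms(1)]
  show "(\<lambda>X. slice A \<theta> (a \<odot>\<^bsub>left_tensor complex_ring A N\<^esub> X)) \<in> lin (A \<otimes>\<^sub>\<complex> N) A"
    by (rule linear_comp[OF bilinear_right[OF left_tensor_bilinear assms(2)] S])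
  show "(\<lambda>X. a \<otimes>\<^bsub>A\<^esub> slice A \<theta> X) \<in> lin (A \<otimes>\<^sub>\<complex> N) A"
    by (rule linear_comp[OF S algebra_mult_left_linear[OF A assms(2)]])
  show "slice A \<theta> (a \<odot>\<^bsub>left_tensor complex_ring A N\<^esub> vtens A N m n) = a \<otimes>\<^bsub>A\<^esub> slice A \<theta> (vtens A N m n)"
    if "m \<in> carrier A" "n \<in> carrier N" for m n
    using that assms A
    by (simp add: left_tensor_smult_vtens slice_vtens[OF algebra_vspace[OF A] N] complex_algebra_def)
qed

end

text \<open>
  Composed with the coaction, \<open>conv A L\<close> turns a linear map \<open>L : C \<rightarrow> A\<close> into the endomorphism
  \<open>a \<mapsto> a\<^sub>(\<^sub>0\<^sub>) L(a\<^sub>(\<^sub>1\<^sub>))\<close> of \<open>A\<close>, called \<open>hat A L\<close> below.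
\<close>

definition conv :: "(complex, 'a, 'x) module_scheme \<Rightarrow> ('c \<Rightarrow> 'a) \<Rightarrow> ('a, 'c) tensor \<Rightarrow> 'a" where
  "conv A L = tensor_lift A (\<lambda>x c. x \<otimes>\<^bsub>A\<^esub> L c)"

definition hat :: "('c, 'a) right_comodule \<Rightarrow> ('c \<Rightarrow> 'a) \<Rightarrow> 'a \<Rightarrow> 'a" where
  "hat A L a = conv A L (rcoact A a)"

locale algebra_comodule =
  fixes C :: "'c coalgebra" and A :: "('c, 'a) right_comodule"
  assumes coalg: "coalgebra C" and alg: "complex_algebra A" and comod: "right_comodule C A"
begin

sublocale A: ring A by (rule algebra_ring[OF alg])

abbreviation act :: "'a \<Rightarrow> ('a, 'n) tensor \<Rightarrow> (complex, 'n, 'y) module_scheme \<Rightarrow> ('a, 'n) tensor" where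
  "act a X N \<equiv> a \<odot>\<^bsub>left_tensor complex_ring A N\<^esub> X"

lemma vA: "vspace A" and vC: "vspace C"
  using alg coalg by (auto simp: complex_algebra_def coalgebra_def)

lemma vAC: "vspace (A \<otimes>\<^sub>\<complex> C)"
  by (rule vspace_vtensor[OF vA vC])

lemma coact_linear: "rcoact A \<in> lin A (A \<otimes>\<^sub>\<complex> C)"
  using comod by (simp add: right_comodule_def)

lemma comult_linear: "comult C \<in> lin C (C \<otimes>\<^sub>\<complex> C)" and counit_linear: "counit C \<in> dual C"
  using coalg by (auto simp: coalgebra_def)

lemmas coact_closed = linear_closed[OF coact_linear]

lemma smult_one_mult: "x \<in> carrier A \<Longrightarrow> (z \<odot>\<^bsub>A\<^esub> \<one>\<^bsub>A\<^esub>) \<otimes>\<^bsub>A\<^esub> x = z \<odot>\<^bsub>A\<^esub> x"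
  and mult_smult_one: "x \<in> carrier A \<Longrightarrow> x \<otimes>\<^bsub>A\<^esub> (z \<odot>\<^bsub>A\<^esub> \<one>\<^bsub>A\<^esub>) = z \<odot>\<^bsub>A\<^esub> x"
  using alg by (auto simp: complex_algebra_def)

lemma conv_bilinear: "L \<in> lin C A \<Longrightarrow> (\<lambda>x c. x \<otimes>\<^bsub>A\<^esub> L c) \<in> bilinear_maps A C A"
  by (rule bilinear_comp[OF algebra_mult_bilinear[OF alg] linear_id(2)])

lemma conv_linear: "L \<in> lin C A \<Longrightarrow> conv A L \<in> lin (A \<otimes>\<^sub>\<complex> C) A"
  unfolding conv_def by (rule vtensor_lift_linear[OF vA vC conv_bilinear vA])

lemma conv_vtens:
  "\<lbrakk>L \<in> lin C A; x \<in> carrier A; c \<in> carrier C\<rbrakk> \<Longrightarrow> conv A L (vtens A C x c) = x \<otimes>\<^bsub>A\<^esub> L c"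
  unfolding conv_def by (rule vtensor_lift_vtens[OF vA vC conv_bilinear vA])

lemma conv_act:
  assumes L: "L \<in> lin C A" and a: "a \<in> carrier A" and X: "X \<in> carrier (A \<otimes>\<^sub>\<complex> C)"
  shows "conv A L (act a X C) = a \<otimes>\<^bsub>A\<^esub> conv A L X"
proof (rule vtensor_ext[OF vA vC _ _ vA _ X])
  show "(\<lambda>X. conv A L (act a X C)) \<in> lin (A \<otimes>\<^sub>\<complex> C) A"
    by (rule linear_comp[OF bilinear_right[OF left_tensor_bilinear[OF alg vC] a] conv_linear[OF L]])
  show "(\<lambda>X. a \<otimes>\<^bsub>A\<^esub> conv A L X) \<in> lin (A \<otimes>\<^sub>\<complex> C) A"
    by (rule linear_comp[OF conv_linear[OF L] algebra_mult_left_linear[OF alg a]])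
  show "conv A L (act a (vtens A C m n) C) = a \<otimes>\<^bsub>A\<^esub> conv A L (vtens A C m n)"
    if "m \<in> carrier A" "n \<in> carrier C" for m n
    using that a linear_closed[OF L]
    by (simp add: left_tensor_smult_vtens[OF alg vC] conv_vtens[OF L] A.m_assoc)
qed

lemma hat_linear: "L \<in> lin C A \<Longrightarrow> hat A L \<in> lin A A"
  unfolding hat_def by (rule linear_comp[OF coact_linear conv_linear])

lemma hat_cong:
  assumes "L \<in> lin C A" "\<And>c. c \<in> carrier C \<Longrightarrow> L' c = L c" "a \<in> carrier A"
  shows "hat A L' a = hat A L a"
  unfolding hat_def conv_def
  by (rule vtensor_lift_cong[OF vA vC conv_bilinear[OF assms(1)] vA])
    (use assms coact_closed in auto)

text \<open>
  Coassociativity of the coaction, in the form in which it is used: if \<open>L(c) = K(c\<^sub>(\<^sub>1\<^sub>), c\<^sub>(\<^sub>2\<^sub>))\<close>, then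
  \<open>a\<^sub>(\<^sub>0\<^sub>) L(a\<^sub>(\<^sub>1\<^sub>))\<close> can be evaluated by first coacting on \<open>a\<close> and then on \<open>a\<^sub>(\<^sub>0\<^sub>)\<close>.
\<close>

lemma hat_comult:
  assumes K: "K \<in> bilinear_maps C C A" and a: "a \<in> carrier A"
  shows "(\<lambda>c. tensor_lift A K (comult C c)) \<in> lin C A"
    and "hat A (\<lambda>c. tensor_lift A K (comult C c)) a =
      tensor_lift A (\<lambda>x d. hat A (\<lambda>c. K c d) x) (rcoact A a)"
    and "(\<lambda>x d. hat A (\<lambda>c. K c d) x) \<in> bilinear_maps A C A"
proof -
  note vCC = vspace_vtensor[OF vC vC]
  note lK = vtensor_lift_linear[OF vC vC K vA]
  show L: "(\<lambda>c. tensor_lift A K (comult C c)) \<in> lin C A"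
    by (rule linear_comp[OF comult_linear lK])
  have bl: "(\<lambda>x u. x \<otimes>\<^bsub>A\<^esub> tensor_lift A K u) \<in> bilinear_maps A (C \<otimes>\<^sub>\<complex> C) A"
    by (rule bilinear_comp[OF algebra_mult_bilinear[OF alg] linear_id(2) lK])
  let ?\<Lambda> = "tensor_lift A (\<lambda>x u. x \<otimes>\<^bsub>A\<^esub> tensor_lift A K u)"
  have \<Lambda>: "?\<Lambda> \<in> lin (A \<otimes>\<^sub>\<complex> (C \<otimes>\<^sub>\<complex> C)) A"
    by (rule vtensor_lift_linear[OF vA vCC bl vA])
  have \<Lambda>_vtens: "?\<Lambda> (vtens A (C \<otimes>\<^sub>\<complex> C) x u) = x \<otimes>\<^bsub>A\<^esub> tensor_lift A K u"
    if "x \<in> carrier A" "u \<in> carrier (C \<otimes>\<^sub>\<complex> C)" for x u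
    by (rule vtensor_lift_vtens[OF vA vCC bl vA that])
  have Kd: "(\<lambda>c. K c d) \<in> lin C A" if "d \<in> carrier C" for d
    by (rule bilinear_left[OF K that])
  have inner: "(\<lambda>d Z. conv A (\<lambda>c. K c d) Z) \<in> bilinear_maps C (A \<otimes>\<^sub>\<complex> C) A"
    unfolding conv_def
  proof (rule bilinear_lift[OF _ _ vC vA vC vA])
    show "(\<lambda>x c. x \<otimes>\<^bsub>A\<^esub> K c d) \<in> bilinear_maps A C A" if "d \<in> carrier C" for d
      by (rule conv_bilinear[OF Kd[OF that]])
    show "(\<lambda>d. x \<otimes>\<^bsub>A\<^esub> K c d) \<in> lin C A" if "x \<in> carrier A" "c \<in> carrier C" for x c
      by (rule linear_comp[OF bilinear_right[OF K that(2)] algebra_mult_left_linear[OF alg that(1)]])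
  qed
  show bil: "(\<lambda>x d. hat A (\<lambda>c. K c d) x) \<in> bilinear_maps A C A"
    unfolding hat_def by (rule bilinear_comp[OF bilinear_flip[OF inner] coact_linear linear_id(2)])
  have 1: "?\<Lambda> (vtensor_map A (C \<otimes>\<^sub>\<complex> C) id (comult C) Y) = conv A (\<lambda>c. tensor_lift A K (comult C c)) Y"
    if Y: "Y \<in> carrier (A \<otimes>\<^sub>\<complex> C)" for Y
  proof (rule vtensor_ext[OF vA vC linear_comp[OF _ \<Lambda>] conv_linear[OF L] vA _ Y])
    show "vtensor_map A (C \<otimes>\<^sub>\<complex> C) id (comult C) \<in> lin (A \<otimes>\<^sub>\<complex> C) (A \<otimes>\<^sub>\<complex> (C \<otimes>\<^sub>\<complex> C))"
      by (rule vtensor_map_linear[OF vA vC vA vCC linear_id(1) comult_linear])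
    show "?\<Lambda> (vtensor_map A (C \<otimes>\<^sub>\<complex> C) id (comult C) (vtens A C m n)) =
        conv A (\<lambda>c. tensor_lift A K (comult C c)) (vtens A C m n)"
      if "m \<in> carrier A" "n \<in> carrier C" for m n
      using that linear_closed[OF comult_linear that(2)]
      by (simp add: vtensor_map_vtens[OF vA vC vA vCC linear_id(1) comult_linear] \<Lambda>_vtens conv_vtens[OF L])
  qed
  have 2: "?\<Lambda> (vassoc A C C (vtens (A \<otimes>\<^sub>\<complex> C) C Z d)) = conv A (\<lambda>c. K c d) Z"
    if Z: "Z \<in> carrier (A \<otimes>\<^sub>\<complex> C)" and d: "d \<in> carrier C" for Z d
  proof (rule vtensor_ext[OF vA vC _ conv_linear[OF Kd[OF d]] vA _ Z])
    show "(\<lambda>Z. ?\<Lambda> (vassoc A C C (vtens (A \<otimes>\<^sub>\<complex> C) C Z d))) \<in> lin (A \<otimes>\<^sub>\<complex> C) A"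
      by (rule linear_comp[OF linear_comp[OF bilinear_left[OF vtens_bilinear[OF vAC vC] d]
              vassoc_linear[OF vA vC vC]] \<Lambda>])
    show "?\<Lambda> (vassoc A C C (vtens (A \<otimes>\<^sub>\<complex> C) C (vtens A C m n) d)) = conv A (\<lambda>c. K c d) (vtens A C m n)"
      if "m \<in> carrier A" "n \<in> carrier C" for m n
      using that d
      by (simp add: vassoc_vtens[OF vA vC vC] \<Lambda>_vtens vtens_closed[OF vC vC] conv_vtens[OF Kd]
          vtensor_lift_vtens[OF vC vC K vA])
  qed
  have 3: "?\<Lambda> (vassoc A C C (vtensor_map (A \<otimes>\<^sub>\<complex> C) C (rcoact A) id Y)) =
      tensor_lift A (\<lambda>x d. hat A (\<lambda>c. K c d) x) Y"
    if Y: "Y \<in> carrier (A \<otimes>\<^sub>\<complex> C)" for Y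
  proof (rule vtensor_ext[OF vA vC _ vtensor_lift_linear[OF vA vC bil vA] vA _ Y])
    show "(\<lambda>Y. ?\<Lambda> (vassoc A C C (vtensor_map (A \<otimes>\<^sub>\<complex> C) C (rcoact A) id Y))) \<in> lin (A \<otimes>\<^sub>\<complex> C) A"
      by (rule linear_comp[OF linear_comp[OF vtensor_map_linear[OF vA vC vAC vC coact_linear linear_id(1)]
              vassoc_linear[OF vA vC vC]] \<Lambda>])
    show "?\<Lambda> (vassoc A C C (vtensor_map (A \<otimes>\<^sub>\<complex> C) C (rcoact A) id (vtens A C m n))) =
        tensor_lift A (\<lambda>x d. hat A (\<lambda>c. K c d) x) (vtens A C m n)"
      if "m \<in> carrier A" "n \<in> carrier C" for m n
      using that coact_closed
      by (simp add: vtensor_map_vtens[OF vA vC vAC vC coact_linear linear_id(1)] 2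
          vtensor_lift_vtens[OF vA vC bil vA, unfolded hat_def] hat_def)
  qed
  have "vassoc A C C (vtensor_map (A \<otimes>\<^sub>\<complex> C) C (rcoact A) id (rcoact A a)) =
      vtensor_map A (C \<otimes>\<^sub>\<complex> C) id (comult C) (rcoact A a)"
    using comod a by (simp add: right_comodule_def)
  then show "hat A (\<lambda>c. tensor_lift A K (comult C c)) a =
      tensor_lift A (\<lambda>x d. hat A (\<lambda>c. K c d) x) (rcoact A a)"
    using 1[OF coact_closed[OF a]] 3[OF coact_closed[OF a]] by (simp add: hat_def)
qed

text \<open>The action \<open>a \<mapsto> a\<^sub>(\<^sub>0\<^sub>) \<gamma>(a\<^sub>(\<^sub>1\<^sub>))\<close> of a functional \<open>\<gamma>\<close> on \<open>C\<close>.\<close>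

definition D :: "('c \<Rightarrow> complex) \<Rightarrow> 'a \<Rightarrow> 'a" where
  "D \<gamma> a = slice A \<gamma> (rcoact A a)"

lemma D_linear: "\<gamma> \<in> dual C \<Longrightarrow> D \<gamma> \<in> lin A A"
  unfolding D_def by (rule linear_comp[OF coact_linear slice_linear[OF vA vC]])

lemmas D_closed = linear_closed[OF D_linear]

lemma D_counit: "a \<in> carrier A \<Longrightarrow> D (counit C) a = a"
  using comod by (simp add: D_def slice_def right_comodule_def)

lemma coact_eqI:
  assumes "X \<in> carrier (A \<otimes>\<^sub>\<complex> C)" "a \<in> carrier A" "\<And>\<gamma>. \<gamma> \<in> dual C \<Longrightarrow> D \<gamma> a = slice A \<gamma> X"
  shows "rcoact A a = X"
  by (rule slices_separate[OF vA vC coact_closed[OF assms(2)] assms(1)])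
    (use assms(3) in \<open>simp add: D_def\<close>)

lemma hat_scalar:
  assumes \<gamma>: "\<gamma> \<in> dual C" and a: "a \<in> carrier A"
  shows "hat A (\<lambda>c. \<gamma> c \<odot>\<^bsub>A\<^esub> \<one>\<^bsub>A\<^esub>) a = D \<gamma> a"
  unfolding hat_def D_def conv_def slice_def
  by (rule vtensor_lift_cong[OF vA vC slice_bilinear[OF vA vC \<gamma>] vA _ coact_closed[OF a]])
    (simp add: mult_smult_one)

end

locale equivariant_hom = A: algebra_comodule C A + A': algebra_comodule C A'
  for C :: "'c coalgebra" and A :: "('c, 'a) right_comodule" and A' :: "('c, 'b) right_comodule" +
  fixes f :: "'a \<Rightarrow> 'b"
  assumes f: "f \<in> equivariant_algebra_homs C A A'"
begin

lemma f_linear: "f \<in> lin A A'"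
  using f by (simp add: equivariant_algebra_homs_def algebra_homs_def)

lemmas f_closed = linear_closed[OF f_linear]

lemma f_mult: "\<lbrakk>x \<in> carrier A; y \<in> carrier A\<rbrakk> \<Longrightarrow> f (x \<otimes>\<^bsub>A\<^esub> y) = f x \<otimes>\<^bsub>A'\<^esub> f y"
  and f_one: "f \<one>\<^bsub>A\<^esub> = \<one>\<^bsub>A'\<^esub>"
  using f by (auto simp: equivariant_algebra_homs_def algebra_homs_def ring_hom_def)

lemma f_coact: "a \<in> carrier A \<Longrightarrow> rcoact A' (f a) = vtensor_map A' C f id (rcoact A a)"
  using f by (simp add: equivariant_algebra_homs_def)

lemma f_tensor_linear: "vspace N \<Longrightarrow> vtensor_map A' N f id \<in> lin (A \<otimes>\<^sub>\<complex> N) (A' \<otimes>\<^sub>\<complex> N)"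
  by (rule vtensor_map_linear[OF A.vA _ A'.vA _ f_linear linear_id(1)])

lemma f_tensor_vtens:
  "\<lbrakk>vspace N; m \<in> carrier A; n \<in> carrier N\<rbrakk>
    \<Longrightarrow> vtensor_map A' N f id (vtens A N m n) = vtens A' N (f m) n"
  by (simp add: vtensor_map_vtens[OF A.vA _ A'.vA _ f_linear linear_id(1)])

lemma f_tensor_act:
  assumes N: "vspace N" and a: "a \<in> carrier A" and X: "X \<in> carrier (A \<otimes>\<^sub>\<complex> N)"
  shows "vtensor_map A' N f id (A.act a X N) = A'.act (f a) (vtensor_map A' N f id X) N"
proof (rule vtensor_ext[OF A.vA N _ _ vspace_vtensor[OF A'.vA N] _ X])
  show "(\<lambda>X. vtensor_map A' N f id (A.act a X N)) \<in> lin (A \<otimes>\<^sub>\<complex> N) (A' \<otimes>\<^sub>\<complex> N)"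
    by (rule linear_comp[OF bilinear_right[OF left_tensor_bilinear[OF A.alg N] a] f_tensor_linear[OF N]])
  show "(\<lambda>X. A'.act (f a) (vtensor_map A' N f id X) N) \<in> lin (A \<otimes>\<^sub>\<complex> N) (A' \<otimes>\<^sub>\<complex> N)"
    by (rule linear_comp[OF f_tensor_linear[OF N]
          bilinear_right[OF left_tensor_bilinear[OF A'.alg N] f_closed[OF a]]])
  show "vtensor_map A' N f id (A.act a (vtens A N m n) N) =
      A'.act (f a) (vtensor_map A' N f id (vtens A N m n)) N"
    if "m \<in> carrier A" "n \<in> carrier N" for m n
    using that a N
    by (simp add: left_tensor_smult_vtens[OF A.alg] left_tensor_smult_vtens[OF A'.alg] f_tensor_vtens
        f_closed f_mult)
qed

lemma slice_f_tensor:
  assumes N: "vspace N" and \<theta>: "\<theta> \<in> dual N" and X: "X \<in> carrier (A \<otimes>\<^sub>\<complex> N)"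
  shows "slice A' \<theta> (vtensor_map A' N f id X) = f (slice A \<theta> X)"
proof (rule vtensor_ext[OF A.vA N _ _ A'.vA _ X])
  show "(\<lambda>X. slice A' \<theta> (vtensor_map A' N f id X)) \<in> lin (A \<otimes>\<^sub>\<complex> N) A'"
    by (rule linear_comp[OF f_tensor_linear[OF N] slice_linear[OF A'.vA N \<theta>]])
  show "(\<lambda>X. f (slice A \<theta> X)) \<in> lin (A \<otimes>\<^sub>\<complex> N) A'"
    by (rule linear_comp[OF slice_linear[OF A.vA N \<theta>] f_linear])
  show "slice A' \<theta> (vtensor_map A' N f id (vtens A N m n)) = f (slice A \<theta> (vtens A N m n))"
    if "m \<in> carrier A" "n \<in> carrier N" for m n
    using that N \<theta>
    by (simp add: f_tensor_vtens slice_vtens[OF A.vA] slice_vtens[OF A'.vA] f_closed lin_smult[OF f_linear])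
qed

lemma D_f: "\<lbrakk>\<gamma> \<in> dual C; a \<in> carrier A\<rbrakk> \<Longrightarrow> A'.D \<gamma> (f a) = f (A.D \<gamma> a)"
  by (simp add: A.D_def A'.D_def f_coact slice_f_tensor A.vC A.coact_closed)

end

lemma (in algebra_comodule) equivariant_id: "equivariant_hom C A A id"
proof
  have "vtensor_map A C id id X = X" if X: "X \<in> carrier (A \<otimes>\<^sub>\<complex> C)" for X
    by (rule vtensor_ext[OF vA vC vtensor_map_linear[OF vA vC vA vC linear_id(1) linear_id(1)]
          linear_id(2) vAC _ X])
      (simp add: vtensor_map_vtens[OF vA vC vA vC linear_id(1) linear_id(1)])
  then show "id \<in> equivariant_algebra_homs C A A"
    using coact_closed
    by (simp add: equivariant_algebra_homs_def algebra_homs_def ring_hom_def linear_id)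
qed

section \<open>Galois extensions\<close>

locale galois_extension = algebra_comodule C A
  for C :: "'c coalgebra" and A :: "('c, 'a) right_comodule" +
  fixes e :: 'c
  assumes galois: "coaugmented_galois_extension C e A"
begin

abbreviation "B \<equiv> coaction_invariants C A"
abbreviation "AR \<equiv> right_via A id"
abbreviation "AL \<equiv> regular_module A"
abbreviation "AA \<equiv> tensor_over_invariants C A"

lemma e_closed: "e \<in> carrier C"
  using galois by (simp add: coaugmented_galois_extension_def group_like_def)

lemma coact_one: "rcoact A \<one>\<^bsub>A\<^esub> = vtens A C \<one>\<^bsub>A\<^esub> e"
  using galois by (simp add: coaugmented_galois_extension_def)

lemma B_iff:
  "b \<in> carrier B \<longleftrightarrow> b \<in> carrier A \<and> (\<forall>a\<in>carrier A. rcoact A (b \<otimes>\<^bsub>A\<^esub> a) = act b (rcoact A a) C)"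
  by (simp add: coaction_invariants_def)

lemma B_simps [simp]:
  "add B = add A" "mult B = mult A" "one B = one A" "zero B = zero A" "smult B = smult A"
  by (simp_all add: coaction_invariants_def)

lemma AR_simps [simp]:
  "carrier AR = carrier A" "add AR = add A" "zero AR = zero A" "b \<odot>\<^bsub>AR\<^esub> x = x \<otimes>\<^bsub>A\<^esub> b"
  by (simp_all add: right_via_def)

lemma AL_simps [simp]:
  "carrier AL = carrier A" "add AL = add A" "zero AL = zero A" "smult AL = mult A"
  by (simp_all add: regular_module_def)

lemma B_closed: "b \<in> carrier B \<Longrightarrow> b \<in> carrier A"
  by (simp add: B_iff)

lemma coact_B_mult: "\<lbrakk>b \<in> carrier B; a \<in> carrier A\<rbrakk> \<Longrightarrow> rcoact A (b \<otimes>\<^bsub>A\<^esub> a) = act b (rcoact A a) C"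
  by (simp add: B_iff)

lemmas act_bil = left_tensor_bilinear[OF alg vC]
lemmas act_closed = bilinear_closed[OF act_bil]

lemma B_smult:
  assumes b: "b \<in> carrier B"
  shows "z \<odot>\<^bsub>A\<^esub> b \<in> carrier B"
proof -
  have "rcoact A ((z \<odot>\<^bsub>A\<^esub> b) \<otimes>\<^bsub>A\<^esub> a) = act (z \<odot>\<^bsub>A\<^esub> b) (rcoact A a) C" if a: "a \<in> carrier A" for a
    using a b lin_smult[OF coact_linear, of "b \<otimes>\<^bsub>A\<^esub> a"] lin_smult[OF bilinear_left[OF act_bil coact_closed[OF a]] B_closed[OF b]]
      alg
    by (simp add: complex_algebra_def B_closed coact_B_mult)
  then show ?thesis
    using B_closed[OF b] vA by (simp add: B_iff module.smult_closed)
qed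

lemma B_subring: "subring (carrier B) A"
proof (rule A.subringI)
  show "carrier B \<subseteq> carrier A" using B_closed by blast
  show "\<one>\<^bsub>A\<^esub> \<in> carrier B"
    by (simp add: B_iff left_tensor_smult_one[OF alg vC] coact_closed)
  fix b assume b: "b \<in> carrier B"
  have "(-1) \<odot>\<^bsub>A\<^esub> b = \<ominus>\<^bsub>A\<^esub> b"
    using B_closed[OF b] module.smult_l_minus[OF vA, of 1 b] module.smult_one[OF vA, of b]
      abelian_group.r_neg[OF ring_abelian_group[of complex_ring], of 1] cring_complex_ring
    by (metis A.minus_equality abelian_group.l_neg add.right_inverse complex_ring_simps(1,2,3,5)
        UNIV_I module.smult_l_distr module.smult_l_null module.smult_closed vA add.left_inverse)
  then show "\<ominus>\<^bsub>A\<^esub> b \<in> carrier B"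
    using B_smult[OF b, of "-1"] by simp
  fix b' assume b': "b' \<in> carrier B"
  show "b \<otimes>\<^bsub>A\<^esub> b' \<in> carrier B"
    using b b' by (simp add: B_iff A.m_assoc left_tensor_smult_mult[OF alg vC] coact_closed)
  show "b \<oplus>\<^bsub>A\<^esub> b' \<in> carrier B"
    using b b' linear_add[OF coact_linear] linear_add[OF bilinear_left[OF act_bil coact_closed]]
    by (simp add: B_iff A.l_distr)
qed

lemma ring_B: "ring B"
  using A.subring_is_ring[OF B_subring] by (simp add: coaction_invariants_def)

sublocale B: ring B by (rule ring_B)

lemma vB: "vspace B"
proof -
  interpret AM: module complex_ring A by (rule vA)
  show ?thesis
    by (rule moduleI[OF cring_complex_ring B.is_abelian_group])
      (use B_closed B_smult in \<open>simp_all add: AM.smult_r_distr AM.smult_l_distr[simplified]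
        AM.smult_assoc1[simplified] AM.smult_one[simplified]\<close>)
qed

lemma algebra_B: "complex_algebra B"
  using alg vB ring_B B_closed by (auto simp: complex_algebra_def)

lemma AA_factors: "tensor_factors B AR AL"
proof -
  have "abelian_group AR" "abelian_group AL"
    by (auto intro!: abelian_group_same[OF _ A.is_abelian_group] simp: same_additive_def)
  then show ?thesis
    by (simp add: tensor_factors_def tensor_factors_axioms_def B_closed)
qed

sublocale AA: tensor_factors B AR AL by (rule AA_factors)

lemma AA_eq: "AA.T = AA"
  by (simp add: tensor_over_invariants_def)

lemma can_balanced: "(\<lambda>a a'. act a (rcoact A a') C) \<in> balanced_maps B AR AL (A \<otimes>\<^sub>\<complex> C)"
  by (rule balanced_mapsI)
    (simp_all add: act_closed coact_closed linear_add[OF coact_linear] B_closed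
      linear_add[OF bilinear_right[OF act_bil]] linear_add[OF bilinear_left[OF act_bil]]
      coact_B_mult left_tensor_smult_mult[OF alg vC])

lemma can_additive: "can C A \<in> additive_maps AA.T (A \<otimes>\<^sub>\<complex> C)"
  unfolding can_def by (rule AA.tensor_lift_additive[OF vspace_abelian_group[OF vAC] can_balanced])

lemma can_tens: "\<lbrakk>x \<in> carrier A; y \<in> carrier A\<rbrakk> \<Longrightarrow> can C A (tens B AR AL x y) = act x (rcoact A y) C"
  unfolding can_def
  by (rule AA.tensor_lift_tens[OF vspace_abelian_group[OF vAC] can_balanced]) simp_all

lemma can_bij: "bij_betw (can C A) (carrier AA.T) (carrier (A \<otimes>\<^sub>\<complex> C))"
  using galois by (simp add: coaugmented_galois_extension_def AA_eq)

definition can_inv :: "('a, 'c) tensor \<Rightarrow> ('a, 'a) tensor" where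
  "can_inv = inv_into (carrier AA.T) (can C A)"

lemma can_inv_closed: "X \<in> carrier (A \<otimes>\<^sub>\<complex> C) \<Longrightarrow> can_inv X \<in> carrier AA.T"
  unfolding can_inv_def using can_bij by (metis bij_betw_def inv_into_into)

lemma can_can_inv: "X \<in> carrier (A \<otimes>\<^sub>\<complex> C) \<Longrightarrow> can C A (can_inv X) = X"
  unfolding can_inv_def by (rule bij_betw_inv_into_right[OF can_bij])

lemma can_inv_can: "t \<in> carrier AA.T \<Longrightarrow> can_inv (can C A t) = t"
  unfolding can_inv_def by (rule bij_betw_inv_into_left[OF can_bij])

lemma can_inv_additive: "can_inv \<in> additive_maps (A \<otimes>\<^sub>\<complex> C) AA.T"
proof (rule additive_mapsI[OF can_inv_closed])
  fix X Y assume XY: "X \<in> carrier (A \<otimes>\<^sub>\<complex> C)" "Y \<in> carrier (A \<otimes>\<^sub>\<complex> C)"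
  then have "can C A (can_inv X \<oplus>\<^bsub>AA.T\<^esub> can_inv Y) = X \<oplus>\<^bsub>A \<otimes>\<^sub>\<complex> C\<^esub> Y"
    by (simp add: additive_add[OF can_additive] can_inv_closed can_can_inv)
  then show "can_inv (X \<oplus>\<^bsub>A \<otimes>\<^sub>\<complex> C\<^esub> Y) = can_inv X \<oplus>\<^bsub>AA.T\<^esub> can_inv Y"
    using can_inv_can[of "can_inv X \<oplus>\<^bsub>AA.T\<^esub> can_inv Y"] XY
    by (simp add: can_inv_closed)
qed

text \<open>The translation map of the Galois extension, written \<open>t\<^sup>1 \<otimes> t\<^sup>2\<close> in comments.\<close>

definition transl :: "'c \<Rightarrow> ('a, 'a) tensor" where
  "transl c = can_inv (vtens A C \<one>\<^bsub>A\<^esub> c)"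

lemma transl_closed: "c \<in> carrier C \<Longrightarrow> transl c \<in> carrier AA.T"
  unfolding transl_def by (intro can_inv_closed vtens_closed[OF vA vC] A.one_closed)

lemma can_transl: "c \<in> carrier C \<Longrightarrow> can C A (transl c) = vtens A C \<one>\<^bsub>A\<^esub> c"
  unfolding transl_def by (intro can_can_inv vtens_closed[OF vA vC] A.one_closed)

subsection \<open>Left linear endomorphisms are convolution operators\<close>

abbreviation "endos \<equiv> linear_maps B AL AL"

lemma endo_closed: "\<lbrakk>h \<in> endos; x \<in> carrier A\<rbrakk> \<Longrightarrow> h x \<in> carrier A"
  and endo_add: "\<lbrakk>h \<in> endos; x \<in> carrier A; y \<in> carrier A\<rbrakk> \<Longrightarrow> h (x \<oplus>\<^bsub>A\<^esub> y) = h x \<oplus>\<^bsub>A\<^esub> h y"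
  and endo_mult: "\<lbrakk>h \<in> endos; b \<in> carrier B; x \<in> carrier A\<rbrakk> \<Longrightarrow> h (b \<otimes>\<^bsub>A\<^esub> x) = b \<otimes>\<^bsub>A\<^esub> h x"
  by (auto simp: linear_maps_def)

lemma endo_balanced: "h \<in> endos \<Longrightarrow> (\<lambda>x y. x \<otimes>\<^bsub>A\<^esub> h y) \<in> balanced_maps B AR AL A"
  by (rule balanced_mapsI)
    (simp_all add: endo_closed endo_add endo_mult A.l_distr A.r_distr A.m_assoc B_closed)

definition tau :: "('a \<Rightarrow> 'a) \<Rightarrow> 'c \<Rightarrow> 'a" where
  "tau h c = tensor_lift A (\<lambda>x y. x \<otimes>\<^bsub>A\<^esub> h y) (transl c)"

text \<open>
  The convolution operator of \<open>tau h\<close> is \<open>h\<close>: the map \<open>x \<otimes> y \<mapsto> x h(y)\<close> on \<open>A \<otimes>\<^sub>B A\<close>, transported along \<open>can\<close>,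
  is left \<open>A\<close>-linear on \<open>A \<otimes> C\<close>, hence of the form \<open>x \<otimes> c \<mapsto> x L(c)\<close>.
\<close>

lemma tau_linear: "h \<in> endos \<Longrightarrow> tau h \<in> lin C A"
  and hat_tau: "\<lbrakk>h \<in> endos; a \<in> carrier A\<rbrakk> \<Longrightarrow> hat A (tau h) a = h a"
proof -
  assume h: "h \<in> endos"
  interpret AM: module complex_ring A by (rule vA)
  note ab = A.is_abelian_group
  let ?m = "tensor_lift A (\<lambda>x y. x \<otimes>\<^bsub>A\<^esub> h y)"
  have m: "?m \<in> additive_maps AA.T A"
    by (rule AA.tensor_lift_additive[OF ab endo_balanced[OF h]])
  have m_tens: "?m (tens B AR AL x y) = x \<otimes>\<^bsub>A\<^esub> h y" if "x \<in> carrier A" "y \<in> carrier A" for x y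
    by (rule AA.tensor_lift_tens[OF ab endo_balanced[OF h]]) (use that in simp_all)
  let ?\<Theta> = "\<lambda>X. ?m (can_inv X)"
  have \<Theta>: "?\<Theta> \<in> additive_maps (A \<otimes>\<^sub>\<complex> C) A"
    by (rule additive_comp[OF can_inv_additive m])
  have \<Theta>_act: "?\<Theta> (act a X C) = a \<otimes>\<^bsub>A\<^esub> ?\<Theta> X" if a: "a \<in> carrier A" and X: "X \<in> carrier (A \<otimes>\<^sub>\<complex> C)" for a X
  proof -
    have la: "(\<lambda>x. a \<otimes>\<^bsub>A\<^esub> x) \<in> linear_maps B AR AR"
      by (rule linear_mapsI[OF additive_mapsI]) (use a in \<open>simp_all add: A.r_distr A.m_assoc B_closed\<close>)
    note bal = tens_map_balanced[OF AA_factors AA_factors la linear_id(2)]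
    let ?a = "tensor_lift AA.T (\<lambda>x y. tens B AR AL (a \<otimes>\<^bsub>A\<^esub> x) y)"
    have add: "?a \<in> additive_maps AA.T AA.T"
      by (rule AA.tensor_lift_additive[OF AA.abelian_group_T bal])
    have tens: "?a (tens B AR AL x y) = tens B AR AL (a \<otimes>\<^bsub>A\<^esub> x) y" if "x \<in> carrier A" "y \<in> carrier A" for x y
      by (rule AA.tensor_lift_tens[OF AA.abelian_group_T bal]) (use that in simp_all)
    note t = can_inv_closed[OF X]
    have "can C A (?a (can_inv X)) = act a (can C A (can_inv X)) C"
      by (rule AA.tensor_ext[OF additive_comp[OF add can_additive]
            additive_comp[OF can_additive linear_maps_additive[OF bilinear_right[OF act_bil a]]]
            vspace_abelian_group[OF vAC] _ t])
        (use a in \<open>simp add: tens can_tens left_tensor_smult_mult[OF alg vC] coact_closed\<close>)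
    then have "can_inv (act a X C) = ?a (can_inv X)"
      using can_can_inv[OF X] can_inv_can[OF additive_closed[OF add t]] by simp
    moreover have "?m (?a (can_inv X)) = a \<otimes>\<^bsub>A\<^esub> ?m (can_inv X)"
      by (rule AA.tensor_ext[OF additive_comp[OF add m]
            additive_comp[OF m linear_maps_additive[OF algebra_mult_left_linear[OF alg a]]] ab _ t])
        (use a in \<open>simp add: tens m_tens A.m_assoc endo_closed[OF h]\<close>)
    ultimately show ?thesis by simp
  qed
  have scalar: "z \<odot>\<^bsub>A \<otimes>\<^sub>\<complex> C\<^esub> X = act (z \<odot>\<^bsub>A\<^esub> \<one>\<^bsub>A\<^esub>) X C" if X: "X \<in> carrier (A \<otimes>\<^sub>\<complex> C)" for z X
    using lin_smult[OF bilinear_left[OF act_bil X] A.one_closed] left_tensor_smult_one[OF alg vC X] by simp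
  have \<Theta>_lin: "?\<Theta> \<in> lin (A \<otimes>\<^sub>\<complex> C) A"
    by (rule linear_mapsI[OF \<Theta>])
      (use additive_closed[OF \<Theta>] in \<open>simp add: scalar \<Theta>_act smult_one_mult\<close>)
  have tau_eq: "tau h = (\<lambda>c. ?\<Theta> (vtens A C \<one>\<^bsub>A\<^esub> c))"
    by (simp add: tau_def transl_def fun_eq_iff)
  show tau: "tau h \<in> lin C A"
    unfolding tau_eq by (rule linear_comp[OF bilinear_right[OF vtens_bilinear[OF vA vC] A.one_closed] \<Theta>_lin])
  assume a: "a \<in> carrier A"
  have "conv A (tau h) (rcoact A a) = ?\<Theta> (rcoact A a)"
  proof (rule vtensor_ext[OF vA vC conv_linear[OF tau] \<Theta>_lin vA _ coact_closed[OF a]])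
    fix x c assume "x \<in> carrier A" "c \<in> carrier C"
    then show "conv A (tau h) (vtens A C x c) = ?\<Theta> (vtens A C x c)"
      using \<Theta>_act[of x "vtens A C \<one>\<^bsub>A\<^esub> c"]
      by (simp add: conv_vtens[OF tau[unfolded tau_eq]] tau_eq vtens_closed[OF vA vC] left_tensor_smult_vtens[OF alg vC])
  qed
  also have "rcoact A a = can C A (tens B AR AL \<one>\<^bsub>A\<^esub> a)"
    using a by (simp add: can_tens left_tensor_smult_one[OF alg vC] coact_closed)
  also have "?\<Theta> \<dots> = h a"
    using a by (simp add: can_inv_can m_tens endo_closed[OF h])
  finally show "hat A (tau h) a = h a"
    unfolding hat_def using a by (simp add: can_tens left_tensor_smult_one[OF alg vC] coact_closed)
qed

lemma tau_cong:
  assumes "h \<in> endos" "\<And>a. a \<in> carrier A \<Longrightarrow> h' a = h a" "c \<in> carrier C"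
  shows "tau h' c = tau h c"
  unfolding tau_def
  by (rule AA.tensor_lift_cong[OF A.is_abelian_group endo_balanced[OF assms(1)]])
    (use assms in \<open>simp_all add: transl_closed\<close>)

lemma hat_endo:
  assumes L: "L \<in> lin C A"
  shows "hat A L \<in> endos"
proof -
  have "hat A L (b \<otimes>\<^bsub>A\<^esub> x) = b \<otimes>\<^bsub>A\<^esub> hat A L x" if "b \<in> carrier B" "x \<in> carrier A" for b x
    using that by (simp add: hat_def coact_B_mult conv_act[OF L] B_closed coact_closed)
  then show ?thesis
    by (intro linear_mapsI[OF additive_mapsI])
      (simp_all add: linear_closed[OF hat_linear[OF L]] linear_add[OF hat_linear[OF L]])
qed

end

locale galois_hom = A: galois_extension C A e + equivariant_hom C A A' f
  for C :: "'c coalgebra" and A :: "('c, 'a) right_comodule" and e :: 'c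
    and A' :: "('c, 'b) right_comodule" and f :: "'a \<Rightarrow> 'b"
begin

text \<open>
  An equivariant algebra map carries the translation map of \<open>A\<close> to one for \<open>A'\<close>: with \<open>t\<^sup>1 \<otimes> t\<^sup>2\<close> taken at \<open>c\<close>,
  \<open>f(t\<^sup>1) \<delta>(f(t\<^sup>2)) = 1 \<otimes> c\<close> in \<open>A' \<otimes> C\<close>. Hence an endomorphism of \<open>A\<close> that \<open>f\<close> intertwines with the
  convolution operator of \<open>L'\<close> is itself the convolution operator of a lift of \<open>L'\<close> along \<open>f\<close>.
\<close>

lemma f_tau:
  assumes h: "h \<in> A.endos" and L': "L' \<in> lin C A'" and c: "c \<in> carrier C"
    and eq: "\<And>y. y \<in> carrier A \<Longrightarrow> f (h y) = hat A' L' (f y)"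
  shows "f (A.tau h c) = L' c"
proof -
  note ab = A.A.is_abelian_group and ab' = A'.A.is_abelian_group
  note t = A.transl_closed[OF c]
  have coact_f: "rcoact A' (f (b \<otimes>\<^bsub>A\<^esub> y)) = A'.act (f b) (rcoact A' (f y)) C"
    if "b \<in> carrier A.B" "y \<in> carrier A" for b y
    using that by (simp add: f_coact A.B_closed A.coact_B_mult f_tensor_act A.vC A.coact_closed)
  have add: "(\<lambda>X. conv A' L' (vtensor_map A' C f id (can C A X))) \<in> additive_maps A.AA.T A'"
    by (rule additive_comp[OF A.can_additive
          linear_maps_additive[OF linear_comp[OF f_tensor_linear[OF A.vC] A'.conv_linear[OF L']]]])
  have fA: "f \<in> additive_maps A A'"
    by (rule linear_maps_additive[OF f_linear])
  have "f (A.tau h c) = conv A' L' (vtensor_map A' C f id (can C A (A.transl c)))"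
    unfolding A.tau_def
  proof (rule A.AA.tensor_ext[OF additive_comp[OF A.AA.tensor_lift_additive[OF ab A.endo_balanced[OF h]] fA]
        add ab' _ t])
    fix x y assume xy: "x \<in> carrier A.AR" "y \<in> carrier A.AL"
    then show "f (tensor_lift A (\<lambda>x y. x \<otimes>\<^bsub>A\<^esub> h y) (tens A.B A.AR A.AL x y)) =
        conv A' L' (vtensor_map A' C f id (can C A (tens A.B A.AR A.AL x y)))"
      by (simp add: A.AA.tensor_lift_tens[OF ab A.endo_balanced[OF h]] A.can_tens f_mult A.endo_closed[OF h]
          f_tensor_act A.vC A.coact_closed A'.conv_act[OF L'] f_closed f_coact[symmetric] A'.coact_closed
          eq hat_def)
  qed
  also have "\<dots> = L' c"
    using c linear_closed[OF L' c]
    by (simp add: A.can_transl f_tensor_vtens A.vC A'.conv_vtens[OF L'] f_one)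
  finally show ?thesis .
qed

end

context galois_extension
begin

interpretation idh: galois_hom C A e A id
  by (intro galois_hom.intro equivariant_id galois_extension_axioms)

lemma tau_hat:
  assumes L: "L \<in> lin C A" and c: "c \<in> carrier C"
  shows "tau (hat A L) c = L c"
  using idh.f_tau[OF hat_endo[OF L] L c] by simp

text \<open>
  Since \<open>tau\<close> recovers \<open>L\<close>, identities between maps out of \<open>C\<close> may be verified on convolution operators, which
  can be computed without the translation map.
\<close>

lemma hat_inject:
  assumes L: "L \<in> lin C A" "L' \<in> lin C A" and eq: "\<And>a. a \<in> carrier A \<Longrightarrow> hat A L a = hat A L' a"
    and c: "c \<in> carrier C"
  shows "L c = L' c"
  using tau_hat[OF L(1) c] tau_hat[OF L(2) c] tau_cong[OF hat_endo[OF L(2)] eq c] by simp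

subsection \<open>The canonical entwining\<close>

text \<open>
  \<open>psi \<gamma> y c\<close> is \<open>(id \<otimes> \<gamma>) \<psi>(c \<otimes> y)\<close> for the canonical entwining \<open>\<psi>\<close>; \<open>hat_psi\<close> is the identity
  \<open>\<delta>(a y) = a\<^sub>(\<^sub>0\<^sub>) \<psi>(a\<^sub>(\<^sub>1\<^sub>) \<otimes> y)\<close>.
\<close>

definition psi :: "('c \<Rightarrow> complex) \<Rightarrow> 'a \<Rightarrow> 'c \<Rightarrow> 'a" where
  "psi \<gamma> y = tau (\<lambda>a. D \<gamma> (a \<otimes>\<^bsub>A\<^esub> y))"

lemma D_mult_right_endo:
  assumes "\<gamma> \<in> dual C" "y \<in> carrier A"
  shows "(\<lambda>a. D \<gamma> (a \<otimes>\<^bsub>A\<^esub> y)) \<in> endos"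
proof -
  have "D \<gamma> (b \<otimes>\<^bsub>A\<^esub> x) = b \<otimes>\<^bsub>A\<^esub> D \<gamma> x" if "b \<in> carrier B" "x \<in> carrier A" for b x
    using that assms by (simp add: D_def coact_B_mult slice_left_tensor[OF alg vC] B_closed coact_closed)
  then show ?thesis
    using assms
    by (intro linear_mapsI[OF additive_mapsI])
      (simp_all add: D_closed linear_add[OF D_linear] A.l_distr A.m_assoc B_closed)
qed

lemma psi_linear: "\<lbrakk>\<gamma> \<in> dual C; y \<in> carrier A\<rbrakk> \<Longrightarrow> psi \<gamma> y \<in> lin C A"
  unfolding psi_def by (intro tau_linear D_mult_right_endo)

lemma hat_psi: "\<lbrakk>\<gamma> \<in> dual C; y \<in> carrier A; a \<in> carrier A\<rbrakk> \<Longrightarrow> hat A (psi \<gamma> y) a = D \<gamma> (a \<otimes>\<^bsub>A\<^esub> y)"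
  unfolding psi_def by (intro hat_tau D_mult_right_endo)

lemma hat_add:
  assumes "L \<in> lin C A" "L' \<in> lin C A" "a \<in> carrier A"
  shows "hat A (\<lambda>c. L c \<oplus>\<^bsub>A\<^esub> L' c) a = hat A L a \<oplus>\<^bsub>A\<^esub> hat A L' a"
  unfolding hat_def
  by (rule vtensor_ext[OF vA vC conv_linear[OF lin_sum[OF vA assms(1,2)]]
        lin_sum[OF vA conv_linear[OF assms(1)] conv_linear[OF assms(2)]] vA _ coact_closed[OF assms(3)]])
    (use assms linear_closed[OF assms(1)] linear_closed[OF assms(2)] in
      \<open>simp add: conv_vtens lin_sum[OF vA assms(1,2)] A.r_distr\<close>)

lemma hat_smult:
  assumes "L \<in> lin C A" "a \<in> carrier A"
  shows "hat A (\<lambda>c. z \<odot>\<^bsub>A\<^esub> L c) a = z \<odot>\<^bsub>A\<^esub> hat A L a"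
  unfolding hat_def
  by (rule vtensor_ext[OF vA vC conv_linear[OF lin_smult_right[OF vA assms(1)]]
        lin_smult_right[OF vA conv_linear[OF assms(1)]] vA _ coact_closed[OF assms(2)]])
    (use assms linear_closed[OF assms(1)] alg in
      \<open>simp add: conv_vtens lin_smult_right[OF vA assms(1)] complex_algebra_def\<close>)

lemma psi_bilinear:
  assumes \<gamma>: "\<gamma> \<in> dual C"
  shows "(\<lambda>c y. psi \<gamma> y c) \<in> bilinear_maps C A A"
proof (rule bilinearI)
  interpret AM: module complex_ring A by (rule vA)
  show "(\<lambda>c. psi \<gamma> y c) \<in> lin C A" if "y \<in> carrier A" for y
    using psi_linear[OF \<gamma> that] by simp
  fix c assume c: "c \<in> carrier C"
  show "(\<lambda>y. psi \<gamma> y c) \<in> lin A A"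
  proof (rule linI)
    fix y y' assume y: "y \<in> carrier A" "y' \<in> carrier A"
    show "psi \<gamma> (y \<oplus>\<^bsub>A\<^esub> y') c = psi \<gamma> y c \<oplus>\<^bsub>A\<^esub> psi \<gamma> y' c"
      by (rule hat_inject[OF psi_linear[OF \<gamma>] lin_sum[OF vA psi_linear[OF \<gamma> y(1)] psi_linear[OF \<gamma> y(2)]] _ c])
        (use y \<gamma> in \<open>simp_all add: hat_psi hat_add psi_linear A.r_distr linear_add[OF D_linear]\<close>)
  next
    fix z y assume y: "y \<in> carrier A"
    show "psi \<gamma> (z \<odot>\<^bsub>A\<^esub> y) c = z \<odot>\<^bsub>A\<^esub> psi \<gamma> y c"
      by (rule hat_inject[OF psi_linear[OF \<gamma>] lin_smult_right[OF vA psi_linear[OF \<gamma> y]] _ c])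
        (use y \<gamma> alg in \<open>simp_all add: hat_psi hat_smult psi_linear lin_smult[OF D_linear] complex_algebra_def\<close>)
  qed (use linear_closed[OF psi_linear[OF \<gamma>] c] in simp)
qed

lemma D_invariant:
  assumes \<gamma>: "\<gamma> \<in> dual C" and b: "b \<in> carrier B"
  shows "D \<gamma> b = \<gamma> e \<odot>\<^bsub>A\<^esub> b"
proof -
  have "rcoact A b = act b (rcoact A \<one>\<^bsub>A\<^esub>) C"
    using coact_B_mult[OF b A.one_closed] B_closed[OF b] by simp
  also have "\<dots> = vtens A C b e"
    using B_closed[OF b] by (simp add: coact_one left_tensor_smult_vtens[OF alg vC] e_closed)
  finally show ?thesis
    using B_closed[OF b] by (simp add: D_def slice_vtens[OF vA vC \<gamma>] e_closed)
qed

text \<open>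
  Conversely, \<open>\<delta>(b) = b \<otimes> e\<close> already makes \<open>b\<close> invariant: by the entwining identity
  \<open>\<delta>(b y) = b \<psi>(e \<otimes> y)\<close>, and \<open>\<psi>(e \<otimes> y) = \<delta>(y)\<close> is the case \<open>b = 1\<close>.
\<close>

lemma invariantI:
  assumes b: "b \<in> carrier A" and Db: "\<And>\<gamma>. \<gamma> \<in> dual C \<Longrightarrow> D \<gamma> b = \<gamma> e \<odot>\<^bsub>A\<^esub> b"
  shows "b \<in> carrier B"
proof -
  have coact_b: "rcoact A b = vtens A C b e"
    by (rule coact_eqI) (use b Db in \<open>simp_all add: vtens_closed[OF vA vC] e_closed slice_vtens[OF vA vC]\<close>)
  have "rcoact A (b \<otimes>\<^bsub>A\<^esub> y) = act b (rcoact A y) C" if y: "y \<in> carrier A" for y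
  proof (rule coact_eqI)
    fix \<gamma> assume \<gamma>: "\<gamma> \<in> dual C"
    have "psi \<gamma> y e = D \<gamma> y"
      using hat_psi[OF \<gamma> y A.one_closed] y \<gamma> linear_closed[OF psi_linear[OF \<gamma> y] e_closed]
      by (simp add: hat_def coact_one conv_vtens psi_linear e_closed)
    then have "D \<gamma> (b \<otimes>\<^bsub>A\<^esub> y) = b \<otimes>\<^bsub>A\<^esub> D \<gamma> y"
      using hat_psi[OF \<gamma> y b] y \<gamma> b by (simp add: hat_def coact_b conv_vtens psi_linear e_closed)
    then show "D \<gamma> (b \<otimes>\<^bsub>A\<^esub> y) = slice A \<gamma> (act b (rcoact A y) C)"
      using b y \<gamma> by (simp add: slice_left_tensor[OF alg vC] coact_closed D_def)
  qed (use b y in \<open>simp_all add: act_closed coact_closed\<close>)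
  then show ?thesis
    using b by (simp add: B_iff)
qed

end

section \<open>The strong connection\<close>

locale split_galois_extension = galois_extension C A e
  for C :: "'c coalgebra" and A :: "('c, 'a) right_comodule" and e :: 'c +
  fixes s :: "'a \<Rightarrow> ('a, 'a) tensor"
  assumes s_B_linear: "s \<in> linear_maps B (regular_module A) (left_tensor complex_ring B A)"
    and s_linear: "s \<in> lin A (B \<otimes>\<^sub>\<complex> A)"
    and s_colinear: "a \<in> carrier A \<Longrightarrow>
      vassoc B A C (vtensor_map (B \<otimes>\<^sub>\<complex> A) C s id (rcoact A a)) =
        vtensor_map B (A \<otimes>\<^sub>\<complex> C) id (rcoact A) (s a)"
    and s_split: "a \<in> carrier A \<Longrightarrow> tensor_lift A (\<lambda>b x. b \<otimes>\<^bsub>A\<^esub> x) (s a) = a"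
begin

lemma vAA: "vspace (A \<otimes>\<^sub>\<complex> A)" and vBA: "vspace (B \<otimes>\<^sub>\<complex> A)"
  by (intro vspace_vtensor vA vB)+

lemmas s_closed = linear_closed[OF s_linear]

lemma lin_into_B: "h \<in> lin X B \<Longrightarrow> h \<in> lin X A"
  using B_closed by (auto simp: linear_maps_def)

lemma lin_from_A_B: "h \<in> lin A X \<Longrightarrow> h \<in> lin B X"
  using B_closed by (auto simp: linear_maps_def)

text \<open>
  The pairing \<open>x \<otimes> y \<mapsto> push x (s y)\<close> of \<open>A\<close> with itself is \<open>B\<close>-balanced, which makes the formula for the strong
  connection below meaningful on \<open>A \<otimes>\<^sub>B A\<close>.
\<close>

definition push :: "'a \<Rightarrow> ('a, 'a) tensor \<Rightarrow> ('a, 'a) tensor" where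
  "push x = tensor_lift (A \<otimes>\<^sub>\<complex> A) (\<lambda>b a. vtens A A (x \<otimes>\<^bsub>A\<^esub> b) a)"

lemma push_inner: "x \<in> carrier A \<Longrightarrow> (\<lambda>b a. vtens A A (x \<otimes>\<^bsub>A\<^esub> b) a) \<in> bilinear_maps B A (A \<otimes>\<^sub>\<complex> A)"
  by (rule bilinear_comp[OF vtens_bilinear[OF vA vA]
        lin_from_A_B[OF algebra_mult_left_linear[OF alg]] linear_id(2)])

lemma push_bilinear: "push \<in> bilinear_maps A (B \<otimes>\<^sub>\<complex> A) (A \<otimes>\<^sub>\<complex> A)"
  unfolding push_def
proof (rule bilinear_lift[OF push_inner _ vA vB vA vAA])
  show "(\<lambda>x. vtens A A (x \<otimes>\<^bsub>A\<^esub> b) a) \<in> lin A (A \<otimes>\<^sub>\<complex> A)" if "b \<in> carrier B" "a \<in> carrier A" for b a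
    by (rule bilinear_comp_left[OF vtens_bilinear[OF vA vA] that(2)
          algebra_mult_right_linear[OF alg B_closed[OF that(1)]]])
qed

lemma push_linear: "x \<in> carrier A \<Longrightarrow> push x \<in> lin (B \<otimes>\<^sub>\<complex> A) (A \<otimes>\<^sub>\<complex> A)"
  using bilinear_right[OF push_bilinear] by simp

lemma push_vtens:
  "\<lbrakk>x \<in> carrier A; b \<in> carrier B; a \<in> carrier A\<rbrakk> \<Longrightarrow> push x (vtens B A b a) = vtens A A (x \<otimes>\<^bsub>A\<^esub> b) a"
  unfolding push_def by (rule vtensor_lift_vtens[OF vB vA push_inner vAA])

lemma push_mult:
  assumes x: "x \<in> carrier A" and b: "b \<in> carrier B" and X: "X \<in> carrier (B \<otimes>\<^sub>\<complex> A)"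
  shows "push (x \<otimes>\<^bsub>A\<^esub> b) X = push x (b \<odot>\<^bsub>left_tensor complex_ring B A\<^esub> X)"
proof -
  have xb: "x \<otimes>\<^bsub>A\<^esub> b \<in> carrier A" using x b B_closed by simp
  show ?thesis
  proof (rule vtensor_ext[OF vB vA push_linear[OF xb]
        linear_comp[OF bilinear_right[OF left_tensor_bilinear[OF algebra_B vA] b] push_linear[OF x]] vAA _ X])
    fix m n assume "m \<in> carrier B" "n \<in> carrier A"
    then show "push (x \<otimes>\<^bsub>A\<^esub> b) (vtens B A m n) = push x (b \<odot>\<^bsub>left_tensor complex_ring B A\<^esub> vtens B A m n)"
      using x b xb B.m_closed[of b m] left_tensor_smult_vtens[OF algebra_B vA, of b m n]
      by (simp add: push_vtens A.m_assoc B_closed)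
  qed
qed

lemma push_s_balanced: "(\<lambda>x y. push x (s y)) \<in> balanced_maps B AR AL (A \<otimes>\<^sub>\<complex> A)"
  by (rule balanced_mapsI)
    (use linear_smult[OF s_B_linear] in \<open>simp_all add: bilinear_closed[OF push_bilinear] s_closed linear_add[OF s_linear]
      linear_add[OF push_linear] linear_add[OF bilinear_left[OF push_bilinear]] push_mult\<close>)

text \<open>
  The strong connection \<open>\<ell>(c) = t\<^sup>1 s(t\<^sup>2)\<close>, where \<open>t\<^sup>1 \<otimes> t\<^sup>2\<close> is the translation map at \<open>c\<close>. Because \<open>s\<close> is
  \<open>B\<close>-linear, it is recovered as \<open>s(a) = a\<^sub>(\<^sub>0\<^sub>) \<ell>(a\<^sub>(\<^sub>1\<^sub>))\<close>.
\<close>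

definition ell :: "'c \<Rightarrow> ('a, 'a) tensor" where
  "ell c = tensor_lift (A \<otimes>\<^sub>\<complex> A) (\<lambda>x y. push x (s y)) (transl c)"

lemma ell_lift_additive: "tensor_lift (A \<otimes>\<^sub>\<complex> A) (\<lambda>x y. push x (s y)) \<in> additive_maps AA.T (A \<otimes>\<^sub>\<complex> A)"
  by (rule AA.tensor_lift_additive[OF vspace_abelian_group[OF vAA] push_s_balanced])

lemma ell_lift_tens:
  "\<lbrakk>x \<in> carrier A; y \<in> carrier A\<rbrakk>
    \<Longrightarrow> tensor_lift (A \<otimes>\<^sub>\<complex> A) (\<lambda>x y. push x (s y)) (tens B AR AL x y) = push x (s y)"
  by (rule AA.tensor_lift_tens[OF vspace_abelian_group[OF vAA] push_s_balanced]) simp_all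

lemma ell_closed: "c \<in> carrier C \<Longrightarrow> ell c \<in> carrier (A \<otimes>\<^sub>\<complex> A)"
  unfolding ell_def by (rule additive_closed[OF ell_lift_additive transl_closed])

definition s_slice :: "('a \<Rightarrow> complex) \<Rightarrow> 'a \<Rightarrow> 'a" where
  "s_slice \<eta> a = slice B \<eta> (s a)"

lemma s_slice_linear: "\<eta> \<in> dual A \<Longrightarrow> s_slice \<eta> \<in> lin A B"
  unfolding s_slice_def by (rule linear_comp[OF s_linear slice_linear[OF vB vA]])

lemma s_slice_closed: "\<lbrakk>\<eta> \<in> dual A; a \<in> carrier A\<rbrakk> \<Longrightarrow> s_slice \<eta> a \<in> carrier B"
  by (rule linear_closed[OF s_slice_linear])

lemma s_slice_endo:
  assumes \<eta>: "\<eta> \<in> dual A"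
  shows "s_slice \<eta> \<in> endos"
proof -
  have "s_slice \<eta> (b \<otimes>\<^bsub>A\<^esub> a) = b \<otimes>\<^bsub>A\<^esub> s_slice \<eta> a" if "b \<in> carrier B" "a \<in> carrier A" for b a
    using that linear_smult[OF s_B_linear, of b a] slice_left_tensor[OF algebra_B vA \<eta> that(1) s_closed[OF that(2)]]
    by (simp add: s_slice_def)
  then show ?thesis
    using linear_add[OF s_slice_linear[OF \<eta>]]
    by (intro linear_mapsI[OF additive_mapsI]) (simp_all add: s_slice_closed \<eta> B_closed)
qed

lemma slice_push:
  assumes \<eta>: "\<eta> \<in> dual A" and x: "x \<in> carrier A" and X: "X \<in> carrier (B \<otimes>\<^sub>\<complex> A)"
  shows "slice A \<eta> (push x X) = x \<otimes>\<^bsub>A\<^esub> slice B \<eta> X"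
proof (rule vtensor_ext[OF vB vA linear_comp[OF push_linear[OF x] slice_linear[OF vA vA \<eta>]]
      linear_comp[OF lin_into_B[OF slice_linear[OF vB vA \<eta>]] algebra_mult_left_linear[OF alg x]] vA _ X])
  fix m n assume "m \<in> carrier B" "n \<in> carrier A"
  then show "slice A \<eta> (push x (vtens B A m n)) = x \<otimes>\<^bsub>A\<^esub> slice B \<eta> (vtens B A m n)"
    using x alg B_closed[of m]
    by (simp add: push_vtens slice_vtens[OF vA vA \<eta>] slice_vtens[OF vB vA \<eta>] complex_algebra_def)
qed

lemma slice_ell:
  assumes \<eta>: "\<eta> \<in> dual A" and c: "c \<in> carrier C"
  shows "slice A \<eta> (ell c) = tau (s_slice \<eta>) c"
  unfolding ell_def tau_def
proof (rule AA.tensor_ext[OF additive_comp[OF ell_lift_additive linear_maps_additive[OF slice_linear[OF vA vA \<eta>]]]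
      AA.tensor_lift_additive[OF A.is_abelian_group endo_balanced[OF s_slice_endo[OF \<eta>]]]
      A.is_abelian_group _ transl_closed[OF c]])
  fix x y assume xy: "x \<in> carrier AR" "y \<in> carrier AL"
  then show "slice A \<eta> (tensor_lift (A \<otimes>\<^sub>\<complex> A) (\<lambda>x y. push x (s y)) (tens B AR AL x y)) =
      tensor_lift A (\<lambda>x y. x \<otimes>\<^bsub>A\<^esub> s_slice \<eta> y) (tens B AR AL x y)"
    by (simp add: ell_lift_tens slice_push[OF \<eta>] s_closed s_slice_def[symmetric]
        AA.tensor_lift_tens[OF A.is_abelian_group endo_balanced[OF s_slice_endo[OF \<eta>]]])
qed

text \<open>
  As \<open>s\<close> splits the multiplication, \<open>\<ell>\<^sup>1(c) \<ell>\<^sup>2(c) = t\<^sup>1 t\<^sup>2\<close>; and \<open>c \<mapsto> t\<^sup>1 t\<^sup>2\<close> is the linear map whose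
  convolution operator is the identity, as is the one of \<open>c \<mapsto> \<epsilon>(c) 1\<close>.
\<close>

lemma mult_ell:
  assumes c: "c \<in> carrier C"
  shows "tensor_lift A (\<lambda>x y. x \<otimes>\<^bsub>A\<^esub> y) (ell c) = counit C c \<odot>\<^bsub>A\<^esub> \<one>\<^bsub>A\<^esub>"
proof -
  note mb = algebra_mult_bilinear[OF alg]
  have mB: "(\<lambda>x y. x \<otimes>\<^bsub>A\<^esub> y) \<in> bilinear_maps B A A"
    by (rule bilinear_comp[OF mb lin_from_A_B[OF linear_id(2)] linear_id(2)])
  have id: "(\<lambda>a. a) \<in> endos" by (rule linear_id)
  have push: "tensor_lift A (\<lambda>x y. x \<otimes>\<^bsub>A\<^esub> y) (push x X) = x \<otimes>\<^bsub>A\<^esub> tensor_lift A (\<lambda>b y. b \<otimes>\<^bsub>A\<^esub> y) X"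
    if x: "x \<in> carrier A" and X: "X \<in> carrier (B \<otimes>\<^sub>\<complex> A)" for x X
  proof (rule vtensor_ext[OF vB vA linear_comp[OF push_linear[OF x] vtensor_lift_linear[OF vA vA mb vA]]
        linear_comp[OF vtensor_lift_linear[OF vB vA mB vA] algebra_mult_left_linear[OF alg x]] vA _ X])
    fix m n assume "m \<in> carrier B" "n \<in> carrier A"
    then show "tensor_lift A (\<lambda>x y. x \<otimes>\<^bsub>A\<^esub> y) (push x (vtens B A m n)) =
        x \<otimes>\<^bsub>A\<^esub> tensor_lift A (\<lambda>b y. b \<otimes>\<^bsub>A\<^esub> y) (vtens B A m n)"
      using x B_closed[of m]
      by (simp add: push_vtens vtensor_lift_vtens[OF vA vA mb vA] vtensor_lift_vtens[OF vB vA mB vA] A.m_assoc)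
  qed
  have "tensor_lift A (\<lambda>x y. x \<otimes>\<^bsub>A\<^esub> y) (ell c) = tau (\<lambda>a. a) c"
    unfolding ell_def tau_def
  proof (rule AA.tensor_ext[OF additive_comp[OF ell_lift_additive linear_maps_additive[OF vtensor_lift_linear[OF vA vA mb vA]]]
        AA.tensor_lift_additive[OF A.is_abelian_group endo_balanced[OF id]]
        A.is_abelian_group _ transl_closed[OF c]])
    fix x y assume xy: "x \<in> carrier AR" "y \<in> carrier AL"
    then show "tensor_lift A (\<lambda>x y. x \<otimes>\<^bsub>A\<^esub> y) (tensor_lift (A \<otimes>\<^sub>\<complex> A) (\<lambda>x y. push x (s y)) (tens B AR AL x y)) =
        tensor_lift A (\<lambda>x y. x \<otimes>\<^bsub>A\<^esub> y) (tens B AR AL x y)"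
      by (simp add: ell_lift_tens push s_closed s_split
          AA.tensor_lift_tens[OF A.is_abelian_group endo_balanced[OF id]])
  qed
  also have "\<dots> = tau (hat A (\<lambda>c. counit C c \<odot>\<^bsub>A\<^esub> \<one>\<^bsub>A\<^esub>)) c"
    by (rule tau_cong[OF hat_endo[OF lin_smult_left[OF vA A.one_closed counit_linear]] _ c])
      (simp add: hat_scalar[OF counit_linear] D_counit)
  also have "\<dots> = counit C c \<odot>\<^bsub>A\<^esub> \<one>\<^bsub>A\<^esub>"
    by (rule tau_hat[OF lin_smult_left[OF vA A.one_closed counit_linear] c])
  finally show ?thesis .
qed

text \<open>
  The colinearity of \<open>s\<close>, with \<open>\<eta>\<close> applied to the leg in \<open>A\<close> and \<open>\<gamma>\<close> to the leg in \<open>C\<close>. In this contracted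
  form it involves only endomorphisms of \<open>A\<close>.
\<close>

lemma s_slice_colinear:
  assumes \<eta>: "\<eta> \<in> dual A" and \<gamma>: "\<gamma> \<in> dual C" and a: "a \<in> carrier A"
  shows "s_slice \<eta> (D \<gamma> a) = s_slice (\<lambda>x. \<eta> (D \<gamma> x)) a"
proof -
  let ?\<theta> = "\<lambda>X. \<eta> (slice A \<gamma> X)"
  have \<theta>: "?\<theta> \<in> dual (A \<otimes>\<^sub>\<complex> C)"
    by (rule linear_comp[OF slice_linear[OF vA vC \<gamma>] \<eta>])
  have \<eta>D: "(\<lambda>x. \<eta> (D \<gamma> x)) \<in> dual A"
    by (rule linear_comp[OF D_linear[OF \<gamma>] \<eta>])
  note S = slice_linear[OF vB vAC \<theta>]
  interpret BM: module complex_ring B by (rule vB)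
  have 1: "slice B ?\<theta> (vtensor_map B (A \<otimes>\<^sub>\<complex> C) id (rcoact A) Y) = slice B (\<lambda>x. \<eta> (D \<gamma> x)) Y"
    if Y: "Y \<in> carrier (B \<otimes>\<^sub>\<complex> A)" for Y
  proof (rule vtensor_ext[OF vB vA linear_comp[OF vtensor_map_linear[OF vB vA vB vAC linear_id(1) coact_linear] S]
        slice_linear[OF vB vA \<eta>D] vB _ Y])
    fix m n assume "m \<in> carrier B" "n \<in> carrier A"
    then show "slice B ?\<theta> (vtensor_map B (A \<otimes>\<^sub>\<complex> C) id (rcoact A) (vtens B A m n)) =
        slice B (\<lambda>x. \<eta> (D \<gamma> x)) (vtens B A m n)"
      by (simp add: vtensor_map_vtens[OF vB vA vB vAC linear_id(1) coact_linear] slice_vtens[OF vB vAC \<theta>]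
          slice_vtens[OF vB vA \<eta>D] coact_closed D_def[symmetric])
  qed
  have 2: "slice B ?\<theta> (vassoc B A C (vtens (B \<otimes>\<^sub>\<complex> A) C Z c)) = \<gamma> c \<odot>\<^bsub>B\<^esub> slice B \<eta> Z"
    if Z: "Z \<in> carrier (B \<otimes>\<^sub>\<complex> A)" and c: "c \<in> carrier C" for Z c
  proof (rule vtensor_ext[OF vB vA linear_comp[OF linear_comp[OF bilinear_left[OF vtens_bilinear[OF vBA vC] c]
          vassoc_linear[OF vB vA vC]] S] lin_smult_right[OF vB slice_linear[OF vB vA \<eta>]] vB _ Z])
    fix m n assume "m \<in> carrier B" "n \<in> carrier A"
    then show "slice B ?\<theta> (vassoc B A C (vtens (B \<otimes>\<^sub>\<complex> A) C (vtens B A m n) c)) =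
        \<gamma> c \<odot>\<^bsub>B\<^esub> slice B \<eta> (vtens B A m n)"
      using c BM.smult_assoc1[of "\<gamma> c" "\<eta> n" m]
      by (simp add: vassoc_vtens[OF vB vA vC] slice_vtens[OF vB vAC \<theta>] vtens_closed[OF vA vC]
          slice_vtens[OF vB vA \<eta>] slice_vtens[OF vA vC \<gamma>] lin_smult[OF \<eta>])
  qed
  have 3: "slice B ?\<theta> (vassoc B A C (vtensor_map (B \<otimes>\<^sub>\<complex> A) C s id Y)) = s_slice \<eta> (slice A \<gamma> Y)"
    if Y: "Y \<in> carrier (A \<otimes>\<^sub>\<complex> C)" for Y
  proof (rule vtensor_ext[OF vA vC linear_comp[OF linear_comp[OF vtensor_map_linear[OF vA vC vBA vC s_linear linear_id(1)]
          vassoc_linear[OF vB vA vC]] S] linear_comp[OF slice_linear[OF vA vC \<gamma>] s_slice_linear[OF \<eta>]] vB _ Y])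
    fix m n assume "m \<in> carrier A" "n \<in> carrier C"
    then show "slice B ?\<theta> (vassoc B A C (vtensor_map (B \<otimes>\<^sub>\<complex> A) C s id (vtens A C m n))) =
        s_slice \<eta> (slice A \<gamma> (vtens A C m n))"
      using lin_smult[OF s_slice_linear[OF \<eta>], of m "\<gamma> n"]
      by (simp add: vtensor_map_vtens[OF vA vC vBA vC s_linear linear_id(1)] 2 s_closed
          slice_vtens[OF vA vC \<gamma>] s_slice_def)
  qed
  show ?thesis
    using 1[OF s_closed[OF a]] 3[OF coact_closed[OF a]] s_colinear[OF a]
    by (simp add: s_slice_def D_def)
qed

definition ell_slice :: "('a \<Rightarrow> complex) \<Rightarrow> 'c \<Rightarrow> 'a" where
  "ell_slice \<eta> = tau (s_slice \<eta>)"

lemma ell_slice_linear: "\<eta> \<in> dual A \<Longrightarrow> ell_slice \<eta> \<in> lin C A"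
  unfolding ell_slice_def by (intro tau_linear s_slice_endo)

lemma ell_slice_eq: "\<lbrakk>\<eta> \<in> dual A; c \<in> carrier C\<rbrakk> \<Longrightarrow> slice A \<eta> (ell c) = ell_slice \<eta> c"
  by (simp add: slice_ell ell_slice_def)

lemma hat_ell_slice: "\<lbrakk>\<eta> \<in> dual A; a \<in> carrier A\<rbrakk> \<Longrightarrow> hat A (ell_slice \<eta>) a = s_slice \<eta> a"
  unfolding ell_slice_def by (intro hat_tau s_slice_endo)

text \<open>
  The strong connection is right colinear, \<open>\<ell>\<^sup>1(c) \<otimes> \<delta>(\<ell>\<^sup>2(c)) = \<ell>(c\<^sub>(\<^sub>1\<^sub>)) \<otimes> c\<^sub>(\<^sub>2\<^sub>)\<close>, and left colinear,
  \<open>\<psi>(c\<^sub>(\<^sub>1\<^sub>) \<otimes> \<ell>\<^sup>1(c\<^sub>(\<^sub>2\<^sub>))) \<otimes> \<ell>\<^sup>2(c\<^sub>(\<^sub>2\<^sub>)) = \<ell>\<^sup>1(c) \<otimes> e \<otimes> \<ell>\<^sup>2(c)\<close>. Both identities between maps out of \<open>C\<close> are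
  checked on their convolution operators: there the first is the colinearity of \<open>s\<close>, and the second says
  that \<open>s\<close> takes values in \<open>B \<otimes> A\<close>.
\<close>

lemma ell_right_colinear:
  assumes \<eta>: "\<eta> \<in> dual A" and \<gamma>: "\<gamma> \<in> dual C" and c: "c \<in> carrier C"
  shows "ell_slice (\<lambda>x. \<eta> (D \<gamma> x)) c = tensor_lift A (\<lambda>c d. \<gamma> d \<odot>\<^bsub>A\<^esub> ell_slice \<eta> c) (comult C c)"
proof -
  have \<eta>D: "(\<lambda>x. \<eta> (D \<gamma> x)) \<in> dual A"
    by (rule linear_comp[OF D_linear[OF \<gamma>] \<eta>])
  note L = ell_slice_linear[OF \<eta>]
  let ?K = "\<lambda>c d. \<gamma> d \<odot>\<^bsub>A\<^esub> ell_slice \<eta> c"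
  have K: "?K \<in> bilinear_maps C C A"
    by (rule bilinear_flip[OF bilinear_comp[OF bilinear_smult[OF vA] \<gamma> L]])
  have bil: "(\<lambda>x d. \<gamma> d \<odot>\<^bsub>A\<^esub> s_slice \<eta> x) \<in> bilinear_maps A C A"
    by (rule bilinear_flip[OF bilinear_comp[OF bilinear_smult[OF vA] \<gamma> lin_into_B[OF s_slice_linear[OF \<eta>]]]])
  have "hat A (ell_slice (\<lambda>x. \<eta> (D \<gamma> x))) a = hat A (\<lambda>c. tensor_lift A ?K (comult C c)) a"
    if a: "a \<in> carrier A" for a
  proof -
    have "hat A (\<lambda>c. tensor_lift A ?K (comult C c)) a =
        tensor_lift A (\<lambda>x d. hat A (\<lambda>c. ?K c d) x) (rcoact A a)"
      by (rule hat_comult(2)[OF K a])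
    also have "\<dots> = tensor_lift A (\<lambda>x d. \<gamma> d \<odot>\<^bsub>A\<^esub> s_slice \<eta> x) (rcoact A a)"
      by (rule vtensor_lift_cong[OF vA vC bil vA _ coact_closed[OF a]])
        (simp add: hat_smult[OF L] hat_ell_slice[OF \<eta>])
    also have "\<dots> = s_slice \<eta> (slice A \<gamma> (rcoact A a))"
    proof (rule vtensor_ext[OF vA vC vtensor_lift_linear[OF vA vC bil vA]
          linear_comp[OF slice_linear[OF vA vC \<gamma>] lin_into_B[OF s_slice_linear[OF \<eta>]]] vA _ coact_closed[OF a]])
      fix m n assume "m \<in> carrier A" "n \<in> carrier C"
      then show "tensor_lift A (\<lambda>x d. \<gamma> d \<odot>\<^bsub>A\<^esub> s_slice \<eta> x) (vtens A C m n) =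
          s_slice \<eta> (slice A \<gamma> (vtens A C m n))"
        by (simp add: vtensor_lift_vtens[OF vA vC bil vA] slice_vtens[OF vA vC \<gamma>]
            lin_smult[OF lin_into_B[OF s_slice_linear[OF \<eta>]]])
    qed
    finally show ?thesis
      using s_slice_colinear[OF \<eta> \<gamma> a] by (simp add: hat_ell_slice[OF \<eta>D] a D_def[symmetric])
  qed
  then show ?thesis
    by (rule hat_inject[OF ell_slice_linear[OF \<eta>D] hat_comult(1)[OF K A.one_closed] _ c])
qed

lemma ell_left_bilinear:
  assumes \<eta>: "\<eta> \<in> dual A" and \<gamma>: "\<gamma> \<in> dual C"
  shows "(\<lambda>c d. psi \<gamma> (ell_slice \<eta> d) c) \<in> bilinear_maps C C A"
  by (rule bilinear_comp[OF psi_bilinear[OF \<gamma>] linear_id(2) ell_slice_linear[OF \<eta>]])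

lemma ell_left_colinear:
  assumes \<eta>: "\<eta> \<in> dual A" and \<gamma>: "\<gamma> \<in> dual C" and c: "c \<in> carrier C"
  shows "tensor_lift A (\<lambda>c d. psi \<gamma> (ell_slice \<eta> d) c) (comult C c) = \<gamma> e \<odot>\<^bsub>A\<^esub> ell_slice \<eta> c"
proof -
  note L = ell_slice_linear[OF \<eta>]
  let ?K = "\<lambda>c d. psi \<gamma> (ell_slice \<eta> d) c"
  note K = ell_left_bilinear[OF \<eta> \<gamma>]
  have bil: "(\<lambda>x d. D \<gamma> (x \<otimes>\<^bsub>A\<^esub> ell_slice \<eta> d)) \<in> bilinear_maps A C A"
    by (rule bilinear_post[OF conv_bilinear[OF L] D_linear[OF \<gamma>]])
  have "hat A (\<lambda>c. tensor_lift A ?K (comult C c)) a = hat A (\<lambda>c. \<gamma> e \<odot>\<^bsub>A\<^esub> ell_slice \<eta> c) a"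
    if a: "a \<in> carrier A" for a
  proof -
    have "hat A (\<lambda>c. tensor_lift A ?K (comult C c)) a =
        tensor_lift A (\<lambda>x d. hat A (psi \<gamma> (ell_slice \<eta> d)) x) (rcoact A a)"
      by (rule hat_comult(2)[OF K a])
    also have "\<dots> = tensor_lift A (\<lambda>x d. D \<gamma> (x \<otimes>\<^bsub>A\<^esub> ell_slice \<eta> d)) (rcoact A a)"
      by (rule vtensor_lift_cong[OF vA vC bil vA _ coact_closed[OF a]])
        (simp add: hat_psi[OF \<gamma>] linear_closed[OF L])
    also have "\<dots> = D \<gamma> (conv A (ell_slice \<eta>) (rcoact A a))"
    proof (rule vtensor_ext[OF vA vC vtensor_lift_linear[OF vA vC bil vA]
          linear_comp[OF conv_linear[OF L] D_linear[OF \<gamma>]] vA _ coact_closed[OF a]])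
      fix m n assume "m \<in> carrier A" "n \<in> carrier C"
      then show "tensor_lift A (\<lambda>x d. D \<gamma> (x \<otimes>\<^bsub>A\<^esub> ell_slice \<eta> d)) (vtens A C m n) =
          D \<gamma> (conv A (ell_slice \<eta>) (vtens A C m n))"
        by (simp add: vtensor_lift_vtens[OF vA vC bil vA] conv_vtens[OF L])
    qed
    \<comment> \<open>here it enters that the first leg of \<open>s(a)\<close> lies in \<open>B\<close>\<close>
    also have "\<dots> = \<gamma> e \<odot>\<^bsub>A\<^esub> s_slice \<eta> a"
      using hat_ell_slice[OF \<eta> a] D_invariant[OF \<gamma> s_slice_closed[OF \<eta> a]] by (simp add: hat_def)
    finally show ?thesis
      by (simp add: hat_smult[OF L a] hat_ell_slice[OF \<eta> a])
  qed
  then show ?thesis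
    by (rule hat_inject[OF hat_comult(1)[OF K A.one_closed] lin_smult_right[OF vA L] _ c])
qed

end

lemma galois_extensionI:
  assumes "coalgebra C" "coaugmented_galois_extension C e A"
  shows "galois_extension C A e"
  using assms
  by (simp add: galois_extension_def galois_extension_axioms_def algebra_comodule_def coaugmented_galois_extension_def)

lemma equivariantly_projective_split:
  assumes "coalgebra C" "coaugmented_galois_extension C e A" "equivariantly_projective C A"
  obtains s where "split_galois_extension C A e s"
proof -
  show thesis
    using galois_extensionI[OF assms(1,2)] assms(3) that
    by (auto simp: equivariantly_projective_def Let_def split_galois_extension_def
        split_galois_extension_axioms_def)
qed

locale principal_hom =
  A: split_galois_extension C A e s + A': galois_extension C A' e + galois_hom C A e A' f
  for C :: "'c coalgebra" and A :: "('c, 'a) right_comodule" and e :: 'c and s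
    and A' :: "('c, 'b) right_comodule" and f :: "'a \<Rightarrow> 'b"
begin

text \<open>
  Both \<open>\<psi>\<close> are determined by the coactions of products, which \<open>f\<close> respects.
\<close>

lemma f_psi:
  assumes "\<gamma> \<in> dual C" "y \<in> carrier A" "c \<in> carrier C"
  shows "f (A.psi \<gamma> y c) = A'.psi \<gamma> (f y) c"
  unfolding A.psi_def
  by (rule f_tau[OF A.D_mult_right_endo A'.psi_linear])
    (use assms in \<open>simp_all add: f_closed A'.hat_psi D_f[symmetric] f_mult\<close>)

text \<open>
  Although invariance is a condition on all products \<open>b a\<close>, it amounts to \<open>\<delta>(b) = b \<otimes> e\<close>, which a colinear
  map preserves even if it is not surjective.
\<close>

lemma f_invariant:
  assumes "b \<in> carrier A.B"
  shows "f b \<in> carrier A'.B"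
  by (rule A'.invariantI)
    (use assms in \<open>simp_all add: f_closed A.B_closed D_f A.D_invariant lin_smult[OF f_linear]\<close>)

lemma f_ell_linear: "\<eta> \<in> dual A \<Longrightarrow> (\<lambda>c. f (A.ell_slice \<eta> c)) \<in> lin C A'"
  by (rule linear_comp[OF A.ell_slice_linear f_linear])

text \<open>
  The map \<open>a' \<mapsto> a'\<^sub>(\<^sub>0\<^sub>) f(\<ell>\<^sup>1(a'\<^sub>(\<^sub>1\<^sub>))) \<otimes> \<ell>\<^sup>2(a'\<^sub>(\<^sub>1\<^sub>))\<close> from \<open>A'\<close> to \<open>A' \<otimes> A\<close> has its first leg in \<open>B'\<close>: apply the
  entwining identity in \<open>A'\<close> and the left colinearity of \<open>\<ell>\<close>, which \<open>f\<close> transports from \<open>A\<close> to \<open>A'\<close>.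
\<close>

lemma hat_f_ell_invariant:
  assumes \<eta>: "\<eta> \<in> dual A" and a: "a \<in> carrier A'"
  shows "hat A' (\<lambda>c. f (A.ell_slice \<eta> c)) a \<in> carrier A'.B"
proof (rule A'.invariantI)
  note L = f_ell_linear[OF \<eta>] and l = A.ell_slice_linear[OF \<eta>] and vA' = A'.vA and vC = A.vC
  show "hat A' (\<lambda>c. f (A.ell_slice \<eta> c)) a \<in> carrier A'"
    by (rule linear_closed[OF A'.hat_linear[OF L] a])
  fix \<gamma> assume \<gamma>: "\<gamma> \<in> dual C"
  let ?K = "\<lambda>c d. A.psi \<gamma> (A.ell_slice \<eta> d) c" and ?K' = "\<lambda>c d. A'.psi \<gamma> (f (A.ell_slice \<eta> d)) c"
  note K = A.ell_left_bilinear[OF \<eta> \<gamma>]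
  have K': "?K' \<in> bilinear_maps C C A'"
    by (rule bilinear_comp[OF A'.psi_bilinear[OF \<gamma>] linear_id(2) L])
  have bil: "(\<lambda>x d. A'.D \<gamma> (x \<otimes>\<^bsub>A'\<^esub> f (A.ell_slice \<eta> d))) \<in> bilinear_maps A' C A'"
    by (rule bilinear_post[OF A'.conv_bilinear[OF L] A'.D_linear[OF \<gamma>]])
  have "A'.D \<gamma> (hat A' (\<lambda>c. f (A.ell_slice \<eta> c)) a) =
      tensor_lift A' (\<lambda>x d. A'.D \<gamma> (x \<otimes>\<^bsub>A'\<^esub> f (A.ell_slice \<eta> d))) (rcoact A' a)"
    unfolding hat_def
  proof (rule vtensor_ext[OF vA' vC linear_comp[OF A'.conv_linear[OF L] A'.D_linear[OF \<gamma>]]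
        vtensor_lift_linear[OF vA' vC bil vA'] vA' _ A'.coact_closed[OF a]])
    fix m n assume "m \<in> carrier A'" "n \<in> carrier C"
    then show "A'.D \<gamma> (conv A' (\<lambda>c. f (A.ell_slice \<eta> c)) (vtens A' C m n)) =
        tensor_lift A' (\<lambda>x d. A'.D \<gamma> (x \<otimes>\<^bsub>A'\<^esub> f (A.ell_slice \<eta> d))) (vtens A' C m n)"
      by (simp add: vtensor_lift_vtens[OF vA' vC bil vA'] A'.conv_vtens[OF L])
  qed
  also have "\<dots> = tensor_lift A' (\<lambda>x d. hat A' (\<lambda>c. ?K' c d) x) (rcoact A' a)"
    by (rule vtensor_lift_cong[OF vA' vC A'.hat_comult(3)[OF K' a] vA' _ A'.coact_closed[OF a]])
      (simp add: A'.hat_psi[OF \<gamma>] linear_closed[OF L])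
  also have "\<dots> = hat A' (\<lambda>c. tensor_lift A' ?K' (comult C c)) a"
    by (rule A'.hat_comult(2)[OF K' a, symmetric])
  also have "\<dots> = hat A' (\<lambda>c. \<gamma> e \<odot>\<^bsub>A'\<^esub> f (A.ell_slice \<eta> c)) a"
  proof (rule A'.hat_cong[OF lin_smult_right[OF vA' L] _ a])
    fix c assume c: "c \<in> carrier C"
    have "tensor_lift A' ?K' (comult C c) = f (tensor_lift A ?K (comult C c))"
    proof (rule vtensor_ext[OF vC vC vtensor_lift_linear[OF vC vC K' vA']
          linear_comp[OF vtensor_lift_linear[OF vC vC K A.vA] f_linear] vA' _ linear_closed[OF A.comult_linear c]])
      fix m n assume "m \<in> carrier C" "n \<in> carrier C"
      then show "tensor_lift A' ?K' (vtens C C m n) = f (tensor_lift A ?K (vtens C C m n))"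
        by (simp add: vtensor_lift_vtens[OF vC vC K' vA'] vtensor_lift_vtens[OF vC vC K A.vA]
            f_psi[OF \<gamma>] linear_closed[OF l])
    qed
    then show "tensor_lift A' ?K' (comult C c) = \<gamma> e \<odot>\<^bsub>A'\<^esub> f (A.ell_slice \<eta> c)"
      using A.ell_left_colinear[OF \<eta> \<gamma> c] lin_smult[OF f_linear] linear_closed[OF l c] by simp
  qed
  also have "\<dots> = \<gamma> e \<odot>\<^bsub>A'\<^esub> hat A' (\<lambda>c. f (A.ell_slice \<eta> c)) a"
    by (rule A'.hat_smult[OF L a])
  finally show "A'.D \<gamma> (hat A' (\<lambda>c. f (A.ell_slice \<eta> c)) a) = \<gamma> e \<odot>\<^bsub>A'\<^esub> hat A' (\<lambda>c. f (A.ell_slice \<eta> c)) a" .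
qed

end

section \<open>Cotensor products in coordinates\<close>

lemma slice_cong:
  assumes "vspace M" "vspace N" "\<theta> \<in> dual N" "\<And>n. n \<in> carrier N \<Longrightarrow> \<theta>' n = \<theta> n"
    and "X \<in> carrier (M \<otimes>\<^sub>\<complex> N)"
  shows "slice M \<theta>' X = slice M \<theta> X"
  unfolding slice_def
  by (rule vtensor_lift_cong[OF assms(1,2) slice_bilinear[OF assms(1-3)] assms(1) _ assms(5)])
    (simp add: assms(4))

lemma slice_scaled:
  assumes M: "vspace M" and N: "vspace N" and \<theta>: "\<theta> \<in> dual N" and X: "X \<in> carrier (M \<otimes>\<^sub>\<complex> N)"
  shows "slice M (\<lambda>n. a * \<theta> n) X = a \<odot>\<^bsub>M\<^esub> slice M \<theta> X"
proof -
  interpret M: module complex_ring M by (rule M)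
  have a\<theta>: "(\<lambda>n. a * \<theta> n) \<in> dual N"
    using lin_smult_right[OF vspace_regular \<theta>, of a] by simp
  show ?thesis
    by (rule vtensor_ext[OF M N slice_linear[OF M N a\<theta>] lin_smult_right[OF M slice_linear[OF M N \<theta>]] M _ X])
      (simp add: slice_vtens[OF M N a\<theta>] slice_vtens[OF M N \<theta>] M.smult_assoc1[simplified])
qed

lemma slice_diff:
  assumes M: "vspace M" and N: "vspace N" and \<theta>: "\<theta> \<in> dual N" "\<theta>' \<in> dual N" and X: "X \<in> carrier (M \<otimes>\<^sub>\<complex> N)"
  shows "(\<lambda>n. \<theta> n - \<theta>' n) \<in> dual N"
    and "slice M (\<lambda>n. \<theta> n - \<theta>' n) X \<oplus>\<^bsub>M\<^esub> slice M \<theta>' X = slice M \<theta> X"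
proof -
  interpret M: module complex_ring M by (rule M)
  show d: "(\<lambda>n. \<theta> n - \<theta>' n) \<in> dual N"
    by (intro linI) (simp_all add: linear_add[OF \<theta>(1)] linear_add[OF \<theta>(2)] lin_smult[OF \<theta>(1)]
        lin_smult[OF \<theta>(2)] algebra_simps)
  show "slice M (\<lambda>n. \<theta> n - \<theta>' n) X \<oplus>\<^bsub>M\<^esub> slice M \<theta>' X = slice M \<theta> X"
  proof (rule vtensor_ext[OF M N lin_sum[OF M slice_linear[OF M N d] slice_linear[OF M N \<theta>(2)]]
        slice_linear[OF M N \<theta>(1)] M _ X])
    fix m n assume "m \<in> carrier M" "n \<in> carrier N"
    then show "slice M (\<lambda>n. \<theta> n - \<theta>' n) (vtens M N m n) \<oplus>\<^bsub>M\<^esub> slice M \<theta>' (vtens M N m n) =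
        slice M \<theta> (vtens M N m n)"
      using M.smult_l_distr[of "\<theta> n - \<theta>' n" "\<theta>' n" m]
      by (simp add: slice_vtens[OF M N d] slice_vtens[OF M N \<theta>(1)] slice_vtens[OF M N \<theta>(2)])
  qed
qed

locale comodule_basis =
  fixes C :: "'c coalgebra" and V :: "('c, 'v) left_comodule" and S :: "'v set" and \<xi> :: "'v \<Rightarrow> 'v \<Rightarrow> complex"
  assumes coalgebra: "coalgebra C" and comodule: "left_comodule C V"
    and finite_S: "finite S" and S_closed: "S \<subseteq> carrier V"
    and \<xi>_dual: "s \<in> S \<Longrightarrow> \<xi> s \<in> dual V"
    and \<xi>_S: "\<lbrakk>s \<in> S; t \<in> S\<rbrakk> \<Longrightarrow> \<xi> s t = (if s = t then 1 else 0)"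
    and expansion: "v \<in> carrier V \<Longrightarrow> v = (\<Oplus>\<^bsub>V\<^esub>s\<in>S. \<xi> s v \<odot>\<^bsub>V\<^esub> s)"
begin

lemma vC': "vspace C" and vV: "vspace V"
  using coalgebra comodule by (auto simp: coalgebra_def left_comodule_def)

lemma vCV: "vspace (C \<otimes>\<^sub>\<complex> V)"
  by (rule vspace_vtensor[OF vC' vV])

lemma lcoact_linear: "lcoact V \<in> lin V (C \<otimes>\<^sub>\<complex> V)"
  using comodule by (simp add: left_comodule_def)

lemma comult_linear': "comult C \<in> lin C (C \<otimes>\<^sub>\<complex> C)"
  using coalgebra by (auto simp: coalgebra_def)

lemma S_in: "s \<in> S \<Longrightarrow> s \<in> carrier V"
  using S_closed by blast

lemma expand_tensor:
  assumes X: "vspace X" and x: "x \<in> carrier (X \<otimes>\<^sub>\<complex> V)"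
  shows "x = (\<Oplus>\<^bsub>X \<otimes>\<^sub>\<complex> V\<^esub>u\<in>S. vtens X V (slice X (\<xi> u) x) u)"
proof (rule vtensor_ext[OF X vV linear_id(2) lin_finsum_map _ _ x])
  note bil = vtens_bilinear[OF X vV] and vXV = vspace_vtensor[OF X vV]
  interpret X: module complex_ring X by (rule X)
  interpret V: module complex_ring V by (rule vV)
  interpret XV: module complex_ring "X \<otimes>\<^sub>\<complex> V" by (rule vXV)
  show "vspace (X \<otimes>\<^sub>\<complex> V)" "vspace (X \<otimes>\<^sub>\<complex> V)" "vspace (X \<otimes>\<^sub>\<complex> V)" by (rule vXV)+
  show "(\<lambda>x. vtens X V (slice X (\<xi> u) x) u) \<in> lin (X \<otimes>\<^sub>\<complex> V) (X \<otimes>\<^sub>\<complex> V)" if "u \<in> S" for u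
    by (rule bilinear_comp_left[OF bil S_in[OF that] slice_linear[OF X vV \<xi>_dual[OF that]]])
  fix m v assume mv: "m \<in> carrier X" "v \<in> carrier V"
  have "vtens X V m v = vtens X V m (\<Oplus>\<^bsub>V\<^esub>u\<in>S. \<xi> u v \<odot>\<^bsub>V\<^esub> u)"
    using expansion[OF mv(2)] by simp
  also have "\<dots> = (\<Oplus>\<^bsub>X \<otimes>\<^sub>\<complex> V\<^esub>u\<in>S. vtens X V m (\<xi> u v \<odot>\<^bsub>V\<^esub> u))"
    by (rule lin_finsum[OF bilinear_right[OF bil mv(1)] vV vXV]) (use S_in in auto)
  also have "\<dots> = (\<Oplus>\<^bsub>X \<otimes>\<^sub>\<complex> V\<^esub>u\<in>S. vtens X V (slice X (\<xi> u) (vtens X V m v)) u)"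
    by (rule XV.finsum_cong')
      (use mv S_in in \<open>auto simp: slice_vtens[OF X vV \<xi>_dual] vtens_smult_right[OF X vV] vtens_closed[OF X vV]\<close>)
  finally show "vtens X V m v = (\<Oplus>\<^bsub>X \<otimes>\<^sub>\<complex> V\<^esub>u\<in>S. vtens X V (slice X (\<xi> u) (vtens X V m v)) u)" .
qed

text \<open>The matrix coefficients: \<open>\<rho>(s) = \<Sum>u. coeff s u \<otimes> u\<close>.\<close>

definition coeff :: "'v \<Rightarrow> 'v \<Rightarrow> 'c" where
  "coeff s u = slice C (\<xi> u) (lcoact V s)"

lemma coeff_closed: "\<lbrakk>s \<in> S; u \<in> S\<rbrakk> \<Longrightarrow> coeff s u \<in> carrier C"
  unfolding coeff_def
  by (intro linear_closed[OF slice_linear[OF vC' vV \<xi>_dual]] linear_closed[OF lcoact_linear] S_in)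

text \<open>
  The next two lemmas compute the coordinate at \<open>u\<close> of the two sides of the cotensor condition. They are
  stated for an arbitrary space \<open>X\<close> in place of \<open>A\<close>, because \<open>X = C\<close> gives the comultiplication of the matrix
  coefficients and \<open>X = A\<close> gives the description of the cotensor product.
\<close>

lemma coordinate_right_coaction:
  assumes X: "vspace X" and d: "d \<in> lin X (X \<otimes>\<^sub>\<complex> C)" and x: "x \<in> carrier (X \<otimes>\<^sub>\<complex> V)" and u: "u \<in> S"
  shows "vtensor_map X C id (slice C (\<xi> u)) (vassoc X C V (vtensor_map (X \<otimes>\<^sub>\<complex> C) V d id x)) =
    d (slice X (\<xi> u) x)"
proof -
  note vXC = vspace_vtensor[OF X vC']
  note su = slice_linear[OF vC' vV \<xi>_dual[OF u]]
  note R = vtensor_map_linear[OF X vCV X vC' linear_id(1) su]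
  interpret XC: module complex_ring "X \<otimes>\<^sub>\<complex> C" by (rule vXC)
  have 1: "vtensor_map X C id (slice C (\<xi> u)) (vassoc X C V (vtens (X \<otimes>\<^sub>\<complex> C) V Z v)) = \<xi> u v \<odot>\<^bsub>X \<otimes>\<^sub>\<complex> C\<^esub> Z"
    if Z: "Z \<in> carrier (X \<otimes>\<^sub>\<complex> C)" and v: "v \<in> carrier V" for Z v
  proof (rule vtensor_ext[OF X vC' linear_comp[OF linear_comp[OF bilinear_left[OF vtens_bilinear[OF vXC vV] v]
          vassoc_linear[OF X vC' vV]] R] lin_smult_right[OF vXC linear_id(2)] vXC _ Z])
    fix m n assume "m \<in> carrier X" "n \<in> carrier C"
    then show "vtensor_map X C id (slice C (\<xi> u)) (vassoc X C V (vtens (X \<otimes>\<^sub>\<complex> C) V (vtens X C m n) v)) =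
        \<xi> u v \<odot>\<^bsub>X \<otimes>\<^sub>\<complex> C\<^esub> vtens X C m n"
      using v
      by (simp add: vassoc_vtens[OF X vC' vV] vtensor_map_vtens[OF X vCV X vC' linear_id(1) su]
          vtens_closed[OF vC' vV] slice_vtens[OF vC' vV \<xi>_dual[OF u]] vtens_smult_right[OF X vC']
          smult_vtens[OF X vC'])
  qed
  show ?thesis
  proof (rule vtensor_ext[OF X vV linear_comp[OF linear_comp[OF vtensor_map_linear[OF X vV vXC vV d linear_id(1)]
          vassoc_linear[OF X vC' vV]] R] linear_comp[OF slice_linear[OF X vV \<xi>_dual[OF u]] d] vXC _ x])
    fix m n assume "m \<in> carrier X" "n \<in> carrier V"
    then show "vtensor_map X C id (slice C (\<xi> u)) (vassoc X C V (vtensor_map (X \<otimes>\<^sub>\<complex> C) V d id (vtens X V m n))) =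
        d (slice X (\<xi> u) (vtens X V m n))"
      by (simp add: vtensor_map_vtens[OF X vV vXC vV d linear_id(1)] 1 linear_closed[OF d]
          slice_vtens[OF X vV \<xi>_dual[OF u]] lin_smult[OF d])
  qed
qed

lemma coordinate_left_coaction:
  assumes X: "vspace X" and x: "x \<in> carrier (X \<otimes>\<^sub>\<complex> V)" and u: "u \<in> S"
  shows "vtensor_map X C id (slice C (\<xi> u)) (vtensor_map X (C \<otimes>\<^sub>\<complex> V) id (lcoact V) x) =
    (\<Oplus>\<^bsub>X \<otimes>\<^sub>\<complex> C\<^esub>s\<in>S. vtens X C (slice X (\<xi> s) x) (coeff s u))"
proof -
  note vXC = vspace_vtensor[OF X vC'] and bil = vtens_bilinear[OF X vC']
  note su = slice_linear[OF vC' vV \<xi>_dual[OF u]]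
  note R = vtensor_map_linear[OF X vCV X vC' linear_id(1) su]
  interpret V: module complex_ring V by (rule vV)
  interpret C: module complex_ring C by (rule vC')
  interpret X: module complex_ring X by (rule X)
  interpret XC: module complex_ring "X \<otimes>\<^sub>\<complex> C" by (rule vXC)
  have lin: "(\<lambda>x. \<Oplus>\<^bsub>X \<otimes>\<^sub>\<complex> C\<^esub>s\<in>S. vtens X C (slice X (\<xi> s) x) (coeff s u)) \<in> lin (X \<otimes>\<^sub>\<complex> V) (X \<otimes>\<^sub>\<complex> C)"
    by (rule lin_finsum_map[OF vspace_vtensor[OF X vV] vXC],
        rule bilinear_comp_left[OF bil coeff_closed[OF _ u] slice_linear[OF X vV \<xi>_dual]])
  show ?thesis
  proof (rule vtensor_ext[OF X vV linear_comp[OF vtensor_map_linear[OF X vV X vCV linear_id(1) lcoact_linear] R]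
        lin vXC _ x])
    fix m v assume mv: "m \<in> carrier X" "v \<in> carrier V"
    have "slice C (\<xi> u) (lcoact V v) = slice C (\<xi> u) (lcoact V (\<Oplus>\<^bsub>V\<^esub>s\<in>S. \<xi> s v \<odot>\<^bsub>V\<^esub> s))"
      using expansion[OF mv(2)] by simp
    also have "\<dots> = (\<Oplus>\<^bsub>C\<^esub>s\<in>S. slice C (\<xi> u) (lcoact V (\<xi> s v \<odot>\<^bsub>V\<^esub> s)))"
      by (rule lin_finsum[OF linear_comp[OF lcoact_linear su] vV vC']) (use S_in in auto)
    also have "\<dots> = (\<Oplus>\<^bsub>C\<^esub>s\<in>S. \<xi> s v \<odot>\<^bsub>C\<^esub> coeff s u)"
      by (rule C.finsum_cong')
        (use S_in coeff_closed u in \<open>auto simp: lin_smult[OF linear_comp[OF lcoact_linear su]] coeff_def\<close>)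
    finally have *: "slice C (\<xi> u) (lcoact V v) = (\<Oplus>\<^bsub>C\<^esub>s\<in>S. \<xi> s v \<odot>\<^bsub>C\<^esub> coeff s u)" .
    have "vtensor_map X C id (slice C (\<xi> u)) (vtensor_map X (C \<otimes>\<^sub>\<complex> V) id (lcoact V) (vtens X V m v)) =
        vtens X C m (\<Oplus>\<^bsub>C\<^esub>s\<in>S. \<xi> s v \<odot>\<^bsub>C\<^esub> coeff s u)"
      using mv linear_closed[OF lcoact_linear mv(2)]
      by (simp add: vtensor_map_vtens[OF X vV X vCV linear_id(1) lcoact_linear]
          vtensor_map_vtens[OF X vCV X vC' linear_id(1) su] *)
    also have "\<dots> = (\<Oplus>\<^bsub>X \<otimes>\<^sub>\<complex> C\<^esub>s\<in>S. vtens X C m (\<xi> s v \<odot>\<^bsub>C\<^esub> coeff s u))"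
      by (rule lin_finsum[OF bilinear_right[OF bil mv(1)] vC' vXC]) (use coeff_closed u in auto)
    also have "\<dots> = (\<Oplus>\<^bsub>X \<otimes>\<^sub>\<complex> C\<^esub>s\<in>S. vtens X C (slice X (\<xi> s) (vtens X V m v)) (coeff s u))"
      by (rule XC.finsum_cong')
        (use mv coeff_closed u in \<open>auto simp: slice_vtens[OF X vV \<xi>_dual] vtens_smult_right[OF X vC']
          intro!: vtens_closed[OF X vC']\<close>)
    finally show "vtensor_map X C id (slice C (\<xi> u)) (vtensor_map X (C \<otimes>\<^sub>\<complex> V) id (lcoact V) (vtens X V m v)) =
        (\<Oplus>\<^bsub>X \<otimes>\<^sub>\<complex> C\<^esub>s\<in>S. vtens X C (slice X (\<xi> s) (vtens X V m v)) (coeff s u))" .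
  qed
qed

lemma coordinates_separate:
  assumes X: "vspace X" and Y: "Y \<in> carrier (X \<otimes>\<^sub>\<complex> (C \<otimes>\<^sub>\<complex> V))" "Z \<in> carrier (X \<otimes>\<^sub>\<complex> (C \<otimes>\<^sub>\<complex> V))"
    and eq: "\<And>u. u \<in> S \<Longrightarrow> vtensor_map X C id (slice C (\<xi> u)) Y = vtensor_map X C id (slice C (\<xi> u)) Z"
  shows "Y = Z"
proof -
  note vXC = vspace_vtensor[OF X vC'] and vXCV = vspace_vtensor[OF X vCV] and bil = vtens_bilinear[OF X vCV]
  interpret XCV: module complex_ring "X \<otimes>\<^sub>\<complex> (C \<otimes>\<^sub>\<complex> V)" by (rule vXCV)
  let ?R = "\<lambda>u. vtensor_map X C id (slice C (\<xi> u))"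
  let ?J = "\<lambda>u. vtensor_map X (C \<otimes>\<^sub>\<complex> V) id (\<lambda>c. vtens C V c u)"
  have su: "slice C (\<xi> u) \<in> lin (C \<otimes>\<^sub>\<complex> V) C" and ju: "(\<lambda>c. vtens C V c u) \<in> lin C (C \<otimes>\<^sub>\<complex> V)" if "u \<in> S" for u
    by (rule slice_linear[OF vC' vV \<xi>_dual[OF that]], rule bilinear_left[OF vtens_bilinear[OF vC' vV] S_in[OF that]])
  have R: "?R u \<in> lin (X \<otimes>\<^sub>\<complex> (C \<otimes>\<^sub>\<complex> V)) (X \<otimes>\<^sub>\<complex> C)" and J: "?J u \<in> lin (X \<otimes>\<^sub>\<complex> C) (X \<otimes>\<^sub>\<complex> (C \<otimes>\<^sub>\<complex> V))"
    if "u \<in> S" for u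
    by (rule vtensor_map_linear[OF X vCV X vC' linear_id(1) su[OF that]],
        rule vtensor_map_linear[OF X vC' X vCV linear_id(1) ju[OF that]])
  have "W = (\<Oplus>\<^bsub>X \<otimes>\<^sub>\<complex> (C \<otimes>\<^sub>\<complex> V)\<^esub>u\<in>S. ?J u (?R u W))" if W: "W \<in> carrier (X \<otimes>\<^sub>\<complex> (C \<otimes>\<^sub>\<complex> V))" for W
  proof (rule vtensor_ext[OF X vCV linear_id(2) lin_finsum_map[OF vXCV vXCV linear_comp[OF R J]] vXCV _ W])
    fix m w assume mw: "m \<in> carrier X" "w \<in> carrier (C \<otimes>\<^sub>\<complex> V)"
    have "vtens X (C \<otimes>\<^sub>\<complex> V) m w = vtens X (C \<otimes>\<^sub>\<complex> V) m (\<Oplus>\<^bsub>C \<otimes>\<^sub>\<complex> V\<^esub>u\<in>S. vtens C V (slice C (\<xi> u) w) u)"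
      using expand_tensor[OF vC' mw(2)] by simp
    also have "\<dots> = (\<Oplus>\<^bsub>X \<otimes>\<^sub>\<complex> (C \<otimes>\<^sub>\<complex> V)\<^esub>u\<in>S. vtens X (C \<otimes>\<^sub>\<complex> V) m (vtens C V (slice C (\<xi> u) w) u))"
      by (rule lin_finsum[OF bilinear_right[OF bil mw(1)] vCV vXCV])
        (use S_in mw linear_closed[OF su] in \<open>auto intro!: vtens_closed[OF vC' vV]\<close>)
    also have "\<dots> = (\<Oplus>\<^bsub>X \<otimes>\<^sub>\<complex> (C \<otimes>\<^sub>\<complex> V)\<^esub>u\<in>S. ?J u (?R u (vtens X (C \<otimes>\<^sub>\<complex> V) m w)))"
      by (rule XCV.finsum_cong')
        (use mw linear_closed[OF su] linear_closed[OF J] vtens_closed[OF X vC'] in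
          \<open>auto simp: vtensor_map_vtens[OF X vCV X vC' linear_id(1) su] vtensor_map_vtens[OF X vC' X vCV linear_id(1) ju]
            intro!: vtens_closed[OF X vCV] vtens_closed[OF vC' vV] S_in\<close>)
    finally show "vtens X (C \<otimes>\<^sub>\<complex> V) m w = (\<Oplus>\<^bsub>X \<otimes>\<^sub>\<complex> (C \<otimes>\<^sub>\<complex> V)\<^esub>u\<in>S. ?J u (?R u (vtens X (C \<otimes>\<^sub>\<complex> V) m w)))" .
  qed
  note exp = this
  have "(\<Oplus>\<^bsub>X \<otimes>\<^sub>\<complex> (C \<otimes>\<^sub>\<complex> V)\<^esub>u\<in>S. ?J u (?R u Y)) = (\<Oplus>\<^bsub>X \<otimes>\<^sub>\<complex> (C \<otimes>\<^sub>\<complex> V)\<^esub>u\<in>S. ?J u (?R u Z))"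
    by (rule XCV.finsum_cong') (use linear_closed[OF linear_comp[OF R J]] Y eq in auto)
  then show ?thesis
    using exp[OF Y(1)] exp[OF Y(2)] by simp
qed

text \<open>
  Coassociativity of \<open>V\<close> says that \<open>\<rho>(s)\<close> satisfies the cotensor condition over \<open>C\<close>; these are its coordinates.
\<close>

lemma comult_coeff:
  assumes "s \<in> S" "u \<in> S"
  shows "comult C (coeff s u) = (\<Oplus>\<^bsub>C \<otimes>\<^sub>\<complex> C\<^esub>r\<in>S. vtens C C (coeff s r) (coeff r u))"
proof -
  note sV = S_in[OF assms(1)]
  note \<rho>s = linear_closed[OF lcoact_linear sV]
  have "vassoc C C V (vtensor_map (C \<otimes>\<^sub>\<complex> C) V (comult C) id (lcoact V s)) =
      vtensor_map C (C \<otimes>\<^sub>\<complex> V) id (lcoact V) (lcoact V s)"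
    using comodule sV by (simp add: left_comodule_def)
  then show ?thesis
    using coordinate_right_coaction[OF vC' comult_linear' \<rho>s assms(2)]
      coordinate_left_coaction[OF vC' \<rho>s assms(2)]
    by (simp add: coeff_def)
qed

end

locale associated_module = galois_extension C A e + comodule_basis C V S \<xi>
  for C :: "'c coalgebra" and A :: "('c, 'a) right_comodule" and e :: 'c
    and V :: "('c, 'v) left_comodule" and S \<xi>
begin

abbreviation "P \<equiv> cotensor C A V"

lemma vAV: "vspace (A \<otimes>\<^sub>\<complex> V)"
  by (rule vspace_vtensor[OF vA vV])

lemma P_simps [simp]:
  "add P = add (A \<otimes>\<^sub>\<complex> V)" "zero P = zero (A \<otimes>\<^sub>\<complex> V)" "b \<odot>\<^bsub>P\<^esub> x = act b x V"
  using same_additive_left_vtensor[of A V] by (simp_all add: cotensor_def same_additive_def)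

lemma coord_linear: "s \<in> S \<Longrightarrow> slice A (\<xi> s) \<in> lin (A \<otimes>\<^sub>\<complex> V) A"
  by (rule slice_linear[OF vA vV \<xi>_dual])

lemmas coord_closed = linear_closed[OF coord_linear]

lemma P_closed: "x \<in> carrier P \<Longrightarrow> x \<in> carrier (A \<otimes>\<^sub>\<complex> V)"
  by (simp add: cotensor_def)

text \<open>
  The two sides of the cotensor condition are elements of \<open>A \<otimes> (C \<otimes> V)\<close>, so they are compared coordinate by
  coordinate with respect to the basis of \<open>V\<close>.
\<close>

lemma cotensor_iff:
  "x \<in> carrier P \<longleftrightarrow> x \<in> carrier (A \<otimes>\<^sub>\<complex> V) \<and>
    (\<forall>u\<in>S. rcoact A (slice A (\<xi> u) x) = (\<Oplus>\<^bsub>A \<otimes>\<^sub>\<complex> C\<^esub>s\<in>S. vtens A C (slice A (\<xi> s) x) (coeff s u)))"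
proof -
  let ?l = "vassoc A C V (vtensor_map (A \<otimes>\<^sub>\<complex> C) V (rcoact A) id x)"
  let ?r = "vtensor_map A (C \<otimes>\<^sub>\<complex> V) id (lcoact V) x"
  interpret T: module complex_ring "A \<otimes>\<^sub>\<complex> (C \<otimes>\<^sub>\<complex> V)" by (rule vspace_vtensor[OF vA vCV])
  have c: "?l \<in> carrier (A \<otimes>\<^sub>\<complex> (C \<otimes>\<^sub>\<complex> V))" "?r \<in> carrier (A \<otimes>\<^sub>\<complex> (C \<otimes>\<^sub>\<complex> V))"
    if "x \<in> carrier (A \<otimes>\<^sub>\<complex> V)"
    using linear_closed[OF linear_comp[OF vtensor_map_linear[OF vA vV vAC vV coact_linear linear_id(1)]
          vassoc_linear[OF vA vC vV]] that]
      linear_closed[OF vtensor_map_linear[OF vA vV vA vCV linear_id(1) lcoact_linear] that]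
    by auto
  have "x \<in> carrier P \<longleftrightarrow> x \<in> carrier (A \<otimes>\<^sub>\<complex> V) \<and> ?l = ?r"
    using c T.diff_zero_imp_eq[of ?l ?r] by (auto simp: cotensor_def a_minus_def T.r_neg)
  moreover have "?l = ?r \<longleftrightarrow>
      (\<forall>u\<in>S. rcoact A (slice A (\<xi> u) x) = (\<Oplus>\<^bsub>A \<otimes>\<^sub>\<complex> C\<^esub>s\<in>S. vtens A C (slice A (\<xi> s) x) (coeff s u)))"
    if x: "x \<in> carrier (A \<otimes>\<^sub>\<complex> V)"
    using coordinates_separate[OF vA c[OF x]] coordinate_right_coaction[OF vA coact_linear x]
      coordinate_left_coaction[OF vA x]
    by auto
  ultimately show ?thesis by blast
qed

lemma coact_coord:
  "\<lbrakk>x \<in> carrier P; u \<in> S\<rbrakk> \<Longrightarrow>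
    rcoact A (slice A (\<xi> u) x) = (\<Oplus>\<^bsub>A \<otimes>\<^sub>\<complex> C\<^esub>s\<in>S. vtens A C (slice A (\<xi> s) x) (coeff s u))"
  by (simp add: cotensor_iff)

lemma coord_act:
  "\<lbrakk>s \<in> S; a \<in> carrier A; x \<in> carrier (A \<otimes>\<^sub>\<complex> V)\<rbrakk> \<Longrightarrow> slice A (\<xi> s) (act a x V) = a \<otimes>\<^bsub>A\<^esub> slice A (\<xi> s) x"
  by (rule slice_left_tensor[OF alg vV \<xi>_dual])

lemmas actV_bil = left_tensor_bilinear[OF alg vV]
lemmas actV_closed = bilinear_closed[OF actV_bil]

lemma vtens_coeff_closed:
  "\<lbrakk>x \<in> carrier (A \<otimes>\<^sub>\<complex> V); s \<in> S; u \<in> S\<rbrakk> \<Longrightarrow> vtens A C (slice A (\<xi> s) x) (coeff s u) \<in> carrier (A \<otimes>\<^sub>\<complex> C)"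
  by (intro vtens_closed[OF vA vC] coord_closed coeff_closed)

lemma P_act:
  assumes b: "b \<in> carrier B" and x: "x \<in> carrier P"
  shows "act b x V \<in> carrier P"
  unfolding cotensor_iff
proof (intro conjI ballI)
  note bA = B_closed[OF b] and xV = P_closed[OF x]
  interpret AC: module complex_ring "A \<otimes>\<^sub>\<complex> C" by (rule vAC)
  show "act b x V \<in> carrier (A \<otimes>\<^sub>\<complex> V)"
    by (rule actV_closed[OF bA xV])
  fix u assume u: "u \<in> S"
  have "rcoact A (slice A (\<xi> u) (act b x V)) = act b (\<Oplus>\<^bsub>A \<otimes>\<^sub>\<complex> C\<^esub>s\<in>S. vtens A C (slice A (\<xi> s) x) (coeff s u)) C"
    using u b bA x xV by (simp add: coord_act coact_B_mult coord_closed coact_coord)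
  also have "\<dots> = (\<Oplus>\<^bsub>A \<otimes>\<^sub>\<complex> C\<^esub>s\<in>S. act b (vtens A C (slice A (\<xi> s) x) (coeff s u)) C)"
    by (rule lin_finsum[OF bilinear_right[OF act_bil bA] vAC vAC]) (use xV u vtens_coeff_closed in auto)
  also have "\<dots> = (\<Oplus>\<^bsub>A \<otimes>\<^sub>\<complex> C\<^esub>s\<in>S. vtens A C (slice A (\<xi> s) (act b x V)) (coeff s u))"
    by (rule AC.finsum_cong')
      (use xV u bA in \<open>auto simp: coord_act left_tensor_smult_vtens[OF alg vC] coord_closed coeff_closed
        intro!: vtens_closed[OF vA vC]\<close>)
  finally show "rcoact A (slice A (\<xi> u) (act b x V)) =
      (\<Oplus>\<^bsub>A \<otimes>\<^sub>\<complex> C\<^esub>s\<in>S. vtens A C (slice A (\<xi> s) (act b x V)) (coeff s u))" .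
qed

lemma P_add:
  assumes x: "x \<in> carrier P" and y: "y \<in> carrier P"
  shows "x \<oplus>\<^bsub>A \<otimes>\<^sub>\<complex> V\<^esub> y \<in> carrier P"
  unfolding cotensor_iff
proof (intro conjI ballI)
  note xV = P_closed[OF x] and yV = P_closed[OF y]
  interpret AC: module complex_ring "A \<otimes>\<^sub>\<complex> C" by (rule vAC)
  interpret AV: module complex_ring "A \<otimes>\<^sub>\<complex> V" by (rule vAV)
  show "x \<oplus>\<^bsub>A \<otimes>\<^sub>\<complex> V\<^esub> y \<in> carrier (A \<otimes>\<^sub>\<complex> V)"
    using xV yV by simp
  fix u assume u: "u \<in> S"
  have "(\<Oplus>\<^bsub>A \<otimes>\<^sub>\<complex> C\<^esub>s\<in>S. vtens A C (slice A (\<xi> s) (x \<oplus>\<^bsub>A \<otimes>\<^sub>\<complex> V\<^esub> y)) (coeff s u)) =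
      (\<Oplus>\<^bsub>A \<otimes>\<^sub>\<complex> C\<^esub>s\<in>S. vtens A C (slice A (\<xi> s) x) (coeff s u) \<oplus>\<^bsub>A \<otimes>\<^sub>\<complex> C\<^esub> vtens A C (slice A (\<xi> s) y) (coeff s u))"
    by (rule AC.finsum_cong')
      (use xV yV u in \<open>auto simp: linear_add[OF coord_linear] coord_closed coeff_closed
        linear_add[OF bilinear_left[OF vtens_bilinear[OF vA vC]]] vtens_coeff_closed\<close>)
  also have "\<dots> = rcoact A (slice A (\<xi> u) x) \<oplus>\<^bsub>A \<otimes>\<^sub>\<complex> C\<^esub> rcoact A (slice A (\<xi> u) y)"
    unfolding coact_coord[OF x u] coact_coord[OF y u]
    by (rule AC.finsum_addf) (use xV yV u vtens_coeff_closed in auto)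
  also have "\<dots> = rcoact A (slice A (\<xi> u) (x \<oplus>\<^bsub>A \<otimes>\<^sub>\<complex> V\<^esub> y))"
    using u xV yV by (simp add: linear_add[OF coord_linear] linear_add[OF coact_linear] coord_closed)
  finally show "rcoact A (slice A (\<xi> u) (x \<oplus>\<^bsub>A \<otimes>\<^sub>\<complex> V\<^esub> y)) =
      (\<Oplus>\<^bsub>A \<otimes>\<^sub>\<complex> C\<^esub>s\<in>S. vtens A C (slice A (\<xi> s) (x \<oplus>\<^bsub>A \<otimes>\<^sub>\<complex> V\<^esub> y)) (coeff s u))" ..
qed

lemma left_module_AV: "left_module A (left_tensor complex_ring A V)"
  by (rule left_tensor_module[OF alg vV])

lemma left_tensor_simps:
  "carrier (left_tensor complex_ring A V) = carrier (A \<otimes>\<^sub>\<complex> V)"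
  "add (left_tensor complex_ring A V) = add (A \<otimes>\<^sub>\<complex> V)"
  "zero (left_tensor complex_ring A V) = zero (A \<otimes>\<^sub>\<complex> V)"
  using same_additive_left_vtensor[of A V] by (auto simp: same_additive_def)

lemma P_zero: "\<zero>\<^bsub>A \<otimes>\<^sub>\<complex> V\<^esub> \<in> carrier P"
  unfolding cotensor_iff
proof (intro conjI ballI)
  interpret AC: module complex_ring "A \<otimes>\<^sub>\<complex> C" by (rule vAC)
  interpret AV: module complex_ring "A \<otimes>\<^sub>\<complex> V" by (rule vAV)
  show "\<zero>\<^bsub>A \<otimes>\<^sub>\<complex> V\<^esub> \<in> carrier (A \<otimes>\<^sub>\<complex> V)" by simp
  fix u assume u: "u \<in> S"
  have "(\<Oplus>\<^bsub>A \<otimes>\<^sub>\<complex> C\<^esub>s\<in>S. vtens A C (slice A (\<xi> s) \<zero>\<^bsub>A \<otimes>\<^sub>\<complex> V\<^esub>) (coeff s u)) = (\<Oplus>\<^bsub>A \<otimes>\<^sub>\<complex> C\<^esub>s\<in>S. \<zero>\<^bsub>A \<otimes>\<^sub>\<complex> C\<^esub>)"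
    by (rule AC.finsum_cong')
      (use u in \<open>auto simp: lin_zero[OF coord_linear vAV vA] coeff_closed
        lin_zero[OF bilinear_left[OF vtens_bilinear[OF vA vC]] vA vAC]\<close>)
  then show "rcoact A (slice A (\<xi> u) \<zero>\<^bsub>A \<otimes>\<^sub>\<complex> V\<^esub>) =
      (\<Oplus>\<^bsub>A \<otimes>\<^sub>\<complex> C\<^esub>s\<in>S. vtens A C (slice A (\<xi> s) \<zero>\<^bsub>A \<otimes>\<^sub>\<complex> V\<^esub>) (coeff s u))"
    using u by (simp add: lin_zero[OF coord_linear vAV vA] lin_zero[OF coact_linear vA vAC])
qed

lemma left_module_P: "left_module B P"
proof -
  interpret M: left_module A "left_tensor complex_ring A V" by (rule left_module_AV)
  interpret AV: module complex_ring "A \<otimes>\<^sub>\<complex> V" by (rule vAV)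
  have ab: "abelian_group P"
  proof (rule abelian_groupI)
    fix x assume x: "x \<in> carrier P"
    have "act (\<ominus>\<^bsub>A\<^esub> \<one>\<^bsub>A\<^esub>) x V \<oplus>\<^bsub>A \<otimes>\<^sub>\<complex> V\<^esub> x = act (\<ominus>\<^bsub>A\<^esub> \<one>\<^bsub>A\<^esub> \<oplus>\<^bsub>A\<^esub> \<one>\<^bsub>A\<^esub>) x V"
      using P_closed[OF x] M.smult_l_distr[of "\<ominus>\<^bsub>A\<^esub> \<one>\<^bsub>A\<^esub>" "\<one>\<^bsub>A\<^esub>" x] M.smult_one[of x]
      by (simp add: left_tensor_simps)
    also have "\<dots> = \<zero>\<^bsub>A \<otimes>\<^sub>\<complex> V\<^esub>"
      using left_module_smult_zero(1)[OF left_module_AV, of x] P_closed[OF x]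
      by (simp add: left_tensor_simps A.l_neg)
    finally show "\<exists>y\<in>carrier P. y \<oplus>\<^bsub>P\<^esub> x = \<zero>\<^bsub>P\<^esub>"
      using P_act[OF subringE(5)[OF B_subring subringE(3)[OF B_subring]] x] by (intro bexI) simp_all
  qed (simp_all add: P_add P_zero P_closed AV.a_ac)
  show ?thesis
    by (intro left_module.intro left_module_axioms.intro ring_B ab)
      (simp_all add: P_act P_closed B_closed linear_add[OF bilinear_left[OF actV_bil]]
        linear_add[OF bilinear_right[OF actV_bil]] left_tensor_smult_mult[OF alg vV]
        left_tensor_smult_one[OF alg vV])
qed

end

subsection \<open>A finite dual basis from the strong connection\<close>

locale split_associated_module = split_galois_extension C A e s + associated_module C A e V S \<xi>
  for C :: "'c coalgebra" and A :: "('c, 'a) right_comodule" and e :: 'c and s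
    and V :: "('c, 'v) left_comodule" and S \<xi>
begin

lemma vAAV: "vspace (A \<otimes>\<^sub>\<complex> (A \<otimes>\<^sub>\<complex> V))"
  by (rule vspace_vtensor[OF vA vAV])

lemma tail_linear: "u \<in> S \<Longrightarrow> (\<lambda>a. vtens A V a u) \<in> lin A (A \<otimes>\<^sub>\<complex> V)"
  by (rule bilinear_left[OF vtens_bilinear[OF vA vV] S_in])

abbreviation insert_tail :: "'v \<Rightarrow> ('a, 'a) tensor \<Rightarrow> ('a, ('a, 'v) tensor) tensor" where
  "insert_tail u \<equiv> vtensor_map A (A \<otimes>\<^sub>\<complex> V) id (\<lambda>a. vtens A V a u)"

lemma insert_tail_linear: "u \<in> S \<Longrightarrow> insert_tail u \<in> lin (A \<otimes>\<^sub>\<complex> A) (A \<otimes>\<^sub>\<complex> (A \<otimes>\<^sub>\<complex> V))"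
  by (rule vtensor_map_linear[OF vA vA vA vAV linear_id(1) tail_linear])

lemma insert_tail_vtens:
  "\<lbrakk>u \<in> S; x \<in> carrier A; y \<in> carrier A\<rbrakk>
    \<Longrightarrow> insert_tail u (vtens A A x y) = vtens A (A \<otimes>\<^sub>\<complex> V) x (vtens A V y u)"
  by (simp add: vtensor_map_vtens[OF vA vA vA vAV linear_id(1) tail_linear])

text \<open>The tensor \<open>\<ell>(r\<^sub>(\<^sub>-\<^sub>1\<^sub>)) \<otimes> r\<^sub>(\<^sub>0\<^sub>)\<close> in \<open>A \<otimes> (A \<otimes> V)\<close>, for a basis vector \<open>r\<close> of \<open>V\<close>.\<close>

definition kernel_tensor :: "'v \<Rightarrow> ('a, ('a, 'v) tensor) tensor" where
  "kernel_tensor r = (\<Oplus>\<^bsub>A \<otimes>\<^sub>\<complex> (A \<otimes>\<^sub>\<complex> V)\<^esub>u\<in>S. insert_tail u (ell (coeff r u)))"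

lemma insert_ell_closed:
  "\<lbrakk>r \<in> S; u \<in> S\<rbrakk> \<Longrightarrow> insert_tail u (ell (coeff r u)) \<in> carrier (A \<otimes>\<^sub>\<complex> (A \<otimes>\<^sub>\<complex> V))"
  by (intro linear_closed[OF insert_tail_linear] ell_closed coeff_closed)

lemma kernel_tensor_closed: "r \<in> S \<Longrightarrow> kernel_tensor r \<in> carrier (A \<otimes>\<^sub>\<complex> (A \<otimes>\<^sub>\<complex> V))"
proof -
  interpret T: module complex_ring "A \<otimes>\<^sub>\<complex> (A \<otimes>\<^sub>\<complex> V)" by (rule vAAV)
  show "r \<in> S \<Longrightarrow> kernel_tensor r \<in> carrier (A \<otimes>\<^sub>\<complex> (A \<otimes>\<^sub>\<complex> V))"
    unfolding kernel_tensor_def by (rule T.finsum_closed) (auto intro: insert_ell_closed)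
qed

lemma slice_kernel_tensor:
  assumes \<theta>: "\<theta> \<in> dual (A \<otimes>\<^sub>\<complex> V)" and r: "r \<in> S"
  shows "slice A \<theta> (kernel_tensor r) = (\<Oplus>\<^bsub>A\<^esub>u\<in>S. slice A (\<lambda>a. \<theta> (vtens A V a u)) (ell (coeff r u)))"
proof -
  note sl = slice_linear[OF vA vAV \<theta>]
  have \<theta>u: "(\<lambda>a. \<theta> (vtens A V a u)) \<in> dual A" if "u \<in> S" for u
    by (rule linear_comp[OF tail_linear[OF that] \<theta>])
  have "slice A \<theta> (insert_tail u X) = slice A (\<lambda>a. \<theta> (vtens A V a u)) X"
    if u: "u \<in> S" and X: "X \<in> carrier (A \<otimes>\<^sub>\<complex> A)" for u X
    by (rule vtensor_ext[OF vA vA linear_comp[OF insert_tail_linear[OF u] sl] slice_linear[OF vA vA \<theta>u[OF u]] vA _ X])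
      (use u in \<open>simp add: insert_tail_vtens slice_vtens[OF vA vAV \<theta>] slice_vtens[OF vA vA \<theta>u[OF u]]
        vtens_closed[OF vA vV] S_in\<close>)
  moreover have "slice A \<theta> (kernel_tensor r) = (\<Oplus>\<^bsub>A\<^esub>u\<in>S. slice A \<theta> (insert_tail u (ell (coeff r u))))"
    unfolding kernel_tensor_def by (rule lin_finsum[OF sl vAAV vA]) (use r insert_ell_closed in auto)
  moreover have "\<dots> = (\<Oplus>\<^bsub>A\<^esub>u\<in>S. slice A (\<lambda>a. \<theta> (vtens A V a u)) (ell (coeff r u)))"
    by (rule A.finsum_cong')
      (use r calculation(1) \<theta>u in \<open>auto simp: ell_closed coeff_closed intro!: linear_closed[OF slice_linear[OF vA vA]]\<close>)
  ultimately show ?thesis by simp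
qed

text \<open>
  A common decomposition of all kernel tensors, with second legs \<open>F k\<close> independent of \<open>r\<close>. The functional \<open>\<theta>\<close> of the
  last clause does not depend on \<open>r\<close> either: this is how properties of the strong connection pass to the first legs
  \<open>G k\<close>, and it follows from the linear independence of the \<open>F k\<close>.
\<close>

definition connection_basis ::
    "'j set \<Rightarrow> ('j \<Rightarrow> 'v \<Rightarrow> 'a) \<Rightarrow> ('j \<Rightarrow> ('a, 'v) tensor) \<Rightarrow> bool" where
  "connection_basis J G F \<longleftrightarrow> finite J \<and> (\<forall>k\<in>J. F k \<in> carrier P) \<and>
    (\<forall>k\<in>J. \<forall>r\<in>S. G k r \<in> carrier A) \<and>
    (\<forall>r\<in>S. kernel_tensor r = (\<Oplus>\<^bsub>A \<otimes>\<^sub>\<complex> (A \<otimes>\<^sub>\<complex> V)\<^esub>k\<in>J. vtens A (A \<otimes>\<^sub>\<complex> V) (G k r) (F k))) \<and>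
    (\<forall>k\<in>J. \<exists>\<theta>. \<theta> \<in> dual (A \<otimes>\<^sub>\<complex> V) \<and> (\<forall>r\<in>S. G k r = slice A \<theta> (kernel_tensor r)))"

text \<open>
  The cotensor product is the common kernel of the maps \<open>E1 - E2\<close> below, which measure the failure of the
  cotensor condition. They annihilate the second leg of the kernel tensor, because the strong connection
  is right colinear.
\<close>

lemma kernel_tensor_right:
  assumes \<eta>: "\<eta> \<in> dual A" and \<gamma>: "\<gamma> \<in> dual C" and u: "u \<in> S" and r: "r \<in> S"
  defines "E1 \<equiv> \<lambda>x. D \<gamma> (slice A (\<xi> u) x)"
    and "E2 \<equiv> \<lambda>x. \<Oplus>\<^bsub>A\<^esub>q\<in>S. \<gamma> (coeff q u) \<odot>\<^bsub>A\<^esub> slice A (\<xi> q) x"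
  shows "slice A (\<lambda>x. \<eta> (E1 x)) (kernel_tensor r) = slice A (\<lambda>x. \<eta> (E2 x)) (kernel_tensor r)"
proof -
  interpret AM: module complex_ring A by (rule vA)
  have E1: "E1 \<in> lin (A \<otimes>\<^sub>\<complex> V) A"
    unfolding E1_def by (rule linear_comp[OF coord_linear[OF u] D_linear[OF \<gamma>]])
  have E2: "E2 \<in> lin (A \<otimes>\<^sub>\<complex> V) A"
    unfolding E2_def by (rule lin_finsum_map[OF vAV vA lin_smult_right[OF vA coord_linear]])
  have \<eta>D: "(\<lambda>a. \<eta> (D \<gamma> a)) \<in> dual A"
    by (rule linear_comp[OF D_linear[OF \<gamma>] \<eta>])
  have zero: "(\<lambda>a. 0) \<in> dual A"
    by (rule linI) auto
  note ab = A.is_abelian_group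
  have "slice A (\<lambda>x. \<eta> (E1 x)) (kernel_tensor r) =
      (\<Oplus>\<^bsub>A\<^esub>q\<in>S. slice A (\<lambda>a. \<eta> (E1 (vtens A V a q))) (ell (coeff r q)))"
    by (rule slice_kernel_tensor[OF linear_comp[OF E1 \<eta>] r])
  also have "\<dots> = (\<Oplus>\<^bsub>A\<^esub>q\<in>S. if q = u then ell_slice (\<lambda>a. \<eta> (D \<gamma> a)) (coeff r u) else \<zero>\<^bsub>A\<^esub>)"
  proof (rule A.finsum_cong')
    fix q assume q: "q \<in> S"
    note X = ell_closed[OF coeff_closed[OF r q]]
    have E1q: "E1 (vtens A V a q) = (if q = u then D \<gamma> a else \<zero>\<^bsub>A\<^esub>)" if "a \<in> carrier A" for a
      using that q u AM.smult_one[of a] AM.smult_l_null[of a] lin_zero[OF D_linear[OF \<gamma>] vA vA]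
      by (simp add: E1_def slice_vtens[OF vA vV \<xi>_dual] S_in \<xi>_S)
    show "slice A (\<lambda>a. \<eta> (E1 (vtens A V a q))) (ell (coeff r q)) =
        (if q = u then ell_slice (\<lambda>a. \<eta> (D \<gamma> a)) (coeff r u) else \<zero>\<^bsub>A\<^esub>)"
    proof (cases "q = u")
      case True
      then show ?thesis
        using slice_cong[OF vA vA \<eta>D _ X, of "\<lambda>a. \<eta> (E1 (vtens A V a q))"] E1q
        by (simp add: ell_slice_eq[OF \<eta>D] coeff_closed r u)
    next
      case False
      have "slice A (\<lambda>a. \<eta> (E1 (vtens A V a q))) (ell (coeff r q)) = slice A (\<lambda>a. 0 * 0) (ell (coeff r q))"
        by (simp, rule slice_cong[OF vA vA zero _ X]) (simp add: E1q False lin_zero[OF \<eta> vA vspace_regular])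
      also have "\<dots> = \<zero>\<^bsub>A\<^esub>"
        using slice_scaled[OF vA vA zero X, of 0] linear_closed[OF slice_linear[OF vA vA zero] X]
          AM.smult_l_null by simp
      finally show ?thesis using False by simp
    qed
  qed (use linear_closed[OF ell_slice_linear[OF \<eta>D]] coeff_closed r u in auto)
  also have "\<dots> = ell_slice (\<lambda>a. \<eta> (D \<gamma> a)) (coeff r u)"
    by (rule A.finsum_delta) (use finite_S u r linear_closed[OF ell_slice_linear[OF \<eta>D]] coeff_closed in auto)
  also have "\<dots> = tensor_lift A (\<lambda>c d. \<gamma> d \<odot>\<^bsub>A\<^esub> ell_slice \<eta> c)
      (\<Oplus>\<^bsub>C \<otimes>\<^sub>\<complex> C\<^esub>q\<in>S. vtens C C (coeff r q) (coeff q u))"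
    using ell_right_colinear[OF \<eta> \<gamma> coeff_closed[OF r u]] comult_coeff[OF r u] by simp
  also have "\<dots> = (\<Oplus>\<^bsub>A\<^esub>q\<in>S. \<gamma> (coeff q u) \<odot>\<^bsub>A\<^esub> ell_slice \<eta> (coeff r q))"
  proof -
    have K: "(\<lambda>c d. \<gamma> d \<odot>\<^bsub>A\<^esub> ell_slice \<eta> c) \<in> bilinear_maps C C A"
      by (rule bilinear_flip[OF bilinear_comp[OF bilinear_smult[OF vA] \<gamma> ell_slice_linear[OF \<eta>]]])
    have "tensor_lift A (\<lambda>c d. \<gamma> d \<odot>\<^bsub>A\<^esub> ell_slice \<eta> c)
        (\<Oplus>\<^bsub>C \<otimes>\<^sub>\<complex> C\<^esub>q\<in>S. vtens C C (coeff r q) (coeff q u)) =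
        (\<Oplus>\<^bsub>A\<^esub>q\<in>S. tensor_lift A (\<lambda>c d. \<gamma> d \<odot>\<^bsub>A\<^esub> ell_slice \<eta> c) (vtens C C (coeff r q) (coeff q u)))"
      by (rule lin_finsum[OF vtensor_lift_linear[OF vC vC K vA] vspace_vtensor[OF vC vC] vA])
        (use r u coeff_closed in \<open>auto intro: vtens_closed[OF vC vC]\<close>)
    also have "\<dots> = (\<Oplus>\<^bsub>A\<^esub>q\<in>S. \<gamma> (coeff q u) \<odot>\<^bsub>A\<^esub> ell_slice \<eta> (coeff r q))"
      by (rule A.finsum_cong')
        (use r u coeff_closed linear_closed[OF ell_slice_linear[OF \<eta>]] in
          \<open>auto simp: vtensor_lift_vtens[OF vC vC K vA]\<close>)
    finally show ?thesis .
  qed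
  also have "\<dots> = (\<Oplus>\<^bsub>A\<^esub>q\<in>S. slice A (\<lambda>a. \<eta> (E2 (vtens A V a q))) (ell (coeff r q)))"
  proof (rule A.finsum_cong')
    fix q assume q: "q \<in> S"
    note X = ell_closed[OF coeff_closed[OF r q]]
    have E2q: "E2 (vtens A V a q) = \<gamma> (coeff q u) \<odot>\<^bsub>A\<^esub> a" if a: "a \<in> carrier A" for a
    proof -
      have "E2 (vtens A V a q) = (\<Oplus>\<^bsub>A\<^esub>p\<in>S. if p = q then \<gamma> (coeff q u) \<odot>\<^bsub>A\<^esub> a else \<zero>\<^bsub>A\<^esub>)"
        unfolding E2_def
        by (rule A.finsum_cong')
          (use a q AM.smult_one[of a] AM.smult_l_null[of a] in
            \<open>auto simp: slice_vtens[OF vA vV \<xi>_dual] S_in \<xi>_S AM.smult_r_null\<close>)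
      also have "\<dots> = \<gamma> (coeff q u) \<odot>\<^bsub>A\<^esub> a"
        by (rule A.finsum_delta) (use finite_S q a in auto)
      finally show ?thesis .
    qed
    have "(\<lambda>a. \<gamma> (coeff q u) * \<eta> a) \<in> dual A"
      using lin_smult_right[OF vspace_regular \<eta>] by simp
    then have "slice A (\<lambda>a. \<eta> (E2 (vtens A V a q))) (ell (coeff r q)) =
        slice A (\<lambda>a. \<gamma> (coeff q u) * \<eta> a) (ell (coeff r q))"
      by (rule slice_cong[OF vA vA _ _ X]) (simp add: E2q lin_smult[OF \<eta>])
    then show "\<gamma> (coeff q u) \<odot>\<^bsub>A\<^esub> ell_slice \<eta> (coeff r q) =
        slice A (\<lambda>a. \<eta> (E2 (vtens A V a q))) (ell (coeff r q))"
      using slice_scaled[OF vA vA \<eta> X] by (simp add: ell_slice_eq[OF \<eta>] coeff_closed r q)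
  next
    show "(\<lambda>q. slice A (\<lambda>a. \<eta> (E2 (vtens A V a q))) (ell (coeff r q))) \<in> S \<rightarrow> carrier A"
      by (auto intro!: linear_closed[OF slice_linear[OF vA vA linear_comp[OF tail_linear linear_comp[OF E2 \<eta>]]]]
          ell_closed coeff_closed r)
  qed simp
  also have "\<dots> = slice A (\<lambda>x. \<eta> (E2 x)) (kernel_tensor r)"
    by (rule slice_kernel_tensor[OF linear_comp[OF E2 \<eta>] r, symmetric])
  finally show ?thesis .
qed

text \<open>
  A shortest decomposition works. The independence of its first legs puts the second legs into the cotensor
  product, and a family dual to the independent second legs provides the functionals \<open>\<theta>\<close>.
\<close>

lemma connection_basis_exists:
  obtains J :: "('v \<times> nat) set" and G F where "connection_basis J G F"
proof -
  interpret AM: module complex_ring A by (rule vA)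
  interpret AC: module complex_ring "A \<otimes>\<^sub>\<complex> C" by (rule vAC)
  obtain J G F where J: "finite (J :: ('v \<times> nat) set)" and F: "\<And>k. k \<in> J \<Longrightarrow> F k \<in> carrier (A \<otimes>\<^sub>\<complex> V)"
    and G: "\<And>k r. \<lbrakk>k \<in> J; r \<in> S\<rbrakk> \<Longrightarrow> G k r \<in> carrier A"
    and sum: "\<And>r. r \<in> S \<Longrightarrow> kernel_tensor r = (\<Oplus>\<^bsub>A \<otimes>\<^sub>\<complex> (A \<otimes>\<^sub>\<complex> V)\<^esub>k\<in>J. vtens A (A \<otimes>\<^sub>\<complex> V) (G k r) (F k))"
    and indF: "independent_family (A \<otimes>\<^sub>\<complex> V) J F"
    and indG: "\<forall>z. (\<forall>r\<in>S. (\<Oplus>\<^bsub>A\<^esub>k\<in>J. z k \<odot>\<^bsub>A\<^esub> G k r) = \<zero>\<^bsub>A\<^esub>) \<longrightarrow> (\<forall>k\<in>J. z k = 0)"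
    by (rule minimal_decomposition[OF vA vAV finite_S, of kernel_tensor])
      (erule kernel_tensor_closed, rule that)
  have slice_sum: "slice A \<theta> (kernel_tensor r) = (\<Oplus>\<^bsub>A\<^esub>k\<in>J. \<theta> (F k) \<odot>\<^bsub>A\<^esub> G k r)"
    if \<theta>: "\<theta> \<in> dual (A \<otimes>\<^sub>\<complex> V)" and r: "r \<in> S" for \<theta> r
  proof -
    have "slice A \<theta> (kernel_tensor r) = (\<Oplus>\<^bsub>A\<^esub>k\<in>J. slice A \<theta> (vtens A (A \<otimes>\<^sub>\<complex> V) (G k r) (F k)))"
      unfolding sum[OF r] by (rule lin_finsum[OF slice_linear[OF vA vAV \<theta>] vAAV vA])
        (use F G r in \<open>auto intro: vtens_closed[OF vA vAV]\<close>)
    also have "\<dots> = (\<Oplus>\<^bsub>A\<^esub>k\<in>J. \<theta> (F k) \<odot>\<^bsub>A\<^esub> G k r)"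
      by (rule A.finsum_cong') (use F G r in \<open>auto simp: slice_vtens[OF vA vAV \<theta>]\<close>)
    finally show ?thesis .
  qed
  have "F k \<in> carrier P" if k: "k \<in> J" for k
    unfolding cotensor_iff
  proof (intro conjI ballI coact_eqI)
    fix u assume u: "u \<in> S"
    show "(\<Oplus>\<^bsub>A \<otimes>\<^sub>\<complex> C\<^esub>s\<in>S. vtens A C (slice A (\<xi> s) (F k)) (coeff s u)) \<in> carrier (A \<otimes>\<^sub>\<complex> C)"
      by (rule AC.finsum_closed) (use u F[OF k] vtens_coeff_closed in auto)
    show "slice A (\<xi> u) (F k) \<in> carrier A"
      by (rule coord_closed[OF u F[OF k]])
    fix \<gamma> assume \<gamma>: "\<gamma> \<in> dual C"
    let ?E1 = "\<lambda>x. D \<gamma> (slice A (\<xi> u) x)"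
    let ?E2 = "\<lambda>x. \<Oplus>\<^bsub>A\<^esub>q\<in>S. \<gamma> (coeff q u) \<odot>\<^bsub>A\<^esub> slice A (\<xi> q) x"
    have E: "?E1 \<in> lin (A \<otimes>\<^sub>\<complex> V) A" "?E2 \<in> lin (A \<otimes>\<^sub>\<complex> V) A"
      by (rule linear_comp[OF coord_linear[OF u] D_linear[OF \<gamma>]])
        (rule lin_finsum_map[OF vAV vA lin_smult_right[OF vA coord_linear]])
    have "?E1 (F k) = ?E2 (F k)"
    proof (rule dual_separates[OF vA linear_closed[OF E(1) F[OF k]] linear_closed[OF E(2) F[OF k]]])
      fix \<eta> assume \<eta>: "\<eta> \<in> dual A"
      note d = slice_diff[OF vA vAV linear_comp[OF E(1) \<eta>] linear_comp[OF E(2) \<eta>]]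
      have "(\<Oplus>\<^bsub>A\<^esub>k\<in>J. (\<eta> (?E1 (F k)) - \<eta> (?E2 (F k))) \<odot>\<^bsub>A\<^esub> G k r) = \<zero>\<^bsub>A\<^esub>" if r: "r \<in> S" for r
      proof -
        note t = kernel_tensor_closed[OF r]
        let ?d = "slice A (\<lambda>x. \<eta> (?E1 x) - \<eta> (?E2 x)) (kernel_tensor r)"
        have c: "?d \<in> carrier A" "slice A (\<lambda>x. \<eta> (?E2 x)) (kernel_tensor r) \<in> carrier A"
          by (rule linear_closed[OF slice_linear[OF vA vAV d(1)[OF t]] t],
              rule linear_closed[OF slice_linear[OF vA vAV linear_comp[OF E(2) \<eta>]] t])
        have "?d \<oplus>\<^bsub>A\<^esub> slice A (\<lambda>x. \<eta> (?E2 x)) (kernel_tensor r) = slice A (\<lambda>x. \<eta> (?E2 x)) (kernel_tensor r)"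
          using d(2)[OF t] kernel_tensor_right[OF \<eta> \<gamma> u r] by simp
        then have "?d = \<zero>\<^bsub>A\<^esub>"
          using c A.add.l_cancel_one'[of "slice A (\<lambda>x. \<eta> (?E2 x)) (kernel_tensor r)" ?d]
          by (simp add: A.a_comm)
        then show ?thesis
          using slice_sum[OF d(1)[OF t] r] by simp
      qed
      then have "\<forall>k\<in>J. \<eta> (?E1 (F k)) - \<eta> (?E2 (F k)) = 0"
        using indG[THEN spec, of "\<lambda>k. \<eta> (?E1 (F k)) - \<eta> (?E2 (F k))"] by simp
      with k show "\<eta> (?E1 (F k)) = \<eta> (?E2 (F k))" by simp
    qed
    also have "?E2 (F k) = slice A \<gamma> (\<Oplus>\<^bsub>A \<otimes>\<^sub>\<complex> C\<^esub>s\<in>S. vtens A C (slice A (\<xi> s) (F k)) (coeff s u))"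
    proof -
      have "slice A \<gamma> (\<Oplus>\<^bsub>A \<otimes>\<^sub>\<complex> C\<^esub>s\<in>S. vtens A C (slice A (\<xi> s) (F k)) (coeff s u)) =
          (\<Oplus>\<^bsub>A\<^esub>s\<in>S. slice A \<gamma> (vtens A C (slice A (\<xi> s) (F k)) (coeff s u)))"
        by (rule lin_finsum[OF slice_linear[OF vA vC \<gamma>] vAC vA]) (use u F[OF k] vtens_coeff_closed in auto)
      also have "\<dots> = ?E2 (F k)"
        by (rule A.finsum_cong') (use u F[OF k] in \<open>auto simp: slice_vtens[OF vA vC \<gamma>] coord_closed coeff_closed\<close>)
      finally show ?thesis ..
    qed
    finally show "D \<gamma> (slice A (\<xi> u) (F k)) =
        slice A \<gamma> (\<Oplus>\<^bsub>A \<otimes>\<^sub>\<complex> C\<^esub>s\<in>S. vtens A C (slice A (\<xi> s) (F k)) (coeff s u))" .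
  qed (rule F[OF k])
  moreover have "\<exists>\<theta>. \<theta> \<in> dual (A \<otimes>\<^sub>\<complex> V) \<and> (\<forall>r\<in>S. G k r = slice A \<theta> (kernel_tensor r))" if k: "k \<in> J" for k
  proof -
    obtain \<theta> where \<theta>: "\<And>k. k \<in> J \<Longrightarrow> \<theta> k \<in> dual (A \<otimes>\<^sub>\<complex> V)"
      "\<And>k l. \<lbrakk>k \<in> J; l \<in> J\<rbrakk> \<Longrightarrow> \<theta> k (F l) = (if k = l then 1 else 0)"
      by (rule dual_family[OF vAV J F indF], assumption, rule that)
    have "slice A (\<theta> k) (kernel_tensor r) = G k r" if r: "r \<in> S" for r
    proof -
      have "slice A (\<theta> k) (kernel_tensor r) = (\<Oplus>\<^bsub>A\<^esub>l\<in>J. if l = k then G k r else \<zero>\<^bsub>A\<^esub>)"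
        unfolding slice_sum[OF \<theta>(1)[OF k] r]
        by (rule A.finsum_cong') (use G r k \<theta>(2) AM.smult_one AM.smult_l_null in auto)
      also have "\<dots> = G k r"
        by (rule A.finsum_delta) (use J k G r in auto)
      finally show ?thesis .
    qed
    then show ?thesis
      using \<theta>(1)[OF k] by (intro exI[of _ "\<theta> k"]) simp
  qed
  ultimately have "connection_basis J G F"
    unfolding connection_basis_def using J G sum by (intro conjI ballI) blast+
  then show thesis by (rule that)
qed

end

locale principal_associated =
  principal_hom C A e s A' f + A: split_associated_module C A e s V S \<xi> + A': associated_module C A' e V S \<xi>
  for C :: "'c coalgebra" and A :: "('c, 'a) right_comodule" and e :: 'c and s
    and A' :: "('c, 'b) right_comodule" and f :: "'a \<Rightarrow> 'b"
    and V :: "('c, 'v) left_comodule" and S \<xi>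
begin

text \<open>
  For \<open>g = G k\<close>, where \<open>G\<close> and \<open>F\<close> decompose the kernel tensors, these are the coordinate functionals of a
  dual basis of \<open>A' \<box> V\<close>.
\<close>

definition phi :: "('v \<Rightarrow> 'a) \<Rightarrow> ('b, 'v) tensor \<Rightarrow> 'b" where
  "phi g x = (\<Oplus>\<^bsub>A'\<^esub>s\<in>S. slice A' (\<xi> s) x \<otimes>\<^bsub>A'\<^esub> f (g s))"

abbreviation "f_tensor \<equiv> vtensor_map A' V f id"

lemmas f_tensor_lin = f_tensor_linear[OF A.vV]

lemma f_tensor_P:
  assumes x: "x \<in> carrier A.P"
  shows "f_tensor x \<in> carrier A'.P"
  unfolding A'.cotensor_iff
proof (intro conjI ballI)
  note xV = A.P_closed[OF x]
  interpret AC: module complex_ring "A' \<otimes>\<^sub>\<complex> C" by (rule A'.vAC)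
  show "f_tensor x \<in> carrier (A' \<otimes>\<^sub>\<complex> V)"
    by (rule linear_closed[OF f_tensor_lin xV])
  fix u assume u: "u \<in> S"
  have "rcoact A' (slice A' (\<xi> u) (f_tensor x)) = vtensor_map A' C f id (rcoact A (slice A (\<xi> u) x))"
    using u xV by (simp add: slice_f_tensor[OF A.vV A.\<xi>_dual] f_coact A.coord_closed)
  also have "\<dots> = (\<Oplus>\<^bsub>A' \<otimes>\<^sub>\<complex> C\<^esub>r\<in>S. vtensor_map A' C f id (vtens A C (slice A (\<xi> r) x) (A.coeff r u)))"
    unfolding A.coact_coord[OF x u]
    by (rule lin_finsum[OF f_tensor_linear[OF A.vC] A.vAC A'.vAC]) (use xV u A.vtens_coeff_closed in auto)
  also have "\<dots> = (\<Oplus>\<^bsub>A' \<otimes>\<^sub>\<complex> C\<^esub>r\<in>S. vtens A' C (slice A' (\<xi> r) (f_tensor x)) (A.coeff r u))"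
    by (rule AC.finsum_cong')
      (use xV u in \<open>auto simp: f_tensor_vtens[OF A.vC] slice_f_tensor[OF A.vV A.\<xi>_dual] A.coord_closed A.coeff_closed
        f_closed intro!: vtens_closed[OF A'.vA A.vC]\<close>)
  finally show "rcoact A' (slice A' (\<xi> u) (f_tensor x)) =
      (\<Oplus>\<^bsub>A' \<otimes>\<^sub>\<complex> C\<^esub>r\<in>S. vtens A' C (slice A' (\<xi> r) (f_tensor x)) (A.coeff r u))" .
qed

text \<open>
  Along \<open>f\<close> the functionals on \<open>A' \<box> V\<close> correspond to those on \<open>A \<box> V\<close>, which are the case \<open>f = id\<close>.
\<close>

lemma phi_f_tensor:
  assumes x: "x \<in> carrier (A \<otimes>\<^sub>\<complex> V)" and g: "\<And>r. r \<in> S \<Longrightarrow> g r \<in> carrier A"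
  shows "phi g (f_tensor x) = f (\<Oplus>\<^bsub>A\<^esub>r\<in>S. slice A (\<xi> r) x \<otimes>\<^bsub>A\<^esub> g r)"
proof -
  have "f (\<Oplus>\<^bsub>A\<^esub>r\<in>S. slice A (\<xi> r) x \<otimes>\<^bsub>A\<^esub> g r) = (\<Oplus>\<^bsub>A'\<^esub>r\<in>S. f (slice A (\<xi> r) x \<otimes>\<^bsub>A\<^esub> g r))"
    by (rule lin_finsum[OF f_linear A.vA A'.vA]) (use x g A.coord_closed in auto)
  also have "\<dots> = phi g (f_tensor x)"
    unfolding phi_def
    by (rule A'.A.finsum_cong')
      (use x g in \<open>auto simp: slice_f_tensor[OF A.vV A.\<xi>_dual] f_mult A.coord_closed f_closed\<close>)
  finally show ?thesis ..
qed

lemma phi_summand_closed: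
  "\<lbrakk>x \<in> carrier (A' \<otimes>\<^sub>\<complex> V); g r \<in> carrier A; r \<in> S\<rbrakk> \<Longrightarrow> slice A' (\<xi> r) x \<otimes>\<^bsub>A'\<^esub> f (g r) \<in> carrier A'"
  by (intro A'.A.m_closed A'.coord_closed f_closed)

text \<open>
  By the last clause of \<open>connection_basis\<close>, \<open>phi (G k)\<close> arises from the map of \<open>hat_f_ell_invariant\<close> by
  contracting the second legs: the coordinates of \<open>x\<close>, combined with the matrix coefficients of \<open>V\<close>, give
  the coaction of \<open>A'\<close> on these coordinates, as \<open>x\<close> lies in the cotensor product.
\<close>

lemma phi_invariant:
  assumes cb: "A.connection_basis J G F" and k: "k \<in> J" and x: "x \<in> carrier A'.P"
  shows "phi (G k) x \<in> carrier A'.B"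
proof -
  obtain \<theta> where \<theta>: "\<theta> \<in> dual (A \<otimes>\<^sub>\<complex> V)" and G: "\<And>r. r \<in> S \<Longrightarrow> G k r = slice A \<theta> (A.kernel_tensor r)"
    using cb k unfolding A.connection_basis_def by blast
  note xV = A'.P_closed[OF x]
  interpret AM: module complex_ring A' by (rule A'.vA)
  let ?\<theta> = "\<lambda>u a. \<theta> (vtens A V a u)"
  have \<theta>u: "?\<theta> u \<in> dual A" if "u \<in> S" for u
    by (rule linear_comp[OF A.tail_linear[OF that] \<theta>])
  let ?L = "\<lambda>u c. f (A.ell_slice (?\<theta> u) c)"
  have L: "?L u \<in> lin C A'" if "u \<in> S" for u
    by (rule f_ell_linear[OF \<theta>u[OF that]])
  have fG: "f (G k r) = (\<Oplus>\<^bsub>A'\<^esub>u\<in>S. ?L u (A.coeff r u))" if r: "r \<in> S" for r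
  proof -
    have "G k r = (\<Oplus>\<^bsub>A\<^esub>u\<in>S. A.ell_slice (?\<theta> u) (A.coeff r u))"
      unfolding G[OF r] A.slice_kernel_tensor[OF \<theta> r]
      by (rule A.A.finsum_cong')
        (use r in \<open>auto simp: A.ell_slice_eq[OF \<theta>u] A.coeff_closed linear_closed[OF A.ell_slice_linear[OF \<theta>u]]\<close>)
    then show ?thesis
      using lin_finsum[OF f_linear A.vA A'.vA, of "\<lambda>u. A.ell_slice (?\<theta> u) (A.coeff r u)" S]
        linear_closed[OF A.ell_slice_linear[OF \<theta>u]] A.coeff_closed r by auto
  qed
  have "phi (G k) x = (\<Oplus>\<^bsub>A'\<^esub>r\<in>S. \<Oplus>\<^bsub>A'\<^esub>u\<in>S. slice A' (\<xi> r) x \<otimes>\<^bsub>A'\<^esub> ?L u (A.coeff r u))"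
    unfolding phi_def
  proof (rule A'.A.finsum_cong')
    fix r assume r: "r \<in> S"
    show "slice A' (\<xi> r) x \<otimes>\<^bsub>A'\<^esub> f (G k r) = (\<Oplus>\<^bsub>A'\<^esub>u\<in>S. slice A' (\<xi> r) x \<otimes>\<^bsub>A'\<^esub> ?L u (A.coeff r u))"
      unfolding fG[OF r]
      by (rule lin_finsum[OF algebra_mult_left_linear[OF A'.alg A'.coord_closed[OF r xV]] A'.vA A'.vA])
        (use r linear_closed[OF L] A.coeff_closed in auto)
  qed (use xV linear_closed[OF L] A.coeff_closed A'.coord_closed in \<open>auto intro!: A'.A.finsum_closed\<close>)
  also have "\<dots> = (\<Oplus>\<^bsub>A'\<^esub>u\<in>S. \<Oplus>\<^bsub>A'\<^esub>r\<in>S. slice A' (\<xi> r) x \<otimes>\<^bsub>A'\<^esub> ?L u (A.coeff r u))"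
    by (rule A'.A.finsum_swap[OF A.finite_S A.finite_S])
      (use xV linear_closed[OF L] A.coeff_closed A'.coord_closed in auto)
  also have "\<dots> = (\<Oplus>\<^bsub>A'\<^esub>u\<in>S. hat A' (?L u) (slice A' (\<xi> u) x))"
  proof (rule A'.A.finsum_cong')
    fix u assume u: "u \<in> S"
    have "hat A' (?L u) (slice A' (\<xi> u) x) =
        (\<Oplus>\<^bsub>A'\<^esub>r\<in>S. conv A' (?L u) (vtens A' C (slice A' (\<xi> r) x) (A.coeff r u)))"
      unfolding hat_def A'.coact_coord[OF x u]
      by (rule lin_finsum[OF A'.conv_linear[OF L[OF u]] A'.vAC A'.vA]) (use xV u A'.vtens_coeff_closed in auto)
    also have "\<dots> = (\<Oplus>\<^bsub>A'\<^esub>r\<in>S. slice A' (\<xi> r) x \<otimes>\<^bsub>A'\<^esub> ?L u (A.coeff r u))"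
      by (rule A'.A.finsum_cong')
        (use xV u linear_closed[OF L[OF u]] in \<open>auto simp: A'.conv_vtens[OF L[OF u]] A'.coord_closed A.coeff_closed\<close>)
    finally show "(\<Oplus>\<^bsub>A'\<^esub>r\<in>S. slice A' (\<xi> r) x \<otimes>\<^bsub>A'\<^esub> ?L u (A.coeff r u)) = hat A' (?L u) (slice A' (\<xi> u) x)" ..
  qed (use xV linear_closed[OF A'.hat_linear[OF L]] A'.coord_closed in auto)
  also have "\<dots> \<in> carrier A'.B"
  proof -
    have "(\<Oplus>\<^bsub>A'\<^esub>u\<in>U. hat A' (?L u) (slice A' (\<xi> u) x)) \<in> carrier A'.B" if "finite U" "U \<subseteq> S" for U
      using that
    proof (induction U rule: finite_induct)
      case empty
      then show ?case using A'.B.zero_closed by simp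
    next
      case (insert u U)
      have h: "hat A' (?L u) (slice A' (\<xi> u) x) \<in> carrier A'.B" if "u \<in> S" for u
        by (rule hat_f_ell_invariant[OF \<theta>u[OF that] A'.coord_closed[OF that xV]])
      have "(\<Oplus>\<^bsub>A'\<^esub>u\<in>insert u U. hat A' (?L u) (slice A' (\<xi> u) x)) =
          hat A' (?L u) (slice A' (\<xi> u) x) \<oplus>\<^bsub>A'\<^esub> (\<Oplus>\<^bsub>A'\<^esub>u\<in>U. hat A' (?L u) (slice A' (\<xi> u) x))"
        by (rule A'.A.finsum_insert) (use insert h A'.B_closed in auto)
      then show ?case
        using insert h A'.B.a_closed[of "hat A' (?L u) (slice A' (\<xi> u) x)"] by simp
    qed
    then show ?thesis using A.finite_S by blast
  qed
  finally show ?thesis .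
qed

lemma phi_linear:
  assumes cb: "A.connection_basis J G F" and k: "k \<in> J"
  shows "phi (G k) \<in> linear_maps A'.B A'.P (regular_module A'.B)"
proof -
  have G: "\<And>r. r \<in> S \<Longrightarrow> G k r \<in> carrier A"
    using cb k by (auto simp: A.connection_basis_def)
  note bil = algebra_mult_bilinear[OF A'.alg]
  have lin: "phi (G k) \<in> lin (A' \<otimes>\<^sub>\<complex> V) A'"
    unfolding phi_def
    by (rule lin_finsum_map[OF A'.vAV A'.vA], rule bilinear_comp_left[OF bil f_closed[OF G] A'.coord_linear])
  have smult: "phi (G k) (A'.act b x V) = b \<otimes>\<^bsub>A'\<^esub> phi (G k) x" if b: "b \<in> carrier A'" and x: "x \<in> carrier (A' \<otimes>\<^sub>\<complex> V)" for b x
  proof -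
    have "b \<otimes>\<^bsub>A'\<^esub> phi (G k) x = (\<Oplus>\<^bsub>A'\<^esub>r\<in>S. b \<otimes>\<^bsub>A'\<^esub> (slice A' (\<xi> r) x \<otimes>\<^bsub>A'\<^esub> f (G k r)))"
      unfolding phi_def
      by (rule lin_finsum[OF algebra_mult_left_linear[OF A'.alg b] A'.vA A'.vA]) (use x G phi_summand_closed in auto)
    also have "\<dots> = phi (G k) (A'.act b x V)"
      unfolding phi_def
      by (rule A'.A.finsum_cong') (use x G b in \<open>auto simp: A'.coord_act A'.coord_closed f_closed A'.A.m_assoc\<close>)
    finally show ?thesis ..
  qed
  show ?thesis
    by (rule linear_mapsI[OF additive_mapsI])
      (use phi_invariant[OF cb k] in \<open>simp_all add: regular_module_def linear_add[OF lin] A'.P_closed smult A'.B_closed\<close>)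
qed

text \<open>Since \<open>\<ell>\<^sup>1(c) \<ell>\<^sup>2(c) = \<epsilon>(c)\<close>, multiplying the two legs of the kernel tensor together gives back \<open>x\<close>.\<close>

lemma phi_expansion:
  assumes cb: "A.connection_basis J G F" and x: "x \<in> carrier A'.P"
  shows "x = (\<Oplus>\<^bsub>A'.P\<^esub>k\<in>J. phi (G k) x \<odot>\<^bsub>A'.P\<^esub> f_tensor (F k))"
proof -
  have J: "finite J" and F: "\<And>k. k \<in> J \<Longrightarrow> F k \<in> carrier A.P"
    and G: "\<And>k r. \<lbrakk>k \<in> J; r \<in> S\<rbrakk> \<Longrightarrow> G k r \<in> carrier A"
    and sum: "\<And>r. r \<in> S \<Longrightarrow> A.kernel_tensor r = (\<Oplus>\<^bsub>A \<otimes>\<^sub>\<complex> (A \<otimes>\<^sub>\<complex> V)\<^esub>k\<in>J. vtens A (A \<otimes>\<^sub>\<complex> V) (G k r) (F k))"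
    using cb by (auto simp: A.connection_basis_def)
  note xV = A'.P_closed[OF x] and vAV' = A'.vAV and mb = algebra_mult_bilinear[OF A.alg]
  have FV: "f_tensor (F k) \<in> carrier (A' \<otimes>\<^sub>\<complex> V)" if "k \<in> J" for k
    by (rule linear_closed[OF f_tensor_lin A.P_closed[OF F[OF that]]])
  interpret AV: module complex_ring "A' \<otimes>\<^sub>\<complex> V" by (rule vAV')
  interpret AM: module complex_ring A' by (rule A'.vA)
  \<comment> \<open>
    The sum over \<open>r\<close> of the images of the kernel tensors under the maps \<open>?W r\<close> is computed in two ways: from the
    definition of the kernel tensors it is \<open>x\<close>, from their decomposition it is the right-hand side.
  \<close>
  let ?x = "\<lambda>r. slice A' (\<xi> r) x"
  let ?w = "\<lambda>r g y. A'.act (?x r \<otimes>\<^bsub>A'\<^esub> f g) (f_tensor y) V"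
  let ?W = "\<lambda>r. tensor_lift (A' \<otimes>\<^sub>\<complex> V) (?w r)"
  have wb: "?w r \<in> bilinear_maps A (A \<otimes>\<^sub>\<complex> V) (A' \<otimes>\<^sub>\<complex> V)" if "r \<in> S" for r
    by (rule bilinear_comp[OF A'.actV_bil linear_comp[OF f_linear
            algebra_mult_left_linear[OF A'.alg A'.coord_closed[OF that xV]]] f_tensor_lin])
  have W: "?W r \<in> lin (A \<otimes>\<^sub>\<complex> (A \<otimes>\<^sub>\<complex> V)) (A' \<otimes>\<^sub>\<complex> V)" if "r \<in> S" for r
    by (rule vtensor_lift_linear[OF A.vA A.vAV wb[OF that] vAV'])
  have W_vtens: "?W r (vtens A (A \<otimes>\<^sub>\<complex> V) g y) = ?w r g y"
    if "r \<in> S" "g \<in> carrier A" "y \<in> carrier (A \<otimes>\<^sub>\<complex> V)" for r g y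
    by (rule vtensor_lift_vtens[OF A.vA A.vAV wb[OF that(1)] vAV' that(2,3)])
  have W_tail: "?W r (A.insert_tail u X) = vtens A' V (?x r \<otimes>\<^bsub>A'\<^esub> f (tensor_lift A (\<lambda>x y. x \<otimes>\<^bsub>A\<^esub> y) X)) u"
    if r: "r \<in> S" and u: "u \<in> S" and X: "X \<in> carrier (A \<otimes>\<^sub>\<complex> A)" for r u X
  proof (rule vtensor_ext[OF A.vA A.vA linear_comp[OF A.insert_tail_linear[OF u] W[OF r]] _ vAV' _ X])
    show "(\<lambda>X. vtens A' V (?x r \<otimes>\<^bsub>A'\<^esub> f (tensor_lift A (\<lambda>x y. x \<otimes>\<^bsub>A\<^esub> y) X)) u) \<in> lin (A \<otimes>\<^sub>\<complex> A) (A' \<otimes>\<^sub>\<complex> V)"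
      by (rule bilinear_comp_left[OF vtens_bilinear[OF A'.vA A.vV] A.S_in[OF u]
            linear_comp[OF linear_comp[OF vtensor_lift_linear[OF A.vA A.vA mb A.vA] f_linear]
              algebra_mult_left_linear[OF A'.alg A'.coord_closed[OF r xV]]]])
    fix m n assume "m \<in> carrier A" "n \<in> carrier A"
    then show "?W r (A.insert_tail u (vtens A A m n)) =
        vtens A' V (?x r \<otimes>\<^bsub>A'\<^esub> f (tensor_lift A (\<lambda>x y. x \<otimes>\<^bsub>A\<^esub> y) (vtens A A m n))) u"
      using u r xV
      by (simp add: A.insert_tail_vtens W_vtens vtens_closed[OF A.vA A.vV] A.S_in f_tensor_vtens[OF A.vV]
          left_tensor_smult_vtens[OF A'.alg A.vV] A'.coord_closed f_closed
          vtensor_lift_vtens[OF A.vA A.vA mb A.vA] f_mult A'.A.m_assoc)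
  qed
  have closed: "vtens A' V (counit C (A.coeff r u) \<odot>\<^bsub>A'\<^esub> ?x r) u \<in> carrier (A' \<otimes>\<^sub>\<complex> V)" if "r \<in> S" "u \<in> S" for r u
    using that xV by (intro vtens_closed[OF A'.vA A.vV]) (simp_all add: A'.coord_closed A.S_in)
  have "(\<Oplus>\<^bsub>A' \<otimes>\<^sub>\<complex> V\<^esub>r\<in>S. ?W r (A.kernel_tensor r)) =
      (\<Oplus>\<^bsub>A' \<otimes>\<^sub>\<complex> V\<^esub>r\<in>S. \<Oplus>\<^bsub>A' \<otimes>\<^sub>\<complex> V\<^esub>u\<in>S. vtens A' V (counit C (A.coeff r u) \<odot>\<^bsub>A'\<^esub> ?x r) u)"
  proof (rule AV.finsum_cong')
    fix r assume r: "r \<in> S"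
    have "?W r (A.kernel_tensor r) = (\<Oplus>\<^bsub>A' \<otimes>\<^sub>\<complex> V\<^esub>u\<in>S. ?W r (A.insert_tail u (A.ell (A.coeff r u))))"
      unfolding A.kernel_tensor_def
      by (rule lin_finsum[OF W[OF r] A.vAAV vAV']) (use r A.insert_ell_closed in auto)
    also have "\<dots> = (\<Oplus>\<^bsub>A' \<otimes>\<^sub>\<complex> V\<^esub>u\<in>S. vtens A' V (counit C (A.coeff r u) \<odot>\<^bsub>A'\<^esub> ?x r) u)"
      by (rule AV.finsum_cong')
        (use r xV closed in \<open>auto simp: W_tail A.ell_closed A.coeff_closed A.mult_ell lin_smult[OF f_linear] f_one
          A'.mult_smult_one A'.coord_closed\<close>)
    finally show "?W r (A.kernel_tensor r) =
        (\<Oplus>\<^bsub>A' \<otimes>\<^sub>\<complex> V\<^esub>u\<in>S. vtens A' V (counit C (A.coeff r u) \<odot>\<^bsub>A'\<^esub> ?x r) u)" .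
  qed (use closed in \<open>auto intro!: AV.finsum_closed\<close>)
  also have "\<dots> = (\<Oplus>\<^bsub>A' \<otimes>\<^sub>\<complex> V\<^esub>u\<in>S. \<Oplus>\<^bsub>A' \<otimes>\<^sub>\<complex> V\<^esub>r\<in>S. vtens A' V (counit C (A.coeff r u) \<odot>\<^bsub>A'\<^esub> ?x r) u)"
    by (rule AV.finsum_swap[OF A.finite_S A.finite_S closed])
  also have "\<dots> = (\<Oplus>\<^bsub>A' \<otimes>\<^sub>\<complex> V\<^esub>u\<in>S. vtens A' V (?x u) u)"
  proof (rule AV.finsum_cong')
    fix u assume u: "u \<in> S"
    have "?x u = A'.D (counit C) (?x u)"
      by (rule A'.D_counit[OF A'.coord_closed[OF u xV], symmetric])
    also have "\<dots> = (\<Oplus>\<^bsub>A'\<^esub>r\<in>S. slice A' (counit C) (vtens A' C (?x r) (A.coeff r u)))"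
      unfolding A'.D_def A'.coact_coord[OF x u]
      by (rule lin_finsum[OF slice_linear[OF A'.vA A.vC A.counit_linear] A'.vAC A'.vA])
        (use xV u A'.vtens_coeff_closed in auto)
    also have "\<dots> = (\<Oplus>\<^bsub>A'\<^esub>r\<in>S. counit C (A.coeff r u) \<odot>\<^bsub>A'\<^esub> ?x r)"
      by (rule A'.A.finsum_cong')
        (use xV u in \<open>auto simp: slice_vtens[OF A'.vA A.vC A.counit_linear] A'.coord_closed A.coeff_closed\<close>)
    finally have "vtens A' V (?x u) u = vtens A' V (\<Oplus>\<^bsub>A'\<^esub>r\<in>S. counit C (A.coeff r u) \<odot>\<^bsub>A'\<^esub> ?x r) u"
      by simp
    also have "\<dots> = (\<Oplus>\<^bsub>A' \<otimes>\<^sub>\<complex> V\<^esub>r\<in>S. vtens A' V (counit C (A.coeff r u) \<odot>\<^bsub>A'\<^esub> ?x r) u)"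
      by (rule lin_finsum[OF bilinear_left[OF vtens_bilinear[OF A'.vA A.vV] A.S_in[OF u]] A'.vA vAV'])
        (use xV A'.coord_closed in auto)
    finally show "(\<Oplus>\<^bsub>A' \<otimes>\<^sub>\<complex> V\<^esub>r\<in>S. vtens A' V (counit C (A.coeff r u) \<odot>\<^bsub>A'\<^esub> ?x r) u) = vtens A' V (?x u) u" ..
  qed (use xV in \<open>auto intro!: vtens_closed[OF A'.vA A.vV] A'.coord_closed A.S_in\<close>)
  also have "\<dots> = x"
    by (rule A.expand_tensor[OF A'.vA xV, symmetric])
  finally have 1: "(\<Oplus>\<^bsub>A' \<otimes>\<^sub>\<complex> V\<^esub>r\<in>S. ?W r (A.kernel_tensor r)) = x" .
  have wc: "?w r (G k r) (F k) \<in> carrier (A' \<otimes>\<^sub>\<complex> V)" if "r \<in> S" "k \<in> J" for r k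
    using that by (intro A'.actV_closed phi_summand_closed xV G FV)
  have "(\<Oplus>\<^bsub>A' \<otimes>\<^sub>\<complex> V\<^esub>r\<in>S. ?W r (A.kernel_tensor r)) =
      (\<Oplus>\<^bsub>A' \<otimes>\<^sub>\<complex> V\<^esub>r\<in>S. \<Oplus>\<^bsub>A' \<otimes>\<^sub>\<complex> V\<^esub>k\<in>J. ?w r (G k r) (F k))"
  proof (rule AV.finsum_cong')
    fix r assume r: "r \<in> S"
    have "?W r (A.kernel_tensor r) = (\<Oplus>\<^bsub>A' \<otimes>\<^sub>\<complex> V\<^esub>k\<in>J. ?W r (vtens A (A \<otimes>\<^sub>\<complex> V) (G k r) (F k)))"
      unfolding sum[OF r]
      by (rule lin_finsum[OF W[OF r] A.vAAV vAV']) (use r G A.P_closed[OF F] vtens_closed[OF A.vA A.vAV] in auto)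
    also have "\<dots> = (\<Oplus>\<^bsub>A' \<otimes>\<^sub>\<complex> V\<^esub>k\<in>J. ?w r (G k r) (F k))"
      by (rule AV.finsum_cong') (use r G A.P_closed[OF F] wc in \<open>auto simp: W_vtens\<close>)
    finally show "?W r (A.kernel_tensor r) = (\<Oplus>\<^bsub>A' \<otimes>\<^sub>\<complex> V\<^esub>k\<in>J. ?w r (G k r) (F k))" .
  qed (use wc in \<open>auto intro!: AV.finsum_closed\<close>)
  also have "\<dots> = (\<Oplus>\<^bsub>A' \<otimes>\<^sub>\<complex> V\<^esub>k\<in>J. \<Oplus>\<^bsub>A' \<otimes>\<^sub>\<complex> V\<^esub>r\<in>S. ?w r (G k r) (F k))"
    by (rule AV.finsum_swap[OF A.finite_S J wc])
  also have "\<dots> = (\<Oplus>\<^bsub>A' \<otimes>\<^sub>\<complex> V\<^esub>k\<in>J. A'.act (phi (G k) x) (f_tensor (F k)) V)"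
  proof (rule AV.finsum_cong')
    fix k assume k: "k \<in> J"
    show "(\<Oplus>\<^bsub>A' \<otimes>\<^sub>\<complex> V\<^esub>r\<in>S. ?w r (G k r) (F k)) = A'.act (phi (G k) x) (f_tensor (F k)) V"
      unfolding phi_def
      by (rule lin_finsum[OF bilinear_left[OF A'.actV_bil FV[OF k]] A'.vA vAV', symmetric])
        (use k G xV phi_summand_closed in auto)
  qed (use phi_invariant[OF cb _ x] A'.B_closed FV A'.actV_closed in auto)
  finally have "x = (\<Oplus>\<^bsub>A' \<otimes>\<^sub>\<complex> V\<^esub>k\<in>J. A'.act (phi (G k) x) (f_tensor (F k)) V)"
    using 1 by simp
  moreover have "finsum A'.P h J = finsum (A' \<otimes>\<^sub>\<complex> V) h J" if h: "h \<in> J \<rightarrow> carrier A'.P" for h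
  proof -
    have "(\<lambda>x. x) \<in> additive_maps A'.P (A' \<otimes>\<^sub>\<complex> V)"
      by (rule additive_mapsI) (simp_all add: A'.P_closed)
    from additive_finsum[OF this left_module_abelian_group[OF A'.left_module_P] AV.abelian_group_axioms h]
    show ?thesis by simp
  qed
  ultimately show ?thesis
    using phi_invariant[OF cb _ x] f_tensor_P[OF F] A'.P_act by simp
qed

end

section \<open>Finitely generated projective modules\<close>

lemma regular_module_simps:
  "carrier (regular_module R) = carrier R" "add (regular_module R) = add R"
  "zero (regular_module R) = zero R" "smult (regular_module R) = mult R"
  by (simp_all add: regular_module_def)

lemma left_module_smult_finsum:
  assumes M: "left_module R M" and r: "r \<in> carrier R" and a: "a \<in> I \<rightarrow> carrier M"
  shows "r \<odot>\<^bsub>M\<^esub> (\<Oplus>\<^bsub>M\<^esub>i\<in>I. a i) = (\<Oplus>\<^bsub>M\<^esub>i\<in>I. r \<odot>\<^bsub>M\<^esub> a i)"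
  by (rule additive_finsum[OF left_module_smult_additive(1)[OF M r] left_module_abelian_group[OF M]
        left_module_abelian_group[OF M] a])

lemma left_module_submodule:
  assumes M: "left_module R M" and H: "H \<subseteq> carrier M" "\<zero>\<^bsub>M\<^esub> \<in> H"
    and add: "\<And>x y. \<lbrakk>x \<in> H; y \<in> H\<rbrakk> \<Longrightarrow> x \<oplus>\<^bsub>M\<^esub> y \<in> H"
    and smult: "\<And>r x. \<lbrakk>r \<in> carrier R; x \<in> H\<rbrakk> \<Longrightarrow> r \<odot>\<^bsub>M\<^esub> x \<in> H"
  shows "left_module R (M\<lparr>carrier := H\<rparr>)"
proof -
  interpret M: left_module R M by fact
  have c: "x \<in> carrier M" if "x \<in> H" for x using that H by auto
  have "abelian_group (M\<lparr>carrier := H\<rparr>)"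
  proof (rule abelian_groupI)
    fix x assume "x \<in> carrier (M\<lparr>carrier := H\<rparr>)"
    then have x: "x \<in> H" by simp
    have "(\<ominus>\<^bsub>R\<^esub> \<one>\<^bsub>R\<^esub>) \<odot>\<^bsub>M\<^esub> x \<oplus>\<^bsub>M\<^esub> x = (\<ominus>\<^bsub>R\<^esub> \<one>\<^bsub>R\<^esub> \<oplus>\<^bsub>R\<^esub> \<one>\<^bsub>R\<^esub>) \<odot>\<^bsub>M\<^esub> x"
      using c[OF x] by (simp add: M.smult_l_distr M.smult_one)
    also have "\<dots> = \<zero>\<^bsub>M\<^esub>"
      using left_module_smult_zero(1)[OF M c[OF x]] by (simp add: M.R.l_neg)
    finally show "\<exists>y\<in>carrier (M\<lparr>carrier := H\<rparr>). y \<oplus>\<^bsub>M\<lparr>carrier := H\<rparr>\<^esub> x = \<zero>\<^bsub>M\<lparr>carrier := H\<rparr>\<^esub>"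
      using smult[OF _ x, of "\<ominus>\<^bsub>R\<^esub> \<one>\<^bsub>R\<^esub>"] by (intro bexI) simp_all
  qed (use H add c in \<open>simp_all add: M.M.a_ac\<close>)
  then show ?thesis
    by (intro left_module.intro left_module_axioms.intro M.R.ring_axioms)
      (use c smult in \<open>simp_all add: M.smult_l_distr M.smult_r_distr M.smult_assoc M.smult_one\<close>)
qed

lemma linear_isos_linear: "h \<in> linear_isos R M N \<Longrightarrow> h \<in> linear_maps R M N"
  and linear_isos_bij: "h \<in> linear_isos R M N \<Longrightarrow> bij_betw h (carrier M) (carrier N)"
  by (auto simp: linear_isos_def)

lemma linear_isosI:
  assumes "h \<in> linear_maps R M N" "k \<in> linear_maps R N M"
    and "\<And>x. x \<in> carrier M \<Longrightarrow> k (h x) = x" "\<And>y. y \<in> carrier N \<Longrightarrow> h (k y) = y"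
  shows "h \<in> linear_isos R M N"
proof -
  have "bij_betw h (carrier M) (carrier N)"
    by (rule bij_betwI[of _ _ _ k]) (use assms linear_closed in \<open>auto simp: linear_maps_def\<close>)
  then show ?thesis using assms(1) by (simp add: linear_isos_def)
qed

lemma linear_isos_inverse:
  assumes h: "h \<in> linear_isos R M N" and M: "left_module R M"
  obtains k where "k \<in> linear_isos R N M"
    "\<And>x. x \<in> carrier M \<Longrightarrow> k (h x) = x" "\<And>y. y \<in> carrier N \<Longrightarrow> h (k y) = y"
proof -
  interpret M: left_module R M by fact
  let ?k = "inv_into (carrier M) h"
  note b = linear_isos_bij[OF h] and l = linear_isos_linear[OF h]
  have kh: "?k (h x) = x" if "x \<in> carrier M" for x by (rule bij_betw_inv_into_left[OF b that])
  have hk: "h (?k y) = y" if "y \<in> carrier N" for y by (rule bij_betw_inv_into_right[OF b that])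
  have kc: "?k y \<in> carrier M" if "y \<in> carrier N" for y
    using bij_betw_inv_into[OF b] that by (auto simp: bij_betw_def)
  have k: "?k \<in> linear_maps R N M"
  proof (rule linear_mapsI[OF additive_mapsI])
    fix x y assume xy: "x \<in> carrier N" "y \<in> carrier N"
    then have "h (?k x \<oplus>\<^bsub>M\<^esub> ?k y) = x \<oplus>\<^bsub>N\<^esub> y"
      by (simp add: linear_add[OF l] kc hk)
    then show "?k (x \<oplus>\<^bsub>N\<^esub> y) = ?k x \<oplus>\<^bsub>M\<^esub> ?k y"
      using kh[of "?k x \<oplus>\<^bsub>M\<^esub> ?k y"] xy kc by simp
  next
    fix r x assume rx: "r \<in> carrier R" "x \<in> carrier N"
    then have "h (r \<odot>\<^bsub>M\<^esub> ?k x) = r \<odot>\<^bsub>N\<^esub> x"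
      by (simp add: linear_smult[OF l] kc hk)
    then show "?k (r \<odot>\<^bsub>N\<^esub> x) = r \<odot>\<^bsub>M\<^esub> ?k x"
      using kh[of "r \<odot>\<^bsub>M\<^esub> ?k x"] rx kc M.smult_closed by simp
  qed (rule kc)
  then have "?k \<in> linear_isos R N M"
    by (rule linear_isosI[OF _ l hk kh])
  then show thesis using that kh hk by blast
qed

lemma module_isomorphic_sym: "\<lbrakk>module_isomorphic R M N; left_module R M\<rbrakk> \<Longrightarrow> module_isomorphic R N M"
proof -
  assume iso: "module_isomorphic R M N" and M: "left_module R M"
  obtain h where h: "h \<in> linear_isos R M N" using iso by (auto simp: module_isomorphic_def)
  obtain k where "k \<in> linear_isos R N M" by (rule linear_isos_inverse[OF h M]) (rule that)
  then show "module_isomorphic R N M" by (auto simp: module_isomorphic_def)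
qed

lemma module_isomorphic_trans:
  assumes "module_isomorphic R M N" "module_isomorphic R N P"
  shows "module_isomorphic R M P"
proof -
  obtain h k where h: "h \<in> linear_isos R M N" and k: "k \<in> linear_isos R N P"
    using assms by (auto simp: module_isomorphic_def)
  have "(\<lambda>x. k (h x)) \<in> linear_isos R M P"
    using linear_comp[OF linear_isos_linear[OF h] linear_isos_linear[OF k]]
      bij_betw_trans[OF linear_isos_bij[OF h] linear_isos_bij[OF k]]
    by (simp add: linear_isos_def comp_def)
  then show ?thesis by (auto simp: module_isomorphic_def)
qed

lemma module_isomorphicI: "h \<in> linear_isos R M N \<Longrightarrow> module_isomorphic R M N"
  by (auto simp: module_isomorphic_def)

subsection \<open>Direct sums and free modules\<close>

lemma direct_sum_simps [simp]:
  "carrier (direct_sum M N) = carrier M \<times> carrier N" "zero (direct_sum M N) = (\<zero>\<^bsub>M\<^esub>, \<zero>\<^bsub>N\<^esub>)"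
  "(m, n) \<oplus>\<^bsub>direct_sum M N\<^esub> (m', n') = (m \<oplus>\<^bsub>M\<^esub> m', n \<oplus>\<^bsub>N\<^esub> n')"
  "r \<odot>\<^bsub>direct_sum M N\<^esub> (m, n) = (r \<odot>\<^bsub>M\<^esub> m, r \<odot>\<^bsub>N\<^esub> n)"
  by (simp_all add: direct_sum_def)

lemma left_module_direct_sum:
  assumes "left_module R M" "left_module R N"
  shows "left_module R (direct_sum M N)"
proof -
  interpret M: left_module R M by fact
  interpret N: left_module R N by fact
  have "abelian_group (direct_sum M N)"
  proof (rule abelian_groupI)
    fix x assume "x \<in> carrier (direct_sum M N)"
    then show "\<exists>y\<in>carrier (direct_sum M N). y \<oplus>\<^bsub>direct_sum M N\<^esub> x = \<zero>\<^bsub>direct_sum M N\<^esub>"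
      by (intro bexI[of _ "(\<ominus>\<^bsub>M\<^esub> fst x, \<ominus>\<^bsub>N\<^esub> snd x)"]) (auto simp: M.M.l_neg N.M.l_neg)
  qed (auto simp: M.M.a_ac N.M.a_ac)
  then show ?thesis
    by (intro left_module.intro left_module_axioms.intro M.R.ring_axioms)
      (auto simp: M.smult_closed N.smult_closed M.smult_l_distr N.smult_l_distr M.smult_r_distr N.smult_r_distr
        M.smult_assoc N.smult_assoc M.smult_one N.smult_one)
qed

lemma linear_fst: "fst \<in> linear_maps R (direct_sum M N) M"
  and linear_snd: "snd \<in> linear_maps R (direct_sum M N) N"
  by (auto simp: linear_maps_def)

lemma linear_inl:
  assumes "left_module R N"
  shows "(\<lambda>x. (x, \<zero>\<^bsub>N\<^esub>)) \<in> linear_maps R M (direct_sum M N)"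
proof -
  interpret N: left_module R N by fact
  show ?thesis
    using left_module_smult_zero(2)[OF assms] by (auto simp: linear_maps_def)
qed

lemma linear_inr:
  assumes "left_module R M"
  shows "(\<lambda>x. (\<zero>\<^bsub>M\<^esub>, x)) \<in> linear_maps R N (direct_sum M N)"
proof -
  interpret M: left_module R M by fact
  show ?thesis
    using left_module_smult_zero(2)[OF assms] by (auto simp: linear_maps_def)
qed

lemma linear_sum:
  assumes N: "left_module R N" and h: "h \<in> linear_maps R M N" and k: "k \<in> linear_maps R M N"
  shows "(\<lambda>x. h x \<oplus>\<^bsub>N\<^esub> k x) \<in> linear_maps R M N"
proof -
  interpret N: left_module R N by fact
  show ?thesis
    using linear_closed[OF h] linear_closed[OF k]
    by (intro linear_mapsI[OF additive_mapsI])
      (simp_all add: linear_add[OF h] linear_add[OF k] linear_smult[OF h] linear_smult[OF k]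
        N.smult_r_distr N.M.a_ac)
qed

lemma linear_pair:
  assumes "h \<in> linear_maps R X M" "k \<in> linear_maps R X N"
  shows "(\<lambda>x. (h x, k x)) \<in> linear_maps R X (direct_sum M N)"
  using assms by (auto simp: linear_maps_def)

lemma direct_sum_cong:
  assumes "module_isomorphic R M M'" "module_isomorphic R N N'"
  shows "module_isomorphic R (direct_sum M N) (direct_sum M' N')"
proof -
  obtain h k where h: "h \<in> linear_isos R M M'" and k: "k \<in> linear_isos R N N'"
    using assms by (auto simp: module_isomorphic_def)
  have "map_prod h k \<in> linear_isos R (direct_sum M N) (direct_sum M' N')"
    using h k bij_betw_map_prod[of h "carrier M" "carrier M'" k "carrier N" "carrier N'"]
    by (auto simp: linear_isos_def linear_maps_def)
  then show ?thesis by (rule module_isomorphicI)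
qed

lemma direct_sum_comm: "module_isomorphic R (direct_sum M N) (direct_sum N M)"
  by (rule module_isomorphicI[OF linear_isosI[of "\<lambda>x. (snd x, fst x)" _ _ _ "\<lambda>x. (snd x, fst x)"]])
    (auto simp: linear_maps_def)

lemma direct_sum_assoc:
  "module_isomorphic R (direct_sum (direct_sum M N) P) (direct_sum M (direct_sum N P))"
  by (rule module_isomorphicI[OF linear_isosI[of "\<lambda>x. (fst (fst x), (snd (fst x), snd x))" _ _ _
          "\<lambda>x. ((fst x, fst (snd x)), snd (snd x))"]])
    (auto simp: linear_maps_def)

lemma free_module_simps [simp]:
  "carrier (free_module R n) = {..<n} \<rightarrow>\<^sub>E carrier R" "zero (free_module R n) = (\<lambda>i\<in>{..<n}. \<zero>\<^bsub>R\<^esub>)"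
  "x \<oplus>\<^bsub>free_module R n\<^esub> y = (\<lambda>i\<in>{..<n}. x i \<oplus>\<^bsub>R\<^esub> y i)"
  "r \<odot>\<^bsub>free_module R n\<^esub> x = (\<lambda>i\<in>{..<n}. r \<otimes>\<^bsub>R\<^esub> x i)"
  by (simp_all add: free_module_def)

lemma left_module_free:
  assumes "ring R"
  shows "left_module R (free_module R n)"
proof -
  interpret R: ring R by fact
  note ext = PiE_ext[of _ "{..<n}" "\<lambda>_. carrier R"]
  have "abelian_group (free_module R n)"
  proof (rule abelian_groupI)
    fix x assume x: "x \<in> carrier (free_module R n)"
    then have xi: "x i \<in> carrier R" if "i < n" for i using that by auto
    have "(\<lambda>i\<in>{..<n}. \<ominus>\<^bsub>R\<^esub> x i) \<oplus>\<^bsub>free_module R n\<^esub> x = \<zero>\<^bsub>free_module R n\<^esub>"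
      unfolding free_module_simps by (rule restrict_ext) (simp add: xi R.l_neg)
    moreover have "(\<lambda>i\<in>{..<n}. \<ominus>\<^bsub>R\<^esub> x i) \<in> carrier (free_module R n)"
      by (simp add: xi)
    ultimately show "\<exists>y\<in>carrier (free_module R n). y \<oplus>\<^bsub>free_module R n\<^esub> x = \<zero>\<^bsub>free_module R n\<^esub>"
      by (rule bexI)
  next
    fix x assume x: "x \<in> carrier (free_module R n)"
    then show "\<zero>\<^bsub>free_module R n\<^esub> \<oplus>\<^bsub>free_module R n\<^esub> x = x"
      by (intro ext) (auto simp: PiE_iff)
  qed (auto simp: PiE_iff R.a_ac intro!: restrict_ext)
  then show ?thesis
  proof (intro left_module.intro left_module_axioms.intro R.ring_axioms)
    fix x assume x: "x \<in> carrier (free_module R n)"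
    then show "\<one>\<^bsub>R\<^esub> \<odot>\<^bsub>free_module R n\<^esub> x = x"
      by (intro ext) (auto simp: PiE_iff)
  qed (auto simp: PiE_iff R.l_distr R.r_distr R.m_assoc intro!: restrict_ext)
qed

lemma direct_sum_free_zero:
  assumes M: "left_module R M"
  shows "module_isomorphic R (direct_sum M (free_module R 0)) M"
proof -
  interpret M: left_module R M by fact
  show ?thesis
    by (rule module_isomorphicI[OF linear_isosI[OF linear_fst linear_inl[OF left_module_free[OF M.R.ring_axioms]]]])
      auto
qed

subsection \<open>Dual bases\<close>

definition dual_basis ::
    "('r, 's) ring_scheme \<Rightarrow> ('r, 'm, 'x) module_scheme \<Rightarrow> 'j set \<Rightarrow> ('j \<Rightarrow> 'm) \<Rightarrow> ('j \<Rightarrow> 'm \<Rightarrow> 'r) \<Rightarrow> bool"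
where
  "dual_basis R P J p \<phi> \<longleftrightarrow> finite J \<and> (\<forall>k\<in>J. p k \<in> carrier P) \<and>
    (\<forall>k\<in>J. \<phi> k \<in> linear_maps R P (regular_module R)) \<and>
    (\<forall>x\<in>carrier P. x = (\<Oplus>\<^bsub>P\<^esub>k\<in>J. \<phi> k x \<odot>\<^bsub>P\<^esub> p k))"

lemma dual_basis_reindex:
  assumes P: "left_module R P" and db: "dual_basis R P J p \<phi>" and h: "bij_betw h I J"
  shows "dual_basis R P I (\<lambda>i. p (h i)) (\<lambda>i. \<phi> (h i))"
proof -
  interpret P: left_module R P by fact
  have J: "finite J" and p: "\<And>k. k \<in> J \<Longrightarrow> p k \<in> carrier P"
    and \<phi>: "\<And>k. k \<in> J \<Longrightarrow> \<phi> k \<in> linear_maps R P (regular_module R)"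
    and exp: "\<And>x. x \<in> carrier P \<Longrightarrow> x = (\<Oplus>\<^bsub>P\<^esub>k\<in>J. \<phi> k x \<odot>\<^bsub>P\<^esub> p k)"
    using db by (auto simp: dual_basis_def)
  have hI: "h ` I = J" "inj_on h I" and hc: "\<And>i. i \<in> I \<Longrightarrow> h i \<in> J"
    using h by (auto simp: bij_betw_def)
  have "x = (\<Oplus>\<^bsub>P\<^esub>i\<in>I. \<phi> (h i) x \<odot>\<^bsub>P\<^esub> p (h i))" if x: "x \<in> carrier P" for x
  proof -
    have "(\<Oplus>\<^bsub>P\<^esub>k\<in>h ` I. \<phi> k x \<odot>\<^bsub>P\<^esub> p k) = (\<Oplus>\<^bsub>P\<^esub>i\<in>I. \<phi> (h i) x \<odot>\<^bsub>P\<^esub> p (h i))"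
      by (rule P.M.finsum_reindex)
        (use hc p linear_closed[OF \<phi> x] hI in \<open>auto simp: regular_module_simps intro!: P.smult_closed\<close>)
    then show ?thesis
      using exp[OF x] hI by simp
  qed
  moreover have "finite I"
    using J hI finite_imageD by auto
  ultimately show ?thesis
    using hc p \<phi> unfolding dual_basis_def by (intro conjI ballI) auto
qed

text \<open>
  A dual basis with \<open>n\<close> elements presents \<open>P\<close> as a retract of \<open>R^n\<close>.
\<close>

lemma dual_basis_embedding:
  fixes P :: "('r, 'm, 'x) module_scheme"
  assumes P: "left_module R P" and db: "dual_basis R P {..<n} p \<phi>"
  defines "\<iota> \<equiv> \<lambda>x. \<lambda>i\<in>{..<n}. \<phi> i x" and "\<pi> \<equiv> \<lambda>r. \<Oplus>\<^bsub>P\<^esub>i\<in>{..<n}. r i \<odot>\<^bsub>P\<^esub> p i"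
  shows "\<iota> \<in> linear_maps R P (free_module R n)" "\<pi> \<in> linear_maps R (free_module R n) P"
    and "\<And>x. x \<in> carrier P \<Longrightarrow> \<pi> (\<iota> x) = x"
proof -
  interpret P: left_module R P by fact
  have p: "\<And>k. k < n \<Longrightarrow> p k \<in> carrier P"
    and \<phi>: "\<And>k. k < n \<Longrightarrow> \<phi> k \<in> linear_maps R P (regular_module R)"
    and exp: "\<And>x. x \<in> carrier P \<Longrightarrow> x = (\<Oplus>\<^bsub>P\<^esub>k\<in>{..<n}. \<phi> k x \<odot>\<^bsub>P\<^esub> p k)"
    using db by (auto simp: dual_basis_def)
  have \<phi>c: "\<phi> k x \<in> carrier R" if "k < n" "x \<in> carrier P" for k x
    using linear_closed[OF \<phi> that(2)] that(1) by (simp add: regular_module_simps)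
  show "\<iota> \<in> linear_maps R P (free_module R n)"
    unfolding \<iota>_def
    by (rule linear_mapsI[OF additive_mapsI])
      (auto simp: \<phi>c linear_add[OF \<phi>] linear_smult[OF \<phi>] regular_module_simps intro!: restrict_ext)
  show "\<pi> \<in> linear_maps R (free_module R n) P"
  proof (rule linear_mapsI[OF additive_mapsI])
    fix x y assume xy: "x \<in> carrier (free_module R n)" "y \<in> carrier (free_module R n)"
    then show "\<pi> x \<in> carrier P"
      unfolding \<pi>_def by (intro P.M.finsum_closed) (auto simp: p PiE_iff intro!: P.smult_closed)
    have "\<pi> (x \<oplus>\<^bsub>free_module R n\<^esub> y) = (\<Oplus>\<^bsub>P\<^esub>i\<in>{..<n}. x i \<odot>\<^bsub>P\<^esub> p i \<oplus>\<^bsub>P\<^esub> y i \<odot>\<^bsub>P\<^esub> p i)"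
      unfolding \<pi>_def
      by (rule P.M.finsum_cong') (use xy in \<open>auto simp: p PiE_iff P.smult_l_distr intro!: P.smult_closed\<close>)
    also have "\<dots> = \<pi> x \<oplus>\<^bsub>P\<^esub> \<pi> y"
      unfolding \<pi>_def by (rule P.M.finsum_addf) (use xy in \<open>auto simp: p PiE_iff intro!: P.smult_closed\<close>)
    finally show "\<pi> (x \<oplus>\<^bsub>free_module R n\<^esub> y) = \<pi> x \<oplus>\<^bsub>P\<^esub> \<pi> y" .
  next
    fix r x assume rx: "r \<in> carrier R" "x \<in> carrier (free_module R n)"
    have "r \<odot>\<^bsub>P\<^esub> \<pi> x = (\<Oplus>\<^bsub>P\<^esub>i\<in>{..<n}. r \<odot>\<^bsub>P\<^esub> (x i \<odot>\<^bsub>P\<^esub> p i))"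
      unfolding \<pi>_def
      by (rule left_module_smult_finsum[OF P rx(1)]) (use rx in \<open>auto simp: p PiE_iff intro!: P.smult_closed\<close>)
    also have "\<dots> = \<pi> (r \<odot>\<^bsub>free_module R n\<^esub> x)"
      unfolding \<pi>_def
      by (rule P.M.finsum_cong') (use rx in \<open>auto simp: p PiE_iff P.smult_assoc intro!: P.smult_closed\<close>)
    finally show "\<pi> (r \<odot>\<^bsub>free_module R n\<^esub> x) = r \<odot>\<^bsub>P\<^esub> \<pi> x" ..
  qed
  show "\<pi> (\<iota> x) = x" if x: "x \<in> carrier P" for x
  proof -
    have "\<pi> (\<iota> x) = (\<Oplus>\<^bsub>P\<^esub>k\<in>{..<n}. \<phi> k x \<odot>\<^bsub>P\<^esub> p k)"
      unfolding \<pi>_def \<iota>_def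
      by (rule P.M.finsum_cong') (use x in \<open>auto simp: p \<phi>c intro!: P.smult_closed\<close>)
    then show ?thesis using exp[OF x] by simp
  qed
qed

text \<open>
  The complement of \<open>P\<close> in the free module is the kernel of the retraction \<open>\<pi>\<close>. The image of the section \<open>\<iota>\<close> is a copy
  of \<open>P\<close> in the type of \<open>R^n\<close>.
\<close>

lemma dual_basis_fg_projective:
  fixes P :: "('r, 'm, 'x) module_scheme"
  assumes P: "left_module R P" and db: "dual_basis R P J p \<phi>"
  shows "fg_projective R P"
    and "\<exists>P' :: ('r, nat \<Rightarrow> 'r) module. left_module R P' \<and> module_isomorphic R P P'"
proof -
  interpret P: left_module R P by fact
  define n where "n = card J"
  have "finite J" using db by (simp add: dual_basis_def)
  then obtain h where h: "bij_betw h {..<n} J"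
    using ex_bij_betw_nat_finite[of J] by (auto simp: n_def lessThan_atLeast0)
  note db' = dual_basis_reindex[OF P db h]
  define \<iota> where "\<iota> = (\<lambda>x. \<lambda>i\<in>{..<n}. \<phi> (h i) x)"
  define \<pi> where "\<pi> = (\<lambda>r. \<Oplus>\<^bsub>P\<^esub>i\<in>{..<n}. r i \<odot>\<^bsub>P\<^esub> p (h i))"
  let ?F = "free_module R n"
  have \<iota>: "\<iota> \<in> linear_maps R P ?F" and \<pi>: "\<pi> \<in> linear_maps R ?F P"
    and \<pi>\<iota>: "\<And>x. x \<in> carrier P \<Longrightarrow> \<pi> (\<iota> x) = x"
    using dual_basis_embedding[OF P db'] by (simp_all add: \<iota>_def \<pi>_def)
  note F = left_module_free[OF P.R.ring_axioms, of n]
  interpret F: left_module R ?F by (rule F)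
  note pab = P.M.abelian_group_axioms and fab = F.M.abelian_group_axioms
  have \<iota>0: "\<iota> \<zero>\<^bsub>P\<^esub> = \<zero>\<^bsub>?F\<^esub>" and \<pi>0: "\<pi> \<zero>\<^bsub>?F\<^esub> = \<zero>\<^bsub>P\<^esub>"
    by (rule additive_zero[OF linear_maps_additive[OF \<iota>] pab fab],
        rule additive_zero[OF linear_maps_additive[OF \<pi>] fab pab])
  note [simp del] = free_module_simps
  let ?Q = "?F\<lparr>carrier := {r \<in> carrier ?F. \<pi> r = \<zero>\<^bsub>P\<^esub>}\<rparr>"
  have Q: "left_module R ?Q"
    by (rule left_module_submodule[OF F])
      (auto simp: \<pi>0 linear_add[OF \<pi>] linear_smult[OF \<pi>] F.smult_closed left_module_smult_zero(2)[OF P])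
  have Q_incl: "(\<lambda>q. q) \<in> linear_maps R ?Q ?F"
    by (auto simp: linear_maps_def)
  let ?g = "\<lambda>x. \<iota> (fst x) \<oplus>\<^bsub>?F\<^esub> snd x"
  let ?k = "\<lambda>r. (\<pi> r, r \<ominus>\<^bsub>?F\<^esub> \<iota> (\<pi> r))"
  have diff: "\<pi> (r \<ominus>\<^bsub>?F\<^esub> \<iota> (\<pi> r)) = \<zero>\<^bsub>P\<^esub>" if r: "r \<in> carrier ?F" for r
  proof -
    have "\<pi> (r \<ominus>\<^bsub>?F\<^esub> \<iota> (\<pi> r)) = \<pi> r \<ominus>\<^bsub>P\<^esub> \<pi> (\<iota> (\<pi> r))"
      by (rule additive_diff[OF linear_maps_additive[OF \<pi>] fab pab r linear_closed[OF \<iota> linear_closed[OF \<pi> r]]])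
    then show ?thesis
      using linear_closed[OF \<pi> r] by (simp add: \<pi>\<iota> a_minus_def P.M.r_neg)
  qed
  have "?g \<in> linear_maps R (direct_sum P ?Q) ?F"
    by (rule linear_sum[OF F linear_comp[OF linear_fst \<iota>] linear_comp[OF linear_snd Q_incl]])
  moreover have "bij_betw ?g (carrier (direct_sum P ?Q)) (carrier ?F)"
  proof (rule bij_betwI[of _ _ _ ?k])
    show "?g \<in> carrier (direct_sum P ?Q) \<rightarrow> carrier ?F"
      using linear_closed[OF \<iota>] by auto
    show "?k \<in> carrier ?F \<rightarrow> carrier (direct_sum P ?Q)"
      using linear_closed[OF \<iota>] linear_closed[OF \<pi>] diff by auto
    show "?k (?g x) = x" if x: "x \<in> carrier (direct_sum P ?Q)" for x
    proof -
      obtain y q where yq: "x = (y, q)" "y \<in> carrier P" "q \<in> carrier ?F" "\<pi> q = \<zero>\<^bsub>P\<^esub>"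
        using x by auto
      note c = linear_closed[OF \<iota> yq(2)]
      have "\<pi> (\<iota> y \<oplus>\<^bsub>?F\<^esub> q) = y"
        using yq c by (simp add: linear_add[OF \<pi>] \<pi>\<iota>)
      moreover have "(\<iota> y \<oplus>\<^bsub>?F\<^esub> q) \<ominus>\<^bsub>?F\<^esub> \<iota> y = q"
        using yq c by (simp add: a_minus_def F.M.a_comm[of "\<iota> y" q] F.M.a_assoc F.M.r_neg)
      ultimately show ?thesis
        using yq by simp
    qed
    show "?g (?k r) = r" if r: "r \<in> carrier ?F" for r
      using r linear_closed[OF \<iota> linear_closed[OF \<pi> r]] by (simp add: a_minus_def F.M.a_ac F.M.r_neg2 F.M.r_neg1 F.M.r_neg)
  qed
  ultimately have "?g \<in> linear_isos R (direct_sum P ?Q) ?F"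
    by (simp add: linear_isos_def)
  then show "fg_projective R P"
    unfolding fg_projective_def using P Q module_isomorphicI by (intro conjI exI)
  let ?P = "?F\<lparr>carrier := \<iota> ` carrier P\<rparr>"
  have "left_module R ?P"
  proof (rule left_module_submodule[OF F])
    show "\<zero>\<^bsub>?F\<^esub> \<in> \<iota> ` carrier P"
      by (rule image_eqI[where f = \<iota> and x = "\<zero>\<^bsub>P\<^esub>"]) (simp_all add: \<iota>0)
    fix x y assume "x \<in> \<iota> ` carrier P" "y \<in> \<iota> ` carrier P"
    then obtain u v where uv: "x = \<iota> u" "y = \<iota> v" "u \<in> carrier P" "v \<in> carrier P" by auto
    then show "x \<oplus>\<^bsub>?F\<^esub> y \<in> \<iota> ` carrier P"
      by (intro image_eqI[of _ _ "u \<oplus>\<^bsub>P\<^esub> v"]) (simp_all add: linear_add[OF \<iota>])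
  next
    fix r x assume "r \<in> carrier R" "x \<in> \<iota> ` carrier P"
    then obtain u where "x = \<iota> u" "u \<in> carrier P" "r \<in> carrier R" by auto
    then show "r \<odot>\<^bsub>?F\<^esub> x \<in> \<iota> ` carrier P"
      by (intro image_eqI[of _ _ "r \<odot>\<^bsub>P\<^esub> u"]) (simp_all add: linear_smult[OF \<iota>] P.smult_closed)
  qed (use linear_closed[OF \<iota>] in auto)
  moreover have "inj_on \<iota> (carrier P)"
    by (rule inj_on_inverseI[of _ \<pi>]) (rule \<pi>\<iota>)
  then have "\<iota> \<in> linear_isos R P ?P"
    using \<iota> by (auto simp: linear_isos_def linear_maps_def bij_betw_def)
  ultimately show "\<exists>P' :: ('r, nat \<Rightarrow> 'r) module. left_module R P' \<and> module_isomorphic R P P'"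
    using module_isomorphicI by blast
qed

text \<open>
  The functionals are the coordinates of \<open>R^n\<close> restricted to the summand \<open>P\<close>, the vectors are the projections of the
  unit vectors \<open>\<delta> i\<close>. Dual bases, unlike complements, are transported along isomorphisms, sums and ring changes by
  explicit formulas.
\<close>

lemma fg_projective_dual_basis:
  fixes P :: "('r, 'm, 'x) module_scheme"
  assumes "fg_projective R P"
  obtains n p \<phi> where "dual_basis R P {..<n::nat} p \<phi>"
proof -
  have P: "left_module R P" using assms by (simp add: fg_projective_def)
  obtain n and Q :: "('r, nat \<Rightarrow> 'r) module" and h where Q: "left_module R Q" and h: "h \<in> linear_isos R (direct_sum P Q) (free_module R n)"
    using assms by (auto simp: fg_projective_def module_isomorphic_def)
  interpret P: left_module R P by fact
  interpret Q: left_module R Q by fact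
  let ?F = "free_module R n"
  have F: "left_module R ?F" by (rule left_module_free[OF P.R.ring_axioms])
  interpret F: left_module R ?F by (rule F)
  note PQ = left_module_direct_sum[OF P Q]
  obtain k where k: "k \<in> linear_isos R ?F (direct_sum P Q)"
    and kh: "\<And>x. x \<in> carrier (direct_sum P Q) \<Longrightarrow> k (h x) = x"
    by (rule linear_isos_inverse[OF h PQ]) (rule that)
  note hl = linear_isos_linear[OF h] and kl = linear_isos_linear[OF k]
  define \<delta> where "\<delta> i = (\<lambda>j\<in>{..<n}. if j = i then \<one>\<^bsub>R\<^esub> else \<zero>\<^bsub>R\<^esub>)" for i
  have \<delta>: "\<delta> i \<in> carrier ?F" for i
    by (auto simp: \<delta>_def)
  have ev: "(\<lambda>r. r j) \<in> additive_maps ?F R" if "j < n" for j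
    by (rule additive_mapsI) (use that in auto)
  have expF: "r = (\<Oplus>\<^bsub>?F\<^esub>i\<in>{..<n}. r i \<odot>\<^bsub>?F\<^esub> \<delta> i)" if r: "r \<in> carrier ?F" for r
  proof (rule PiE_ext[of _ "{..<n}" "\<lambda>_. carrier R"])
    have c: "(\<lambda>i. r i \<odot>\<^bsub>?F\<^esub> \<delta> i) \<in> {..<n} \<rightarrow> carrier ?F"
      using r \<delta> by (intro Pi_I F.smult_closed) auto
    show "(\<Oplus>\<^bsub>?F\<^esub>i\<in>{..<n}. r i \<odot>\<^bsub>?F\<^esub> \<delta> i) \<in> {..<n} \<rightarrow>\<^sub>E carrier R"
      using F.M.finsum_closed[OF c] by simp
    show "r \<in> {..<n} \<rightarrow>\<^sub>E carrier R" using r by simp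
    fix j assume j: "j \<in> {..<n}"
    have "(\<Oplus>\<^bsub>?F\<^esub>i\<in>{..<n}. r i \<odot>\<^bsub>?F\<^esub> \<delta> i) j = (\<Oplus>\<^bsub>R\<^esub>i\<in>{..<n}. (r i \<odot>\<^bsub>?F\<^esub> \<delta> i) j)"
      by (rule additive_finsum[OF ev F.M.abelian_group_axioms P.R.abelian_group_axioms c]) (use j in simp)
    also have "\<dots> = (\<Oplus>\<^bsub>R\<^esub>i\<in>{..<n}. if i = j then r j else \<zero>\<^bsub>R\<^esub>)"
      by (rule P.R.finsum_cong') (use j r in \<open>auto simp: \<delta>_def PiE_iff\<close>)
    also have "\<dots> = r j"
      by (rule P.R.finsum_delta) (use j r in auto)
    finally show "r j = (\<Oplus>\<^bsub>?F\<^esub>i\<in>{..<n}. r i \<odot>\<^bsub>?F\<^esub> \<delta> i) j" ..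
  qed
  let ?in = "\<lambda>x. (x, \<zero>\<^bsub>Q\<^esub>)"
  note inl = linear_inl[OF Q, of P] and g = linear_comp[OF kl linear_fst]
  have "dual_basis R P {..<n} (\<lambda>i. fst (k (\<delta> i))) (\<lambda>i x. h (?in x) i)"
    unfolding dual_basis_def
  proof (intro conjI ballI)
    fix i assume i: "i \<in> {..<n}"
    show "fst (k (\<delta> i)) \<in> carrier P" by (rule linear_closed[OF g \<delta>])
    have "(\<lambda>r. r i) \<in> linear_maps R ?F (regular_module R)"
      by (rule linear_mapsI[OF additive_mapsI]) (use i in \<open>auto simp: regular_module_simps\<close>)
    then show "(\<lambda>x. h (?in x) i) \<in> linear_maps R P (regular_module R)"
      by (rule linear_comp[OF linear_comp[OF inl hl]])
  next
    fix x assume x: "x \<in> carrier P"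
    have hx: "h (?in x) \<in> carrier ?F"
      by (rule linear_closed[OF hl linear_closed[OF inl x]])
    have c: "(\<lambda>i. h (?in x) i \<odot>\<^bsub>?F\<^esub> \<delta> i) \<in> {..<n} \<rightarrow> carrier ?F"
      using hx \<delta> by (intro Pi_I F.smult_closed) auto
    have "x = fst (k (h (?in x)))"
      using kh[of "?in x"] x by simp
    also have "\<dots> = fst (k (\<Oplus>\<^bsub>?F\<^esub>i\<in>{..<n}. h (?in x) i \<odot>\<^bsub>?F\<^esub> \<delta> i))"
      using expF[OF hx] by simp
    also have "\<dots> = (\<Oplus>\<^bsub>P\<^esub>i\<in>{..<n}. fst (k (h (?in x) i \<odot>\<^bsub>?F\<^esub> \<delta> i)))"
      by (rule additive_finsum[OF linear_maps_additive[OF g] F.M.abelian_group_axioms P.M.abelian_group_axioms c])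
    also have "\<dots> = (\<Oplus>\<^bsub>P\<^esub>i\<in>{..<n}. h (?in x) i \<odot>\<^bsub>P\<^esub> fst (k (\<delta> i)))"
    proof (rule P.M.finsum_cong')
      fix i assume i: "i \<in> {..<n}"
      have "h (?in x) i \<in> carrier R" using hx i by auto
      then show "fst (k (h (?in x) i \<odot>\<^bsub>?F\<^esub> \<delta> i)) = h (?in x) i \<odot>\<^bsub>P\<^esub> fst (k (\<delta> i))"
        by (rule linear_smult[OF g _ \<delta>])
    qed (use hx linear_closed[OF g \<delta>] in \<open>auto intro!: P.smult_closed\<close>)
    finally show "x = (\<Oplus>\<^bsub>P\<^esub>i\<in>{..<n}. h (?in x) i \<odot>\<^bsub>P\<^esub> fst (k (\<delta> i)))" .
  qed simp
  then show thesis by (rule that)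
qed

lemma fg_projective_left_module: "fg_projective R P \<Longrightarrow> left_module R P"
  by (simp add: fg_projective_def)

lemma fg_projective_iso:
  assumes fg: "fg_projective R P" and iso: "module_isomorphic R P P'" and P': "left_module R P'"
  shows "fg_projective R P'"
proof -
  have P: "left_module R P" by (rule fg_projective_left_module[OF fg])
  interpret P: left_module R P by fact
  interpret P': left_module R P' by fact
  obtain h where h: "h \<in> linear_isos R P P'" using iso by (auto simp: module_isomorphic_def)
  obtain k where k: "k \<in> linear_isos R P' P" and hk: "\<And>y. y \<in> carrier P' \<Longrightarrow> h (k y) = y"
    by (rule linear_isos_inverse[OF h P]) (rule that)
  note hl = linear_isos_linear[OF h] and kl = linear_isos_linear[OF k]
  obtain n p \<phi> where db: "dual_basis R P {..<n::nat} p \<phi>"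
    by (rule fg_projective_dual_basis[OF fg])
  then have p: "\<And>i. i < n \<Longrightarrow> p i \<in> carrier P"
    and \<phi>: "\<And>i. i < n \<Longrightarrow> \<phi> i \<in> linear_maps R P (regular_module R)"
    and exp: "\<And>x. x \<in> carrier P \<Longrightarrow> x = (\<Oplus>\<^bsub>P\<^esub>i\<in>{..<n}. \<phi> i x \<odot>\<^bsub>P\<^esub> p i)"
    by (auto simp: dual_basis_def)
  have \<phi>c: "\<phi> i x \<in> carrier R" if "i < n" "x \<in> carrier P" for i x
    using linear_closed[OF \<phi> that(2)] that(1) by (simp add: regular_module_simps)
  have "dual_basis R P' {..<n} (\<lambda>i. h (p i)) (\<lambda>i y. \<phi> i (k y))"
    unfolding dual_basis_def
  proof (intro conjI ballI)
    fix y assume y: "y \<in> carrier P'"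
    note ky = linear_closed[OF kl y]
    have "y = h (\<Oplus>\<^bsub>P\<^esub>i\<in>{..<n}. \<phi> i (k y) \<odot>\<^bsub>P\<^esub> p i)"
      using exp[OF ky] hk[OF y] by simp
    also have "\<dots> = (\<Oplus>\<^bsub>P'\<^esub>i\<in>{..<n}. h (\<phi> i (k y) \<odot>\<^bsub>P\<^esub> p i))"
      by (rule additive_finsum[OF linear_maps_additive[OF hl] P.M.abelian_group_axioms P'.M.abelian_group_axioms])
        (use p \<phi>c ky in \<open>auto intro!: P.smult_closed\<close>)
    also have "\<dots> = (\<Oplus>\<^bsub>P'\<^esub>i\<in>{..<n}. \<phi> i (k y) \<odot>\<^bsub>P'\<^esub> h (p i))"
      by (rule P'.M.finsum_cong')
        (use p \<phi>c ky linear_closed[OF hl] in \<open>auto simp: linear_smult[OF hl] intro!: P'.smult_closed\<close>)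
    finally show "y = (\<Oplus>\<^bsub>P'\<^esub>i\<in>{..<n}. \<phi> i (k y) \<odot>\<^bsub>P'\<^esub> h (p i))" .
  qed (use p linear_closed[OF hl] linear_comp[OF kl \<phi>] in auto)
  then show ?thesis by (rule dual_basis_fg_projective(1)[OF P'])
qed

lemma fg_projective_copy:
  fixes P :: "('r, 'm, 'x) module_scheme"
  assumes "fg_projective R P"
  obtains P' :: "('r, nat \<Rightarrow> 'r) module" where "fg_projective R P'" "module_isomorphic R P P'"
proof -
  obtain n p \<phi> where db: "dual_basis R P {..<n::nat} p \<phi>"
    by (rule fg_projective_dual_basis[OF assms])
  obtain P' :: "('r, nat \<Rightarrow> 'r) module" where "left_module R P'" "module_isomorphic R P P'"
    using dual_basis_fg_projective(2)[OF fg_projective_left_module[OF assms] db] by blast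
  then show thesis using that fg_projective_iso[OF assms] by blast
qed

lemma fg_projective_free_zero:
  assumes "ring R"
  shows "fg_projective R (free_module R 0)"
proof (rule dual_basis_fg_projective(1)[OF left_module_free[OF assms]])
  interpret F: left_module R "free_module R 0" by (rule left_module_free[OF assms])
  have "finsum (free_module R 0) a {} = \<zero>\<^bsub>free_module R 0\<^esub>" for a :: "nat \<Rightarrow> nat \<Rightarrow> 'a"
    by (rule F.M.finsum_empty)
  then show "dual_basis R (free_module R 0) ({} :: nat set) (\<lambda>_. undefined) (\<lambda>_ _. undefined)"
    by (simp add: dual_basis_def restrict_def)
qed

lemma fg_projective_direct_sum:
  assumes fgP: "fg_projective R P" and fgQ: "fg_projective R Q"
  shows "fg_projective R (direct_sum P Q)"
proof -
  have P: "left_module R P" and Q: "left_module R Q"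
    by (rule fg_projective_left_module[OF fgP], rule fg_projective_left_module[OF fgQ])
  note PQ = left_module_direct_sum[OF P Q]
  interpret P: left_module R P by (rule P)
  interpret Q: left_module R Q by (rule Q)
  interpret PQ: left_module R "direct_sum P Q" by (rule PQ)
  obtain n p \<phi> where db: "dual_basis R P {..<n::nat} p \<phi>"
    by (rule fg_projective_dual_basis[OF fgP])
  obtain m q \<psi> where db': "dual_basis R Q {..<m::nat} q \<psi>"
    by (rule fg_projective_dual_basis[OF fgQ])
  have p: "\<And>i. i < n \<Longrightarrow> p i \<in> carrier P" and q: "\<And>i. i < m \<Longrightarrow> q i \<in> carrier Q"
    and \<phi>: "\<And>i. i < n \<Longrightarrow> \<phi> i \<in> linear_maps R P (regular_module R)"
    and \<psi>: "\<And>i. i < m \<Longrightarrow> \<psi> i \<in> linear_maps R Q (regular_module R)"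
    and exp: "\<And>x. x \<in> carrier P \<Longrightarrow> x = (\<Oplus>\<^bsub>P\<^esub>i\<in>{..<n}. \<phi> i x \<odot>\<^bsub>P\<^esub> p i)"
    and exp': "\<And>x. x \<in> carrier Q \<Longrightarrow> x = (\<Oplus>\<^bsub>Q\<^esub>i\<in>{..<m}. \<psi> i x \<odot>\<^bsub>Q\<^esub> q i)"
    using db db' by (auto simp: dual_basis_def)
  have \<phi>c: "\<phi> i x \<in> carrier R" if "i < n" "x \<in> carrier P" for i x
    using linear_closed[OF \<phi> that(2)] that(1) by (simp add: regular_module_simps)
  have \<psi>c: "\<psi> i x \<in> carrier R" if "i < m" "x \<in> carrier Q" for i x
    using linear_closed[OF \<psi> that(2)] that(1) by (simp add: regular_module_simps)
  let ?inl = "\<lambda>x. (x, \<zero>\<^bsub>Q\<^esub>)" and ?inr = "\<lambda>x. (\<zero>\<^bsub>P\<^esub>, x)"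
  note inl = linear_inl[OF Q, of P] and inr = linear_inr[OF P, of Q]
  let ?b = "\<lambda>k. if k < n then ?inl (p k) else ?inr (q (k - n))"
  let ?\<beta> = "\<lambda>k x. if k < n then \<phi> k (fst x) else \<psi> (k - n) (snd x)"
  have "dual_basis R (direct_sum P Q) {..<n + m} ?b ?\<beta>"
    unfolding dual_basis_def
  proof (intro conjI ballI)
    fix k assume k: "k \<in> {..<n + m}"
    show "?b k \<in> carrier (direct_sum P Q)" using k p q by auto
    show "?\<beta> k \<in> linear_maps R (direct_sum P Q) (regular_module R)"
      using linear_comp[OF linear_fst[where N = Q] \<phi>[of k]] linear_comp[OF linear_snd[where M = P] \<psi>[of "k - n"]] k
      by (cases "k < n") auto
  next
    fix z assume "z \<in> carrier (direct_sum P Q)"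
    then obtain x y where z: "z = (x, y)" and x: "x \<in> carrier P" and y: "y \<in> carrier Q" by auto
    note ad = additive_finsum[OF linear_maps_additive[OF inl] P.M.abelian_group_axioms PQ.M.abelian_group_axioms]
      additive_finsum[OF linear_maps_additive[OF inr] Q.M.abelian_group_axioms PQ.M.abelian_group_axioms]
    have xc: "(\<lambda>i. \<phi> i x \<odot>\<^bsub>P\<^esub> p i) \<in> {..<n} \<rightarrow> carrier P" and yc: "(\<lambda>i. \<psi> i y \<odot>\<^bsub>Q\<^esub> q i) \<in> {..<m} \<rightarrow> carrier Q"
      using x y p q \<phi>c \<psi>c by (auto intro!: P.smult_closed Q.smult_closed)
    have "z = ?inl x \<oplus>\<^bsub>direct_sum P Q\<^esub> ?inr y"
      using x y z by simp
    also have "?inl x = ?inl (\<Oplus>\<^bsub>P\<^esub>i\<in>{..<n}. \<phi> i x \<odot>\<^bsub>P\<^esub> p i)"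
      using exp[OF x] by simp
    also have "\<dots> = (\<Oplus>\<^bsub>direct_sum P Q\<^esub>i\<in>{..<n}. ?inl (\<phi> i x \<odot>\<^bsub>P\<^esub> p i))"
      by (rule ad(1)[OF xc])
    also have "?inr y = ?inr (\<Oplus>\<^bsub>Q\<^esub>i\<in>{..<m}. \<psi> i y \<odot>\<^bsub>Q\<^esub> q i)"
      using exp'[OF y] by simp
    also have "\<dots> = (\<Oplus>\<^bsub>direct_sum P Q\<^esub>i\<in>{..<m}. ?inr (\<psi> i y \<odot>\<^bsub>Q\<^esub> q i))"
      by (rule ad(2)[OF yc])
    also have "(\<Oplus>\<^bsub>direct_sum P Q\<^esub>i\<in>{..<n}. ?inl (\<phi> i x \<odot>\<^bsub>P\<^esub> p i)) \<oplus>\<^bsub>direct_sum P Q\<^esub>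
          (\<Oplus>\<^bsub>direct_sum P Q\<^esub>i\<in>{..<m}. ?inr (\<psi> i y \<odot>\<^bsub>Q\<^esub> q i)) =
        (\<Oplus>\<^bsub>direct_sum P Q\<^esub>k\<in>{..<n + m}. if k < n then ?inl (\<phi> k x \<odot>\<^bsub>P\<^esub> p k) else ?inr (\<psi> (k - n) y \<odot>\<^bsub>Q\<^esub> q (k - n)))"
      by (rule PQ.M.finsum_append[symmetric]) (use xc yc in auto)
    also have "\<dots> = (\<Oplus>\<^bsub>direct_sum P Q\<^esub>k\<in>{..<n + m}. ?\<beta> k z \<odot>\<^bsub>direct_sum P Q\<^esub> ?b k)"
    proof (rule PQ.M.finsum_cong')
      fix k assume k: "k \<in> {..<n + m}"
      show "(if k < n then ?inl (\<phi> k x \<odot>\<^bsub>P\<^esub> p k) else ?inr (\<psi> (k - n) y \<odot>\<^bsub>Q\<^esub> q (k - n))) =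
          ?\<beta> k z \<odot>\<^bsub>direct_sum P Q\<^esub> ?b k"
        using k x y z \<phi>c[of k x] \<psi>c[of "k - n" y] left_module_smult_zero(2)[OF P] left_module_smult_zero(2)[OF Q]
        by (cases "k < n") auto
    next
      show "(\<lambda>k. ?\<beta> k z \<odot>\<^bsub>direct_sum P Q\<^esub> ?b k) \<in> {..<n + m} \<rightarrow> carrier (direct_sum P Q)"
        using x y z p q \<phi>c \<psi>c
        by (intro Pi_I PQ.smult_closed) auto
    qed simp
    finally show "z = (\<Oplus>\<^bsub>direct_sum P Q\<^esub>k\<in>{..<n + m}. ?\<beta> k z \<odot>\<^bsub>direct_sum P Q\<^esub> ?b k)" .
  qed simp
  then show ?thesis by (rule dual_basis_fg_projective(1)[OF PQ])
qed

subsection \<open>Base change\<close>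

lemma right_via_simps:
  "carrier (right_via R' f) = carrier R'" "add (right_via R' f) = add R'" "zero (right_via R' f) = zero R'"
  "mult (right_via R' f) = mult R'" "one (right_via R' f) = one R'" "r \<odot>\<^bsub>right_via R' f\<^esub> m = m \<otimes>\<^bsub>R'\<^esub> f r"
  by (simp_all add: right_via_def)

locale base_change_hom =
  R: ring R + R': ring R' for R :: "('r, 's) ring_scheme" and R' :: "('q, 't) ring_scheme" +
  fixes f :: "'r \<Rightarrow> 'q"
  assumes hom: "f \<in> ring_hom R R'"
begin

abbreviation bc where "bc P \<equiv> base_change R R' f P"
abbreviation bt where "bt P \<equiv> base_change_tens R R' f P"

lemma f_closed: "r \<in> carrier R \<Longrightarrow> f r \<in> carrier R'"
  by (rule ring_hom_closed[OF hom])

lemma factors: "left_module R P \<Longrightarrow> tensor_factors R (right_via R' f) P"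
proof -
  assume P: "left_module R P"
  have "abelian_group (right_via R' f)"
    by (rule abelian_group_same[OF _ R'.abelian_group_axioms]) (simp add: same_additive_def right_via_simps)
  then show ?thesis
    using left_module_abelian_group[OF P] left_module.smult_closed[OF P]
    by (simp add: tensor_factors_def tensor_factors_axioms_def right_via_simps f_closed)
qed

lemma bc_same: "same_additive (bc P) (tensor_group R (right_via R' f) P)"
  unfolding base_change_def by (rule same_additive_left_tensor)

lemma bc_same_simps:
  "carrier (bc P) = carrier (tensor_group R (right_via R' f) P)"
  "add (bc P) = add (tensor_group R (right_via R' f) P)"
  "zero (bc P) = zero (tensor_group R (right_via R' f) P)"
  using bc_same[of P] by (auto simp: same_additive_def)

lemma left_mult_linear:
  "a \<in> carrier R' \<Longrightarrow> (\<lambda>m. a \<otimes>\<^bsub>R'\<^esub> m) \<in> linear_maps R (right_via R' f) (right_via R' f)"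
  by (rule linear_mapsI[OF additive_mapsI]) (simp_all add: right_via_simps R'.r_distr R'.m_assoc f_closed)

lemma bc_module: "left_module R P \<Longrightarrow> left_module R' (bc P)"
  and bc_smult: "\<lbrakk>left_module R P; a \<in> carrier R'; b \<in> carrier R'; x \<in> carrier P\<rbrakk>
    \<Longrightarrow> a \<odot>\<^bsub>bc P\<^esub> bt P b x = bt P (a \<otimes>\<^bsub>R'\<^esub> b) x"
proof -
  assume P: "left_module R P"
  have sm: "a \<odot>\<^bsub>bc P\<^esub> X = tensor_lift (tensor_group R (right_via R' f) P)
      (\<lambda>m n. tens R (right_via R' f) P (a \<otimes>\<^bsub>R'\<^esub> m) n) X" for a X
    unfolding base_change_def smult_left_tensor by (simp add: right_via_simps)
  show "left_module R' (bc P)"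
    by (rule tensor_left_module(1)[OF factors[OF P] R'.ring_axioms left_mult_linear _ _ _ bc_same sm])
      (simp_all add: right_via_simps R'.l_distr R'.m_assoc)
  assume "a \<in> carrier R'" "b \<in> carrier R'" "x \<in> carrier P"
  then show "a \<odot>\<^bsub>bc P\<^esub> bt P b x = bt P (a \<otimes>\<^bsub>R'\<^esub> b) x"
    unfolding base_change_tens_def
    by (intro tensor_left_module(2)[OF factors[OF P] R'.ring_axioms left_mult_linear _ _ _ bc_same sm])
      (simp_all add: right_via_simps R'.l_distr R'.m_assoc)
qed

lemma bt_closed: "\<lbrakk>left_module R P; b \<in> carrier R'; x \<in> carrier P\<rbrakk> \<Longrightarrow> bt P b x \<in> carrier (bc P)"
  unfolding base_change_tens_def bc_same_simps
  by (rule tensor_factors.tens_closed[OF factors]) (simp_all add: right_via_simps)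

lemma bt_balanced: "left_module R P \<Longrightarrow> bt P \<in> balanced_maps R (right_via R' f) P (bc P)"
  using tensor_factors.tens_balanced[OF factors[of P]] balanced_maps_same[OF bc_same]
  unfolding base_change_tens_def by blast

lemma bt_smult:
  "\<lbrakk>left_module R P; r \<in> carrier R; b \<in> carrier R'; x \<in> carrier P\<rbrakk>
    \<Longrightarrow> bt P b (r \<odot>\<^bsub>P\<^esub> x) = bt P (b \<otimes>\<^bsub>R'\<^esub> f r) x"
  using balanced_smult[OF bt_balanced[of P], of r b x] by (simp add: right_via_simps)

lemma bt_additive_right: "\<lbrakk>left_module R P; b \<in> carrier R'\<rbrakk> \<Longrightarrow> (\<lambda>x. bt P b x) \<in> additive_maps P (bc P)"
  using balanced_right[OF bt_balanced[of P], of b] by (simp add: right_via_simps)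

lemma bt_additive_left: "\<lbrakk>left_module R P; x \<in> carrier P\<rbrakk> \<Longrightarrow> (\<lambda>b. bt P b x) \<in> additive_maps R' (bc P)"
proof -
  have "additive_maps (right_via R' f) (bc P) = additive_maps R' (bc P)"
    by (rule additive_maps_same) (simp_all add: same_additive_def right_via_simps)
  then show "\<lbrakk>left_module R P; x \<in> carrier P\<rbrakk> \<Longrightarrow> (\<lambda>b. bt P b x) \<in> additive_maps R' (bc P)"
    using balanced_left[OF bt_balanced[of P], of x] by simp
qed

lemma bc_ext:
  assumes P: "left_module R P" and g: "g \<in> additive_maps (bc P) H" and h: "h \<in> additive_maps (bc P) H"
    and H: "abelian_group H"
    and eq: "\<And>b x. \<lbrakk>b \<in> carrier R'; x \<in> carrier P\<rbrakk> \<Longrightarrow> g (bt P b x) = h (bt P b x)"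
    and t: "t \<in> carrier (bc P)"
  shows "g t = h t"
proof -
  have s: "additive_maps (bc P) H = additive_maps (tensor_group R (right_via R' f) P) H"
    by (rule additive_maps_same[OF bc_same]) (simp add: same_additive_def)
  show ?thesis
    by (rule tensor_factors.tensor_ext[OF factors[OF P] g[unfolded s] h[unfolded s] H])
      (use eq t in \<open>simp_all add: right_via_simps base_change_tens_def bc_same_simps\<close>)
qed

text \<open>
  The additive lift exists because \<open>\<beta>\<close> is balanced; it is \<open>R'\<close>-linear because \<open>\<beta>\<close> is linear in its first argument.
\<close>

lemma bc_lift:
  assumes P: "left_module R P" and N: "left_module R' N"
    and \<beta>: "\<And>b. b \<in> carrier R' \<Longrightarrow> \<beta> b \<in> additive_maps P N"
    and \<beta>R: "\<And>a b x. \<lbrakk>a \<in> carrier R'; b \<in> carrier R'; x \<in> carrier P\<rbrakk> \<Longrightarrow> \<beta> (a \<oplus>\<^bsub>R'\<^esub> b) x = \<beta> a x \<oplus>\<^bsub>N\<^esub> \<beta> b x"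
      "\<And>a b x. \<lbrakk>a \<in> carrier R'; b \<in> carrier R'; x \<in> carrier P\<rbrakk> \<Longrightarrow> \<beta> (a \<otimes>\<^bsub>R'\<^esub> b) x = a \<odot>\<^bsub>N\<^esub> \<beta> b x"
    and \<beta>f: "\<And>r b x. \<lbrakk>r \<in> carrier R; b \<in> carrier R'; x \<in> carrier P\<rbrakk> \<Longrightarrow> \<beta> (b \<otimes>\<^bsub>R'\<^esub> f r) x = \<beta> b (r \<odot>\<^bsub>P\<^esub> x)"
  shows "tensor_lift N \<beta> \<in> linear_maps R' (bc P) N"
    and "\<lbrakk>b \<in> carrier R'; x \<in> carrier P\<rbrakk> \<Longrightarrow> tensor_lift N \<beta> (bt P b x) = \<beta> b x"
proof -
  interpret P: left_module R P by fact
  interpret N: left_module R' N by fact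
  interpret T: tensor_factors R "right_via R' f" P by (rule factors[OF P])
  have bal: "\<beta> \<in> balanced_maps R (right_via R' f) P N"
    by (rule balanced_mapsI)
      (simp_all add: right_via_simps additive_closed[OF \<beta>] additive_add[OF \<beta>] \<beta>R \<beta>f)
  have s: "additive_maps (bc P) N = additive_maps T.T N"
    by (rule additive_maps_same[OF bc_same]) (simp add: same_additive_def)
  have add: "tensor_lift N \<beta> \<in> additive_maps (bc P) N"
    unfolding s by (rule T.tensor_lift_additive[OF N.M.abelian_group_axioms bal])
  show tens: "tensor_lift N \<beta> (bt P b x) = \<beta> b x" if "b \<in> carrier R'" "x \<in> carrier P" for b x
    unfolding base_change_tens_def
    by (rule T.tensor_lift_tens[OF N.M.abelian_group_axioms bal]) (use that in \<open>simp_all add: right_via_simps\<close>)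
  show "tensor_lift N \<beta> \<in> linear_maps R' (bc P) N"
  proof (rule linear_mapsI[OF add])
    fix a t assume a: "a \<in> carrier R'" and t: "t \<in> carrier (bc P)"
    show "tensor_lift N \<beta> (a \<odot>\<^bsub>bc P\<^esub> t) = a \<odot>\<^bsub>N\<^esub> tensor_lift N \<beta> t"
      by (rule bc_ext[OF P additive_comp[OF left_module_smult_additive(1)[OF bc_module[OF P] a] add]
            additive_comp[OF add left_module_smult_additive(1)[OF N a]] N.M.abelian_group_axioms _ t])
        (use a in \<open>simp add: bc_smult P tens \<beta>R\<close>)
  qed
qed

abbreviation bm where "bm Q h \<equiv> base_change_map R R' f Q h"

lemma bc_map:
  assumes P: "left_module R P" and Q: "left_module R Q" and h: "h \<in> linear_maps R P Q"
  shows "bm Q h \<in> linear_maps R' (bc P) (bc Q)"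
    and "\<lbrakk>b \<in> carrier R'; x \<in> carrier P\<rbrakk> \<Longrightarrow> bm Q h (bt P b x) = bt Q b (h x)"
proof -
  have 1: "(\<lambda>p. bt Q b (h p)) \<in> additive_maps P (bc Q)" if "b \<in> carrier R'" for b
    by (rule additive_comp[OF linear_maps_additive[OF h] bt_additive_right[OF Q that]])
  note L = bc_lift[OF P bc_module[OF Q], of "\<lambda>r p. bt Q r (h p)", OF 1]
  show "bm Q h \<in> linear_maps R' (bc P) (bc Q)"
    unfolding base_change_map_def
    by (rule L(1)) (simp_all add: additive_add[OF bt_additive_left[OF Q]] linear_closed[OF h] bc_smult Q
        linear_smult[OF h] bt_smult)
  show "\<lbrakk>b \<in> carrier R'; x \<in> carrier P\<rbrakk> \<Longrightarrow> bm Q h (bt P b x) = bt Q b (h x)"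
    unfolding base_change_map_def
    by (rule L(2)) (simp_all add: additive_add[OF bt_additive_left[OF Q]] linear_closed[OF h] bc_smult Q
        linear_smult[OF h] bt_smult)
qed

lemma bc_iso:
  assumes P: "left_module R P" and Q: "left_module R Q" and iso: "module_isomorphic R P Q"
  shows "module_isomorphic R' (bc P) (bc Q)"
proof -
  obtain h where h: "h \<in> linear_isos R P Q" using iso by (auto simp: module_isomorphic_def)
  obtain k where k: "k \<in> linear_isos R Q P"
    and kh: "\<And>x. x \<in> carrier P \<Longrightarrow> k (h x) = x" and hk: "\<And>y. y \<in> carrier Q \<Longrightarrow> h (k y) = y"
    by (rule linear_isos_inverse[OF h P]) (rule that)
  note hl = linear_isos_linear[OF h] and kl = linear_isos_linear[OF k]
  note H = bc_map[OF P Q hl] and K = bc_map[OF Q P kl]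
  have "bm P k (bm Q h t) = t" if t: "t \<in> carrier (bc P)" for t
    by (rule bc_ext[OF P linear_maps_additive[OF linear_comp[OF H(1) K(1)]] linear_maps_additive[OF linear_id(2)]
          left_module_abelian_group[OF bc_module[OF P]] _ t])
      (simp add: H(2) K(2) linear_closed[OF hl] kh)
  moreover have "bm Q h (bm P k t) = t" if t: "t \<in> carrier (bc Q)" for t
    by (rule bc_ext[OF Q linear_maps_additive[OF linear_comp[OF K(1) H(1)]] linear_maps_additive[OF linear_id(2)]
          left_module_abelian_group[OF bc_module[OF Q]] _ t])
      (simp add: H(2) K(2) linear_closed[OF kl] hk)
  ultimately show ?thesis
    by (intro module_isomorphicI[OF linear_isosI[OF H(1) K(1)]])
qed

text \<open>
  An additive functor preserves the projections and injections of a direct sum and the relations between them.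
\<close>

lemma bc_direct_sum:
  assumes P: "left_module R P" and Q: "left_module R Q"
  shows "module_isomorphic R' (bc (direct_sum P Q)) (direct_sum (bc P) (bc Q))"
proof -
  note PQ = left_module_direct_sum[OF P Q]
  interpret P: left_module R P by (rule P)
  interpret Q: left_module R Q by (rule Q)
  note f1 = bc_map[OF PQ P linear_fst] and f2 = bc_map[OF PQ Q linear_snd]
  note i1 = bc_map[OF P PQ linear_inl[OF Q]] and i2 = bc_map[OF Q PQ linear_inr[OF P]]
  note bP = bc_module[OF P] and bQ = bc_module[OF Q] and bPQ = bc_module[OF PQ]
  interpret bP: left_module R' "bc P" by (rule bP)
  interpret bQ: left_module R' "bc Q" by (rule bQ)
  let ?g = "\<lambda>t. (bm P fst t, bm Q snd t)"
  let ?k = "\<lambda>u. bm (direct_sum P Q) (\<lambda>x. (x, \<zero>\<^bsub>Q\<^esub>)) (fst u) \<oplus>\<^bsub>bc (direct_sum P Q)\<^esub>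
      bm (direct_sum P Q) (\<lambda>x. (\<zero>\<^bsub>P\<^esub>, x)) (snd u)"
  have g: "?g \<in> linear_maps R' (bc (direct_sum P Q)) (direct_sum (bc P) (bc Q))"
    by (rule linear_pair[OF f1(1) f2(1)])
  have k: "?k \<in> linear_maps R' (direct_sum (bc P) (bc Q)) (bc (direct_sum P Q))"
    by (rule linear_sum[OF bPQ linear_comp[OF linear_fst i1(1)] linear_comp[OF linear_snd i2(1)]])
  have kg: "?k (?g t) = t" if t: "t \<in> carrier (bc (direct_sum P Q))" for t
  proof (rule bc_ext[OF PQ linear_maps_additive[OF linear_comp[OF g k]] linear_maps_additive[OF linear_id(2)]
        left_module_abelian_group[OF bPQ] _ t])
    fix b x assume b: "b \<in> carrier R'" and x: "x \<in> carrier (direct_sum P Q)"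
    then have "?k (?g (bt (direct_sum P Q) b x)) =
        bt (direct_sum P Q) b (fst x, \<zero>\<^bsub>Q\<^esub>) \<oplus>\<^bsub>bc (direct_sum P Q)\<^esub> bt (direct_sum P Q) b (\<zero>\<^bsub>P\<^esub>, snd x)"
      using x by (auto simp: f1(2) f2(2) i1(2) i2(2))
    also have "\<dots> = bt (direct_sum P Q) b x"
      using x b additive_add[OF bt_additive_right[OF PQ b], of "(fst x, \<zero>\<^bsub>Q\<^esub>)" "(\<zero>\<^bsub>P\<^esub>, snd x)"] by auto
    finally show "?k (?g (bt (direct_sum P Q) b x)) = bt (direct_sum P Q) b x" .
  qed
  have zero: "bt P b \<zero>\<^bsub>P\<^esub> = \<zero>\<^bsub>bc P\<^esub>" "bt Q b \<zero>\<^bsub>Q\<^esub> = \<zero>\<^bsub>bc Q\<^esub>" if b: "b \<in> carrier R'" for b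
    by (rule additive_zero[OF bt_additive_right[OF P b] P.M.abelian_group_axioms bP.M.abelian_group_axioms],
        rule additive_zero[OF bt_additive_right[OF Q b] Q.M.abelian_group_axioms bQ.M.abelian_group_axioms])
  have zeroP: "(\<lambda>t. \<zero>\<^bsub>bc P\<^esub>) \<in> additive_maps (bc Q) (bc P)" and zeroQ: "(\<lambda>t. \<zero>\<^bsub>bc Q\<^esub>) \<in> additive_maps (bc P) (bc Q)"
    by (auto intro!: additive_mapsI)
  have 11: "bm P fst (bm (direct_sum P Q) (\<lambda>x. (x, \<zero>\<^bsub>Q\<^esub>)) t) = t" if t: "t \<in> carrier (bc P)" for t
    by (rule bc_ext[OF P linear_maps_additive[OF linear_comp[OF i1(1) f1(1)]] linear_maps_additive[OF linear_id(2)]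
          bP.M.abelian_group_axioms _ t]) (simp add: i1(2) f1(2))
  have 21: "bm Q snd (bm (direct_sum P Q) (\<lambda>x. (x, \<zero>\<^bsub>Q\<^esub>)) t) = \<zero>\<^bsub>bc Q\<^esub>" if t: "t \<in> carrier (bc P)" for t
    by (rule bc_ext[OF P linear_maps_additive[OF linear_comp[OF i1(1) f2(1)]] zeroQ
          bQ.M.abelian_group_axioms _ t]) (simp add: i1(2) f2(2) zero)
  have 12: "bm P fst (bm (direct_sum P Q) (\<lambda>x. (\<zero>\<^bsub>P\<^esub>, x)) t) = \<zero>\<^bsub>bc P\<^esub>" if t: "t \<in> carrier (bc Q)" for t
    by (rule bc_ext[OF Q linear_maps_additive[OF linear_comp[OF i2(1) f1(1)]] zeroP
          bP.M.abelian_group_axioms _ t]) (simp add: i2(2) f1(2) zero)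
  have 22: "bm Q snd (bm (direct_sum P Q) (\<lambda>x. (\<zero>\<^bsub>P\<^esub>, x)) t) = t" if t: "t \<in> carrier (bc Q)" for t
    by (rule bc_ext[OF Q linear_maps_additive[OF linear_comp[OF i2(1) f2(1)]] linear_maps_additive[OF linear_id(2)]
          bQ.M.abelian_group_axioms _ t]) (simp add: i2(2) f2(2))
  have gk: "?g (?k u) = u" if u: "u \<in> carrier (direct_sum (bc P) (bc Q))" for u
    using u linear_closed[OF i1(1)] linear_closed[OF i2(1)]
    by (auto simp: linear_add[OF f1(1)] linear_add[OF f2(1)] 11 12 21 22)
  show ?thesis
    by (rule module_isomorphicI[OF linear_isosI[OF g k kg gk]])
qed

text \<open>
  A dual basis \<open>p i\<close>, \<open>\<phi> i\<close> of \<open>P\<close> gives the vectors \<open>1 \<otimes> p i\<close> and the functionals \<open>b \<otimes> x \<mapsto> b f(\<phi> i x)\<close>.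
\<close>

lemma bc_fg_projective:
  assumes "fg_projective R P"
  shows "fg_projective R' (bc P)"
proof -
  have P: "left_module R P" by (rule fg_projective_left_module[OF assms])
  interpret P: left_module R P by (rule P)
  interpret bP: left_module R' "bc P" by (rule bc_module[OF P])
  obtain n p \<phi> where db: "dual_basis R P {..<n::nat} p \<phi>"
    by (rule fg_projective_dual_basis[OF assms])
  then have p: "\<And>i. i < n \<Longrightarrow> p i \<in> carrier P"
    and \<phi>: "\<And>i. i < n \<Longrightarrow> \<phi> i \<in> linear_maps R P (regular_module R)"
    and exp: "\<And>x. x \<in> carrier P \<Longrightarrow> x = (\<Oplus>\<^bsub>P\<^esub>i\<in>{..<n}. \<phi> i x \<odot>\<^bsub>P\<^esub> p i)"
    by (auto simp: dual_basis_def)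
  have \<phi>c: "\<phi> i x \<in> carrier R" if "i < n" "x \<in> carrier P" for i x
    using linear_closed[OF \<phi> that(2)] that(1) by (simp add: regular_module_simps)
  have \<phi>a: "\<phi> i (x \<oplus>\<^bsub>P\<^esub> y) = \<phi> i x \<oplus>\<^bsub>R\<^esub> \<phi> i y" if "i < n" "x \<in> carrier P" "y \<in> carrier P" for i x y
    using linear_add[OF \<phi>[OF that(1)] that(2,3)] by (simp add: regular_module_simps)
  have \<phi>m: "\<phi> i (r \<odot>\<^bsub>P\<^esub> x) = r \<otimes>\<^bsub>R\<^esub> \<phi> i x" if "i < n" "r \<in> carrier R" "x \<in> carrier P" for i x r
    using linear_smult[OF \<phi>[OF that(1)] that(2,3)] by (simp add: regular_module_simps)
  have reg: "left_module R' (regular_module R')"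
  proof -
    have "abelian_group (regular_module R')"
      by (rule abelian_group_same[OF _ R'.abelian_group_axioms]) (simp add: same_additive_def regular_module_simps)
    then show ?thesis
      by (intro left_module.intro left_module_axioms.intro R'.ring_axioms)
        (simp_all add: regular_module_simps R'.l_distr R'.r_distr R'.m_assoc)
  qed
  let ?\<beta> = "\<lambda>i b x. b \<otimes>\<^bsub>R'\<^esub> f (\<phi> i x)"
  let ?\<psi> = "\<lambda>i. tensor_lift (regular_module R') (?\<beta> i)"
  have L: "?\<psi> i \<in> linear_maps R' (bc P) (regular_module R')"
    "\<And>b x. \<lbrakk>b \<in> carrier R'; x \<in> carrier P\<rbrakk> \<Longrightarrow> ?\<psi> i (bt P b x) = ?\<beta> i b x" if i: "i < n" for i
  proof -
    have 1: "?\<beta> i b \<in> additive_maps P (regular_module R')" if "b \<in> carrier R'" for b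
      by (rule additive_mapsI)
        (use i that in \<open>simp_all add: regular_module_simps \<phi>a \<phi>c f_closed ring_hom_add[OF hom] R'.r_distr\<close>)
    note L = bc_lift[OF P reg, of "?\<beta> i", OF 1]
    show "?\<psi> i \<in> linear_maps R' (bc P) (regular_module R')"
      by (rule L(1)) (use i in \<open>simp_all add: regular_module_simps \<phi>m \<phi>c f_closed ring_hom_mult[OF hom] R'.l_distr R'.m_assoc\<close>)
    show "?\<psi> i (bt P b x) = ?\<beta> i b x" if "b \<in> carrier R'" "x \<in> carrier P" for b x
      by (rule L(2)) (use i that in \<open>simp_all add: regular_module_simps \<phi>m \<phi>c f_closed ring_hom_mult[OF hom] R'.l_distr R'.m_assoc\<close>)
  qed
  have bp: "bt P \<one>\<^bsub>R'\<^esub> (p i) \<in> carrier (bc P)" if "i < n" for i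
    using that by (intro bt_closed P p) auto
  have "dual_basis R' (bc P) {..<n} (\<lambda>i. bt P \<one>\<^bsub>R'\<^esub> (p i)) ?\<psi>"
    unfolding dual_basis_def
  proof (intro conjI ballI)
    fix t assume t: "t \<in> carrier (bc P)"
    have add: "(\<lambda>t. \<Oplus>\<^bsub>bc P\<^esub>i\<in>{..<n}. ?\<psi> i t \<odot>\<^bsub>bc P\<^esub> bt P \<one>\<^bsub>R'\<^esub> (p i)) \<in> additive_maps (bc P) (bc P)"
    proof (rule additive_mapsI)
      fix t u assume tu: "t \<in> carrier (bc P)" "u \<in> carrier (bc P)"
      have c: "?\<psi> i t \<in> carrier R'" "?\<psi> i u \<in> carrier R'" if "i < n" for i
        using linear_closed[OF L(1)[OF that]] tu by (simp_all add: regular_module_simps)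
      show "(\<Oplus>\<^bsub>bc P\<^esub>i\<in>{..<n}. ?\<psi> i t \<odot>\<^bsub>bc P\<^esub> bt P \<one>\<^bsub>R'\<^esub> (p i)) \<in> carrier (bc P)"
        by (rule bP.M.finsum_closed) (auto intro!: bP.smult_closed c bp)
      have "(\<Oplus>\<^bsub>bc P\<^esub>i\<in>{..<n}. ?\<psi> i (t \<oplus>\<^bsub>bc P\<^esub> u) \<odot>\<^bsub>bc P\<^esub> bt P \<one>\<^bsub>R'\<^esub> (p i)) =
          (\<Oplus>\<^bsub>bc P\<^esub>i\<in>{..<n}. ?\<psi> i t \<odot>\<^bsub>bc P\<^esub> bt P \<one>\<^bsub>R'\<^esub> (p i) \<oplus>\<^bsub>bc P\<^esub> ?\<psi> i u \<odot>\<^bsub>bc P\<^esub> bt P \<one>\<^bsub>R'\<^esub> (p i))"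
        by (rule bP.M.finsum_cong')
          (use tu c bp in \<open>auto simp: linear_add[OF L(1)] regular_module_simps bP.smult_l_distr intro!: bP.smult_closed\<close>)
      also have "\<dots> = (\<Oplus>\<^bsub>bc P\<^esub>i\<in>{..<n}. ?\<psi> i t \<odot>\<^bsub>bc P\<^esub> bt P \<one>\<^bsub>R'\<^esub> (p i)) \<oplus>\<^bsub>bc P\<^esub>
          (\<Oplus>\<^bsub>bc P\<^esub>i\<in>{..<n}. ?\<psi> i u \<odot>\<^bsub>bc P\<^esub> bt P \<one>\<^bsub>R'\<^esub> (p i))"
        by (rule bP.M.finsum_addf) (use c bp in \<open>auto intro!: bP.smult_closed\<close>)
      finally show "(\<Oplus>\<^bsub>bc P\<^esub>i\<in>{..<n}. ?\<psi> i (t \<oplus>\<^bsub>bc P\<^esub> u) \<odot>\<^bsub>bc P\<^esub> bt P \<one>\<^bsub>R'\<^esub> (p i)) =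
          (\<Oplus>\<^bsub>bc P\<^esub>i\<in>{..<n}. ?\<psi> i t \<odot>\<^bsub>bc P\<^esub> bt P \<one>\<^bsub>R'\<^esub> (p i)) \<oplus>\<^bsub>bc P\<^esub>
          (\<Oplus>\<^bsub>bc P\<^esub>i\<in>{..<n}. ?\<psi> i u \<odot>\<^bsub>bc P\<^esub> bt P \<one>\<^bsub>R'\<^esub> (p i))" .
    qed
    show "t = (\<Oplus>\<^bsub>bc P\<^esub>i\<in>{..<n}. ?\<psi> i t \<odot>\<^bsub>bc P\<^esub> bt P \<one>\<^bsub>R'\<^esub> (p i))"
    proof (rule bc_ext[OF P linear_maps_additive[OF linear_id(2)] add bP.M.abelian_group_axioms _ t])
      fix b x assume b: "b \<in> carrier R'" and x: "x \<in> carrier P"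
      have "bt P b x = bt P b (\<Oplus>\<^bsub>P\<^esub>i\<in>{..<n}. \<phi> i x \<odot>\<^bsub>P\<^esub> p i)"
        using exp[OF x] by simp
      also have "\<dots> = (\<Oplus>\<^bsub>bc P\<^esub>i\<in>{..<n}. bt P b (\<phi> i x \<odot>\<^bsub>P\<^esub> p i))"
        by (rule additive_finsum[OF bt_additive_right[OF P b] P.M.abelian_group_axioms bP.M.abelian_group_axioms])
          (use p \<phi>c x in \<open>auto intro!: P.smult_closed\<close>)
      also have "\<dots> = (\<Oplus>\<^bsub>bc P\<^esub>i\<in>{..<n}. ?\<psi> i (bt P b x) \<odot>\<^bsub>bc P\<^esub> bt P \<one>\<^bsub>R'\<^esub> (p i))"
        by (rule bP.M.finsum_cong')
          (use b x p \<phi>c in \<open>auto simp: L(2) bt_smult P bc_smult f_closed intro!: bP.smult_closed bt_closed\<close>)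
      finally show "bt P b x = (\<Oplus>\<^bsub>bc P\<^esub>i\<in>{..<n}. ?\<psi> i (bt P b x) \<odot>\<^bsub>bc P\<^esub> bt P \<one>\<^bsub>R'\<^esub> (p i))" .
    qed
  qed (use L(1) bp in auto)
  then show ?thesis by (rule dual_basis_fg_projective(1)[OF bc_module[OF P]])
qed

lemma bc_free_zero: "module_isomorphic R' (bc (free_module R 0)) (free_module R' 0)"
proof -
  note F = left_module_free[OF R.ring_axioms, of 0] and F' = left_module_free[OF R'.ring_axioms, of 0]
  interpret F: left_module R "free_module R 0" by (rule F)
  interpret F': left_module R' "free_module R' 0" by (rule F')
  interpret bF: left_module R' "bc (free_module R 0)" by (rule bc_module[OF F])
  have bF0: "t = \<zero>\<^bsub>bc (free_module R 0)\<^esub>" if t: "t \<in> carrier (bc (free_module R 0))" for t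
  proof (rule bc_ext[OF F linear_maps_additive[OF linear_id(2)] _ bF.M.abelian_group_axioms _ t])
    show "(\<lambda>t. \<zero>\<^bsub>bc (free_module R 0)\<^esub>) \<in> additive_maps (bc (free_module R 0)) (bc (free_module R 0))"
      by (auto intro!: additive_mapsI)
    fix b x assume b: "b \<in> carrier R'" and x: "x \<in> carrier (free_module R 0)"
    have "x = \<zero>\<^bsub>free_module R 0\<^esub>" using x by (simp add: restrict_def)
    then show "bt (free_module R 0) b x = \<zero>\<^bsub>bc (free_module R 0)\<^esub>"
      using additive_zero[OF bt_additive_right[OF F b] F.M.abelian_group_axioms bF.M.abelian_group_axioms] by simp
  qed
  have F0: "t = \<zero>\<^bsub>free_module R' 0\<^esub>" if "t \<in> carrier (free_module R' 0)" for t
    using that by (simp add: restrict_def)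
  note z = left_module_smult_zero(2)[OF F'] left_module_smult_zero(2)[OF bc_module[OF F]]
  have "(\<lambda>_. \<zero>\<^bsub>free_module R' 0\<^esub>) \<in> linear_maps R' (bc (free_module R 0)) (free_module R' 0)"
    "(\<lambda>_. \<zero>\<^bsub>bc (free_module R 0)\<^esub>) \<in> linear_maps R' (free_module R' 0) (bc (free_module R 0))"
    by (rule linear_mapsI[OF additive_mapsI], simp_all only: F'.M.zero_closed F'.M.l_zero z)
      (rule linear_mapsI[OF additive_mapsI], simp_all only: bF.M.zero_closed bF.M.l_zero z)
  then show ?thesis
    by (rule module_isomorphicI[OF linear_isosI]) (rule bF0[symmetric], assumption, rule F0[symmetric], assumption)
qed

end

section \<open>The Grothendieck group\<close>

text \<open>
  The equation \<open>a - b = a' - b'\<close> in the Grothendieck group of a commutative monoid; the summand \<open>s\<close> compensates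
  for the failure of cancellation.
\<close>

definition (in comm_monoid) same_difference :: "'a \<Rightarrow> 'a \<Rightarrow> 'a \<Rightarrow> 'a \<Rightarrow> bool" where
  "same_difference a b a' b' \<longleftrightarrow> (\<exists>s\<in>carrier G. a \<otimes> b' \<otimes> s = a' \<otimes> b \<otimes> s)"

lemma (in comm_monoid) same_difference_refl:
  "\<lbrakk>a \<in> carrier G; b \<in> carrier G\<rbrakk> \<Longrightarrow> same_difference a b a b"
  unfolding same_difference_def by (intro bexI[of _ \<one>]) auto

lemma (in comm_monoid) same_difference_sym:
  "same_difference a b a' b' \<Longrightarrow> same_difference a' b' a b"
  unfolding same_difference_def by (elim bexE) (rule bexI, rule sym)

lemma (in comm_monoid) same_difference_trans:
  assumes c: "a \<in> carrier G" "b \<in> carrier G" "a' \<in> carrier G" "b' \<in> carrier G" "a'' \<in> carrier G" "b'' \<in> carrier G"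
    and 1: "same_difference a b a' b'" and 2: "same_difference a' b' a'' b''"
  shows "same_difference a b a'' b''"
proof -
  obtain s t where s: "s \<in> carrier G" "a \<otimes> b' \<otimes> s = a' \<otimes> b \<otimes> s"
    and t: "t \<in> carrier G" "a' \<otimes> b'' \<otimes> t = a'' \<otimes> b' \<otimes> t"
    using 1 2 by (auto simp: same_difference_def)
  have "a \<otimes> b'' \<otimes> (b' \<otimes> a' \<otimes> s \<otimes> t) = (a \<otimes> b' \<otimes> s) \<otimes> (a' \<otimes> b'' \<otimes> t)"
    using c s(1) t(1) by (simp add: m_ac)
  also have "\<dots> = (a' \<otimes> b \<otimes> s) \<otimes> (a'' \<otimes> b' \<otimes> t)"
    using s t by simp
  also have "\<dots> = a'' \<otimes> b \<otimes> (b' \<otimes> a' \<otimes> s \<otimes> t)"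
    using c s(1) t(1) by (simp add: m_ac)
  finally show ?thesis
    unfolding same_difference_def by (rule bexI) (use c s t in simp)
qed

lemma (in comm_monoid) same_difference_mult:
  assumes c: "a \<in> carrier G" "b \<in> carrier G" "a' \<in> carrier G" "b' \<in> carrier G"
      "x \<in> carrier G" "y \<in> carrier G" "x' \<in> carrier G" "y' \<in> carrier G"
    and 1: "same_difference a b a' b'" and 2: "same_difference x y x' y'"
  shows "same_difference (a \<otimes> x) (b \<otimes> y) (a' \<otimes> x') (b' \<otimes> y')"
proof -
  obtain s t where s: "s \<in> carrier G" "a \<otimes> b' \<otimes> s = a' \<otimes> b \<otimes> s"
    and t: "t \<in> carrier G" "x \<otimes> y' \<otimes> t = x' \<otimes> y \<otimes> t"
    using 1 2 by (auto simp: same_difference_def)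
  have "(a \<otimes> x) \<otimes> (b' \<otimes> y') \<otimes> (s \<otimes> t) = (a \<otimes> b' \<otimes> s) \<otimes> (x \<otimes> y' \<otimes> t)"
    using c s(1) t(1) by (simp add: m_ac)
  also have "\<dots> = (a' \<otimes> b \<otimes> s) \<otimes> (x' \<otimes> y \<otimes> t)"
    using s t by simp
  also have "\<dots> = (a' \<otimes> x') \<otimes> (b \<otimes> y) \<otimes> (s \<otimes> t)"
    using c s(1) t(1) by (simp add: m_ac)
  finally show ?thesis
    unfolding same_difference_def by (rule bexI) (use s t in simp)
qed

text \<open>
  Isomorphism classes, represented inside the fixed type \<open>nat \<Rightarrow> 'r\<close>, form a commutative monoid. Working
  there, rather than with modules of different types, makes the manipulation of iterated direct sums
  equational.
\<close>

definition iso_class ::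
    "('r, 's) ring_scheme \<Rightarrow> ('r, 'm, 'x) module_scheme \<Rightarrow> ('r, nat \<Rightarrow> 'r) module set"
where
  "iso_class R P = {P'. fg_projective R P' \<and> module_isomorphic R P P'}"

lemma iso_class_eqI:
  assumes P: "fg_projective R P" and iso: "module_isomorphic R P Q"
  shows "iso_class R P = iso_class R Q"
  unfolding iso_class_def
  using module_isomorphic_trans[OF iso]
    module_isomorphic_trans[OF module_isomorphic_sym[OF iso fg_projective_left_module[OF P]]]
  by blast

lemma iso_class_eqD:
  fixes R :: "('r, 's) ring_scheme"
  assumes P: "fg_projective R P" and Q: "fg_projective R Q" and eq: "iso_class R P = iso_class R Q"
  shows "module_isomorphic R P Q"
proof -
  obtain P' :: "('r, nat \<Rightarrow> 'r) module" where "fg_projective R P'" "module_isomorphic R P P'"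
    by (rule fg_projective_copy[OF P])
  then have P': "P' \<in> iso_class R P" by (simp add: iso_class_def)
  then have "P' \<in> iso_class R Q" using eq by simp
  then have "module_isomorphic R Q P'" by (simp add: iso_class_def)
  then have "module_isomorphic R P' Q"
    by (rule module_isomorphic_sym[OF _ fg_projective_left_module[OF Q]])
  then show ?thesis
    using P' module_isomorphic_trans by (auto simp: iso_class_def)
qed

definition class_monoid :: "('r, 's) ring_scheme \<Rightarrow> ('r, nat \<Rightarrow> 'r) module set monoid" where
  "class_monoid R =
    \<lparr>carrier = {iso_class R P | P :: ('r, nat \<Rightarrow> 'r) module. fg_projective R P},
     mult = (\<lambda>X Y. iso_class R (direct_sum (SOME P. P \<in> X) (SOME Q. Q \<in> Y))),
     one = iso_class R (free_module R 0)\<rparr>"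

lemma iso_class_closed:
  fixes R :: "('r, 's) ring_scheme"
  assumes P: "fg_projective R P"
  shows "iso_class R P \<in> carrier (class_monoid R)"
proof -
  obtain P' :: "('r, nat \<Rightarrow> 'r) module" where "fg_projective R P'" "module_isomorphic R P P'"
    by (rule fg_projective_copy[OF P])
  then show ?thesis
    using iso_class_eqI[OF P] by (auto simp: class_monoid_def)
qed

lemma iso_class_some:
  fixes R :: "('r, 's) ring_scheme"
  assumes P: "fg_projective R P"
  shows "fg_projective R (SOME P'. P' \<in> iso_class R P)" "module_isomorphic R P (SOME P'. P' \<in> iso_class R P)"
proof -
  obtain P' :: "('r, nat \<Rightarrow> 'r) module" where "fg_projective R P'" "module_isomorphic R P P'"
    by (rule fg_projective_copy[OF P])
  then have "P' \<in> iso_class R P" by (simp add: iso_class_def)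
  then have "(SOME P'. P' \<in> iso_class R P) \<in> iso_class R P" by (rule someI)
  then show "fg_projective R (SOME P'. P' \<in> iso_class R P)" "module_isomorphic R P (SOME P'. P' \<in> iso_class R P)"
    by (auto simp: iso_class_def)
qed

lemma iso_class_mult:
  assumes P: "fg_projective R P" and Q: "fg_projective R Q"
  shows "iso_class R P \<otimes>\<^bsub>class_monoid R\<^esub> iso_class R Q = iso_class R (direct_sum P Q)"
  using iso_class_eqI[OF fg_projective_direct_sum[OF P Q]
      direct_sum_cong[OF iso_class_some(2)[OF P] iso_class_some(2)[OF Q]]]
  by (simp add: class_monoid_def)

lemma comm_monoid_class_monoid:
  fixes R :: "('r, 's) ring_scheme"
  assumes R: "ring R"
  shows "comm_monoid (class_monoid R)"
proof (rule comm_monoidI)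
  have ex: "\<exists>P :: ('r, nat \<Rightarrow> 'r) module. fg_projective R P \<and> X = iso_class R P"
    if "X \<in> carrier (class_monoid R)" for X
    using that by (auto simp: class_monoid_def)
  have one: "\<one>\<^bsub>class_monoid R\<^esub> = iso_class R (free_module R 0)"
    by (simp add: class_monoid_def)
  note F = fg_projective_free_zero[OF R] and [simp] = iso_class_mult fg_projective_direct_sum iso_class_closed
  show "\<one>\<^bsub>class_monoid R\<^esub> \<in> carrier (class_monoid R)"
    unfolding one by (rule iso_class_closed[OF F])
  fix X Y assume "X \<in> carrier (class_monoid R)" "Y \<in> carrier (class_monoid R)"
  then obtain P Q :: "('r, nat \<Rightarrow> 'r) module"
    where P: "fg_projective R P" "X = iso_class R P" and Q: "fg_projective R Q" "Y = iso_class R Q"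
    using ex by meson
  show "X \<otimes>\<^bsub>class_monoid R\<^esub> Y \<in> carrier (class_monoid R)"
    using P Q by simp
  show "X \<otimes>\<^bsub>class_monoid R\<^esub> Y = Y \<otimes>\<^bsub>class_monoid R\<^esub> X"
    using P Q iso_class_eqI[OF fg_projective_direct_sum[OF P(1) Q(1)] direct_sum_comm] by simp
  show "\<one>\<^bsub>class_monoid R\<^esub> \<otimes>\<^bsub>class_monoid R\<^esub> X = X"
    using P F one iso_class_eqI[OF fg_projective_direct_sum[OF F P(1)] direct_sum_comm]
      iso_class_eqI[OF fg_projective_direct_sum[OF P(1) F] direct_sum_free_zero[OF fg_projective_left_module[OF P(1)]]]
    by simp
  fix Z assume "Z \<in> carrier (class_monoid R)"
  then obtain S :: "('r, nat \<Rightarrow> 'r) module" where S: "fg_projective R S" "Z = iso_class R S"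
    using ex by meson
  show "X \<otimes>\<^bsub>class_monoid R\<^esub> Y \<otimes>\<^bsub>class_monoid R\<^esub> Z = X \<otimes>\<^bsub>class_monoid R\<^esub> (Y \<otimes>\<^bsub>class_monoid R\<^esub> Z)"
    using P Q S
      iso_class_eqI[OF fg_projective_direct_sum[OF fg_projective_direct_sum[OF P(1) Q(1)] S(1)] direct_sum_assoc]
    by simp
qed

context
  fixes R :: "('r, 's) ring_scheme"
  assumes R: "ring R"
begin

interpretation K: comm_monoid "class_monoid R"
  by (rule comm_monoid_class_monoid[OF R])

text \<open>
  Membership in a class of \<open>K\<^sub>0\<close> becomes an equation in the commutative monoid of isomorphism classes.
\<close>

lemma K0_diff_iff:
  assumes P: "fg_projective R P" and Q: "fg_projective R Q"
  shows "(P', Q') \<in> K0_diff R P Q \<longleftrightarrow> fg_projective R P' \<and> fg_projective R Q' \<and>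
    K.same_difference (iso_class R P) (iso_class R Q) (iso_class R P') (iso_class R Q')"
proof -
  have "(\<exists>S :: ('r, nat \<Rightarrow> 'r) module. fg_projective R S \<and>
        module_isomorphic R (direct_sum (direct_sum P Q') S) (direct_sum (direct_sum P' Q) S)) \<longleftrightarrow>
      K.same_difference (iso_class R P) (iso_class R Q) (iso_class R P') (iso_class R Q')"
    if P': "fg_projective R P'" and Q': "fg_projective R Q'"
  proof
    assume "\<exists>S :: ('r, nat \<Rightarrow> 'r) module. fg_projective R S \<and>
        module_isomorphic R (direct_sum (direct_sum P Q') S) (direct_sum (direct_sum P' Q) S)"
    then obtain S :: "('r, nat \<Rightarrow> 'r) module" where S: "fg_projective R S"
      "module_isomorphic R (direct_sum (direct_sum P Q') S) (direct_sum (direct_sum P' Q) S)" by blast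
    show "K.same_difference (iso_class R P) (iso_class R Q) (iso_class R P') (iso_class R Q')"
      unfolding K.same_difference_def
      using P Q P' Q' S iso_class_eqI[OF _ S(2)]
      by (intro bexI[of _ "iso_class R S"]) (simp_all add: iso_class_mult fg_projective_direct_sum iso_class_closed)
  next
    assume "K.same_difference (iso_class R P) (iso_class R Q) (iso_class R P') (iso_class R Q')"
    then obtain X where X: "X \<in> carrier (class_monoid R)"
      "iso_class R P \<otimes>\<^bsub>class_monoid R\<^esub> iso_class R Q' \<otimes>\<^bsub>class_monoid R\<^esub> X =
        iso_class R P' \<otimes>\<^bsub>class_monoid R\<^esub> iso_class R Q \<otimes>\<^bsub>class_monoid R\<^esub> X"
      unfolding K.same_difference_def by blast
    then obtain S :: "('r, nat \<Rightarrow> 'r) module" where S: "fg_projective R S" "X = iso_class R S"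
      by (auto simp: class_monoid_def)
    then have "iso_class R (direct_sum (direct_sum P Q') S) = iso_class R (direct_sum (direct_sum P' Q) S)"
      using X P Q P' Q' by (simp add: iso_class_mult fg_projective_direct_sum)
    then have "module_isomorphic R (direct_sum (direct_sum P Q') S) (direct_sum (direct_sum P' Q) S)"
      by (rule iso_class_eqD[rotated -1]) (intro fg_projective_direct_sum P Q P' Q' S(1))+
    with S(1) show "\<exists>S :: ('r, nat \<Rightarrow> 'r) module. fg_projective R S \<and>
        module_isomorphic R (direct_sum (direct_sum P Q') S) (direct_sum (direct_sum P' Q) S)"
      by (intro exI conjI)
  qed
  then show ?thesis
    by (auto simp: K0_diff_def)
qed

lemma K0_diff_eqI:
  assumes fg: "fg_projective R P" "fg_projective R Q" "fg_projective R P'" "fg_projective R Q'"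
    and same: "K.same_difference (iso_class R P) (iso_class R Q) (iso_class R P') (iso_class R Q')"
  shows "K0_diff R P Q = K0_diff R P' Q'"
proof -
  note c = iso_class_closed[OF fg(1)] iso_class_closed[OF fg(2)] iso_class_closed[OF fg(3)] iso_class_closed[OF fg(4)]
  have "(X, Y) \<in> K0_diff R P Q \<longleftrightarrow> (X, Y) \<in> K0_diff R P' Q'" for X Y
    unfolding K0_diff_iff[OF fg(1,2)] K0_diff_iff[OF fg(3,4)]
    using K.same_difference_trans[OF c(1-4) iso_class_closed iso_class_closed same, of X Y]
      K.same_difference_trans[OF c(3,4,1,2) iso_class_closed iso_class_closed K.same_difference_sym[OF same], of X Y]
    by blast
  then show ?thesis by auto
qed

lemma K0_diff_member:
  assumes "fg_projective R P" "fg_projective R Q" "(P', Q') \<in> K0_diff R P Q"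
  shows "fg_projective R P'" "fg_projective R Q'"
    "K.same_difference (iso_class R P) (iso_class R Q) (iso_class R P') (iso_class R Q')"
  using assms by (auto simp: K0_diff_iff)

lemma K0_diff_cong:
  assumes fg: "fg_projective R P" "fg_projective R Q"
    and iso: "module_isomorphic R P P'" "module_isomorphic R Q Q'"
    and fg': "fg_projective R P'" "fg_projective R Q'"
  shows "K0_diff R P Q = K0_diff R P' Q'"
proof (rule K0_diff_eqI[OF fg fg'])
  show "K.same_difference (iso_class R P) (iso_class R Q) (iso_class R P') (iso_class R Q')"
    using iso_class_eqI[OF fg(1) iso(1)] iso_class_eqI[OF fg(2) iso(2)]
      K.same_difference_refl[OF iso_class_closed[OF fg'(1)] iso_class_closed[OF fg'(2)]] by simp
qed

lemma K0_diff_copy: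
  fixes P :: "('r, 'm, 'x) module_scheme" and Q :: "('r, 'n, 'y) module_scheme"
  assumes fg: "fg_projective R P" "fg_projective R Q"
  obtains P' Q' :: "('r, nat \<Rightarrow> 'r) module" where "fg_projective R P'" "fg_projective R Q'"
    "K0_diff R P Q = K0_diff R P' Q'" "(P', Q') \<in> K0_diff R P Q"
proof -
  obtain P' :: "('r, nat \<Rightarrow> 'r) module" where P': "fg_projective R P'" "module_isomorphic R P P'"
    by (rule fg_projective_copy[OF fg(1)])
  obtain Q' :: "('r, nat \<Rightarrow> 'r) module" where Q': "fg_projective R Q'" "module_isomorphic R Q Q'"
    by (rule fg_projective_copy[OF fg(2)])
  have eq: "K0_diff R P Q = K0_diff R P' Q'"
    by (rule K0_diff_cong[OF fg P'(2) Q'(2) P'(1) Q'(1)])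
  then have "(P', Q') \<in> K0_diff R P Q"
    using P' Q' by (simp add: K0_diff_iff K.same_difference_refl iso_class_closed)
  then show thesis
    by (rule that[OF P'(1) Q'(1) eq])
qed

lemma K0_diff_closed:
  assumes "fg_projective R P" "fg_projective R Q"
  shows "K0_diff R P Q \<in> carrier (K0 R)"
  by (rule K0_diff_copy[OF assms]) (auto simp: K0_def)

lemma K0_diff_mult:
  assumes fg: "fg_projective R P" "fg_projective R Q" "fg_projective R P'" "fg_projective R Q'"
  shows "K0_diff R P Q \<otimes>\<^bsub>K0 R\<^esub> K0_diff R P' Q' = K0_diff R (direct_sum P P') (direct_sum Q Q')"
proof -
  have eq: "K0_diff R (direct_sum X X') (direct_sum Y Y') = K0_diff R (direct_sum P P') (direct_sum Q Q')"
    if XY: "(X, Y) \<in> K0_diff R P Q" and XY': "(X', Y') \<in> K0_diff R P' Q'" for X Y X' Y'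
  proof -
    note 1 = K0_diff_member[OF fg(1,2) XY] and 2 = K0_diff_member[OF fg(3,4) XY']
    have "K.same_difference (iso_class R P \<otimes>\<^bsub>class_monoid R\<^esub> iso_class R P') (iso_class R Q \<otimes>\<^bsub>class_monoid R\<^esub> iso_class R Q')
        (iso_class R X \<otimes>\<^bsub>class_monoid R\<^esub> iso_class R X') (iso_class R Y \<otimes>\<^bsub>class_monoid R\<^esub> iso_class R Y')"
      by (rule K.same_difference_mult) (use fg 1 2 in \<open>auto intro: iso_class_closed\<close>)
    then show ?thesis
      using fg 1(1,2) 2(1,2) by (intro K0_diff_eqI[symmetric]) (auto simp: iso_class_mult intro: fg_projective_direct_sum)
  qed
  obtain X Y where XY: "(X, Y) \<in> K0_diff R P Q"
    by (rule K0_diff_copy[OF fg(1,2)])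
  obtain X' Y' where XY': "(X', Y') \<in> K0_diff R P' Q'"
    by (rule K0_diff_copy[OF fg(3,4)])
  have "K0_diff R P Q \<otimes>\<^bsub>K0 R\<^esub> K0_diff R P' Q' =
      (\<Union>p\<in>K0_diff R P Q. \<Union>q\<in>K0_diff R P' Q'. K0_diff R (direct_sum (fst p) (fst q)) (direct_sum (snd p) (snd q)))"
    by (simp add: K0_def case_prod_beta)
  also have "\<dots> = (\<Union>p\<in>K0_diff R P Q. \<Union>q\<in>K0_diff R P' Q'. K0_diff R (direct_sum P P') (direct_sum Q Q'))"
    using eq by (intro SUP_cong refl) (metis prod.collapse)
  also have "\<dots> = K0_diff R (direct_sum P P') (direct_sum Q Q')"
    using XY XY' by blast
  finally show ?thesis .
qed

end

context base_change_hom
begin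

text \<open>
  The induced map is a union over all representatives. It has a single value because base change commutes with
  direct sums, so that it preserves stable isomorphisms.
\<close>

lemma K0_map_diff:
  assumes fg: "fg_projective R P" "fg_projective R Q"
  shows "K0_map R R' f (K0_diff R P Q) = K0_diff R' (bc P) (bc Q)"
proof -
  interpret K: comm_monoid "class_monoid R" by (rule comm_monoid_class_monoid[OF R.ring_axioms])
  interpret K': comm_monoid "class_monoid R'" by (rule comm_monoid_class_monoid[OF R'.ring_axioms])
  have three: "iso_class R' (bc (direct_sum (direct_sum X Y) Z)) =
      iso_class R' (bc X) \<otimes>\<^bsub>class_monoid R'\<^esub> iso_class R' (bc Y) \<otimes>\<^bsub>class_monoid R'\<^esub> iso_class R' (bc Z)"
    if X: "fg_projective R X" and Y: "fg_projective R Y" and Z: "fg_projective R Z"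
    for X :: "('r, 'm, 'x) module_scheme" and Y :: "('r, 'n, 'y) module_scheme" and Z :: "('r, 'p, 'z) module_scheme"
  proof -
    note XY = fg_projective_direct_sum[OF X Y]
    note XYZ = fg_projective_direct_sum[OF XY Z]
    have "iso_class R' (bc (direct_sum (direct_sum X Y) Z)) = iso_class R' (direct_sum (bc (direct_sum X Y)) (bc Z))"
      by (rule iso_class_eqI[OF bc_fg_projective[OF XYZ] bc_direct_sum])
        (use XY Z fg_projective_left_module in auto)
    moreover have "iso_class R' (bc (direct_sum X Y)) = iso_class R' (direct_sum (bc X) (bc Y))"
      by (rule iso_class_eqI[OF bc_fg_projective[OF XY] bc_direct_sum])
        (use X Y fg_projective_left_module in auto)
    ultimately show ?thesis
      using bc_fg_projective[OF X] bc_fg_projective[OF Y] bc_fg_projective[OF Z] bc_fg_projective[OF XY]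
      by (simp add: iso_class_mult[symmetric])
  qed
  have eq: "K0_diff R' (bc X) (bc Y) = K0_diff R' (bc P) (bc Q)" if XY: "(X, Y) \<in> K0_diff R P Q" for X Y
  proof -
    note m = K0_diff_member[OF R.ring_axioms fg XY]
    have "\<exists>S :: ('r, nat \<Rightarrow> 'r) module. fg_projective R S \<and>
        module_isomorphic R (direct_sum (direct_sum P Y) S) (direct_sum (direct_sum X Q) S)"
      using XY by (simp add: K0_diff_def)
    then obtain S :: "('r, nat \<Rightarrow> 'r) module" where S: "fg_projective R S"
      and iso: "module_isomorphic R (direct_sum (direct_sum P Y) S) (direct_sum (direct_sum X Q) S)" by blast
    have lm: "left_module R (direct_sum (direct_sum P Y) S)" "left_module R (direct_sum (direct_sum X Q) S)"
      by (rule fg_projective_left_module, intro fg_projective_direct_sum fg m S)+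
    have "iso_class R' (bc (direct_sum (direct_sum P Y) S)) = iso_class R' (bc (direct_sum (direct_sum X Q) S))"
      by (rule iso_class_eqI[OF bc_fg_projective bc_iso[OF lm iso]], intro fg_projective_direct_sum fg m S)
    then have "K'.same_difference (iso_class R' (bc P)) (iso_class R' (bc Q)) (iso_class R' (bc X)) (iso_class R' (bc Y))"
      unfolding K'.same_difference_def three[OF fg(1) m(2) S] three[OF m(1) fg(2) S]
      by (rule bexI) (rule iso_class_closed[OF bc_fg_projective[OF S]])
    then show ?thesis
      by (intro K0_diff_eqI[OF R'.ring_axioms, symmetric] bc_fg_projective fg m)
  qed
  obtain X Y where XY: "(X, Y) \<in> K0_diff R P Q"
    by (rule K0_diff_copy[OF R.ring_axioms fg])
  have "K0_map R R' f (K0_diff R P Q) = (\<Union>p\<in>K0_diff R P Q. K0_diff R' (bc (fst p)) (bc (snd p)))"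
    by (simp add: K0_map_def case_prod_beta)
  also have "\<dots> = (\<Union>p\<in>K0_diff R P Q. K0_diff R' (bc P) (bc Q))"
    using eq by (intro SUP_cong refl) (metis prod.collapse)
  also have "\<dots> = K0_diff R' (bc P) (bc Q)"
    using XY by blast
  finally show ?thesis .
qed

lemma K0_map_hom: "K0_map R R' f \<in> hom (K0 R) (K0 R')"
proof (rule homI)
  have ex: "\<exists>(P :: ('r, nat \<Rightarrow> 'r) module) (Q :: ('r, nat \<Rightarrow> 'r) module). fg_projective R P \<and> fg_projective R Q \<and> X = K0_diff R P Q"
    if "X \<in> carrier (K0 R)" for X
    using that unfolding K0_def by simp blast
  fix X assume "X \<in> carrier (K0 R)"
  then obtain P Q :: "('r, nat \<Rightarrow> 'r) module"
    where P: "fg_projective R P" and Q: "fg_projective R Q" and X: "X = K0_diff R P Q"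
    using ex by meson
  show "K0_map R R' f X \<in> carrier (K0 R')"
    unfolding X K0_map_diff[OF P Q]
    by (rule K0_diff_closed[OF R'.ring_axioms bc_fg_projective[OF P] bc_fg_projective[OF Q]])
  fix Y assume "Y \<in> carrier (K0 R)"
  then obtain P' Q' :: "('r, nat \<Rightarrow> 'r) module"
    where P': "fg_projective R P'" and Q': "fg_projective R Q'" and Y: "Y = K0_diff R P' Q'"
    using ex by meson
  note PP = fg_projective_direct_sum[OF P P'] and QQ = fg_projective_direct_sum[OF Q Q']
  have "K0_map R R' f (X \<otimes>\<^bsub>K0 R\<^esub> Y) = K0_diff R' (bc (direct_sum P P')) (bc (direct_sum Q Q'))"
    unfolding X Y K0_diff_mult[OF R.ring_axioms P Q P' Q'] by (rule K0_map_diff[OF PP QQ])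
  also have "\<dots> = K0_diff R' (direct_sum (bc P) (bc P')) (direct_sum (bc Q) (bc Q'))"
    by (rule K0_diff_cong[OF R'.ring_axioms bc_fg_projective[OF PP] bc_fg_projective[OF QQ]
          bc_direct_sum bc_direct_sum])
      (use P Q P' Q' in \<open>auto intro!: fg_projective_direct_sum bc_fg_projective fg_projective_left_module\<close>)
  also have "\<dots> = K0_map R R' f X \<otimes>\<^bsub>K0 R'\<^esub> K0_map R R' f Y"
    unfolding X Y K0_map_diff[OF P Q] K0_map_diff[OF P' Q']
    by (rule K0_diff_mult[OF R'.ring_axioms, symmetric]) (intro bc_fg_projective P Q P' Q')+
  finally show "K0_map R R' f (X \<otimes>\<^bsub>K0 R\<^esub> Y) = K0_map R R' f X \<otimes>\<^bsub>K0 R'\<^esub> K0_map R R' f Y" .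
qed

lemma K0_map_class:
  assumes P: "fg_projective R P" and iso: "module_isomorphic R' (bc P) P'" and P': "fg_projective R' P'"
  shows "K0_map R R' f (K0_class R P) = K0_class R' P'"
  unfolding K0_class_def K0_map_diff[OF P fg_projective_free_zero[OF R.ring_axioms]]
  by (rule K0_diff_cong[OF R'.ring_axioms bc_fg_projective[OF P]
        bc_fg_projective[OF fg_projective_free_zero[OF R.ring_axioms]] iso bc_free_zero P'
        fg_projective_free_zero[OF R'.ring_axioms]])

end

section \<open>Base change of associated modules\<close>

context principal_hom
begin

lemma f_algebra_hom: "f \<in> algebra_homs A.B A'.B"
proof -
  have "f \<in> ring_hom A.B A'.B"
    using f_mult f_one linear_add[OF f_linear] f_invariant A.B_closed
    by (auto simp: ring_hom_def)
  moreover have "f \<in> lin A.B A'.B"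
    using f_invariant A.B_closed linear_add[OF f_linear] lin_smult[OF f_linear]
    by (auto simp: linear_maps_def)
  ultimately show ?thesis by (simp add: algebra_homs_def)
qed

sublocale bch: base_change_hom A.B A'.B f
  by unfold_locales (use f_algebra_hom in \<open>simp add: algebra_homs_def\<close>)

end

context principal_associated
begin

lemma A_associated_id: "principal_associated C A e s A id V S \<xi>"
  by (intro principal_associated.intro principal_hom.intro galois_hom.intro A.equivariant_id
      A.split_galois_extension_axioms A.galois_extension_axioms
      A.split_associated_module_axioms A.associated_module_axioms)

lemma dual_basis_target:
  assumes cb: "A.connection_basis J G F"
  shows "dual_basis A'.B A'.P J (\<lambda>k. f_tensor (F k)) (\<lambda>k. phi (G k))"
  using cb phi_linear[OF cb] phi_expansion[OF cb] f_tensor_P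
  unfolding dual_basis_def A.connection_basis_def by blast

text \<open>
  The dual basis of the target, applied to the identity of \<open>A\<close> as the equivariant map.
\<close>

lemma dual_basis_source:
  assumes cb: "A.connection_basis J G F"
  shows "dual_basis A.B A.P J F (\<lambda>k x. \<Oplus>\<^bsub>A\<^esub>r\<in>S. slice A (\<xi> r) x \<otimes>\<^bsub>A\<^esub> G k r)"
proof -
  interpret I: principal_associated C A e s A id V S \<xi> by (rule A_associated_id)
  interpret P: left_module A.B A.P by (rule A.left_module_P)
  have db: "dual_basis A.B A.P J (\<lambda>k. vtensor_map A V id id (F k)) (\<lambda>k. I.phi (G k))"
    by (rule I.dual_basis_target[OF cb])
  have F: "F k \<in> carrier A.P" if "k \<in> J" for k
    using cb that by (simp add: A.connection_basis_def)
  have id: "vtensor_map A V id id x = x" if x: "x \<in> carrier (A \<otimes>\<^sub>\<complex> V)" for x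
    by (rule vtensor_ext[OF A.vA A.vV vtensor_map_linear[OF A.vA A.vV A.vA A.vV linear_id(1) linear_id(1)]
          linear_id(2) A.vAV _ x])
      (simp add: vtensor_map_vtens[OF A.vA A.vV A.vA A.vV linear_id(1) linear_id(1)])
  have phi: "I.phi (G k) = (\<lambda>x. \<Oplus>\<^bsub>A\<^esub>r\<in>S. slice A (\<xi> r) x \<otimes>\<^bsub>A\<^esub> G k r)" for k
    by (simp add: I.phi_def fun_eq_iff)
  have "(\<Oplus>\<^bsub>A.P\<^esub>k\<in>J. I.phi (G k) x \<odot>\<^bsub>A.P\<^esub> vtensor_map A V id id (F k)) = (\<Oplus>\<^bsub>A.P\<^esub>k\<in>J. I.phi (G k) x \<odot>\<^bsub>A.P\<^esub> F k)"
    if x: "x \<in> carrier A.P" for x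
  proof (rule P.M.finsum_cong')
    show "(\<lambda>k. I.phi (G k) x \<odot>\<^bsub>A.P\<^esub> F k) \<in> J \<rightarrow> carrier A.P"
      using I.phi_invariant[OF cb _ x] F by (intro Pi_I P.smult_closed)
  qed (simp_all add: id A.P_closed F)
  then show ?thesis
    using db F unfolding dual_basis_def phi by simp
qed

definition comparison :: "('b, ('a, 'v) tensor) tensor \<Rightarrow> ('b, 'v) tensor" where
  "comparison = tensor_lift A'.P (\<lambda>b x. b \<odot>\<^bsub>A'.P\<^esub> f_tensor x)"

lemma comparison_linear: "comparison \<in> linear_maps A'.B (bch.bc A.P) A'.P"
  and comparison_tens: "\<lbrakk>b \<in> carrier A'.B; x \<in> carrier A.P\<rbrakk>
    \<Longrightarrow> comparison (bch.bt A.P b x) = b \<odot>\<^bsub>A'.P\<^esub> f_tensor x"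
proof -
  interpret P': left_module A'.B A'.P by (rule A'.left_module_P)
  have 1: "(\<lambda>x. b \<odot>\<^bsub>A'.P\<^esub> f_tensor x) \<in> additive_maps A.P A'.P" if b: "b \<in> carrier A'.B" for b
  proof (rule additive_mapsI)
    fix x y assume xy: "x \<in> carrier A.P" "y \<in> carrier A.P"
    then show "b \<odot>\<^bsub>A'.P\<^esub> f_tensor x \<in> carrier A'.P"
      by (intro P'.smult_closed b f_tensor_P)
    have "f_tensor (x \<oplus>\<^bsub>A.P\<^esub> y) = f_tensor x \<oplus>\<^bsub>A'.P\<^esub> f_tensor y"
      using xy by (simp add: linear_add[OF f_tensor_lin] A.P_closed)
    then show "b \<odot>\<^bsub>A'.P\<^esub> f_tensor (x \<oplus>\<^bsub>A.P\<^esub> y) = b \<odot>\<^bsub>A'.P\<^esub> f_tensor x \<oplus>\<^bsub>A'.P\<^esub> b \<odot>\<^bsub>A'.P\<^esub> f_tensor y"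
      using P'.smult_r_distr[OF b f_tensor_P[OF xy(1)] f_tensor_P[OF xy(2)]] by simp
  qed
  have 2: "(b \<otimes>\<^bsub>A'.B\<^esub> f r) \<odot>\<^bsub>A'.P\<^esub> f_tensor x = b \<odot>\<^bsub>A'.P\<^esub> f_tensor (r \<odot>\<^bsub>A.P\<^esub> x)"
    if "r \<in> carrier A.B" "b \<in> carrier A'.B" "x \<in> carrier A.P" for r b x
    using that P'.smult_assoc[of b "f r" "f_tensor x"] f_tensor_act[OF A.vV A.B_closed A.P_closed]
    by (simp add: f_invariant f_tensor_P)
  note L = bch.bc_lift[OF A.left_module_P A'.left_module_P, of "\<lambda>b x. b \<odot>\<^bsub>A'.P\<^esub> f_tensor x", OF 1 _ _ 2]
  show "comparison \<in> linear_maps A'.B (bch.bc A.P) A'.P"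
    unfolding comparison_def
    by (rule L(1)) (simp_all only: P'.smult_l_distr P'.smult_assoc f_tensor_P)
  show "comparison (bch.bt A.P b x) = b \<odot>\<^bsub>A'.P\<^esub> f_tensor x"
    if "b \<in> carrier A'.B" "x \<in> carrier A.P"
    unfolding comparison_def
    by (rule L(2)) (use that in \<open>simp_all only: P'.smult_l_distr P'.smult_assoc f_tensor_P\<close>)
qed

text \<open>
  The dual bases of \<open>A \<box> V\<close> and \<open>A' \<box> V\<close> correspond under \<open>f\<close>, so \<open>x' \<mapsto> \<Sum>k. \<phi>'\<^sub>k(x') \<otimes> F\<^sub>k\<close> inverts the
  comparison map.
\<close>

lemma comparison_iso: "comparison \<in> linear_isos A'.B (bch.bc A.P) A'.P"
proof -
  interpret P: left_module A.B A.P by (rule A.left_module_P)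
  interpret P': left_module A'.B A'.P by (rule A'.left_module_P)
  interpret bP: left_module A'.B "bch.bc A.P" by (rule bch.bc_module[OF A.left_module_P])
  obtain J :: "('v \<times> nat) set" and G F where cb: "A.connection_basis J G F"
    by (rule A.connection_basis_exists)
  let ?\<phi> = "\<lambda>k x. \<Oplus>\<^bsub>A\<^esub>r\<in>S. slice A (\<xi> r) x \<otimes>\<^bsub>A\<^esub> G k r"
  have F: "F k \<in> carrier A.P" if "k \<in> J" for k
    using cb that by (simp add: A.connection_basis_def)
  have G: "G k r \<in> carrier A" if "k \<in> J" "r \<in> S" for k r
    using cb that by (simp add: A.connection_basis_def)
  note db = dual_basis_source[OF cb] and db' = dual_basis_target[OF cb]
  have \<phi>c: "?\<phi> k x \<in> carrier A.B" if "k \<in> J" "x \<in> carrier A.P" for k x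
    using db that linear_closed[of "?\<phi> k" A.B A.P "regular_module A.B" x]
    by (simp add: dual_basis_def regular_module_simps del: A.P_simps)
  have \<phi>': "phi (G k) \<in> linear_maps A'.B A'.P (regular_module A'.B)" if "k \<in> J" for k
    by (rule phi_linear[OF cb that])
  have \<phi>'c: "phi (G k) y \<in> carrier A'.B" if "k \<in> J" "y \<in> carrier A'.P" for k y
    by (rule phi_invariant[OF cb that])
  let ?\<Psi> = "\<lambda>y. \<Oplus>\<^bsub>bch.bc A.P\<^esub>k\<in>J. bch.bt A.P (phi (G k) y) (F k)"
  have btc: "bch.bt A.P (phi (G k) y) (F k) \<in> carrier (bch.bc A.P)" if "k \<in> J" "y \<in> carrier A'.P" for k y
    by (intro bch.bt_closed A.left_module_P \<phi>'c F that)
  have \<Psi>c: "?\<Psi> y \<in> carrier (bch.bc A.P)" if "y \<in> carrier A'.P" for y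
    by (rule bP.M.finsum_closed) (use that btc in auto)
  have \<Psi>: "?\<Psi> \<in> additive_maps A'.P (bch.bc A.P)"
  proof (rule additive_mapsI[OF \<Psi>c])
    fix x y assume xy: "x \<in> carrier A'.P" "y \<in> carrier A'.P"
    have "?\<Psi> (x \<oplus>\<^bsub>A'.P\<^esub> y) = (\<Oplus>\<^bsub>bch.bc A.P\<^esub>k\<in>J. bch.bt A.P (phi (G k) x) (F k) \<oplus>\<^bsub>bch.bc A.P\<^esub> bch.bt A.P (phi (G k) y) (F k))"
    proof (rule bP.M.finsum_cong')
      fix k assume k: "k \<in> J"
      have "phi (G k) (x \<oplus>\<^bsub>A'.P\<^esub> y) = phi (G k) x \<oplus>\<^bsub>A'.B\<^esub> phi (G k) y"
        using linear_add[OF \<phi>'[OF k] xy] by (simp only: regular_module_simps)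
      then show "bch.bt A.P (phi (G k) (x \<oplus>\<^bsub>A'.P\<^esub> y)) (F k) =
          bch.bt A.P (phi (G k) x) (F k) \<oplus>\<^bsub>bch.bc A.P\<^esub> bch.bt A.P (phi (G k) y) (F k)"
        by (simp only: additive_add[OF bch.bt_additive_left[OF A.left_module_P F[OF k]] \<phi>'c[OF k xy(1)] \<phi>'c[OF k xy(2)]])
    qed (use xy btc in auto)
    also have "\<dots> = ?\<Psi> x \<oplus>\<^bsub>bch.bc A.P\<^esub> ?\<Psi> y"
      by (rule bP.M.finsum_addf) (use xy btc in auto)
    finally show "?\<Psi> (x \<oplus>\<^bsub>A'.P\<^esub> y) = ?\<Psi> x \<oplus>\<^bsub>bch.bc A.P\<^esub> ?\<Psi> y" .
  qed
  note \<Phi> = comparison_linear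
  have "bij_betw comparison (carrier (bch.bc A.P)) (carrier A'.P)"
  proof (rule bij_betwI[of _ _ _ ?\<Psi>])
    show "comparison \<in> carrier (bch.bc A.P) \<rightarrow> carrier A'.P"
      by (intro Pi_I linear_closed[OF \<Phi>])
    show "?\<Psi> \<in> carrier A'.P \<rightarrow> carrier (bch.bc A.P)"
      by (intro Pi_I \<Psi>c)
    show "comparison (?\<Psi> y) = y" if y: "y \<in> carrier A'.P" for y
    proof -
      have "comparison (?\<Psi> y) = (\<Oplus>\<^bsub>A'.P\<^esub>k\<in>J. comparison (bch.bt A.P (phi (G k) y) (F k)))"
        by (rule additive_finsum[OF linear_maps_additive[OF \<Phi>] bP.M.abelian_group_axioms P'.M.abelian_group_axioms])
          (use y btc in auto)
      also have "\<dots> = (\<Oplus>\<^bsub>A'.P\<^esub>k\<in>J. phi (G k) y \<odot>\<^bsub>A'.P\<^esub> f_tensor (F k))"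
        by (rule P'.M.finsum_cong')
          (use y in \<open>simp_all only: comparison_tens \<phi>'c F, intro Pi_I P'.smult_closed \<phi>'c f_tensor_P F\<close>)
      also have "\<dots> = y"
        by (rule phi_expansion[OF cb y, symmetric])
      finally show ?thesis .
    qed
    show "?\<Psi> (comparison t) = t" if t: "t \<in> carrier (bch.bc A.P)" for t
    proof (rule bch.bc_ext[OF A.left_module_P additive_comp[OF linear_maps_additive[OF \<Phi>] \<Psi>]
          linear_maps_additive[OF linear_id(2)] bP.M.abelian_group_axioms _ t])
      fix b x assume b: "b \<in> carrier A'.B" and x: "x \<in> carrier A.P"
      have "?\<Psi> (comparison (bch.bt A.P b x)) = (\<Oplus>\<^bsub>bch.bc A.P\<^esub>k\<in>J. bch.bt A.P b (?\<phi> k x \<odot>\<^bsub>A.P\<^esub> F k))"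
        unfolding comparison_tens[OF b x]
      proof (rule bP.M.finsum_cong')
        fix k assume k: "k \<in> J"
        have "phi (G k) (b \<odot>\<^bsub>A'.P\<^esub> f_tensor x) = b \<otimes>\<^bsub>A'.B\<^esub> phi (G k) (f_tensor x)"
          using linear_smult[OF \<phi>'[OF k] b f_tensor_P[OF x]] by (simp only: regular_module_simps)
        also have "phi (G k) (f_tensor x) = f (?\<phi> k x)"
          by (rule phi_f_tensor[OF A.P_closed[OF x] G[OF k]])
        finally show "bch.bt A.P (phi (G k) (b \<odot>\<^bsub>A'.P\<^esub> f_tensor x)) (F k) = bch.bt A.P b (?\<phi> k x \<odot>\<^bsub>A.P\<^esub> F k)"
          using bch.bt_smult[OF A.left_module_P \<phi>c[OF k x] b F[OF k]] by (simp only:)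
      qed (rule refl, intro Pi_I bch.bt_closed A.left_module_P b P.smult_closed \<phi>c x F)
      also have "\<dots> = bch.bt A.P b (\<Oplus>\<^bsub>A.P\<^esub>k\<in>J. ?\<phi> k x \<odot>\<^bsub>A.P\<^esub> F k)"
        by (rule additive_finsum[OF bch.bt_additive_right[OF A.left_module_P b] P.M.abelian_group_axioms
              bP.M.abelian_group_axioms, symmetric])
          (intro Pi_I P.smult_closed \<phi>c x F)
      also have "(\<Oplus>\<^bsub>A.P\<^esub>k\<in>J. ?\<phi> k x \<odot>\<^bsub>A.P\<^esub> F k) = x"
        using db x by (simp add: dual_basis_def del: A.P_simps)
      finally show "?\<Psi> (comparison (bch.bt A.P b x)) = bch.bt A.P b x" .
    qed
  qed
  then show ?thesis
    using \<Phi> by (simp add: linear_isos_def)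
qed

lemma fg_projective_cotensor: "fg_projective A.B A.P" "fg_projective A'.B A'.P"
proof -
  obtain J :: "('v \<times> nat) set" and G F where cb: "A.connection_basis J G F"
    by (rule A.connection_basis_exists)
  show "fg_projective A.B A.P"
    by (rule dual_basis_fg_projective(1)[OF A.left_module_P dual_basis_source[OF cb]])
  show "fg_projective A'.B A'.P"
    by (rule dual_basis_fg_projective(1)[OF A'.left_module_P dual_basis_target[OF cb]])
qed

end

subsection \<open>Naturality\<close>

text \<open>
  The map \<open>id \<otimes> g\<close> intertwines both sides of the cotensor condition with \<open>id \<otimes> (id \<otimes> g)\<close>; for the coaction of \<open>V\<close>
  this is the colinearity of \<open>g\<close>.
\<close>

lemma (in algebra_comodule) colinear_cotensor:
  assumes V: "left_comodule C V" and W: "left_comodule C W" and g: "g \<in> left_colinear_maps C V W"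
    and x: "x \<in> carrier (cotensor C A V)"
  shows "vtensor_map A W id g x \<in> carrier (cotensor C A W)"
proof -
  have vV: "vspace V" and vW: "vspace W" and rV: "lcoact V \<in> lin V (C \<otimes>\<^sub>\<complex> V)" and rW: "lcoact W \<in> lin W (C \<otimes>\<^sub>\<complex> W)"
    using V W by (auto simp: left_comodule_def)
  have gl: "g \<in> lin V W" and gc: "\<And>v. v \<in> carrier V \<Longrightarrow> lcoact W (g v) = vtensor_map C W id g (lcoact V v)"
    using g by (auto simp: left_colinear_maps_def)
  note vCV = vspace_vtensor[OF vC vV] and vCW = vspace_vtensor[OF vC vW]
  note vACV = vspace_vtensor[OF vA vCV] and vACW = vspace_vtensor[OF vA vCW]
  let ?g = "vtensor_map A W id g" and ?g' = "vtensor_map C W id g"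
  let ?\<theta> = "vtensor_map A (C \<otimes>\<^sub>\<complex> W) id ?g'"
  note lg = vtensor_map_linear[OF vA vV vA vW linear_id(1) gl]
    and lg' = vtensor_map_linear[OF vC vV vC vW linear_id(1) gl]
  note \<theta> = vtensor_map_linear[OF vA vCV vA vCW linear_id(1) lg']
  have xV: "x \<in> carrier (A \<otimes>\<^sub>\<complex> V)"
    using x by (simp add: cotensor_def)
  let ?lV = "\<lambda>x. vassoc A C V (vtensor_map (A \<otimes>\<^sub>\<complex> C) V (rcoact A) id x)"
    and ?lW = "\<lambda>x. vassoc A C W (vtensor_map (A \<otimes>\<^sub>\<complex> C) W (rcoact A) id x)"
    and ?rV = "vtensor_map A (C \<otimes>\<^sub>\<complex> V) id (lcoact V)" and ?rW = "vtensor_map A (C \<otimes>\<^sub>\<complex> W) id (lcoact W)"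
  have lV: "?lV \<in> lin (A \<otimes>\<^sub>\<complex> V) (A \<otimes>\<^sub>\<complex> (C \<otimes>\<^sub>\<complex> V))" and lW: "?lW \<in> lin (A \<otimes>\<^sub>\<complex> W) (A \<otimes>\<^sub>\<complex> (C \<otimes>\<^sub>\<complex> W))"
    by (rule linear_comp[OF vtensor_map_linear[OF vA vV vAC vV coact_linear linear_id(1)] vassoc_linear[OF vA vC vV]],
        rule linear_comp[OF vtensor_map_linear[OF vA vW vAC vW coact_linear linear_id(1)] vassoc_linear[OF vA vC vW]])
  note rVl = vtensor_map_linear[OF vA vV vA vCV linear_id(1) rV]
    and rWl = vtensor_map_linear[OF vA vW vA vCW linear_id(1) rW]
  have l: "?lW (?g x) = ?\<theta> (?lV x)"
  proof (rule vtensor_ext[OF vA vV linear_comp[OF lg lW] linear_comp[OF lV \<theta>] vACW _ xV])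
    fix m n assume mn: "m \<in> carrier A" "n \<in> carrier V"
    have "vassoc A C W (vtens (A \<otimes>\<^sub>\<complex> C) W Z (g n)) = ?\<theta> (vassoc A C V (vtens (A \<otimes>\<^sub>\<complex> C) V Z n))"
      if Z: "Z \<in> carrier (A \<otimes>\<^sub>\<complex> C)" for Z
      by (rule vtensor_ext[OF vA vC linear_comp[OF bilinear_left[OF vtens_bilinear[OF vAC vW] linear_closed[OF gl mn(2)]]
              vassoc_linear[OF vA vC vW]] linear_comp[OF linear_comp[OF bilinear_left[OF vtens_bilinear[OF vAC vV] mn(2)]
              vassoc_linear[OF vA vC vV]] \<theta>] vACW _ Z])
        (use mn linear_closed[OF gl] in \<open>simp add: vassoc_vtens[OF vA vC vW] vassoc_vtens[OF vA vC vV]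
          vtensor_map_vtens[OF vA vCV vA vCW linear_id(1) lg'] vtens_closed[OF vC vV]
          vtensor_map_vtens[OF vC vV vC vW linear_id(1) gl]\<close>)
    then show "?lW (?g (vtens A V m n)) = ?\<theta> (?lV (vtens A V m n))"
      using mn linear_closed[OF gl mn(2)] coact_closed
      by (simp add: vtensor_map_vtens[OF vA vV vA vW linear_id(1) gl]
          vtensor_map_vtens[OF vA vW vAC vW coact_linear linear_id(1)]
          vtensor_map_vtens[OF vA vV vAC vV coact_linear linear_id(1)])
  qed
  have r: "?rW (?g x) = ?\<theta> (?rV x)"
    by (rule vtensor_ext[OF vA vV linear_comp[OF lg rWl] linear_comp[OF rVl \<theta>] vACW _ xV])
      (simp add: vtensor_map_vtens[OF vA vV vA vW linear_id(1) gl] vtensor_map_vtens[OF vA vW vA vCW linear_id(1) rW]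
        vtensor_map_vtens[OF vA vV vA vCV linear_id(1) rV] vtensor_map_vtens[OF vA vCV vA vCW linear_id(1) lg']
        linear_closed[OF gl] linear_closed[OF rV] gc)
  have "?lW (?g x) \<ominus>\<^bsub>A \<otimes>\<^sub>\<complex> (C \<otimes>\<^sub>\<complex> W)\<^esub> ?rW (?g x) = ?\<theta> (?lV x \<ominus>\<^bsub>A \<otimes>\<^sub>\<complex> (C \<otimes>\<^sub>\<complex> V)\<^esub> ?rV x)"
    unfolding l r by (rule lin_diff[OF \<theta> vACV vACW linear_closed[OF lV xV] linear_closed[OF rVl xV], symmetric])
  also have "\<dots> = \<zero>\<^bsub>A \<otimes>\<^sub>\<complex> (C \<otimes>\<^sub>\<complex> W)\<^esub>"
    using x lin_zero[OF \<theta> vACV vACW] by (simp add: cotensor_def)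
  finally show ?thesis
    using linear_closed[OF lg xV] by (simp add: cotensor_def)
qed

lemma (in algebra_comodule) tail_map_act:
  assumes vV: "vspace V" and vW: "vspace W" and g: "g \<in> lin V W"
    and a: "a \<in> carrier A" and x: "x \<in> carrier (A \<otimes>\<^sub>\<complex> V)"
  shows "vtensor_map A W id g (act a x V) = act a (vtensor_map A W id g x) W"
  by (rule vtensor_ext[OF vA vV linear_comp[OF bilinear_right[OF left_tensor_bilinear[OF alg vV] a]
        vtensor_map_linear[OF vA vV vA vW linear_id(1) g]]
        linear_comp[OF vtensor_map_linear[OF vA vV vA vW linear_id(1) g]
        bilinear_right[OF left_tensor_bilinear[OF alg vW] a]] vspace_vtensor[OF vA vW] _ x])
    (use a linear_closed[OF g] in \<open>simp add: left_tensor_smult_vtens[OF alg vV] left_tensor_smult_vtens[OF alg vW]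
      vtensor_map_vtens[OF vA vV vA vW linear_id(1) g]\<close>)

lemma (in equivariant_hom) f_tail_map_commute:
  assumes vV: "vspace V" and vW: "vspace W" and g: "g \<in> lin V W" and x: "x \<in> carrier (A \<otimes>\<^sub>\<complex> V)"
  shows "vtensor_map A' W id g (vtensor_map A' V f id x) = vtensor_map A' W f id (vtensor_map A W id g x)"
  by (rule vtensor_ext[OF A.vA vV linear_comp[OF f_tensor_linear[OF vV]
        vtensor_map_linear[OF A'.vA vV A'.vA vW linear_id(1) g]]
        linear_comp[OF vtensor_map_linear[OF A.vA vV A.vA vW linear_id(1) g] f_tensor_linear[OF vW]]
        vspace_vtensor[OF A'.vA vW] _ x])
    (use linear_closed[OF g] f_closed in \<open>simp add: f_tensor_vtens[OF vV] f_tensor_vtens[OF vW]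
      vtensor_map_vtens[OF A.vA vV A.vA vW linear_id(1) g] vtensor_map_vtens[OF A'.vA vV A'.vA vW linear_id(1) g]\<close>)

text \<open>
  Both maps are additive on \<open>B' \<otimes>\<^sub>B (A \<box> V)\<close> and send \<open>b \<otimes> x\<close> to \<open>b ((f \<otimes> g) x)\<close>.
\<close>

lemma comparison_natural:
  assumes "principal_associated C A e s A' f V S \<xi>" "principal_associated C A e s A' f W T \<zeta>"
    and g: "g \<in> left_colinear_maps C V W"
    and t: "t \<in> carrier (base_change (coaction_invariants C A) (coaction_invariants C A') f (cotensor C A V))"
  shows "principal_associated.comparison C A' f W
      (base_change_map (coaction_invariants C A) (coaction_invariants C A') f (cotensor C A W) (vtensor_map A W id g) t) =
    vtensor_map A' W id g (principal_associated.comparison C A' f V t)"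
proof -
  interpret V: principal_associated C A e s A' f V S \<xi> by fact
  interpret W: principal_associated C A e s A' f W T \<zeta> by fact
  have gl: "g \<in> lin V W" using g by (simp add: left_colinear_maps_def)
  note vV = V.A.vV and vW = W.A.vV
  note lA = vtensor_map_linear[OF V.A.vA vV V.A.vA vW linear_id(1) gl]
    and lA' = vtensor_map_linear[OF V.A'.vA vV V.A'.vA vW linear_id(1) gl]
  note PA = V.A.colinear_cotensor[OF V.A.comodule W.A.comodule g]
    and PA' = V.A'.colinear_cotensor[OF V.A.comodule W.A.comodule g]
  have mA: "vtensor_map A W id g \<in> linear_maps V.A.B V.A.P W.A.P"
    by (rule linear_mapsI[OF additive_mapsI])
      (simp_all add: PA linear_add[OF lA] V.A.P_closed V.A.tail_map_act[OF vV vW gl] V.A.B_closed)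
  have mA': "vtensor_map A' W id g \<in> additive_maps V.A'.P W.A'.P"
    by (rule additive_mapsI) (simp_all add: PA' linear_add[OF lA'] V.A'.P_closed)
  note bm = V.bch.bc_map[OF V.A.left_module_P W.A.left_module_P mA]
  show ?thesis
  proof (rule V.bch.bc_ext[OF V.A.left_module_P
        linear_maps_additive[OF linear_comp[OF bm(1) W.comparison_linear]]
        additive_comp[OF linear_maps_additive[OF V.comparison_linear] mA']
        left_module_abelian_group[OF W.A'.left_module_P] _ t])
    fix b x assume b: "b \<in> carrier V.A'.B" and x: "x \<in> carrier V.A.P"
    show "W.comparison (V.bch.bm W.A.P (vtensor_map A W id g) (V.bch.bt V.A.P b x)) =
        vtensor_map A' W id g (V.comparison (V.bch.bt V.A.P b x))"
      using b x
      by (simp add: bm(2) W.comparison_tens V.comparison_tens PA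
          V.A'.tail_map_act[OF vV vW gl] V.A'.B_closed linear_closed[OF V.f_tensor_lin] V.A.P_closed
          V.f_tail_map_commute[OF vV vW gl])
  qed
qed

theorem theorem1p8:
  fixes C :: "'c coalgebra" and e :: 'c
    and A :: "('c, 'a) right_comodule" and A' :: "('c, 'b) right_comodule"
    and B :: "('c, 'a) right_comodule" and B' :: "('c, 'b) right_comodule"
    and f :: "'a \<Rightarrow> 'b"
  defines "B \<equiv> coaction_invariants C A"
    and "B' \<equiv> coaction_invariants C A'"
  assumes "coalgebra C" and "group_like C e"
    and "principal_extension C e A" and "principal_extension C e A'"
    and "f \<in> equivariant_algebra_homs C A A'"
  shows "f \<in> algebra_homs B B' \<and>
    (\<exists>\<Phi> :: ('c, 'v) left_comodule \<Rightarrow> ('b, ('a, 'v) tensor) tensor \<Rightarrow> ('b, 'v) tensor.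
      (\<forall>V. left_comodule C V \<and> finite_dimensional V \<longrightarrow>
        fg_projective B' (base_change B B' f (cotensor C A V)) \<and>
        fg_projective B' (cotensor C A' V) \<and>
        \<Phi> V \<in> linear_isos B' (base_change B B' f (cotensor C A V)) (cotensor C A' V) \<and>
        (\<forall>b \<in> carrier B'. \<forall>x \<in> carrier (cotensor C A V).
          \<Phi> V (base_change_tens B B' f (cotensor C A V) b x) =
            b \<odot>\<^bsub>cotensor C A' V\<^esub> vtensor_map A' V f id x)) \<and>
      (\<forall>V W g. left_comodule C V \<and> finite_dimensional V \<and>
          left_comodule C W \<and> finite_dimensional W \<and> g \<in> left_colinear_maps C V W \<longrightarrow>
        (\<forall>t \<in> carrier (base_change B B' f (cotensor C A V)).
          \<Phi> W (base_change_map B B' f (cotensor C A W) (vtensor_map A W id g) t) =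
            vtensor_map A' W id g (\<Phi> V t)))) \<and>
    K0_map B B' f \<in> hom (K0 B) (K0 B') \<and>
    (\<forall>V :: ('c, 'v) left_comodule. left_comodule C V \<and> finite_dimensional V \<longrightarrow>
      fg_projective B (cotensor C A V) \<and>
      K0_map B B' f (K0_class B (cotensor C A V)) = K0_class B' (cotensor C A' V))"
proof -
  obtain s where s: "split_galois_extension C A e s"
    by (rule equivariantly_projective_split[of C e A]) (use assms in \<open>auto simp: principal_extension_def\<close>)
  have A': "galois_extension C A' e"
    by (rule galois_extensionI) (use assms in \<open>simp_all add: principal_extension_def\<close>)
  interpret A: split_galois_extension C A e s by (rule s)
  interpret A': galois_extension C A' e by (rule A')
  interpret equivariant_hom C A A' f
    by unfold_locales (rule assms)
  interpret principal_hom C A e s A' f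
    by (intro principal_hom.intro galois_hom.intro) unfold_locales
  have assoc: "\<exists>S \<xi>. principal_associated C A e s A' f V S \<xi>"
    if V: "left_comodule C V" "finite_dimensional V" for V :: "('c, 'v) left_comodule"
  proof -
    have "vspace V" using V by (simp add: left_comodule_def)
    then obtain S \<xi> where "finite S" "S \<subseteq> carrier V" "\<And>s. s \<in> S \<Longrightarrow> \<xi> s \<in> dual V"
      "\<And>s t. \<lbrakk>s \<in> S; t \<in> S\<rbrakk> \<Longrightarrow> \<xi> s t = (if s = t then 1 else 0)"
      "\<And>v. v \<in> carrier V \<Longrightarrow> v = (\<Oplus>\<^bsub>V\<^esub>s\<in>S. \<xi> s v \<odot>\<^bsub>V\<^esub> s)"
      by (rule finite_dimensional_basis[OF _ V(2)]) (rule that)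
    then have "comodule_basis C V S \<xi>"
      using V assms by (intro comodule_basis.intro)
    then have "principal_associated C A e s A' f V S \<xi>"
      by (intro principal_associated.intro split_associated_module.intro associated_module.intro
          principal_hom_axioms A.split_galois_extension_axioms A.galois_extension_axioms A'.galois_extension_axioms)
    then show ?thesis by blast
  qed
  let ?\<Phi> = "\<lambda>V. principal_associated.comparison C A' f V"
  have main: "fg_projective B' (base_change B B' f (cotensor C A V))"
    "fg_projective B' (cotensor C A' V)" "fg_projective B (cotensor C A V)"
    "?\<Phi> V \<in> linear_isos B' (base_change B B' f (cotensor C A V)) (cotensor C A' V)"
    "\<And>b x. \<lbrakk>b \<in> carrier B'; x \<in> carrier (cotensor C A V)\<rbrakk> \<Longrightarrow>
      ?\<Phi> V (base_change_tens B B' f (cotensor C A V) b x) = b \<odot>\<^bsub>cotensor C A' V\<^esub> vtensor_map A' V f id x"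
    "K0_map B B' f (K0_class B (cotensor C A V)) = K0_class B' (cotensor C A' V)"
    if V: "left_comodule C V" "finite_dimensional V" for V :: "('c, 'v) left_comodule"
  proof -
    obtain S \<xi> where "principal_associated C A e s A' f V S \<xi>" using assoc[OF V] by blast
    then interpret V: principal_associated C A e s A' f V S \<xi> .
    show "fg_projective B' (cotensor C A' V)" "fg_projective B (cotensor C A V)"
      unfolding B_def B'_def by (rule V.fg_projective_cotensor)+
    then show "fg_projective B' (base_change B B' f (cotensor C A V))"
      unfolding B_def B'_def by (intro bch.bc_fg_projective)
    show "?\<Phi> V \<in> linear_isos B' (base_change B B' f (cotensor C A V)) (cotensor C A' V)"
      unfolding B_def B'_def by (rule V.comparison_iso)
    show "?\<Phi> V (base_change_tens B B' f (cotensor C A V) b x) = b \<odot>\<^bsub>cotensor C A' V\<^esub> vtensor_map A' V f id x"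
      if "b \<in> carrier B'" "x \<in> carrier (cotensor C A V)" for b x
      using that unfolding B_def B'_def by (rule V.comparison_tens)
    show "K0_map B B' f (K0_class B (cotensor C A V)) = K0_class B' (cotensor C A' V)"
      unfolding B_def B'_def
      by (rule bch.K0_map_class[OF V.fg_projective_cotensor(1) module_isomorphicI[OF V.comparison_iso]
            V.fg_projective_cotensor(2)])
  qed
  have natural: "?\<Phi> W (base_change_map B B' f (cotensor C A W) (vtensor_map A W id g) t) =
      vtensor_map A' W id g (?\<Phi> V t)"
    if V: "left_comodule C V" "finite_dimensional V" and W: "left_comodule C W" "finite_dimensional W"
      and g: "g \<in> left_colinear_maps C V W" and t: "t \<in> carrier (base_change B B' f (cotensor C A V))"
    for V W :: "('c, 'v) left_comodule" and g t
  proof -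
    obtain S \<xi> where 1: "principal_associated C A e s A' f V S \<xi>" using assoc[OF V] by blast
    obtain T \<zeta> where 2: "principal_associated C A e s A' f W T \<zeta>" using assoc[OF W] by blast
    show ?thesis
      unfolding B_def B'_def by (rule comparison_natural[OF 1 2 g t[unfolded B_def B'_def]])
  qed
  have "f \<in> algebra_homs B B'" "K0_map B B' f \<in> hom (K0 B) (K0 B')"
    unfolding B_def B'_def by (rule f_algebra_hom, rule bch.K0_map_hom)
  then show ?thesis
    using main natural by (intro conjI exI[of _ ?\<Phi>]) simp_all
qed

end
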